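(* Let $P$ and $Q$ be convex lattice polygons in $\mathbb{R}^2$ such that no lattice translate of $P$ is contained in $Q$. Let \[h=\sum_{m\in\mathbb{Z}^2}\bigl(\#\pi_0\bigl(P\setminus(Q+m)\bigr)-1\bigr),\] the total number of reduced connected components of the set differences $P\setminus Q'$ as $Q'$ ranges over all lattice translates of $Q$. If \[\#(2Q)+h>\#\bigl((P+Q)^\circ\bigr),\] then $Q$ supports multipliers for $P$: for every nonnegative Laurent polynomial $f$ with monomial support in $2P$ there exists a nonzero Laurent polynomial $g$ with monomial support in $2Q$ such that $fg$ is a sum of squares of Laurent polynomials with monomial support in $P+Q$.
   Context: A binary Laurent polynomial is $f=\sum_{(a,b)\in S}c_{(a,b)}x^ay^b$ with finite $S\subseteq\mathbb{Z}^2$ and real coefficients; it has monomial support in $C\subseteq\mathbb{R}^2$ if $S\subseteq C$, and it is nonnegative if $f(\alpha,\beta)\ge0$ for all $(\alpha,\beta)\in(\mathbb{R}^* )^2$. For $A\subseteq\mathbb{R}^2$: $\#A$ is the number of lattice points of $\mathbb{Z}^2$ in $A$, $A^\circ$ is the interior, $\#\pi_0(A)$ the number of connected components, the number of reduced connected components is $\#\pi_0(A)-1$, and a lattice translate is $A+m$, $m\in\mathbb{Z}^2$. $P+Q$ is the Minkowski sum and $2Q=Q+Q$. *)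

theory Defs
  imports "HOL-Analysis.Analysis"
begin

type_synonym pt = "real \<times> real"

definition lattice_pt :: "int \<times> int \<Rightarrow> pt" where
  "lattice_pt m = (of_int (fst m), of_int (snd m))"

definition nlat :: "pt set \<Rightarrow> nat" where
  "nlat A = card {m :: int \<times> int. lattice_pt m \<in> A}"

definition mink :: "pt set \<Rightarrow> pt set \<Rightarrow> pt set" where
  "mink P Q = {p + q | p q. p \<in> P \<and> q \<in> Q}"

definition ltrans :: "pt set \<Rightarrow> int \<times> int \<Rightarrow> pt set" where
  "ltrans A m = (\<lambda>p. p + lattice_pt m) ` A"

definition convex_lattice_polygon :: "pt set \<Rightarrow> bool" where
  "convex_lattice_polygon P \<longleftrightarrow>
     (\<exists>S. finite S \<and> S \<subseteq> range lattice_pt \<and> P = convex hull S) \<and> interior P \<noteq> {}"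

definition ncomp :: "pt set \<Rightarrow> nat" where
  "ncomp A = card (components A)"

text \<open>h = total number of reduced connected components of P minus lattice translates of Q
  (a finitely supported sum over Z^2, written as a sum over its support).\<close>
definition hcount :: "pt set \<Rightarrow> pt set \<Rightarrow> int" where
  "hcount P Q = (\<Sum>m \<in> {m. int (ncomp (P - ltrans Q m)) - 1 \<noteq> 0}.
                    int (ncomp (P - ltrans Q m)) - 1)"

text \<open>Binary Laurent polynomials with real coefficients: finitely supported coefficient functions.\<close>
type_synonym lpoly = "int \<times> int \<Rightarrow> real"

definition is_lpoly :: "lpoly \<Rightarrow> bool" where
  "is_lpoly c \<longleftrightarrow> finite {s. c s \<noteq> 0}"

definition lsupp :: "lpoly \<Rightarrow> (int \<times> int) set" where
  "lsupp c = {s. c s \<noteq> 0}"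

definition supported_in :: "lpoly \<Rightarrow> pt set \<Rightarrow> bool" where
  "supported_in c C \<longleftrightarrow> is_lpoly c \<and> (\<forall>s \<in> lsupp c. lattice_pt s \<in> C)"

definition leval :: "lpoly \<Rightarrow> real \<Rightarrow> real \<Rightarrow> real" where
  "leval c x y = (\<Sum>s \<in> lsupp c. c s * x powi fst s * y powi snd s)"

definition lnonneg :: "lpoly \<Rightarrow> bool" where
  "lnonneg c \<longleftrightarrow> (\<forall>x y. x \<noteq> 0 \<longrightarrow> y \<noteq> 0 \<longrightarrow> leval c x y \<ge> 0)"

definition lmult :: "lpoly \<Rightarrow> lpoly \<Rightarrow> lpoly" where
  "lmult f g = (\<lambda>n. \<Sum>k \<in> lsupp f. f k * g (n - k))"

definition sos_in :: "lpoly \<Rightarrow> pt set \<Rightarrow> bool" where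
  "sos_in f C \<longleftrightarrow> (\<exists>hs :: lpoly list. (\<forall>h \<in> set hs. supported_in h C) \<and>
                     f = (\<lambda>n. \<Sum>h \<leftarrow> hs. lmult h h n))"

definition supports_multipliers :: "pt set \<Rightarrow> pt set \<Rightarrow> bool" where
  "supports_multipliers Q P \<longleftrightarrow>
     (\<forall>f. supported_in f (mink P P) \<and> lnonneg f \<longrightarrow>
        (\<exists>g. supported_in g (mink Q Q) \<and> g \<noteq> (\<lambda>_. 0) \<and> sos_in (lmult f g) (mink P Q)))"

end

(* Write A = 2P and H = P + Q. Every component of P - Q' contains a lattice point of the boundary of P from
   which the boundary enters Q', unless Q' misses the boundary. Counting these entries over all translates Q'
   and using Pick's formula turns the hypothesis into D < 2(#H - 1), where D = mv A H is the number of zeros on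
   the curve f = 0 of a section of H.

   Close to a given nonnegative polynomial with support in A there is a polynomial f which is positive on the
   real torus and irreducible over the complex numbers, because the products of two non-monomials with Newton
   polygon A depend on fewer parameters than A has lattice points. If f had no multiplier, then the cone of sums
   of squares could be separated from the multiples of f: there would be a functional L on R[2H] which kills f
   R[2Q] and is positive definite on R[H]. After a small perturbation of L, adding suitable multiples of the
   evaluations at a point p of the curve and at its conjugate makes the form L(s t) degenerate on the sections
   of H, with a real kernel element u which does not vanish at the boundary points of the curve, and keeps L(v
   cj(v)) > 0 for nonzero v in C[H] with v(p) = 0. The common zeros of f and u are not real, so modulo the ideal
   (f, u), which has codimension at most D, there are complementary conjugate idempotents e and cj(e). Since
   2(#H - 1) > D, some nonzero v in C[H] with v(p) = 0 is killed by e or by cj(e). Hence v cj(v) = f a + u r,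
   where r is again a section of H, and L(v cj(v)) = 0, a contradiction.

   Multipliers survive the limit, because a sum of squares can be written with a bounded number of squares. *)
theory Submission
  imports Defs "HOL-Library.Poly_Mapping" "Jordan_Normal_Form.Char_Poly" "HOL-Computational_Algebra.Computational_Algebra" "HOL-Computational_Algebra.Field_as_Ring"
begin

section \<open>Lattice-convex sets and Pick's formula\<close>

text \<open>By Pick's formula, D < 2(#H - 1) says that P has fewer interior lattice points than Q
  has lattice points. The factor 2 comes from the two conjugate idempotents, the -1 from the
  condition v(p) = 0, which hides the added evaluations from \<open>v * cj v\<close>. The obstacle
  is that polynomials supported in H need not exhaust the sections of the curve: linear algebra
  finds the kernel element u only in the saturation \<open>V1\<close>, and the quotient r of
  \<open>v * cj v\<close> by u must come back to \<open>V1\<close>, since only there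
  \<open>L (u * r) = 0\<close> is known. That u does not vanish at the boundary points is what keeps
  the degree of r under control. Toric geometry is replaced by statements about exponents: charts
  are directions w, local corrections by multiples of f are glued coefficient by coefficient, and
  intersection numbers are differences of lattice point counts. The element u is a real combination
  of the representer of evaluation at p and its conjugate. As the form of L is symmetric, the values
  of the representer at the boundary become values at p of fixed sections, so all conditions on u
  are generic conditions on p.\<close>

type_synonym lat = "int \<times> int"

definition dotz :: "lat \<Rightarrow> lat \<Rightarrow> int" where
  "dotz w n = fst w * fst n + snd w * snd n"

definition rot :: "lat \<Rightarrow> lat" where "rot w = (- snd w, fst w)"

definition sm :: "int \<Rightarrow> lat \<Rightarrow> lat" where "sm k v = (k * fst v, k * snd v)"

definition prim :: "lat \<Rightarrow> bool" where "prim w \<longleftrightarrow> coprime (fst w) (snd w)"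

definition hz :: "lat set \<Rightarrow> lat \<Rightarrow> int" where "hz S w = Max (dotz w ` S)"

definition LL :: "(lat \<Rightarrow> int) \<Rightarrow> lat set" where "LL h = {n. \<forall>w. dotz w n \<le> h w}"

text \<open>\<open>pg S\<close>: \<open>S\<close> is the set of lattice points of a lattice polygon; integer directions suffice to test this.\<close>

definition pg :: "lat set \<Rightarrow> bool" where "pg S \<longleftrightarrow> finite S \<and> S \<noteq> {} \<and> LL (hz S) \<subseteq> S"

text \<open>The lattice points of the real Minkowski sum of the two polygons, obtained by adding
  support functions. The set of sums \<open>s + t\<close> can be strictly smaller.\<close>

definition msum :: "lat set \<Rightarrow> lat set \<Rightarrow> lat set" where
  "msum S T = LL (\<lambda>w. hz S w + hz T w)"

definition face :: "lat set \<Rightarrow> lat \<Rightarrow> lat set" where "face S w = {n\<in>S. dotz w n = hz S w}"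

definition flen :: "lat set \<Rightarrow> lat \<Rightarrow> int" where "flen S w = int (card (face S w)) - 1"

text \<open>Primitive outer edge normals. For a segment both \<open>w\<close> and \<open>- w\<close>
  occur, so that the formulas below also cover degenerate polygons.\<close>

definition normals :: "lat set \<Rightarrow> lat set" where "normals S = {w. prim w \<and> flen S w \<ge> 1}"

declare split_paired_All [simp del] split_paired_Ex [simp del]

lemma dotz_add [simp]: "dotz w (n + m) = dotz w n + dotz w m" "dotz (w + v) n = dotz w n + dotz v n"
  and dotz_diff [simp]: "dotz w (n - m) = dotz w n - dotz w m" "dotz (w - v) n = dotz w n - dotz v n"
  and dotz_minus [simp]: "dotz w (- n) = - dotz w n" "dotz (- w) n = - dotz w n"
  and dotz_sm [simp]: "dotz w (sm k n) = k * dotz w n" "dotz (sm k w) n = k * dotz w n"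
  and dotz_zero [simp]: "dotz w 0 = 0" "dotz 0 n = 0"
  and dotz_rot_self [simp]: "dotz w (rot w) = 0" "dotz (rot w) w = 0"
  by (auto simp: dotz_def sm_def rot_def algebra_simps)

lemma dotz_commute: "dotz w n = dotz n w" by (simp add: dotz_def)
lemma dotz_rot_swap: "dotz v (rot w) = - dotz w (rot v)" by (simp add: dotz_def rot_def)
lemma dotz_rot_rot [simp]: "dotz (rot v) (rot w) = dotz v w" by (simp add: dotz_def rot_def)
lemma rot_rot [simp]: "rot (rot w) = - w" by (simp add: rot_def prod_eq_iff)
lemma rot_minus [simp]: "rot (- w) = - rot w" by (simp add: rot_def prod_eq_iff)
lemma rot_sm: "rot (sm k w) = sm k (rot w)" by (simp add: rot_def sm_def)
lemma sm_1 [simp]: "sm 1 v = v" and sm_0 [simp]: "sm 0 v = 0" "sm k 0 = 0"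
  and sm_add: "sm (k + l) v = sm k v + sm l v" and sm_add_right: "sm k (v + w) = sm k v + sm k w"
  and sm_sm [simp]: "sm k (sm l v) = sm (k * l) v" and sm_minus [simp]: "sm (- k) v = - sm k v" "sm k (- v) = - sm k v"
  and sm_diff: "sm (k - l) v = sm k v - sm l v" and sm_diff_right: "sm k (v - w) = sm k v - sm k w"
  by (auto simp: sm_def prod_eq_iff algebra_simps)
lemma sm_inj: "v \<noteq> 0 \<Longrightarrow> sm k v = sm l v \<longleftrightarrow> k = l" by (auto simp: sm_def prod_eq_iff)

lemma dotz_pos: "v \<noteq> 0 \<Longrightarrow> dotz v v > 0"
proof -
  assume "v \<noteq> 0"
  then have "fst v \<noteq> 0 \<or> snd v \<noteq> 0" by (auto simp: prod_eq_iff)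
  then have "0 < fst v * fst v + snd v * snd v"
    by (metis not_sum_squares_lt_zero linorder_neqE_linordered_idom sum_squares_eq_zero_iff)
  then show ?thesis by (simp add: dotz_def)
qed

lemma prim_nz: "prim w \<Longrightarrow> w \<noteq> 0" by (auto simp: prim_def)
lemma rot_nz: "w \<noteq> 0 \<Longrightarrow> rot w \<noteq> 0" by (auto simp: rot_def prod_eq_iff)
lemma prim_minus [simp]: "prim (- w) = prim w" by (simp add: prim_def)
lemma prim_rot [simp]: "prim (rot w) = prim w" by (simp add: prim_def rot_def coprime_commute)

lemma prim_bezout: assumes "prim w" obtains m where "dotz w m = 1"
proof -
  obtain a b where "a * fst w + b * snd w = gcd (fst w) (snd w)" using bezout_int by blast
  then have "dotz w (a, b) = 1" using assms by (simp add: prim_def dotz_def mult.commute)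
  then show thesis by (rule that)
qed

lemma orth_prim: assumes "prim w" "dotz w n = 0" obtains k where "n = sm k (rot w)"
proof -
  have co: "coprime (fst w) (snd w)" using assms(1) by (simp add: prim_def)
  have e: "fst w * fst n = - snd w * snd n" using assms(2) by (simp add: dotz_def)
  obtain m where m: "dotz w m = 1" using prim_bezout assms(1) by blast
  \<comment> \<open>Pairing with \<open>rot m\<close> reads off the coordinate along
    \<open>rot w\<close>, because \<open>dotz (rot m) (rot w) = dotz m w = 1\<close>.\<close>
  define k where "k = dotz (rot m) n"
  have m1: "fst w * fst m + snd w * snd m = 1" using m by (simp add: dotz_def)
  have "- (k * snd w) = fst n"
  proof -
    have "- (k * snd w) = snd w * snd m * fst n - fst m * (snd w * snd n)" by (simp add: k_def dotz_def rot_def algebra_simps)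
    also have "\<dots> = snd w * snd m * fst n + fst m * (fst w * fst n)" using e by simp
    also have "\<dots> = (fst w * fst m + snd w * snd m) * fst n" by (simp add: algebra_simps)
    finally show ?thesis using m1 by simp
  qed
  moreover have "k * fst w = snd n"
  proof -
    have "k * fst w = fst w * fst m * snd n - snd m * (fst w * fst n)" by (simp add: k_def dotz_def rot_def algebra_simps)
    also have "\<dots> = fst w * fst m * snd n + snd m * (snd w * snd n)" using e by simp
    also have "\<dots> = (fst w * fst m + snd w * snd m) * snd n" by (simp add: algebra_simps)
    finally show ?thesis using m1 by simp
  qed
  ultimately have "n = sm k (rot w)" by (simp add: sm_def rot_def prod_eq_iff)
  then show thesis by (rule that)
qed

lemma prim_part: assumes "n \<noteq> 0" obtains g e where "g > 0" "prim e" "n = sm g e"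
proof -
  let ?g = "gcd (fst n) (snd n)"
  have g: "?g > 0" using assms by (auto simp: prod_eq_iff gcd_pos_int)
  have "prim (fst n div ?g, snd n div ?g)" using assms unfolding prim_def
    by (simp, intro div_gcd_coprime) (auto simp: prod_eq_iff)
  moreover have "n = sm ?g (fst n div ?g, snd n div ?g)" by (simp add: sm_def prod_eq_iff)
  ultimately show thesis using g that by blast
qed

lemma prim_parallel: assumes "prim w" "prim v" "dotz v (rot w) = 0" shows "v = w \<or> v = - w"
proof -
  have "dotz (rot w) v = 0" using assms(3) by (simp add: dotz_commute)
  then obtain k where k: "v = sm k (rot (rot w))" using orth_prim[of "rot w" v] assms(1) by auto
  have "coprime (k * fst w) (k * snd w)" using assms(2) unfolding prim_def k by (simp add: sm_def)
  then have "k dvd 1" by (meson coprime_def dvd_triv_left)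
  then have "k = 1 \<or> k = -1" by auto
  then show ?thesis using k by auto
qed

lemma hz_ge: "finite S \<Longrightarrow> s \<in> S \<Longrightarrow> dotz w s \<le> hz S w" by (simp add: hz_def)
lemma hz_attained: assumes "finite S" "S \<noteq> {}" obtains s where "s \<in> S" "dotz w s = hz S w"
proof -
  have "hz S w \<in> dotz w ` S" unfolding hz_def using assms by (intro Max_in) auto
  then show thesis using that by (metis imageE)
qed
lemma hz_leI: "finite S \<Longrightarrow> S \<noteq> {} \<Longrightarrow> (\<And>s. s \<in> S \<Longrightarrow> dotz w s \<le> b) \<Longrightarrow> hz S w \<le> b"
  by (simp add: hz_def)
lemma hz_eqI: "finite S \<Longrightarrow> s \<in> S \<Longrightarrow> dotz w s = b \<Longrightarrow> (\<And>s. s \<in> S \<Longrightarrow> dotz w s \<le> b) \<Longrightarrow> hz S w = b"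
  using hz_ge[of S s w] hz_leI[of S w b] by fastforce
lemma hz_sm: assumes "finite S" "S \<noteq> {}" "k \<ge> 0" shows "hz S (sm k w) = k * hz S w"
proof -
  obtain s where s: "s \<in> S" "dotz w s = hz S w" using hz_attained assms by blast
  show ?thesis by (rule hz_eqI[OF assms(1) s(1)]) (auto simp: s assms intro!: mult_left_mono hz_ge)
qed
lemma hz_add_le: assumes "finite S" "S \<noteq> {}" shows "hz S (v + w) \<le> hz S v + hz S w"
  by (rule hz_leI[OF assms]) (simp add: add_mono hz_ge assms)
lemma hz_zero [simp]: "finite S \<Longrightarrow> S \<noteq> {} \<Longrightarrow> hz S 0 = 0"
  using hz_sm[of S 0 0] by simp
lemma hz_mono: "finite T \<Longrightarrow> S \<noteq> {} \<Longrightarrow> S \<subseteq> T \<Longrightarrow> hz S w \<le> hz T w"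
  by (rule hz_leI) (auto intro: hz_ge finite_subset)

lemma pgD: "pg S \<Longrightarrow> finite S" "pg S \<Longrightarrow> S \<noteq> {}" by (auto simp: pg_def)
lemma pg_memI: "pg S \<Longrightarrow> (\<And>w. dotz w n \<le> hz S w) \<Longrightarrow> n \<in> S" unfolding pg_def LL_def by blast
lemma pg_LL: "pg S \<Longrightarrow> LL (hz S) = S" by (auto simp: pg_def LL_def hz_ge)

lemma finite_LL: "finite (LL h)"
proof -
  have "LL h \<subseteq> {- h (-1, 0)..h (1, 0)} \<times> {- h (0, -1)..h (0, 1)}"
  proof
    fix n assume "n \<in> LL h"
    then have "\<forall>w. dotz w n \<le> h w" by (simp add: LL_def)
    from this[rule_format, of "(1,0)"] this[rule_format, of "(-1,0)"] this[rule_format, of "(0,1)"] this[rule_format, of "(0,-1)"]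
    show "n \<in> {- h (-1, 0)..h (1, 0)} \<times> {- h (0, -1)..h (0, 1)}" by (cases n) (auto simp: dotz_def)
  qed
  then show ?thesis by (rule finite_subset) auto
qed

lemma msum_mem: "finite S \<Longrightarrow> finite T \<Longrightarrow> s \<in> S \<Longrightarrow> t \<in> T \<Longrightarrow> s + t \<in> msum S T"
  by (simp add: msum_def LL_def add_mono hz_ge)

lemma
  assumes "finite S" "S \<noteq> {}" "finite T" "T \<noteq> {}"
  shows hz_msum [simp]: "hz (msum S T) w = hz S w + hz T w" and pg_msum: "pg (msum S T)"
proof -
  have fin: "finite (msum S T)" by (simp add: msum_def finite_LL)
  have *: "hz (msum S T) w = hz S w + hz T w" for w
  proof -
    obtain s t where "s \<in> S" "dotz w s = hz S w" "t \<in> T" "dotz w t = hz T w" using hz_attained assms by metis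
    moreover have "dotz w n \<le> hz S w + hz T w" if "n \<in> msum S T" for n using that unfolding msum_def LL_def by blast
    ultimately show ?thesis by (intro hz_eqI[of _ "s + t"] fin msum_mem assms) simp_all
  qed
  then show "hz (msum S T) w = hz S w + hz T w" by simp
  have "LL (hz (msum S T)) \<subseteq> msum S T" unfolding * by (simp add: msum_def)
  moreover have "msum S T \<noteq> {}" using msum_mem assms by blast
  ultimately show "pg (msum S T)" using fin by (simp add: pg_def)
qed

lemma msum_commute: "msum S T = msum T S" by (simp add: msum_def add.commute)

lemma pg_hull: assumes "finite S" "S \<noteq> {}" shows "pg (LL (hz S))" "hz (LL (hz S)) w = hz S w"
proof -
  have e: "LL (hz S) = msum S {0}" by (simp add: msum_def hz_def[of "{0}"])
  show "pg (LL (hz S))" unfolding e by (rule pg_msum) (auto simp: assms)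
  show "hz (LL (hz S)) w = hz S w" unfolding e using assms by (simp add: hz_def[of "{0}"])
qed

text \<open>Convexity with the denominator \<open>k\<close> cleared: each support inequality passes
  to a convex combination with weights \<open>i / k\<close>, \<open>j / k\<close>,
  \<open>l / k\<close>.\<close>

lemma pg_convex3:
  assumes "pg S" "sm k n = sm i a + sm j b + sm l c" "a \<in> S" "b \<in> S" "c \<in> S" "k > 0" "i \<ge> 0" "j \<ge> 0" "l \<ge> 0" "i + j + l = k"
  shows "n \<in> S"
proof (rule pg_memI[OF assms(1)])
  fix w
  have f: "finite S" using assms(1) by (rule pgD)
  have "k * dotz w n = i * dotz w a + j * dotz w b + l * dotz w c"
    using arg_cong[OF assms(2), of "dotz w"] by simp
  also have "\<dots> \<le> i * hz S w + j * hz S w + l * hz S w"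
    using assms f by (intro add_mono mult_left_mono hz_ge) auto
  also have "\<dots> = k * hz S w" using assms(10) by (simp add: algebra_simps flip: assms(10))
  finally show "dotz w n \<le> hz S w" using assms(6) by simp
qed

lemma pg_between:
  assumes "pg S" "a \<in> S" "a + sm l e \<in> S" "0 \<le> i" "i \<le> l" shows "a + sm i e \<in> S"
proof (cases "l = 0")
  case False
  show ?thesis
    by (rule pg_convex3[OF assms(1), of l _ "l - i" a i "a + sm l e" 0 a])
       (use False assms in \<open>auto simp: sm_add_right sm_diff mult.commute\<close>)
qed (use assms in auto)

section \<open>Faces and edges of a lattice polygon\<close>

lemma face_ne: "finite S \<Longrightarrow> S \<noteq> {} \<Longrightarrow> face S w \<noteq> {}" using hz_attained[of S w] by (auto simp: face_def)
lemma finite_face: "finite S \<Longrightarrow> finite (face S w)" by (simp add: face_def)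
lemma flen_ge0: "finite S \<Longrightarrow> S \<noteq> {} \<Longrightarrow> flen S w \<ge> 0"
  using face_ne[of S w] finite_face[of S w] by (simp add: flen_def Suc_le_eq card_gt_0_iff)
    
text \<open>The parameters \<open>k\<close> with \<open>a0 + sm k (rot w)\<close> in
  \<open>S\<close> form a finite set of integers, which is an interval by convexity; the base point
  is then moved to its left end.\<close>

lemma face_interval:
  assumes S: "pg S" and w: "prim w"
  obtains a where "face S w = (\<lambda>i. a + sm i (rot w)) ` {0..flen S w}"
proof -
  let ?E = "rot w"
  have E: "?E \<noteq> 0" using w by (simp add: prim_nz rot_nz)
  note f = pgD[OF S]
  obtain a0 where a0: "a0 \<in> face S w" using face_ne f by blast
  let ?K = "{k. a0 + sm k ?E \<in> S}"
  have inj: "inj (\<lambda>k. a0 + sm k ?E)" by (rule injI) (use sm_inj[OF E] in auto)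
  have fK: "finite ?K" using finite_vimageI[OF f(1) inj] by (simp add: vimage_def)
  have K0: "0 \<in> ?K" using a0 by (simp add: face_def)
  define lo hi where "lo = Min ?K" and "hi = Max ?K"
  have Kne: "?K \<noteq> {}" using K0 by blast
  have lohi: "lo \<in> ?K" "hi \<in> ?K" "\<And>k. k \<in> ?K \<Longrightarrow> lo \<le> k \<and> k \<le> hi"
    unfolding lo_def hi_def using Min_in[OF fK Kne] Max_in[OF fK Kne] Min_le[OF fK] Max_ge[OF fK] by blast+
  have K: "?K = {lo..hi}"
  proof
    show "{lo..hi} \<subseteq> ?K"
    proof
      fix k assume k: "k \<in> {lo..hi}"
      have "(a0 + sm lo ?E) + sm (k - lo) ?E \<in> S"
        by (rule pg_between[OF S, of _ "hi - lo"]) (use k lohi in \<open>auto simp: sm_diff algebra_simps\<close>)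
      then show "k \<in> ?K" by (simp add: sm_diff algebra_simps)
    qed
  qed (use lohi in auto)
  have fc: "face S w = (\<lambda>k. a0 + sm k ?E) ` ?K"
  proof
    show "face S w \<subseteq> (\<lambda>k. a0 + sm k ?E) ` ?K"
    proof
      fix n assume n: "n \<in> face S w"
      then have "dotz w (n - a0) = 0" using a0 by (simp add: face_def)
      then obtain k where "n - a0 = sm k ?E" using orth_prim w by blast
      then have "n = a0 + sm k ?E" by (metis add.commute diff_add_cancel)
      then show "n \<in> (\<lambda>k. a0 + sm k ?E) ` ?K" using n by (auto simp: face_def)
    qed
  qed (use a0 in \<open>auto simp: face_def\<close>)
  have "card (face S w) = card {lo..hi}" unfolding fc K by (rule card_image) (use inj in \<open>auto simp: inj_def inj_on_def\<close>)
  moreover have "lo \<le> hi" using lohi by auto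
  ultimately have l: "flen S w = hi - lo" by (simp add: flen_def)
  have "face S w = (\<lambda>i. (a0 + sm lo ?E) + sm i ?E) ` {0..flen S w}"
    unfolding fc K l
  proof -
    have "{lo..hi} = (\<lambda>i. lo + i) ` {0..hi - lo}" by (simp add: add.commute)
    then show "(\<lambda>k. a0 + sm k ?E) ` {lo..hi} = (\<lambda>i. (a0 + sm lo ?E) + sm i ?E) ` {0..hi - lo}"
      by (simp only: image_image sm_add add.assoc)
  qed
  then show thesis by (rule that)
qed

text \<open>For large \<open>K\<close> the direction \<open>sm K w + v\<close> is \<open>w\<close>
  tilted slightly towards \<open>v\<close>: a point off the face loses at least \<open>K\<close>,
  while \<open>v\<close> varies by at most \<open>2 * M\<close> on \<open>S\<close>. So the maximum
  is taken on the face, and \<open>v\<close> decides there.\<close>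

lemma hz_tilt:
  assumes S: "finite S" "S \<noteq> {}"
  shows "\<exists>K0. \<forall>K\<ge>K0. hz S (sm K w + v) \<le> K * hz S w + hz (face S w) v"
proof -
  define M where "M = Max ((\<lambda>s. \<bar>dotz v s\<bar>) ` S)"
  have M: "\<bar>dotz v s\<bar> \<le> M" if "s \<in> S" for s using that S unfolding M_def by (intro Max_ge) auto
  have ff: "finite (face S w)" "face S w \<noteq> {}" using finite_face face_ne S by auto
  obtain t where t: "t \<in> face S w" "dotz v t = hz (face S w) v" using hz_attained ff by blast
  have "hz S (sm K w + v) \<le> K * hz S w + hz (face S w) v" if K: "K \<ge> 2 * M" for K
  proof (rule hz_leI[OF S])
    fix s assume s: "s \<in> S"
    show "dotz (sm K w + v) s \<le> K * hz S w + hz (face S w) v"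
    proof (cases "s \<in> face S w")
      case True
      then show ?thesis using hz_ge[OF ff(1), of s v] by (simp add: face_def)
    next
      case False
      have M0: "M \<ge> 0" using M[OF s] by simp
      have "dotz w s \<le> hz S w - 1" using False s hz_ge[OF S(1) s, of w] by (simp add: face_def)
      then have "K * dotz w s \<le> K * (hz S w - 1)" using K M0 by (intro mult_left_mono) auto
      moreover have "dotz v s \<le> M" "- M \<le> dotz v t" using M[OF s] M[of t] t by (auto simp: face_def)
      ultimately show ?thesis using K t by (simp add: algebra_simps)
    qed
  qed
  then show ?thesis by blast
qed

text \<open>The ends of the face of the sum are found by tilting \<open>w\<close> towards
  \<open>rot w\<close> and towards \<open>- rot w\<close>. Conversely, each lattice point between
  them is a sum of points of the two faces, so the edge has no gaps.\<close>

lemma flen_msum: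
  assumes S: "pg S" and T: "pg T" and w: "prim w"
  shows "flen (msum S T) w = flen S w + flen T w"
proof -
  let ?E = "rot w"
  have E: "?E \<noteq> 0" using w by (simp add: prim_nz rot_nz)
  have EE: "dotz ?E ?E > 0" using dotz_pos E by blast
  note fS = pgD[OF S] and fT = pgD[OF T]
  obtain a where a: "face S w = (\<lambda>i. a + sm i ?E) ` {0..flen S w}" using face_interval S w by blast
  obtain b where b: "face T w = (\<lambda>i. b + sm i ?E) ` {0..flen T w}" using face_interval T w by blast
  have l0: "flen S w \<ge> 0" "flen T w \<ge> 0" using flen_ge0 fS fT by auto
  have hS: "hz (face S w) ?E = dotz ?E a + flen S w * dotz ?E ?E"
    by (rule hz_eqI[of _ "a + sm (flen S w) ?E"]) (use a l0 EE in \<open>auto simp: finite_face fS intro!: mult_right_mono\<close>)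
  have hT: "hz (face T w) ?E = dotz ?E b + flen T w * dotz ?E ?E"
    by (rule hz_eqI[of _ "b + sm (flen T w) ?E"]) (use b l0 EE in \<open>auto simp: finite_face fT intro!: mult_right_mono\<close>)
  have af: "a \<in> face S w" unfolding a using l0 by (intro image_eqI[of _ _ 0]) auto
  have bf: "b \<in> face T w" unfolding b using l0 by (intro image_eqI[of _ _ 0]) auto
  have hS': "hz (face S w) (-?E) = dotz (-?E) a"
  proof (rule hz_eqI[OF finite_face[OF fS(1)] af refl])
    fix s assume "s \<in> face S w"
    then obtain i where i: "s = a + sm i ?E" "i \<in> {0..flen S w}" unfolding a by (rule imageE)
    have "0 \<le> i * dotz ?E ?E" using i(2) EE by (intro mult_nonneg_nonneg) simp_all
    then show "dotz (-?E) s \<le> dotz (-?E) a" unfolding i(1) by (simp only: dotz_minus dotz_add dotz_sm)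
  qed
  have hT': "hz (face T w) (-?E) = dotz (-?E) b"
  proof (rule hz_eqI[OF finite_face[OF fT(1)] bf refl])
    fix s assume "s \<in> face T w"
    then obtain i where i: "s = b + sm i ?E" "i \<in> {0..flen T w}" unfolding b by (rule imageE)
    have "0 \<le> i * dotz ?E ?E" using i(2) EE by (intro mult_nonneg_nonneg) simp_all
    then show "dotz (-?E) s \<le> dotz (-?E) b" unfolding i(1) by (simp only: dotz_minus dotz_add dotz_sm)
  qed
  have wa: "dotz w a = hz S w" and wb: "dotz w b = hz T w"
    using af bf unfolding face_def by blast+
  have bound: "dotz v n \<le> hz (face S w) v + hz (face T w) v" if n: "n \<in> face (msum S T) w" for n v
  proof -
    obtain K1 K2 where K: "\<forall>K\<ge>K1. hz S (sm K w + v) \<le> K * hz S w + hz (face S w) v"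
      "\<forall>K\<ge>K2. hz T (sm K w + v) \<le> K * hz T w + hz (face T w) v" using hz_tilt fS fT by metis
    define K where "K = max K1 K2"
    have "dotz (sm K w + v) n \<le> hz S (sm K w + v) + hz T (sm K w + v)"
      using n unfolding face_def msum_def LL_def by blast
    also have "\<dots> \<le> K * hz S w + hz (face S w) v + (K * hz T w + hz (face T w) v)"
      using K by (intro add_mono) (auto simp: K_def)
    moreover have "dotz w n = hz S w + hz T w" using n fS fT by (simp add: face_def)
    ultimately show ?thesis by (simp add: algebra_simps)
  qed
  have "face (msum S T) w = (\<lambda>i. (a + b) + sm i ?E) ` {0..flen S w + flen T w}" (is "_ = ?R")
  proof
    show "face (msum S T) w \<subseteq> ?R"
    proof
      fix n assume n: "n \<in> face (msum S T) w"
      then have "dotz w (n - (a + b)) = 0" using wa wb fS fT by (simp add: face_def)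
      then obtain k where "n - (a + b) = sm k ?E" using orth_prim w by blast
      then have k: "n = (a + b) + sm k ?E" by (metis add.commute diff_add_cancel)
      have "k * dotz ?E ?E \<le> (flen S w + flen T w) * dotz ?E ?E"
        using bound[OF n, of ?E] unfolding hS hT k by (simp add: algebra_simps)
      then have "k \<le> flen S w + flen T w" using EE by simp
      moreover have "0 \<le> k * dotz ?E ?E" using bound[OF n, of "-?E"] unfolding hS' hT' k by (simp add: algebra_simps)
      then have "0 \<le> k" using EE by (simp add: zero_le_mult_iff)
      ultimately show "n \<in> ?R" using k by auto
    qed
    show "?R \<subseteq> face (msum S T) w"
    proof (rule image_subsetI)
      fix i assume i: "i \<in> {0..flen S w + flen T w}"
      define i1 i2 where "i1 = min i (flen S w)" and "i2 = i - i1"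
      have "i1 \<in> {0..flen S w}" "i2 \<in> {0..flen T w}" using i l0 by (auto simp: i1_def i2_def)
      then have m: "a + sm i1 ?E \<in> face S w" "b + sm i2 ?E \<in> face T w" unfolding a b by blast+
      have "(a + sm i1 ?E) + (b + sm i2 ?E) \<in> msum S T"
        by (rule msum_mem) (use m fS fT in \<open>auto simp: face_def\<close>)
      moreover have "(a + sm i1 ?E) + (b + sm i2 ?E) = (a + b) + sm i ?E"
        using sm_add[of i1 i2 ?E] by (simp add: i2_def algebra_simps)
      ultimately show "(a + b) + sm i ?E \<in> face (msum S T) w"
        using wa wb fS fT by (simp add: face_def)
    qed
  qed
  then have "card (face (msum S T) w) = card {0..flen S w + flen T w}"
    by (simp add: card_image inj_on_def sm_inj[OF E])
  then show ?thesis using l0 by (simp add: flen_def[of "msum S T"])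
qed

lemma finite_normals: assumes "finite S" shows "finite (normals S)"
proof -
  have sub: "normals S \<subseteq> (\<Union>a\<in>S. \<Union>b\<in>S. {w. prim w \<and> a \<noteq> b \<and> dotz w (a - b) = 0})"
  proof
    fix w assume "w \<in> normals S"
    then have w: "prim w" "flen S w \<ge> 1" by (auto simp: normals_def)
    then have "\<not> card (face S w) \<le> Suc 0" by (simp add: flen_def)
    then obtain a b where ab: "a \<in> face S w" "b \<in> face S w" "a \<noteq> b"
      using card_le_Suc0_iff_eq[OF finite_face[OF assms]] by blast
    then show "w \<in> (\<Union>a\<in>S. \<Union>b\<in>S. {w. prim w \<and> a \<noteq> b \<and> dotz w (a - b) = 0})"
      using w ab by (intro UN_I[of a] UN_I[of b] CollectI) (simp_all add: face_def)
  qed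
  have fin: "finite {w. prim w \<and> a \<noteq> b \<and> dotz w (a - b) = 0}" for a b
  proof (cases "a = b")
    case False
    then obtain g e where e: "g > 0" "prim e" "a - b = sm g e" using prim_part[of "a - b"] by auto
    have "{w. prim w \<and> a \<noteq> b \<and> dotz w (a - b) = 0} \<subseteq> {rot e, - rot e}"
    proof
      fix w assume "w \<in> {w. prim w \<and> a \<noteq> b \<and> dotz w (a - b) = 0}"
      then have w: "prim w" "dotz w (a - b) = 0" by auto
      then have "dotz w (rot (rot e)) = 0" unfolding e using e(1) by simp
      then show "w \<in> {rot e, - rot e}" using prim_parallel[of "rot e" w] w e by simp
    qed
    then show ?thesis by (rule finite_subset) simp
  qed simp
  show ?thesis by (rule finite_subset[OF sub]) (intro finite_UN_I assms fin)
qed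

text \<open>Vectors in an open half plane are preordered by their angle, and \<open>c\<close> is a
  first one. The identity \<open>id\<close> between planar vectors and \<open>\<theta>\<close>
  yields transitivity.\<close>

lemma extreme_ray:
  assumes "finite T" "T \<noteq> {}" "\<And>n. n \<in> T \<Longrightarrow> dotz \<theta> n > 0"
  shows "\<exists>c\<in>T. \<forall>n\<in>T. dotz (rot c) n \<ge> 0"
  using assms
proof (induction T rule: finite_ne_induct)
  case (insert x F)
  then obtain c where c: "c \<in> F" "\<forall>n\<in>F. dotz (rot c) n \<ge> 0" by auto
  have id: "dotz (rot x) t * dotz \<theta> c = dotz (rot x) c * dotz \<theta> t + dotz (rot c) t * dotz \<theta> x" for t
    by (simp add: dotz_def rot_def algebra_simps)
  show ?case
  proof (cases "dotz (rot c) x \<ge> 0")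
    case True
    then show ?thesis using c by auto
  next
    case False
    have "dotz (rot x) t \<ge> 0" if "t \<in> F" for t
    proof -
      have "dotz (rot x) c \<ge> 0" using False by (simp add: dotz_def rot_def algebra_simps)
      then have "0 \<le> dotz (rot x) t * dotz \<theta> c" unfolding id using that insert.prems c
        by (intro add_nonneg_nonneg mult_nonneg_nonneg) (auto simp: less_imp_le)
      then show ?thesis using insert.prems[of c] c by (auto simp: zero_le_mult_iff)
    qed
    then show ?thesis by auto
  qed
qed auto

lemma edges_at_exposed_vertex:
  assumes S: "pg S" and v: "v \<in> S" and \<theta>: "\<And>n. n \<in> S - {v} \<Longrightarrow> dotz \<theta> (n - v) > 0" and ne: "S \<noteq> {v}"
  obtains w1 w2 where "w1 \<noteq> w2" "prim w1" "prim w2" "v \<in> face S w1" "v + rot w1 \<in> S" "v \<in> face S w2" "v - rot w2 \<in> S"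
    "\<And>w. prim w \<Longrightarrow> v \<in> face S w \<Longrightarrow> flen S w \<ge> 1 \<Longrightarrow> w = w1 \<or> w = w2"
proof -
  note f = pgD[OF S]
  let ?T = "(\<lambda>n. n - v) ` (S - {v})"
  have "S - {v} \<noteq> {}" using f ne v by blast
  then have T: "finite ?T" "?T \<noteq> {}" "\<And>n. n \<in> ?T \<Longrightarrow> dotz \<theta> n > 0" using f by (simp, simp, metis \<theta> imageE)
  obtain c where c: "c \<in> ?T" "\<And>n. n \<in> ?T \<Longrightarrow> dotz (rot c) n \<ge> 0" using extreme_ray[OF T] by blast
  \<comment> \<open>Exchanging the coordinates reverses orientation, so the same lemma supplies the
    extreme ray on the other side.\<close>
  let ?r = "\<lambda>n::lat. (snd n, fst n)"
  have "\<exists>c\<in>?r ` ?T. \<forall>n\<in>?r ` ?T. dotz (rot c) n \<ge> 0"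
    by (rule extreme_ray[of _ "?r \<theta>"]) (use T in \<open>auto simp: dotz_def algebra_simps\<close>)
  then obtain c' where c': "c' \<in> ?r ` ?T" "\<forall>n\<in>?r ` ?T. dotz (rot c') n \<ge> 0" by blast
  obtain a where a0: "c' = ?r a" "a \<in> ?T" using c'(1) by (rule imageE)
  have "dotz (rot a) n \<le> 0" if "n \<in> ?T" for n
    using bspec[OF c'(2) imageI[OF that]] unfolding a0(1) by (simp add: dotz_def rot_def algebra_simps)
  note a = a0(2) this
  have nz: "c \<noteq> 0" "a \<noteq> 0" using T(3)[OF c(1)] T(3)[OF a(1)] by auto
  obtain gc ec where ec: "gc > 0" "prim ec" "c = sm gc ec" using prim_part nz by blast
  obtain ga ea where ea: "ga > 0" "prim ea" "a = sm ga ea" using prim_part nz by blast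
  \<comment> \<open>Then \<open>rot w1 = ec\<close> and \<open>- rot w2 = ea\<close>: the edge with
    normal \<open>w1\<close> leaves \<open>v\<close> and the one with normal \<open>w2\<close>
    arrives at \<open>v\<close>.\<close>
  define w1 w2 where "w1 = - rot ec" and "w2 = rot ea"
  have p: "prim w1" "prim w2" using ec ea by (auto simp: w1_def w2_def)
  have le1: "dotz w1 n \<le> 0" if "n \<in> ?T" for n
    using c(2)[OF that] ec unfolding w1_def ec(3) rot_sm by (simp add: zero_le_mult_iff)
  have le2: "dotz w2 n \<le> 0" if "n \<in> ?T" for n
    using a(2)[OF that] ea unfolding w2_def ea(3) rot_sm by (simp add: mult_le_0_iff)
  have faceI: "v \<in> face S w" if "\<And>n. n \<in> ?T \<Longrightarrow> dotz w n \<le> 0" for w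
  proof -
    have "dotz w n \<le> dotz w v" if "n \<in> S" for n
      using \<open>\<And>n. n \<in> ?T \<Longrightarrow> dotz w n \<le> 0\<close>[of "n - v"] that by (cases "n = v") auto
    then have "hz S w = dotz w v" by (rule hz_eqI[OF f(1) v refl])
    then show ?thesis using v by (simp add: face_def)
  qed
  have va: "v + c \<in> S" "v + a \<in> S" using c(1) a(1) by auto
  have m1: "v + rot w1 \<in> S" using pg_between[OF S v, of gc ec 1] va(1) ec by (simp add: w1_def)
  have m2: "v - rot w2 \<in> S" using pg_between[OF S v, of ga ea 1] va(2) ea by (simp add: w2_def)
  have "w1 \<noteq> w2"
  proof
    assume "w1 = w2"
    then have "rot (rot ea) = rot (- rot ec)" by (simp add: w1_def w2_def)
    then have "ea = - ec" by (metis minus_minus rot_minus rot_rot)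
    then have "gc * dotz \<theta> a = - ga * dotz \<theta> c" unfolding ec(3) ea(3) by simp
    moreover have "gc * dotz \<theta> a > 0" "ga * dotz \<theta> c > 0" using T(3)[OF c(1)] T(3)[OF a(1)] ec ea by auto
    ultimately show False by linarith
  qed
  moreover have "w = w1 \<or> w = w2" if w: "prim w" "v \<in> face S w" "flen S w \<ge> 1" for w
  proof -
    have "\<not> card (face S w) \<le> Suc 0" using w by (simp add: flen_def)
    then obtain m where m: "m \<in> face S w" "m \<noteq> v"
      using card_le_Suc0_iff_eq[OF finite_face[OF f(1)]] w(2) by metis
    let ?n = "m - v"
    have n: "?n \<in> ?T" "dotz w ?n = 0" using m w by (auto simp: face_def)
    have wle: "dotz w k \<le> 0" if "k \<in> ?T" for k
    proof -
      from that obtain x where x: "k = x - v" "x \<in> S - {v}" by (rule imageE)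
      then show ?thesis using w(2) hz_ge[OF f(1), of x w] by (simp add: face_def)
    qed
    obtain k where k: "?n = sm k (rot w)" using orth_prim[OF w(1) n(2)] by blast
    have "dotz \<theta> ?n > 0" using T(3) n by blast
    then have k0: "k \<noteq> 0" unfolding k by auto
    have rn: "rot ?n = sm (- k) w" unfolding k rot_sm by simp
    have par: "dotz (rot ?n) e = 0 \<Longrightarrow> prim e \<Longrightarrow> rot e = w \<or> rot e = - w" for e
    proof -
      assume "dotz (rot ?n) e = 0" "prim e"
      then have "dotz w e = 0" unfolding rn using k0 by simp
      then show ?thesis using prim_parallel[of w "rot e"] w \<open>prim e\<close> by (simp add: dotz_commute)
    qed
    show ?thesis
    proof (cases "k > 0")
      case True
      have "dotz (rot ?n) c \<ge> 0" using wle[OF c(1)] True unfolding rn by (simp add: mult_le_0_iff)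
      moreover have "dotz (rot ?n) c = - dotz (rot c) ?n" by (simp only: dotz_def rot_def) (simp add: algebra_simps)
      ultimately have "dotz (rot ?n) c = 0" using c(2)[OF n(1)] by simp
      then have "dotz (rot ?n) ec = 0" unfolding ec(3) using ec by simp
      then have "rot ec = w \<or> rot ec = - w" using par ec(2) by blast
      then consider "w1 = w" | "w1 = - w" unfolding w1_def by fastforce
      then show ?thesis
      proof cases
        case 2
        then have r: "rot w = - ec" by (metis minus_minus rot_minus rot_rot w1_def)
        have "gc * dotz \<theta> ?n = - k * dotz \<theta> c" unfolding k r ec(3) by simp
        then show ?thesis using True \<open>dotz \<theta> ?n > 0\<close> T(3)[OF c(1)] ec
          by (metis mult_minus_left mult_pos_pos neg_0_less_iff_less not_less_iff_gr_or_eq)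
      qed simp
    next
      case False
      have "dotz (rot ?n) a \<le> 0" using wle[OF a(1)] False k0 unfolding rn by (simp add: mult_le_0_iff zero_le_mult_iff)
      moreover have "dotz (rot ?n) a = - dotz (rot a) ?n" by (simp only: dotz_def rot_def) (simp add: algebra_simps)
      ultimately have "dotz (rot ?n) a = 0" using a(2)[OF n(1)] by simp
      then have "dotz (rot ?n) ea = 0" unfolding ea(3) using ea by simp
      then have "rot ea = w \<or> rot ea = - w" using par ea(2) by blast
      then consider "w2 = w" | "w2 = - w" unfolding w2_def by blast
      then show ?thesis
      proof cases
        case 2
        then have r: "rot w = ea" by (metis minus_minus rot_minus rot_rot w2_def)
        have "ga * dotz \<theta> ?n = k * dotz \<theta> a" unfolding k r ea(3) by simp
        then show ?thesis using False \<open>dotz \<theta> ?n > 0\<close> T(3)[OF a(1)] ea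
          by (smt (verit) mult_pos_pos mult_nonpos_nonneg)
      qed simp
    qed
  qed
  ultimately show thesis using that[of w1 w2] p faceI[OF le1] faceI[OF le2] m1 m2 by blast
qed

lemma pg_remove_vertex:
  assumes S: "pg S" and v: "v \<in> S" and \<theta>: "\<And>n. n \<in> S - {v} \<Longrightarrow> dotz \<theta> (n - v) > 0" and ne: "S \<noteq> {v}"
  shows "pg (S - {v})"
proof -
  note f = pgD[OF S]
  have ne': "S - {v} \<noteq> {}" "finite (S - {v})" using v ne f by auto
  have "n \<in> S - {v}" if n: "n \<in> LL (hz (S - {v}))" for n
  proof -
    have le: "dotz w n \<le> hz (S - {v}) w" for w using n by (simp add: LL_def)
    have "n \<in> S" by (rule pg_memI[OF S], rule order_trans[OF le], rule hz_mono[OF f(1) ne'(1) Diff_subset])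
    moreover have "n \<noteq> v"
    proof
      assume "n = v"
      obtain s where s: "s \<in> S - {v}" "dotz (- \<theta>) s = hz (S - {v}) (- \<theta>)" by (rule hz_attained[OF ne'(2,1)])
      show False using le[of "- \<theta>"] \<theta>[OF s(1)] s(2) \<open>n = v\<close> by simp
    qed
    ultimately show ?thesis by simp
  qed
  then show ?thesis using ne' unfolding pg_def by blast
qed

text \<open>Removing \<open>v\<close> exposes new edges; a lattice point strictly between \<open>v\<close> and such an edge would
  have to lie in \<open>S\<close>, so the new edge is at lattice distance one from \<open>v\<close>.\<close>

lemma new_edge_distance:
  assumes S: "pg S" and v: "v \<in> S" and w: "prim w" and fl: "flen (S - {v}) w \<ge> 1" and pg': "pg (S - {v})"
    and lt: "hz (S - {v}) w < dotz w v"
  shows "hz (S - {v}) w = dotz w v - 1"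
proof (rule ccontr)
  assume ne1: "hz (S - {v}) w \<noteq> dotz w v - 1"
  define k where "k = dotz w v - hz (S - {v}) w"
  have k: "k \<ge> 2" using lt ne1 by (simp add: k_def)
  let ?E = "rot w"
  note f' = pgD[OF pg']
  obtain c where c: "face (S - {v}) w = (\<lambda>i. c + sm i ?E) ` {0..flen (S - {v}) w}" using face_interval pg' w by blast
  have "c + sm 0 ?E \<in> face (S - {v}) w" "c + sm 1 ?E \<in> face (S - {v}) w" unfolding c using fl by (force intro!: imageI)+
  then have c1: "c \<in> S - {v}" "c + ?E \<in> S - {v}" "dotz w c = hz (S - {v}) w" by (auto simp: face_def)
  obtain m where m: "dotz w m = 1" using prim_bezout w by blast
  have "dotz w (c - v + sm k m) = 0" using m c1 by (simp add: k_def)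
  then obtain s where s: "c - v + sm k m = sm s ?E" using orth_prim w by blast
  \<comment> \<open>This point has height one above the new edge. Dividing \<open>s\<close> by
    \<open>k\<close> with remainder places it in the triangle with corners \<open>v\<close>,
    \<open>c\<close>, \<open>c + rot w\<close>.\<close>
  define n where "n = c + m - sm (s div k) ?E"
  have "sm k n = sm 1 v + sm (k - 1 - s mod k) c + sm (s mod k) (c + ?E)"
  proof -
    have "sm k n = sm k c + (sm s ?E - c + v) - sm (k * (s div k)) ?E"
      unfolding n_def by (simp add: sm_add_right sm_diff_right flip: s)
    also have "sm (k * (s div k)) ?E = sm s ?E - sm (s mod k) ?E"
      by (simp add: minus_mod_eq_mult_div[symmetric] sm_diff)
    finally show ?thesis by (simp add: sm_add_right sm_diff)
  qed
  then have "n \<in> S" by (rule pg_convex3[OF S]) (use k v c1 in \<open>auto simp: zle_diff1_eq\<close>)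
  moreover have wn: "dotz w n = hz (S - {v}) w + 1" using m c1 by (simp add: n_def)
  moreover have "n \<noteq> v" using wn k by (auto simp: k_def)
  ultimately show False using hz_ge[OF f'(1), of n w] by auto
qed

text \<open>Pick's formula with base point \<open>p\<close>: for a two-dimensional polygon the terms
  \<open>flen S w * (hz S w - dotz w p)\<close> add up to twice the area, by triangulation from
  \<open>p\<close>, and the lengths to the number of boundary points. In this form it also holds for
  segments and points.\<close>

definition pick :: "lat set \<Rightarrow> lat \<Rightarrow> bool" where
  "pick S p \<longleftrightarrow> 2 * int (card S) = 2 + (\<Sum>w\<in>normals S. flen S w * (hz S w - dotz w p + 1))"

lemma sum_normals:
  assumes "finite W" "\<And>w. w \<in> W \<Longrightarrow> prim w" "normals S \<subseteq> W" "finite S" "S \<noteq> {}"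
  shows "(\<Sum>w\<in>normals S. flen S w * g w) = (\<Sum>w\<in>W. flen S w * g w)"
proof (rule sum.mono_neutral_left[OF assms(1,3)])
  show "\<forall>w\<in>W - normals S. flen S w * g w = 0"
  proof
    fix w assume "w \<in> W - normals S"
    then have "\<not> flen S w \<ge> 1" using assms(2) by (auto simp: normals_def)
    then have "flen S w = 0" using flen_ge0[OF assms(4,5), of w] by simp
    then show "flen S w * g w = 0" by simp
  qed
qed

text \<open>The base point is the removed vertex. The two edges at \<open>v\<close> have distance
  zero and lose one unit step each, which accounts for the difference of two; edges away from
  \<open>v\<close> are unchanged; a newly exposed edge lies at distance one below \<open>v\<close>,
  so its factor \<open>hz - dotz w v + 1\<close> is zero.\<close>

lemma pick_step:
  assumes S: "pg S" and v: "v \<in> S" and \<theta>: "\<And>n. n \<in> S - {v} \<Longrightarrow> dotz \<theta> (n - v) > 0" and ne: "S \<noteq> {v}"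
    and IH: "pick (S - {v}) v"
  shows "pick S v"
proof -
  let ?S = "S - {v}"
  have pg': "pg ?S" using pg_remove_vertex assms by blast
  note f = pgD[OF S] and f' = pgD[OF pg']
  obtain w1 w2 where e: "w1 \<noteq> w2" "prim w1" "prim w2" "v \<in> face S w1" "v + rot w1 \<in> S" "v \<in> face S w2" "v - rot w2 \<in> S"
    "\<And>w. prim w \<Longrightarrow> v \<in> face S w \<Longrightarrow> flen S w \<ge> 1 \<Longrightarrow> w = w1 \<or> w = w2"
    using edges_at_exposed_vertex[OF S v \<theta> ne] by blast
  have two: "flen S w \<ge> 1" if "v \<in> face S w" "x \<in> S" "dotz w x = dotz w v" "x \<noteq> v" for w x
  proof -
    have "{v, x} \<subseteq> face S w" using that by (auto simp: face_def)
    then have "card {v, x} \<le> card (face S w)" by (rule card_mono[OF finite_face[OF f(1)]])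
    then show ?thesis using that by (simp add: flen_def)
  qed
  have rn: "rot w1 \<noteq> 0" "rot w2 \<noteq> 0" using rot_nz[OF prim_nz[OF e(2)]] rot_nz[OF prim_nz[OF e(3)]] .
  have fl: "flen S w1 \<ge> 1" "flen S w2 \<ge> 1" using two[OF e(4) e(5)] two[OF e(6) e(7)] rn by auto
  define W where "W = normals S \<union> normals ?S"
  have W: "finite W" "\<And>w. w \<in> W \<Longrightarrow> prim w" "normals S \<subseteq> W" "normals ?S \<subseteq> W"
    using finite_normals f f' by (auto simp: W_def normals_def)
  let ?t = "\<lambda>S w. flen S w * (hz S w - dotz w v + 1)"
  have trm: "?t S w - ?t ?S w = (if w = w1 \<or> w = w2 then 1 else 0)" if "w \<in> W" for w
  proof -
    have w: "prim w" using W that by blast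
    consider "v \<notin> face S w" | "v \<in> face S w" "flen S w \<ge> 1" | "v \<in> face S w" "flen S w = 0"
      using flen_ge0[OF f, of w] by linarith
    then show ?thesis
    proof cases
      case 1
      obtain s where s: "s \<in> S" "dotz w s = hz S w" using hz_attained f by blast
      have h: "hz ?S w = hz S w" using s 1 v by (intro hz_eqI[of _ s]) (auto simp: f face_def hz_ge)
      have "face ?S w = face S w" using 1 unfolding face_def h by auto
      then show ?thesis using h 1 e(4,6) by (auto simp: flen_def)
    next
      case 2
      have "\<not> card (face S w) \<le> Suc 0" using 2 by (simp add: flen_def)
      then obtain m where m: "m \<in> face S w" "m \<noteq> v"
        using card_le_Suc0_iff_eq[OF finite_face[OF f(1)]] 2(1) by metis
      have h: "hz ?S w = hz S w" using m by (intro hz_eqI[of _ m]) (auto simp: f face_def hz_ge)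
      have "face ?S w = face S w - {v}" unfolding face_def h by auto
      then have "flen ?S w = flen S w - 1" using 2 finite_face[OF f(1), of w]
        by (simp add: flen_def card_Diff_singleton_if)
      then show ?thesis using h 2 e(8)[OF w 2] by (auto simp: face_def algebra_simps)
    next
      case 3
      then have nw: "w \<noteq> w1" "w \<noteq> w2" using fl by auto
      have vf: "dotz w v = hz S w" using 3 by (simp add: face_def)
      have "flen ?S w = 0 \<or> hz ?S w = dotz w v - 1"
      proof (cases "flen ?S w \<ge> 1")
        case True
        obtain s where s: "s \<in> ?S" "dotz w s = hz ?S w" by (rule hz_attained[OF f'])
        have sS: "s \<in> S" "s \<noteq> v" using s(1) by simp_all
        have "dotz w s \<noteq> dotz w v" using two[OF 3(1) sS(1) _ sS(2)] 3(2) by linarith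
        then have "hz ?S w < dotz w v" using s vf hz_ge[OF f(1) sS(1), of w] by simp
        then show ?thesis using new_edge_distance[OF S v w True pg'] by blast
      qed (use flen_ge0[OF f', of w] in auto)
      then show ?thesis using 3 nw by auto
    qed
  qed
  have sub: "{w1, w2} \<subseteq> W" using e(2,3) fl by (simp add: W_def normals_def)
  have "(\<Sum>w\<in>W. ?t S w) - (\<Sum>w\<in>W. ?t ?S w) = (\<Sum>w\<in>W. if w = w1 \<or> w = w2 then 1 else 0)"
    by (simp add: sum_subtractf[symmetric] trm)
  also have "\<dots> = (\<Sum>w\<in>{w1, w2}. 1)"
    by (intro sum.mono_neutral_cong_right[OF W(1) sub]) simp_all
  also have "\<dots> = 2" using e(1) by simp
  finally have "(\<Sum>w\<in>W. ?t S w) = (\<Sum>w\<in>W. ?t ?S w) + 2" by simp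
  moreover have "int (card S) = int (card ?S) + 1" using card_Suc_Diff1[OF f(1) v] by linarith
  ultimately show ?thesis using IH unfolding pick_def
    using sum_normals[OF W(1,2,3) f] sum_normals[OF W(1,2,4) f'] by simp
qed

text \<open>Ties on the face are broken by \<open>rot w\<close>; the weight \<open>M + 1\<close> on
  \<open>w\<close> outweighs every difference in direction \<open>rot w\<close>.\<close>

lemma exposed_max:
  assumes S: "finite S" "S \<noteq> {}" and w: "w \<noteq> 0"
  obtains v \<theta> where "v \<in> S" "dotz w v = hz S w" "\<And>n. n \<in> S - {v} \<Longrightarrow> dotz \<theta> (n - v) > 0"
proof -
  have ff: "finite (face S w)" "face S w \<noteq> {}" using S finite_face face_ne by auto
  obtain v where v: "v \<in> face S w" "dotz (rot w) v = hz (face S w) (rot w)" using hz_attained ff by blast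
  define M where "M = Max ((\<lambda>s. \<bar>dotz (rot w) (s - v)\<bar>) ` S)"
  have M: "\<bar>dotz (rot w) (s - v)\<bar> \<le> M" if "s \<in> S" for s using that S unfolding M_def by (intro Max_ge) auto
  have M0: "M \<ge> 0" using M[of v] v by (auto simp: face_def)
  define \<theta> where "\<theta> = - (sm (M + 1) w + rot w)"
  have "dotz \<theta> (n - v) > 0" if n: "n \<in> S - {v}" for n
  proof (cases "n \<in> face S w")
    case True
    have e: "dotz w (n - v) = 0" using True v by (simp add: face_def)
    have "dotz (rot w) (n - v) \<noteq> 0"
    proof
      assume z: "dotz (rot w) (n - v) = 0"
      let ?x = "n - v"
      have "dotz w w * fst ?x = fst w * dotz w ?x - snd w * dotz (rot w) ?x"
        "dotz w w * snd ?x = snd w * dotz w ?x + fst w * dotz (rot w) ?x"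
        by (simp_all add: dotz_def rot_def algebra_simps del: dotz_diff)
      then have "fst ?x = 0" "snd ?x = 0" using e z dotz_pos[OF w] by simp_all
      then have "n - v = 0" by (simp add: prod_eq_iff)
      then show False using n by simp
    qed
    moreover have "dotz (rot w) n \<le> dotz (rot w) v" using hz_ge[OF ff(1) True, of "rot w"] v by simp
    ultimately show ?thesis using e by (simp add: \<theta>_def)
  next
    case False
    have "dotz w (n - v) \<le> -1" using False n v hz_ge[OF S(1), of n w] by (simp add: face_def)
    then have "(M + 1) * dotz w (n - v) \<le> (M + 1) * (-1)" using M0 by (intro mult_left_mono) auto
    then show ?thesis using M[of n] n by (simp add: \<theta>_def algebra_simps abs_le_iff)
  qed
  then show thesis using that[of v \<theta>] v by (auto simp: face_def)
qed

text \<open>The induction yields the formula at exposed vertices only. As a function of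
  \<open>p\<close> it changes by \<open>dotz r p\<close> with \<open>r\<close> the weighted sum of
  the normals, so \<open>r = 0\<close> has to be shown. Otherwise comparing the two extreme vertices
  in direction \<open>r\<close> makes \<open>dotz r\<close> constant on \<open>S\<close>; then
  \<open>S\<close> lies on a line, and its normals \<open>w0\<close> and \<open>- w0\<close> have
  equal lengths and cancel.\<close>

lemma pick_formula: "pg S \<Longrightarrow> pick S p"
proof (induction "card S" arbitrary: S p rule: less_induct)
  case (less S p)
  note S = \<open>pg S\<close>
  note f = pgD[OF S]
  have ver: "pick S v" if "v \<in> S" "\<And>n. n \<in> S - {v} \<Longrightarrow> dotz \<theta> (n - v) > 0" "S \<noteq> {v}" for v \<theta>
  proof (rule pick_step[OF S that])
    have "card (S - {v}) < card S" by (rule card_Diff1_less[OF f(1) that(1)])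
    then show "pick (S - {v}) v" using less(1) pg_remove_vertex[OF S that] by blast
  qed
  show ?case
  proof (cases "\<exists>v. S = {v}")
    case True
    then obtain v where v: "S = {v}" ..
    have "face S w \<subseteq> {v}" for w unfolding face_def v by blast
    then have c1: "card (face S w) \<le> card {v}" for w by (intro card_mono) simp_all
    have "\<not> flen S w \<ge> 1" for w using c1[of w] by (simp add: flen_def)
    then have "normals S = {}" by (simp add: normals_def)
    then show ?thesis by (simp add: pick_def v)
  next
    case False
    define A where "A = (\<Sum>w\<in>normals S. flen S w * fst w)"
    define B where "B = (\<Sum>w\<in>normals S. flen S w * snd w)"
    define r where "r = (A, B)"
    have AB: "(\<Sum>w\<in>normals S. flen S w * dotz w q) = dotz r q" for q
      by (simp add: r_def A_def B_def dotz_def sum_distrib_left sum.distrib algebra_simps)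
    have rel: "(\<Sum>w\<in>normals S. flen S w * (hz S w - dotz w q + 1))
        = (\<Sum>w\<in>normals S. flen S w * (hz S w + 1)) - dotz r q" for q
      unfolding AB[symmetric] by (simp add: sum_subtractf[symmetric] algebra_simps)
    have "(1::int, 0::int) \<noteq> 0" by (simp add: prod_eq_iff)
    then obtain v0 \<theta>0 where v0: "v0 \<in> S" "\<And>n. n \<in> S - {v0} \<Longrightarrow> dotz \<theta>0 (n - v0) > 0"
      using exposed_max f by metis
    have p0: "pick S v0" using ver[OF v0] False by blast
    have "r = 0"
    proof (rule ccontr)
      assume nz: "r \<noteq> 0"
      obtain v1 \<theta>1 where v1: "v1 \<in> S" "dotz r v1 = hz S r" "\<And>n. n \<in> S - {v1} \<Longrightarrow> dotz \<theta>1 (n - v1) > 0"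
        using exposed_max[OF f nz] by blast
      have nz': "- r \<noteq> 0" using nz by simp
      obtain v2 \<theta>2 where v2: "v2 \<in> S" "dotz (- r) v2 = hz S (- r)" "\<And>n. n \<in> S - {v2} \<Longrightarrow> dotz \<theta>2 (n - v2) > 0"
        using exposed_max[OF f nz'] by blast
      have "pick S v1" "pick S v2" using ver v1 v2 False by blast+
      then have "dotz r v1 = dotz r v2" unfolding pick_def rel by linarith
      then have const: "dotz r s = hz S r" if "s \<in> S" for s
        using hz_ge[OF f(1) that, of "r"] hz_ge[OF f(1) that, of "- r"] v1(2) v2(2) by simp
      obtain g w0 where w0: "g > 0" "prim w0" "r = sm g w0" using prim_part nz by blast
      have c0: "dotz w0 s = dotz w0 t" if "s \<in> S" "t \<in> S" for s t
      proof -
        have "dotz r s = dotz r t" using const[OF that(1)] const[OF that(2)] by (rule trans[OF _ sym])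
        then show ?thesis using w0(1) unfolding w0(3) by simp
      qed
      have "normals S \<subseteq> {w0, - w0}"
      proof
        fix w assume "w \<in> normals S"
        then have w: "prim w" "flen S w \<ge> 1" by (auto simp: normals_def)
        then have "\<not> card (face S w) \<le> Suc 0" by (simp add: flen_def)
        then obtain a b where ab: "a \<in> face S w" "b \<in> face S w" "a \<noteq> b"
          using card_le_Suc0_iff_eq[OF finite_face[OF f(1)]] by blast
        have "dotz w0 (a - b) = 0" using c0[of a b] ab by (simp add: face_def)
        then obtain k where k: "a - b = sm k (rot w0)" using orth_prim w0 by blast
        moreover have "dotz w (a - b) = 0" using ab by (simp add: face_def)
        moreover have "k \<noteq> 0" using k ab by auto
        ultimately have "dotz w (rot w0) = 0" by simp
        then show "w \<in> {w0, - w0}" using prim_parallel w0 w by blast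
      qed
      then have W: "(\<Sum>w\<in>normals S. flen S w * dotz w q) = (\<Sum>w\<in>{w0, - w0}. flen S w * dotz w q)" for q
        by (intro sum_normals) (use f w0 in auto)
      have fS: "face S w = S" if w: "w = w0 \<or> w = - w0" for w
      proof -
        obtain t where t: "t \<in> S" "dotz w t = hz S w" by (rule hz_attained[OF f])
        have "dotz w s = hz S w" if "s \<in> S" for s
          unfolding t(2)[symmetric] using c0[OF that t(1)] w by (elim disjE) simp_all
        then show ?thesis unfolding face_def by blast
      qed
      have "face S w0 = S" "face S (- w0) = S" by (rule fS, simp)+
      moreover have "w0 \<noteq> - w0" using prim_nz[OF w0(2)] by (auto simp: prod_eq_iff)
      ultimately have "dotz r q = 0" for q unfolding AB[symmetric] W by (simp add: flen_def)
      then show False using dotz_pos[OF nz] by simp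
    qed
    then show ?thesis using p0 unfolding pick_def rel by simp
  qed
qed

section \<open>Mixed lattice point counts\<close>

text \<open>Minkowski's formula for twice the mixed area, with lattice lengths and integer support
  numbers.\<close>

definition mS :: "lat set \<Rightarrow> lat set \<Rightarrow> int" where
  "mS S T = (\<Sum>w\<in>normals S. flen S w * hz T w)"

definition bS :: "lat set \<Rightarrow> int" where "bS S = (\<Sum>w\<in>normals S. flen S w)"

text \<open>The mixed volume in terms of lattice point counts. It is additive in each argument by
  \<open>mv_msum\<close>, and in Bernstein's theorem it counts the common zeros of two generic
  Laurent polynomials.\<close>

definition mv :: "lat set \<Rightarrow> lat set \<Rightarrow> int" where
  "mv S T = int (card (msum S T)) - int (card S) - int (card T) + 1"

definition neg :: "lat set \<Rightarrow> lat set" where "neg S = uminus ` S"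

definition seg :: "lat \<Rightarrow> lat set" where "seg w = {0, rot w}"

definition wd :: "lat set \<Rightarrow> lat \<Rightarrow> int" where "wd S w = hz S w + hz S (- w)"

lemma pick_mS: "pg S \<Longrightarrow> 2 * int (card S) = 2 + mS S S + bS S"
  using pick_formula[of S 0] by (simp add: pick_def mS_def bS_def algebra_simps sum.distrib)

lemma normals_prim: "w \<in> normals S \<Longrightarrow> prim w" by (simp add: normals_def)

lemma normals_msum: assumes "pg S" "pg T" shows "normals (msum S T) \<subseteq> normals S \<union> normals T"
  using flen_msum[OF assms] flen_ge0[OF pgD[OF assms(1)]] flen_ge0[OF pgD[OF assms(2)]]
  by (force simp: normals_def)

lemma mS_msum_right:
  assumes "pg T" "pg U" shows "mS S (msum T U) = mS S T + mS S U"
  using pgD[OF assms(1)] pgD[OF assms(2)] by (simp add: mS_def sum.distrib[symmetric] algebra_simps)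

lemma sum_flen_msum:
  assumes S: "pg S" and T: "pg T"
  shows "(\<Sum>w\<in>normals (msum S T). flen (msum S T) w * g w)
    = (\<Sum>w\<in>normals S. flen S w * g w) + (\<Sum>w\<in>normals T. flen T w * g w)"
proof -
  let ?W = "normals S \<union> normals T"
  note f = pgD[OF S] pgD[OF T]
  have p: "pg (msum S T)" using f by (intro pg_msum)
  have W: "finite ?W" "\<And>w. w \<in> ?W \<Longrightarrow> prim w" using f finite_normals by (auto simp: normals_def)
  have "(\<Sum>w\<in>normals (msum S T). flen (msum S T) w * g w) = (\<Sum>w\<in>?W. flen (msum S T) w * g w)"
    by (rule sum_normals[OF W(1) W(2) normals_msum[OF S T] pgD[OF p]])
  also have "\<dots> = (\<Sum>w\<in>?W. flen S w * g w + flen T w * g w)"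
    by (intro sum.cong refl) (simp add: flen_msum[OF S T W(2)] distrib_right)
  finally show ?thesis
    using sum_normals[OF W(1) W(2) Un_upper1 f(1,2), of g] sum_normals[OF W(1) W(2) Un_upper2 f(3,4), of g]
    by (simp add: sum.distrib)
qed

lemma mS_msum_left: assumes "pg S" "pg T" shows "mS (msum S T) U = mS S U + mS T U"
  unfolding mS_def by (rule sum_flen_msum[OF assms])

lemma bS_msum: assumes "pg S" "pg T" shows "bS (msum S T) = bS S + bS T"
  using sum_flen_msum[OF assms, of "\<lambda>_. 1"] by (simp add: bS_def)

text \<open>Pick's formula is applied to \<open>S\<close>, \<open>T\<close> and their sum. The
  boundary terms are additive and cancel; expanding the area term of the sum leaves the two mixed
  terms.\<close>

lemma mv_mS: assumes S: "pg S" and T: "pg T" shows "2 * mv S T = mS S T + mS T S"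
proof -
  have p: "pg (msum S T)" using pgD[OF S] pgD[OF T] by (intro pg_msum)
  show ?thesis
    using pick_mS[OF S] pick_mS[OF T] pick_mS[OF p] mS_msum_left[OF S T, of "msum S T"]
      mS_msum_right[OF S T, of S] mS_msum_right[OF S T, of T] bS_msum[OF S T] by (simp add: mv_def)
qed

lemma mv_self: "pg S \<Longrightarrow> mv S S = mS S S" using mv_mS[of S S] by simp
lemma mv_commute: "mv S T = mv T S" by (simp add: mv_def msum_commute)

lemma mv_msum: assumes "pg S" "pg T" "pg U" shows "mv S (msum T U) = mv S T + mv S U"
proof -
  have p: "pg (msum T U)" using pgD[OF assms(2)] pgD[OF assms(3)] by (intro pg_msum)
  show ?thesis
    using mv_mS[OF assms(1) p] mv_mS[OF assms(1,2)] mv_mS[OF assms(1,3)]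
      mS_msum_left[OF assms(2,3)] mS_msum_right[OF assms(2,3)] by simp
qed

lemma mv_msum_left: assumes "pg S" "pg T" "pg U" shows "mv (msum T U) S = mv T S + mv U S"
  using mv_msum[OF assms] by (simp add: mv_commute)

section \<open>Reflections, unit segments and lattice widths\<close>

lemma neg_neg [simp]: "neg (neg S) = S" by (simp add: neg_def image_image)
lemma in_neg: "n \<in> neg S \<longleftrightarrow> - n \<in> S" unfolding neg_def by (metis (no_types, lifting) image_iff minus_minus)
lemma card_neg [simp]: "card (neg S) = card S" unfolding neg_def by (rule card_image) (simp add: inj_on_def)
lemma neg_fin: "finite S \<Longrightarrow> finite (neg S)" "S \<noteq> {} \<Longrightarrow> neg S \<noteq> {}" by (auto simp: neg_def)
lemma hz_neg [simp]: "hz (neg S) w = hz S (- w)" by (simp add: hz_def neg_def image_image)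

lemma pg_neg: assumes "pg S" shows "pg (neg S)"
proof -
  have "- n \<in> S" if "n \<in> LL (hz (neg S))" for n
  proof (rule pg_memI[OF assms])
    fix w
    have "dotz (- w) n \<le> hz S (- (- w))" using that unfolding LL_def by (metis (mono_tags) hz_neg mem_Collect_eq)
    then show "dotz w (- n) \<le> hz S w" by simp
  qed
  then show ?thesis using neg_fin pgD[OF assms] by (auto simp: pg_def in_neg)
qed

lemma flen_neg [simp]: "flen (neg S) w = flen S (- w)"
proof -
  have "face (neg S) w = neg (face S (- w))"
    by (rule Set.set_eqI) (simp add: face_def in_neg)
  then show ?thesis by (simp add: flen_def)
qed

lemma sum_flen_neg: "(\<Sum>w\<in>normals (neg S). flen (neg S) w * g w) = (\<Sum>w\<in>normals S. flen S w * g (- w))"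
  by (rule sum.reindex_bij_witness[of _ uminus uminus]) (auto simp: normals_def)

lemma mS_neg_left: "mS (neg S) T = (\<Sum>w\<in>normals S. flen S w * hz T (- w))"
  unfolding mS_def by (rule sum_flen_neg)

lemma msum_neg: "msum (neg S) (neg T) = neg (msum S T)"
proof (rule Set.set_eqI)
  fix n
  have "(\<forall>w. dotz w n \<le> hz S (- w) + hz T (- w)) \<longleftrightarrow> (\<forall>w. dotz w (- n) \<le> hz S w + hz T w)"
    by (metis dotz_minus minus_minus)
  then show "n \<in> msum (neg S) (neg T) \<longleftrightarrow> n \<in> neg (msum S T)" by (simp add: in_neg msum_def LL_def)
qed

lemma mv_neg: "mv S (neg T) = mv (neg S) T"
proof -
  have "msum S (neg T) = neg (msum (neg S) T)" using msum_neg[of "neg S" T] by simp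
  then show ?thesis by (simp add: mv_def)
qed

lemma hz_seg: "hz (seg w) v = max 0 (dotz v (rot w))" by (simp add: hz_def seg_def)

lemma pg_seg: assumes w: "prim w" shows "pg (seg w)"
proof -
  have E: "rot w \<noteq> 0" using w by (simp add: prim_nz rot_nz)
  have "n \<in> seg w" if n: "n \<in> LL (hz (seg w))" for n
  proof -
    have le: "dotz v n \<le> max 0 (dotz v (rot w))" for v using n by (simp add: LL_def hz_seg)
    have "dotz w n = 0" using le[of w] le[of "- w"] by simp
    then obtain k where k: "n = sm k (rot w)" using orth_prim w by blast
    have p: "dotz (rot w) (rot w) > 0" using dotz_pos[OF E] .
    have "k * dotz (rot w) (rot w) \<le> 1 * dotz (rot w) (rot w)" using le[of "rot w"] p unfolding k by simp
    then have "k \<le> 1" using p by (simp only: mult_le_cancel_right_pos)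
    moreover have "- k * dotz (rot w) (rot w) \<le> 0" using le[of "- rot w"] p unfolding k by simp
    then have "k \<ge> 0" using p by (simp add: zero_le_mult_iff)
    ultimately have "k = 0 \<or> k = 1" by linarith
    then show ?thesis using k by (auto simp: seg_def)
  qed
  then show ?thesis by (auto simp: pg_def seg_def)
qed

text \<open>\<open>Y\<close> is \<open>X\<close> widened by one unit step \<open>E\<close>. Deleting
  the last point of \<open>Y\<close> on each line parallel to \<open>E\<close> leaves
  \<open>X\<close>, and each of the \<open>wd X w + 1\<close> integral levels carries a point of
  \<open>Y\<close>, even if it has no lattice point of \<open>X\<close>.\<close>

lemma card_msum_seg:
  assumes X: "pg X" and w: "prim w"
  shows "int (card (msum X (seg w))) = int (card X) + wd X w + 1"
proof -
  define E Y where "E = rot w" and "Y = msum X (seg w)"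
  have E: "E \<noteq> 0" using w by (simp add: prim_nz rot_nz E_def)
  note f = pgD[OF X]
  have fs: "finite (seg w)" "seg w \<noteq> {}" by (auto simp: seg_def)
  have Y: "pg Y" unfolding Y_def using f fs by (intro pg_msum)
  note fY = pgD[OF Y]
  have inY: "n \<in> Y \<longleftrightarrow> (\<forall>v. dotz v n \<le> hz X v + max 0 (dotz v E))" for n
    by (simp add: Y_def msum_def LL_def hz_seg E_def)
  have key: "n \<in> X \<longleftrightarrow> n \<in> Y \<and> n + E \<in> Y" for n
  proof
    assume "n \<in> X"
    then show "n \<in> Y \<and> n + E \<in> Y" using msum_mem[OF f(1) fs(1), of n 0] msum_mem[OF f(1) fs(1), of n E]
      by (simp add: Y_def seg_def E_def)
  next
    assume a: "n \<in> Y \<and> n + E \<in> Y"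
    show "n \<in> X"
    proof (rule pg_memI[OF X])
      fix v
      have "dotz v n \<le> hz X v + max 0 (dotz v E)" "dotz v n + dotz v E \<le> hz X v + max 0 (dotz v E)"
        using a inY[of n] inY[of "n + E"] by (metis dotz_add(1))+
      then show "dotz v n \<le> hz X v" by linarith
    qed
  qed
  define ends where "ends = {n\<in>Y. n + E \<notin> Y}"
  have Yu: "Y = X \<union> ends" "X \<inter> ends = {}" unfolding ends_def using key by blast+
  have fe: "finite ends" unfolding ends_def using fY(1) by simp
  have c1: "card Y = card X + card ends" unfolding Yu(1) by (rule card_Un_disjoint[OF f(1) fe Yu(2)])
  let ?R = "{- hz X (- w)..hz X w}"
  have "bij_betw (dotz w) ends ?R"
  proof (rule bij_betw_imageI)
    have no: False if "n \<in> ends" "n' \<in> ends" "n' - n = sm k E" "k > 0" for n n' k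
    proof -
      have "n' = n + sm k E" using that(3) by (metis add.commute diff_add_cancel)
      then have "n + sm 1 E \<in> Y" using pg_between[OF Y, of n k E 1] that by (auto simp: ends_def)
      then show False using that by (simp add: ends_def)
    qed
    show "inj_on (dotz w) ends"
    proof (rule inj_onI)
      fix n n' assume a: "n \<in> ends" "n' \<in> ends" "dotz w n = dotz w n'"
      then have "dotz w (n' - n) = 0" by simp
      then obtain k where k: "n' - n = sm k E" using orth_prim w E_def by blast
      have k': "n - n' = sm (- k) E" using k by (metis minus_diff_eq sm_minus(1))
      have "k = 0" using no[OF a(1,2) k] no[OF a(2,1) k'] by (meson linorder_neqE_linordered_idom neg_0_less_iff_less)
      then show "n = n'" using k by simp
    qed
    show "dotz w ` ends = ?R"
    proof
      have "dotz w n \<in> ?R" if "n \<in> Y" for n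
      proof -
        have "dotz w n \<le> hz X w + max 0 (dotz w E)" "dotz (- w) n \<le> hz X (- w) + max 0 (dotz (- w) E)"
          using that inY by blast+
        then show ?thesis by (simp add: E_def)
      qed
      then show "dotz w ` ends \<subseteq> ?R" unfolding ends_def by blast
      show "?R \<subseteq> dotz w ` ends"
      proof
        fix c assume c: "c \<in> ?R"
        obtain x where x: "x \<in> X" "dotz (- w) x = hz X (- w)" using hz_attained f by blast
        obtain x' where x': "x' \<in> X" "dotz w x' = hz X w" using hz_attained f by blast
        define k where "k = dotz w x' - dotz w x"
        have "\<exists>n\<in>Y. dotz w n = c"
        proof (cases "k = 0")
          case True
          then show ?thesis using c x x' key by (intro bexI[of _ x]) (auto simp: k_def)
        next
          case False
          then have k: "k > 0" using c x x' by (auto simp: k_def)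
          define i j where "i = dotz w x' - c" and "j = c - dotz w x"
          have ij: "i \<ge> 0" "j \<ge> 0" "i + j = k" using c x x' by (auto simp: i_def j_def k_def)
          obtain m where m: "dotz w m = 1" using prim_bezout w by blast
          have "dotz w (sm (k * c) m - (sm i x + sm j x')) = 0"
            using m by (simp add: i_def j_def k_def algebra_simps)
          then obtain s where s: "sm (k * c) m - (sm i x + sm j x') = sm s E" using orth_prim w E_def by blast
          \<comment> \<open>The real point \<open>(i x + j x') / k\<close> of \<open>X\<close> on
            level \<open>c\<close> is moved to a lattice point by the fraction
            \<open>(s mod k) / k\<close> of a unit step, which does not leave
            \<open>Y\<close>.\<close>
          define n where "n = sm c m - sm (s div k) E"
          have kn: "sm k n = sm i x + sm j x' + sm (s mod k) E"
          proof -
            have "sm k n = sm i x + sm j x' + sm s E - sm (k * (s div k)) E"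
              unfolding n_def by (simp add: sm_diff_right flip: s)
            then show ?thesis by (simp add: minus_mod_eq_mult_div[symmetric] sm_diff)
          qed
          have "dotz v n \<le> hz X v + max 0 (dotz v E)" for v
          proof -
            have "k * dotz v n = i * dotz v x + j * dotz v x' + (s mod k) * dotz v E"
              using arg_cong[OF kn, of "dotz v"] by simp
            also have "\<dots> \<le> i * hz X v + j * hz X v + k * max 0 (dotz v E)"
            proof (intro add_mono mult_left_mono hz_ge f x x' ij)
              have "(s mod k) * dotz v E \<le> (s mod k) * max 0 (dotz v E)" using k by (intro mult_left_mono) auto
              also have "\<dots> \<le> k * max 0 (dotz v E)" using k by (intro mult_right_mono) (auto simp: less_imp_le)
              finally show "(s mod k) * dotz v E \<le> k * max 0 (dotz v E)" .
            qed
            also have "\<dots> = k * (hz X v + max 0 (dotz v E))" using ij(3) by (simp add: algebra_simps flip: ij(3))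
            finally show ?thesis using k by simp
          qed
          then have "n \<in> Y" using inY by blast
          moreover have "dotz w n = c" using m by (simp add: n_def E_def)
          ultimately show ?thesis by blast
        qed
        then obtain n where n: "n \<in> Y" "dotz w n = c" by blast
        let ?K = "{k. n + sm k E \<in> Y}"
        have "inj (\<lambda>k. n + sm k E)" by (rule injI) (use sm_inj[OF E] in auto)
        then have fK: "finite ?K" using finite_vimageI[OF fY(1)] by (fastforce simp: vimage_def)
        have Kne: "?K \<noteq> {}" using n by (auto intro!: exI[of _ 0])
        define k where "k = Max ?K"
        have "k \<in> ?K" "k + 1 \<notin> ?K" unfolding k_def using Max_in[OF fK Kne] Max_ge[OF fK, of "Max ?K + 1"] by auto
        then have "n + sm k E \<in> ends" by (simp add: ends_def sm_add add.assoc)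
        moreover have "dotz w (n + sm k E) = c" using n by (simp add: E_def)
        ultimately show "c \<in> dotz w ` ends" by blast
      qed
    qed
  qed
  then have "card ends = card ?R" by (rule bij_betw_same_card)
  moreover have "wd X w \<ge> 0"
    using hz_add_le[OF f, of w "- w"] f by (simp add: wd_def)
  ultimately have "int (card ends) = wd X w + 1" by (simp add: wd_def)
  then show ?thesis using c1 by (simp add: Y_def)
qed

lemma normals_seg: assumes w: "prim w"
  shows "(\<Sum>v\<in>normals (seg w). flen (seg w) v * g v) = g w + g (- w)"
proof -
  have E: "rot w \<noteq> 0" using w by (simp add: prim_nz rot_nz)
  have sub: "normals (seg w) \<subseteq> {w, - w}"
  proof
    fix v assume "v \<in> normals (seg w)"
    then have v: "prim v" "flen (seg w) v \<ge> 1" by (auto simp: normals_def)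
    have "card (face (seg w) v) \<ge> 2" using v by (simp add: flen_def)
    moreover have "card (seg w) = 2" using E by (auto simp: seg_def)
    moreover have "face (seg w) v \<subseteq> seg w" "finite (seg w)" by (auto simp: face_def seg_def)
    ultimately have "face (seg w) v = seg w" by (metis card_seteq)
    then have "0 \<in> face (seg w) v" "rot w \<in> face (seg w) v" by (auto simp: seg_def)
    then have "dotz v (rot w) = 0" by (simp add: face_def)
    then show "v \<in> {w, - w}" using prim_parallel[OF w v(1)] by blast
  qed
  have "prim v" if "v \<in> {w, - w}" for v using that w by (elim insertE) simp_all
  then have "(\<Sum>v\<in>normals (seg w). flen (seg w) v * g v) = (\<Sum>v\<in>{w, - w}. flen (seg w) v * g v)"
    by (intro sum_normals sub) (simp_all add: seg_def)
  moreover have "w \<noteq> - w" using prim_nz[OF w] by (auto simp: prod_eq_iff)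
  moreover have fc: "face (seg w) v = seg w" if v: "v = w \<or> v = - w" for v
  proof -
    have z: "dotz v (rot w) = 0" using v by (elim disjE) simp_all
    have hz0: "hz (seg w) v = 0" by (simp add: hz_seg z)
    have "dotz v n = hz (seg w) v" if "n \<in> seg w" for n
      using that unfolding hz0 unfolding seg_def by (elim insertE) (simp_all add: z)
    then show ?thesis unfolding face_def by blast
  qed
  have "card (seg w) = 2" using E by (simp add: seg_def)
  then have "flen (seg w) w = 1" "flen (seg w) (- w) = 1" by (simp_all add: flen_def fc)
  ultimately show ?thesis by simp
qed

lemma wd_minus [simp]: "wd S (- w) = wd S w" by (simp add: wd_def)

text \<open>Cauchy's projection formula: the edges of \<open>Q\<close> facing \<open>rot w\<close>
  project onto its width in direction \<open>w\<close>. It follows by evaluating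
  \<open>mv Q (seg w)\<close> once by counting and once by \<open>mv_mS\<close>.\<close>

lemma width_sum:
  assumes Q: "pg Q" and w: "prim w"
  shows "wd Q w = (\<Sum>v\<in>normals Q. flen Q v * max 0 (dotz v (rot w)))"
proof -
  have "card (seg w) = 2" using rot_nz[OF prim_nz[OF w]] by (simp add: seg_def)
  then have "mv Q (seg w) = wd Q w" using card_msum_seg[OF Q w] by (simp add: mv_def)
  then have "2 * wd Q w = mS Q (seg w) + mS (seg w) Q" using mv_mS[OF Q pg_seg[OF w]] by simp
  moreover have "mS (seg w) Q = wd Q w" unfolding mS_def normals_seg[OF w] by (simp add: wd_def)
  ultimately show ?thesis by (simp add: mS_def hz_seg)
qed

text \<open>By \<open>width_sum\<close> the left side is a double sum over the edges of both
  polygons that is symmetric up to a sign of the directions, which \<open>wd\<close> ignores.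
  Averaging the two forms gives mixed volumes of \<open>P\<close> and of its reflection with
  \<open>Q\<close>.\<close>

lemma sum_width_normals:
  assumes P: "pg P" and Q: "pg Q"
  shows "(\<Sum>w\<in>normals P. flen P w * wd Q w) = mv P Q + mv (neg P) Q"
proof -
  let ?S = "\<lambda>P Q. \<Sum>w\<in>normals P. flen P w * wd Q w"
  have S: "?S P Q = mS P Q + mS (neg P) Q" if "pg P" "pg Q" for P Q
    unfolding mS_neg_left unfolding mS_def wd_def by (simp add: distrib_left sum.distrib)
  have "?S P Q = (\<Sum>w\<in>normals P. \<Sum>v\<in>normals Q. flen P w * flen Q v * max 0 (dotz v (rot w)))"
    by (intro sum.cong refl) (simp add: width_sum[OF Q normals_prim] sum_distrib_left mult.assoc)
  also have "\<dots> = (\<Sum>v\<in>normals Q. \<Sum>w\<in>normals P. flen P w * flen Q v * max 0 (dotz v (rot w)))"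
    by (rule sum.swap)
  also have "\<dots> = (\<Sum>v\<in>normals Q. \<Sum>w\<in>normals P. flen Q v * (flen P w * max 0 (dotz w (rot (- v)))))"
    by (intro sum.cong refl) (simp only: rot_minus dotz_minus dotz_rot_swap[symmetric] mult_ac)
  also have "\<dots> = ?S Q P"
  proof (intro sum.cong refl)
    fix v assume "v \<in> normals Q"
    then have "wd P v = (\<Sum>w\<in>normals P. flen P w * max 0 (dotz w (rot (- v))))"
      using width_sum[OF P, of "- v"] normals_prim[of v] by (simp only: prim_minus wd_minus)
    then show "(\<Sum>w\<in>normals P. flen Q v * (flen P w * max 0 (dotz w (rot (- v))))) = flen Q v * wd P v"
      by (simp only: sum_distrib_left)
  qed
  finally have "2 * ?S P Q = ?S P Q + ?S Q P" by simp
  also have "\<dots> = mS P Q + mS (neg P) Q + (mS Q P + mS Q (neg P))"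
    using S[OF P Q] S[OF Q P] by (simp add: mS_neg_left) (simp add: mS_def sum.distrib[symmetric] wd_def algebra_simps)
  finally show ?thesis using mv_mS[OF P Q] mv_mS[OF pg_neg[OF P] Q] by simp
qed

text \<open>By Pick's formula the conclusion is equivalent to \<open>card P - bS P < card Q\<close>.
  The number \<open>h2\<close> will count the translates of \<open>Q\<close> inside the interior of
  \<open>P\<close>. The bound on \<open>h\<close> and the assumption \<open>hyp\<close> give
  \<open>2 * (card P - bS P) < 2 * card Q - 1 + h2\<close>; for \<open>h2 > 0\<close> this
  contradicts the assumed bound on \<open>h2\<close>, and for \<open>h2 = 0\<close> it implies the
  claim.\<close>

lemma mixed_count_inequality:
  assumes P: "pg P" and Q: "pg Q"
    and h: "h \<le> (\<Sum>w\<in>normals P. flen P w * (wd Q w + 1)) - int (card (msum P (neg Q))) + h2"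
    and hyp: "int (card (msum Q Q)) + h > int (card (msum P Q)) - bS (msum P Q)"
    and h2: "h2 > 0 \<Longrightarrow> int (card Q) + h2 - 1 \<le> int (card P) - bS P" and h20: "h2 \<ge> 0"
  shows "mv (msum P P) (msum P Q) < 2 * (int (card (msum P Q)) - 1)"
proof -
  note p = pgD[OF P] pgD[OF Q]
  have pPQ: "pg (msum P Q)" using p by (intro pg_msum)
  have 1: "(\<Sum>w\<in>normals P. flen P w * (wd Q w + 1)) = mv P Q + mv (neg P) Q + bS P"
    unfolding sum_width_normals[OF P Q, symmetric] by (simp add: bS_def sum.distrib[symmetric] algebra_simps)
  have 2: "int (card (msum P (neg Q))) = mv (neg P) Q + int (card P) + int (card Q) - 1"
    unfolding mv_neg[symmetric] by (simp add: mv_def)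
  have 3: "int (card (msum Q Q)) = mS Q Q + 2 * int (card Q) - 1" using mv_self[OF Q] by (simp add: mv_def)
  have 4: "int (card (msum P Q)) = mv P Q + int (card P) + int (card Q) - 1" by (simp add: mv_def)
  have 5: "mv (msum P P) (msum P Q) = 2 * mS P P + 2 * mv P Q"
    using mv_msum_left[OF pPQ P P] mv_msum[OF P P Q] mv_self[OF P] by simp
  show ?thesis
  proof (cases "h2 > 0")
    case True
    then show ?thesis
      using h hyp h2[OF True] bS_msum[OF P Q] pick_mS[OF P] pick_mS[OF Q] unfolding 1 2 3 4 5 by linarith
  next
    case False
    then have "h2 = 0" using h20 by simp
    then have "2 * int (card P) - 2 * bS P < 2 * int (card Q)"
      using h hyp bS_msum[OF P Q] pick_mS[OF Q] unfolding 1 2 3 4 by linarith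
    then show ?thesis using pick_mS[OF P] unfolding 5 4 by presburger
  qed
qed

section \<open>The boundary cycle of a lattice polygon\<close>

definition fat :: "lat set \<Rightarrow> bool" where "fat S \<longleftrightarrow> (\<forall>w. w \<noteq> 0 \<longrightarrow> wd S w > 0)"

definition bdz :: "lat set \<Rightarrow> lat set" where "bdz S = {n\<in>S. \<exists>w. w \<noteq> 0 \<and> dotz w n = hz S w}"

text \<open>\<open>w\<close> is an outer normal and \<open>rot w\<close> its counterclockwise turn,
  so \<open>p + rot w\<close> is the next lattice point when the boundary is traversed
  counterclockwise.\<close>

definition ostep :: "lat set \<Rightarrow> lat \<Rightarrow> lat \<Rightarrow> bool" where
  "ostep S p w \<longleftrightarrow> prim w \<and> p \<in> face S w \<and> p + rot w \<in> S"

definition nw :: "lat set \<Rightarrow> lat \<Rightarrow> lat" where "nw S p = (THE w. ostep S p w)"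

definition nx :: "lat set \<Rightarrow> lat \<Rightarrow> lat" where "nx S p = p + rot (nw S p)"

lemma bdz_face: assumes S: "finite S" "S \<noteq> {}" and p: "p \<in> bdz S" obtains w where "prim w" "p \<in> face S w"
proof -
  obtain w where w: "w \<noteq> 0" "dotz w p = hz S w" "p \<in> S" using p unfolding bdz_def by blast
  obtain g e where e: "g > 0" "prim e" "w = sm g e" using prim_part w(1) by blast
  have "g * dotz e p = g * hz S e" using w(2) hz_sm[OF S, of g e] e by simp
  then show thesis using that[of e] e w(3) by (simp add: face_def)
qed

lemma face_bdz: "prim w \<Longrightarrow> p \<in> face S w \<Longrightarrow> p \<in> bdz S"
  unfolding bdz_def face_def using prim_nz by blast

text \<open>If no point of \<open>S\<close> lies further along \<open>F\<close>, then
  \<open>p\<close> ends its face, and tilting \<open>w\<close> by \<open>F\<close> exposes it as a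
  vertex; \<open>M + 1\<close> again dominates the tilt.\<close>

lemma exposed_or_step:
  assumes S: "pg S" and w: "prim w" "p \<in> face S w" and F: "F = rot w \<or> F = - rot w"
  shows "p + F \<in> S \<or> (\<exists>\<theta>. \<forall>n\<in>S - {p}. dotz \<theta> (n - p) > 0)"
proof (cases "\<exists>k>0. p + sm k F \<in> S")
  case True
  then obtain k where k: "k > 0" "p + sm k F \<in> S" by blast
  have "p + sm 1 F \<in> S" by (rule pg_between[OF S _ k(2)]) (use w k in \<open>simp_all add: face_def\<close>)
  then show ?thesis by simp
next
  case False
  note f = pgD[OF S]
  define M where "M = Max ((\<lambda>s. \<bar>dotz F (s - p)\<bar>) ` S)"
  have M: "\<bar>dotz F (s - p)\<bar> \<le> M" if "s \<in> S" for s
    using that f unfolding M_def by (intro Max_ge finite_imageI imageI)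
  have pS: "p \<in> S" using w by (simp add: face_def)
  have M0: "M \<ge> 0" using M[OF pS] by simp
  have Fnz: "F \<noteq> 0" using F rot_nz[OF prim_nz[OF w(1)]] by (elim disjE) simp_all
  have "dotz (- (sm (M + 1) w + F)) (n - p) > 0" if n: "n \<in> S - {p}" for n
  proof (cases "dotz w (n - p) = 0")
    case True
    obtain k where k: "n - p = sm k (rot w)" using orth_prim[OF w(1) True] by blast
    obtain l where l: "n - p = sm l F"
    proof (cases "F = rot w")
      case False
      then have "n - p = sm (- k) F" using F k by simp
      then show thesis by (rule that)
    qed (use k that in blast)
    then have np: "n = p + sm l F" by (metis add.commute diff_add_cancel)
    have "l \<noteq> 0" using np n by (intro notI) simp
    moreover have "\<not> l > 0" using False np n by blast
    ultimately have "l < 0" by simp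
    then have "l * dotz F F < 0" using dotz_pos[OF Fnz] by (simp add: mult_less_0_iff)
    moreover have z: "dotz w (sm l F) = 0" using True unfolding l .
    have "dotz (- (sm (M + 1) w + F)) (sm l F) = - ((M + 1) * dotz w (sm l F)) - l * dotz F F"
      by (simp add: algebra_simps)
    ultimately show ?thesis unfolding l z by simp
  next
    case False
    have nS: "n \<in> S" using n by simp
    have "dotz w n \<le> dotz w p" using hz_ge[OF f(1) nS, of w] w(2) by (simp add: face_def)
    then have "dotz w (n - p) \<le> -1" using False by simp
    then have "(M + 1) * dotz w (n - p) \<le> (M + 1) * (-1)" using M0 by (intro mult_left_mono) simp_all
    then show ?thesis using M[OF nS] by (simp add: algebra_simps abs_le_iff)
  qed
  then show ?thesis by blast
qed

lemma fat_ne: "fat S \<Longrightarrow> S \<noteq> {p}"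
proof
  assume a: "fat S" "S = {p}"
  have "(1::int, 0::int) \<noteq> 0" by (simp add: prod_eq_iff)
  then have "wd S (1,0) > 0" using a(1) unfolding fat_def by blast
  moreover have "wd S (1,0) = 0" unfolding a(2) wd_def hz_def by (simp add: dotz_def)
  ultimately show False by simp
qed

lemma steps_exist:
  assumes S: "pg S" and fat: "fat S" and p: "p \<in> bdz S"
  shows "\<exists>w. ostep S p w" "\<exists>w. prim w \<and> p \<in> face S w \<and> p - rot w \<in> S"
proof -
  obtain w where w: "prim w" "p \<in> face S w" using bdz_face pgD[OF S] p by blast
  have pS: "p \<in> S" using p by (simp add: bdz_def)
  have ex: "(\<exists>w. ostep S p w) \<and> (\<exists>w. prim w \<and> p \<in> face S w \<and> p - rot w \<in> S)"
    if expo: "\<exists>\<theta>. \<forall>n\<in>S - {p}. dotz \<theta> (n - p) > 0"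
  proof -
    from expo obtain \<theta> where t: "\<forall>n\<in>S - {p}. dotz \<theta> (n - p) > 0" by blast
    show ?thesis
      by (rule edges_at_exposed_vertex[OF S pS bspec[OF t] fat_ne[OF fat]], assumption) (unfold ostep_def, blast)
  qed
  show "\<exists>w. ostep S p w" using exposed_or_step[OF S w, of "rot w"] ex w unfolding ostep_def by blast
  have "p + - rot w \<in> S \<or> (\<exists>\<theta>. \<forall>n\<in>S - {p}. dotz \<theta> (n - p) > 0)" using exposed_or_step[OF S w] by blast
  then show "\<exists>w. prim w \<and> p \<in> face S w \<and> p - rot w \<in> S" using ex w by (metis add_uminus_conv_diff)
qed

lemma fat_faces: assumes "fat S" "prim w" "p \<in> face S w" "p \<in> face S (- w)" shows False
proof -
  have "wd S w > 0" using assms prim_nz unfolding fat_def by blast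
  then show False using assms(3,4) by (simp add: face_def wd_def)
qed

text \<open>Both normals support \<open>S\<close> at \<open>p\<close>, so
  \<open>dotz v (rot w)\<close> and \<open>dotz w (rot v)\<close> cannot have opposite signs,
  whereas \<open>dotz_rot_swap\<close> makes them negatives of each other. Both vanish and the
  normals are parallel.\<close>

lemma step_unique:
  assumes S: "pg S" and fat: "fat S" and w: "prim w" "p \<in> face S w" and v: "prim v" "p \<in> face S v"
    and s: "p + rot w \<in> S \<and> p + rot v \<in> S \<or> p - rot w \<in> S \<and> p - rot v \<in> S"
  shows "w = v"
proof -
  note f = pgD[OF S]
  have "dotz v (rot w) = 0"
    using s
  proof
    assume a: "p + rot w \<in> S \<and> p + rot v \<in> S"
    show ?thesis using hz_ge[OF f(1) conjunct1[OF a], of v] hz_ge[OF f(1) conjunct2[OF a], of w] w v dotz_rot_swap[of v w]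
      by (simp add: face_def)
  next
    assume a: "p - rot w \<in> S \<and> p - rot v \<in> S"
    show ?thesis using hz_ge[OF f(1) conjunct1[OF a], of v] hz_ge[OF f(1) conjunct2[OF a], of w] w v dotz_rot_swap[of v w]
      by (simp add: face_def)
  qed
  then have "v = w \<or> v = - w" using prim_parallel w v by blast
  then show ?thesis using fat_faces[OF fat w(1,2)] v by blast
qed

lemma nw: assumes S: "pg S" and fat: "fat S" and p: "p \<in> bdz S" shows "ostep S p (nw S p)"
  unfolding nw_def
proof (rule theI')
  show "\<exists>!w. ostep S p w" using steps_exist(1)[OF S fat p] step_unique[OF S fat, of _ p] unfolding ostep_def by blast
qed

lemma nw_eq: assumes S: "pg S" and fat: "fat S" and o: "ostep S p w" shows "nw S p = w"
proof -
  have p: "p \<in> bdz S" using o face_bdz unfolding ostep_def by blast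
  show ?thesis using nw[OF S fat p] o step_unique[OF S fat, of "nw S p" p w] unfolding ostep_def by blast
qed

lemma nx_face: assumes "pg S" "fat S" "p \<in> bdz S"
  shows "nx S p \<in> face S (nw S p)" "nx S p \<in> bdz S"
proof -
  show *: "nx S p \<in> face S (nw S p)" using nw[OF assms] by (simp add: ostep_def nx_def face_def)
  show "nx S p \<in> bdz S" using face_bdz[OF _ *] nw[OF assms] by (simp add: ostep_def)
qed

lemma inj_nx: assumes S: "pg S" and fat: "fat S" shows "inj_on (nx S) (bdz S)"
proof (rule inj_onI)
  fix p q assume p: "p \<in> bdz S" and q: "q \<in> bdz S" and e: "nx S p = nx S q"
  have "nw S p = nw S q"
  proof (rule step_unique[OF S fat, of _ "nx S p"])
    have "nx S p - rot (nw S p) = p" by (simp add: nx_def)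
    moreover have "nx S p - rot (nw S q) = q" unfolding e by (simp add: nx_def)
    ultimately show "nx S p + rot (nw S p) \<in> S \<and> nx S p + rot (nw S q) \<in> S
        \<or> nx S p - rot (nw S p) \<in> S \<and> nx S p - rot (nw S q) \<in> S" using p q by (simp add: bdz_def)
    show "nx S p \<in> face S (nw S q)" unfolding e using nx_face(1)[OF S fat q] .
  qed (use nw[OF S fat p] nw[OF S fat q] nx_face(1)[OF S fat p] in \<open>simp_all add: ostep_def\<close>)
  then show "p = q" using e by (simp add: nx_def)
qed

lemma finite_bdz: "finite S \<Longrightarrow> finite (bdz S)" by (simp add: bdz_def)

text \<open>Each boundary point is charged to the edge along which it is left; an edge is left from
  all its points but the last, that is, from \<open>flen S w\<close> of them.\<close>

lemma sum_bdz:
  assumes S: "pg S" and fat: "fat S"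
  shows "(\<Sum>p\<in>bdz S. g (nw S p)) = (\<Sum>w\<in>normals S. flen S w * g w)"
proof -
  note f = pgD[OF S]
  let ?T = "\<lambda>w. {p \<in> face S w. p + rot w \<in> S}"
  have cT: "int (card (?T w)) = flen S w" if w: "prim w" for w
  proof -
    have E: "rot w \<noteq> 0" using w by (simp add: prim_nz rot_nz)
    obtain a where a: "face S w = (\<lambda>i. a + sm i (rot w)) ` {0..flen S w}" using face_interval S w by blast
    have inj: "inj (\<lambda>i. a + sm i (rot w))" by (rule injI) (use sm_inj[OF E] in simp)
    have "p \<in> ?T w \<longleftrightarrow> p \<in> (\<lambda>i. a + sm i (rot w)) ` {0..<flen S w}" for p
    proof
      assume p: "p \<in> ?T w"
      then have "p + rot w \<in> face S w" by (simp add: face_def)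
      then obtain j where j: "p + rot w = a + sm j (rot w)" "j \<in> {0..flen S w}" unfolding a by (rule imageE)
      have "p \<in> (\<lambda>i. a + sm i (rot w)) ` {0..flen S w}" using p a by simp
      then obtain i where i: "p = a + sm i (rot w)" "i \<in> {0..flen S w}" by (rule imageE)
      have "a + sm (i + 1) (rot w) = a + sm j (rot w)" using i(1) j(1) by (simp add: sm_add add.assoc)
      then have "i + 1 = j" using injD[OF inj] by blast
      then have "i \<in> {0..<flen S w}" using i j by simp
      then show "p \<in> (\<lambda>i. a + sm i (rot w)) ` {0..<flen S w}" unfolding i(1) by (rule imageI)
    next
      assume "p \<in> (\<lambda>i. a + sm i (rot w)) ` {0..<flen S w}"
      then obtain i where i: "p = a + sm i (rot w)" "i \<in> {0..<flen S w}" by (rule imageE)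
      have "p \<in> face S w" unfolding a i(1) by (rule imageI) (use i in simp)
      moreover have "a + sm (i + 1) (rot w) \<in> face S w" unfolding a by (rule imageI) (use i in simp)
      then have "p + rot w \<in> face S w" unfolding i(1) by (simp add: sm_add add.assoc)
      ultimately show "p \<in> ?T w" by (simp add: face_def)
    qed
    then have "?T w = (\<lambda>i. a + sm i (rot w)) ` {0..<flen S w}" by (rule Set.set_eqI)
    then have "card (?T w) = card {0..<flen S w}" using inj by (simp add: card_image inj_on_subset)
    then show ?thesis using flen_ge0[OF f, of w] by simp
  qed
  have "(\<Sum>w\<in>normals S. flen S w * g w) = (\<Sum>w\<in>normals S. \<Sum>p\<in>?T w. g w)"
    by (intro sum.cong refl) (simp add: cT[OF normals_prim])
  also have "\<dots> = (\<Sum>(w, p)\<in>Sigma (normals S) ?T. g w)"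
    by (rule sum.Sigma) (simp_all add: finite_normals finite_face f)
  also have "\<dots> = (\<Sum>p\<in>bdz S. g (nw S p))"
  proof (rule sum.reindex_bij_witness[of _ "\<lambda>p. (nw S p, p)" snd])
    fix x assume "x \<in> Sigma (normals S) ?T"
    then have o: "ostep S (snd x) (fst x)" by (auto simp: ostep_def normals_def)
    then show "(nw S (snd x), snd x) = x" using nw_eq[OF S fat o] by simp
    show "snd x \<in> bdz S" using o face_bdz unfolding ostep_def by blast
    show "g (nw S (snd x)) = (case x of (w, p) \<Rightarrow> g w)" using nw_eq[OF S fat o] by (simp add: case_prod_beta)
  next
    fix p assume p: "p \<in> bdz S"
    note o = nw[OF S fat p]
    have "card (?T (nw S p)) \<noteq> 0" using o finite_face[OF f(1), of "nw S p"] by (auto simp: ostep_def)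
    then have "nw S p \<in> normals S" using o cT[of "nw S p"] unfolding normals_def ostep_def by simp
    then show "(nw S p, p) \<in> Sigma (normals S) ?T" using o by (simp add: ostep_def)
  qed simp
  finally show ?thesis by simp
qed

lemma card_bdz: "pg S \<Longrightarrow> fat S \<Longrightarrow> int (card (bdz S)) = bS S"
  using sum_bdz[of S "\<lambda>_. 1"] by (simp add: bS_def)

text \<open>\<open>nx S\<close> permutes \<open>Cy\<close>. For a boundary point \<open>q\<close>
  with outgoing normal \<open>w\<close>, take \<open>c\<close> in \<open>Cy\<close> with
  \<open>dotz w c\<close> maximal. The steps into and out of \<open>c\<close> do not rise above
  \<open>c\<close>, which forces \<open>c\<close> onto the face with normal \<open>w\<close>.
  Following this edge forwards or backwards from \<open>c\<close> reaches \<open>q\<close>.\<close>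

lemma boundary_cycle:
  assumes S: "pg S" and fat: "fat S" and Cy: "Cy \<subseteq> bdz S" "Cy \<noteq> {}" "nx S ` Cy \<subseteq> Cy"
  shows "Cy = bdz S"
proof
  note f = pgD[OF S]
  have fO: "finite Cy" using Cy(1) finite_bdz[OF f(1)] by (rule finite_subset)
  have OS: "o' \<in> S" if "o' \<in> Cy" for o' using that Cy(1) unfolding bdz_def by blast
  have "card (nx S ` Cy) = card Cy" by (rule card_image[OF inj_on_subset[OF inj_nx[OF S fat] Cy(1)]])
  then have nO: "nx S ` Cy = Cy" by (rule card_subset_eq[OF fO Cy(3)])
  show "bdz S \<subseteq> Cy"
  proof
    fix q assume q: "q \<in> bdz S"
    define w where "w = nw S q"
    have w: "prim w" "q \<in> face S w" using nw[OF S fat q] by (simp_all add: w_def ostep_def)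
    obtain c where c: "c \<in> Cy" "dotz w c = hz Cy w" using hz_attained[OF fO Cy(2)] by blast
    have cb: "c \<in> bdz S" using c Cy by blast
    define w1 where "w1 = nw S c"
    have w1: "prim w1" "c \<in> face S w1" "nx S c = c + rot w1" "nx S c \<in> S"
      using nw[OF S fat cb] by (simp_all add: w1_def ostep_def nx_def)
    have "nx S c \<in> Cy" using c(1) Cy(3) by blast
    then have r1: "dotz w (rot w1) \<le> 0" using hz_ge[OF fO, of "nx S c" w] c(2) unfolding w1(3) by simp
    obtain b where b: "c = nx S b" "b \<in> Cy" using c(1) nO by (metis imageE)
    have bb: "b \<in> bdz S" using b Cy by blast
    define w2 where "w2 = nw S b"
    have w2: "prim w2" "c \<in> face S w2" "c = b + rot w2"
      using nw[OF S fat bb] nx_face(1)[OF S fat bb] unfolding b(1) by (simp_all add: w2_def ostep_def nx_def)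
    have r2: "dotz w (rot w2) \<ge> 0" using hz_ge[OF fO b(2), of w] c(2) unfolding w2(3) by simp
    have d: "dotz w2 (rot w1) \<le> 0" using hz_ge[OF f(1) w1(4), of w2] w2(2) unfolding w1(3) by (simp add: face_def)
    have cf: "c \<in> face S w"
    proof (cases "dotz w2 (rot w1) < 0")
      case True
      have "dotz w n \<le> dotz w c" if n: "n \<in> S" for n
      proof -
        have id: "dotz w2 (rot w1) * dotz w (n - c) = dotz w (rot w1) * dotz w2 (n - c) - dotz w (rot w2) * dotz w1 (n - c)"
          unfolding dotz_def rot_def by (simp add: algebra_simps)
        have "dotz w2 (n - c) \<le> 0" "dotz w1 (n - c) \<le> 0"
          using hz_ge[OF f(1) n] w1(2) w2(2) by (simp_all add: face_def)
        then have "dotz w2 (rot w1) * dotz w (n - c) \<ge> 0" unfolding id using r1 r2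
          by (simp add: mult_nonpos_nonpos mult_nonneg_nonpos order_trans[of _ 0])
        then show ?thesis using True by (simp add: zero_le_mult_iff)
      qed
      then have "hz S w = dotz w c" by (rule hz_eqI[OF f(1) OS[OF c(1)] refl])
      then show ?thesis using OS[OF c(1)] by (simp add: face_def)
    next
      case False
      then have "w2 = w1 \<or> w2 = - w1" using prim_parallel[OF w1(1) w2(1)] d by simp
      then have e: "w2 = w1" using fat_faces[OF fat w1(1,2)] w2(2) by blast
      then have "dotz w (rot w1) = 0" using r1 r2 by simp
      then consider "w = w1" | "w = - w1" using prim_parallel[OF w1(1) w(1)] by blast
      then show ?thesis
      proof cases
        case 1 then show ?thesis using w1(2) by simp
      next
        \<comment> \<open>Here all of \<open>Cy\<close> lies on the face with normal
          \<open>w1\<close>, so the step out of its last point \<open>m\<close> in direction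
          \<open>rot w1\<close> contradicts the choice of \<open>m\<close>.\<close>
        case 2
        have all: "o' \<in> face S w1" if "o' \<in> Cy" for o'
          using hz_ge[OF fO that, of w] c(2) 2 w1(2) hz_ge[OF f(1) OS[OF that], of w1] OS[OF that] by (simp add: face_def)
        obtain m where m: "m \<in> Cy" "dotz (rot w1) m = hz Cy (rot w1)" using hz_attained[OF fO Cy(2)] by blast
        have mb: "m \<in> bdz S" using m Cy by blast
        have "nx S m \<in> Cy" using m(1) Cy(3) by blast
        note nm = all[OF this] hz_ge[OF fO this, of "rot w1"]
        have "dotz w1 (rot (nw S m)) = 0" using nm(1) all[OF m(1)] by (simp add: face_def nx_def)
        then have "w1 = nw S m \<or> w1 = - nw S m" using prim_parallel w1(1) nw[OF S fat mb] unfolding ostep_def by blast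
        moreover have "w1 \<noteq> - nw S m" using fat_faces[OF fat, of "nw S m" m] nw[OF S fat mb] all[OF m(1)] unfolding ostep_def by blast
        ultimately have "nx S m = m + rot w1" by (simp add: nx_def)
        then have "dotz (rot w1) (rot w1) \<le> 0" using nm(2) m(2) by simp
        then show ?thesis using dotz_pos[OF rot_nz[OF prim_nz[OF w1(1)]]] by simp
      qed
    qed
    obtain a where a: "face S w = (\<lambda>i. a + sm i (rot w)) ` {0..flen S w}" using face_interval S w(1) by blast
    have fm: "a + sm i (rot w) \<in> face S w" if "0 \<le> i" "i \<le> flen S w" for i unfolding a by (rule imageI) (use that in simp)
    have nxi: "nx S (a + sm i (rot w)) = a + sm (i + 1) (rot w)" if "0 \<le> i" "i + 1 \<le> flen S w" for i
    proof -
      have e: "(a + sm i (rot w)) + rot w = a + sm (i + 1) (rot w)" by (simp add: sm_add add.assoc)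
      have "ostep S (a + sm i (rot w)) w"
        unfolding ostep_def e using fm[of i] fm[of "i + 1"] that w(1) by (simp add: face_def)
      then show ?thesis using nw_eq[OF S fat] by (simp add: nx_def sm_add add.assoc)
    qed
    obtain i where i: "c = a + sm i (rot w)" "i \<in> {0..flen S w}" using cf unfolding a by (rule imageE)
    obtain j where j: "q = a + sm j (rot w)" "j \<in> {0..flen S w}" using w(2) unfolding a by (rule imageE)
    have up: "a + sm (i + int k) (rot w) \<in> Cy" if "i + int k \<le> flen S w" for k
      using that
    proof (induction k)
      case 0 then show ?case using c(1) i(1) by simp
    next
      case (Suc k)
      then have "a + sm (i + int k) (rot w) \<in> Cy" by simp
      then have "nx S (a + sm (i + int k) (rot w)) \<in> Cy" using Cy(3) by blast
      then show ?case using nxi[of "i + int k"] Suc.prems i(2) by (simp add: ac_simps)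
    qed
    have down: "a + sm (i - int k) (rot w) \<in> Cy" if "0 \<le> i - int k" for k
      using that
    proof (induction k)
      case 0 then show ?case using c(1) i(1) by simp
    next
      case (Suc k)
      let ?y = "a + sm (i - int (Suc k)) (rot w)"
      have "a + sm (i - int k) (rot w) \<in> Cy" using Suc by simp
      moreover have "nx S ?y = a + sm (i - int k) (rot w)" using nxi[of "i - int (Suc k)"] Suc.prems i(2) by simp
      ultimately obtain z where z: "nx S ?y = nx S z" "z \<in> Cy" using nO by (metis imageE)
      have "?y \<in> bdz S" by (rule face_bdz[OF w(1) fm]) (use Suc.prems i in simp_all)
      then have "?y = z" using inj_onD[OF inj_nx[OF S fat] z(1)] z(2) Cy(1) by blast
      then show ?case using z(2) by simp
    qed
    show "q \<in> Cy"
    proof (cases "i \<le> j")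
      case True then show ?thesis using up[of "nat (j - i)"] j by simp
    next
      case False then show ?thesis using down[of "nat (i - j)"] j by simp
    qed
  qed
qed (rule Cy(1))

section \<open>Real polygons and their lattice points\<close>

no_notation Matrix.scalar_prod (infix \<open>\<bullet>\<close> 70)

abbreviation "lp \<equiv> lattice_pt"

definition cv :: "lat set \<Rightarrow> pt set" where "cv S = convex hull (lp ` S)"

lemma lp_simps: "lp (m + n) = lp m + lp n" "lp (m - n) = lp m - lp n" "lp (- n) = - lp n" "lp 0 = 0"
  "lp (sm k n) = of_int k *\<^sub>R lp n"
  by (auto simp: lattice_pt_def sm_def prod_eq_iff)

lemma lp_eq [simp]: "lp m = lp n \<longleftrightarrow> m = n" by (auto simp: lattice_pt_def prod_eq_iff)
lemma inner_lp: "lp w \<bullet> lp n = of_int (dotz w n)" by (simp add: lattice_pt_def dotz_def inner_prod_def)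


text \<open>Rounding the coordinates of \<open>K * w\<close> changes the pairing with
  \<open>n - s\<close> by a bounded amount, whereas the strict gap grows linearly in
  \<open>K\<close>. One large \<open>K\<close> serves the finite set \<open>S\<close>.\<close>

lemma integral_separation:
  fixes w :: pt
  assumes "finite S" "\<And>s. s \<in> S \<Longrightarrow> w \<bullet> lp s < w \<bullet> lp n"
  obtains v where "\<And>s. s \<in> S \<Longrightarrow> dotz v s < dotz v n"
proof -
  define v where "v = (\<lambda>K::nat. (\<lfloor>real K * fst w\<rfloor>, \<lfloor>real K * snd w\<rfloor>))"
  have "\<forall>s\<in>S. \<forall>\<^sub>F K in sequentially. dotz (v K) s < dotz (v K) n"
  proof
    fix s assume s: "s \<in> S"
    define x where "x = n - s"
    define d where "d = w \<bullet> lp x"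
    have d: "d > 0" using assms(2)[OF s] by (simp add: d_def x_def lp_simps inner_diff_right)
    define C where "C = \<bar>real_of_int (fst x)\<bar> + \<bar>real_of_int (snd x)\<bar>"
    have fl: "real K * t * real_of_int y - \<bar>real_of_int y\<bar> \<le> real_of_int \<lfloor>real K * t\<rfloor> * real_of_int y" for K t y
    proof -
      have "\<bar>(real K * t - real_of_int \<lfloor>real K * t\<rfloor>) * real_of_int y\<bar> \<le> 1 * \<bar>real_of_int y\<bar>"
        unfolding abs_mult by (intro mult_right_mono) (auto simp: abs_le_iff, linarith)
      then show ?thesis by (simp add: left_diff_distrib abs_le_iff)
    qed
    have "\<forall>\<^sub>F K in sequentially. real K * d > C"
      using eventually_gt_at_top[of "nat \<lceil>C / d\<rceil>"]
    proof eventually_elim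
      case (elim K)
      then have "C / d < real K" by linarith
      then show ?case using d by (simp add: divide_less_eq)
    qed
    then show "\<forall>\<^sub>F K in sequentially. dotz (v K) s < dotz (v K) n"
    proof eventually_elim
      case (elim K)
      have "real K * d - C \<le> real_of_int (dotz (v K) x)"
        using fl[of K "fst w" "fst x"] fl[of K "snd w" "snd x"]
        by (simp add: d_def C_def v_def dotz_def lattice_pt_def inner_prod_def algebra_simps)
      then have "dotz (v K) x > 0" using elim by linarith
      then show ?case by (simp add: x_def)
    qed
  qed
  then have "\<forall>\<^sub>F K in sequentially. \<forall>s\<in>S. dotz (v K) s < dotz (v K) n"
    using assms(1) by (simp add: eventually_ball_finite_distrib)
  then obtain K where "\<forall>s\<in>S. dotz (v K) s < dotz (v K) n" using eventually_happens'[OF sequentially_bot] by blast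
  then show thesis using that by blast
qed

lemma LL_real:
  fixes w :: pt
  assumes "finite S" "S \<noteq> {}" "n \<in> LL (hz S)"
  obtains s where "s \<in> S" "w \<bullet> lp n \<le> w \<bullet> lp s"
proof (rule ccontr)
  assume "\<not> thesis"
  then have "\<And>s. s \<in> S \<Longrightarrow> w \<bullet> lp s < w \<bullet> lp n" using that by force
  then obtain v where v: "\<And>s. s \<in> S \<Longrightarrow> dotz v s < dotz v n" using integral_separation[OF assms(1)] by metis
  obtain s where s: "s \<in> S" "dotz v s = hz S v" using hz_attained assms by blast
  have "dotz v n \<le> hz S v" using assms(3) by (simp add: LL_def)
  then show False using v[OF s(1)] s(2) by simp
qed

lemma compact_cv: "finite S \<Longrightarrow> compact (cv S)" unfolding cv_def by (intro finite_imp_compact_convex_hull finite_imageI)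
lemma convex_cv: "convex (cv S)" by (simp add: cv_def)
lemma cv_mem: "s \<in> S \<Longrightarrow> lp s \<in> cv S" unfolding cv_def by (intro hull_inc imageI)

lemma cv_le:
  assumes "\<And>s. s \<in> S \<Longrightarrow> w \<bullet> lp s \<le> b" "x \<in> cv S" shows "w \<bullet> x \<le> b"
proof -
  have "cv S \<subseteq> {x. w \<bullet> x \<le> b}" unfolding cv_def
    by (rule hull_minimal) (use assms in \<open>auto simp: convex_halfspace_le\<close>)
  then show ?thesis using assms(2) by blast
qed

lemma lp_in_cv: assumes S: "finite S" "S \<noteq> {}" shows "lp n \<in> cv S \<longleftrightarrow> n \<in> LL (hz S)"
proof
  assume a: "lp n \<in> cv S"
  have "dotz w n \<le> hz S w" for w
  proof -
    have "lp w \<bullet> lp n \<le> of_int (hz S w)"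
      by (rule cv_le[OF _ a]) (use hz_ge[OF S(1)] in \<open>simp add: inner_lp\<close>)
    then show ?thesis by (simp add: inner_lp)
  qed
  then show "n \<in> LL (hz S)" by (simp add: LL_def)
next
  assume n: "n \<in> LL (hz S)"
  show "lp n \<in> cv S"
  proof (rule ccontr)
    assume "lp n \<notin> cv S"
    then obtain a b where ab: "a \<bullet> lp n < b" "\<And>x. x \<in> cv S \<Longrightarrow> a \<bullet> x > b"
      using separating_hyperplane_closed_point[OF convex_cv compact_imp_closed[OF compact_cv[OF S(1)]]] by metis
    obtain s where s: "s \<in> S" "(- a) \<bullet> lp n \<le> (- a) \<bullet> lp s" using LL_real[OF S n] by blast
    then show False using ab(1) ab(2)[OF cv_mem[OF s(1)]] by simp
  qed
qed

definition Lt :: "pt set \<Rightarrow> lat set" where "Lt X = {n. lp n \<in> X}"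

lemma nlat_Lt: "nlat X = card (Lt X)" by (simp add: nlat_def Lt_def)
lemma Lt_cv: "finite S \<Longrightarrow> S \<noteq> {} \<Longrightarrow> Lt (cv S) = LL (hz S)" unfolding Lt_def by (simp add: lp_in_cv)

lemma mink_cv: "mink (cv S) (cv T) = cv {s + t |s t. s \<in> S \<and> t \<in> T}"
proof -
  have "mink (cv S) (cv T) = convex hull (lp ` S) + convex hull (lp ` T)"
    by (auto simp: mink_def cv_def set_plus_def)
  also have "\<dots> = convex hull (lp ` S + lp ` T)" by (rule convex_hull_set_plus[symmetric])
  also have "lp ` S + lp ` T = lp ` {s + t |s t. s \<in> S \<and> t \<in> T}"
  proof
    show "lp ` S + lp ` T \<subseteq> lp ` {s + t |s t. s \<in> S \<and> t \<in> T}"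
      by (rule subsetI, erule set_plus_elim, elim imageE, simp only: lp_simps(1)[symmetric]) blast
    show "lp ` {s + t |s t. s \<in> S \<and> t \<in> T} \<subseteq> lp ` S + lp ` T"
    proof (rule image_subsetI)
      fix x assume "x \<in> {s + t |s t. s \<in> S \<and> t \<in> T}"
      then obtain s t where "x = s + t" "s \<in> S" "t \<in> T" by blast
      then show "lp x \<in> lp ` S + lp ` T" by (simp only: lp_simps) (intro set_plus_intro imageI)
    qed
  qed
  finally show ?thesis by (simp add: cv_def)
qed

lemma Lt_mink:
  assumes S: "finite S" "S \<noteq> {}" and T: "finite T" "T \<noteq> {}"
  shows "Lt (mink (cv S) (cv T)) = msum S T"
proof -
  let ?U = "{s + t |s t. s \<in> S \<and> t \<in> T}"
  have fU: "finite ?U" "?U \<noteq> {}" using S T by (simp add: finite_image_set2, blast)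
  have "hz ?U w = hz S w + hz T w" for w
  proof -
    obtain s t where st: "s \<in> S" "dotz w s = hz S w" "t \<in> T" "dotz w t = hz T w" using hz_attained S T by metis
    show ?thesis
    proof (rule hz_eqI[OF fU(1), of "s + t"])
      show "s + t \<in> ?U" using st by blast
      fix u assume "u \<in> ?U"
      then obtain s' t' where "u = s' + t'" "s' \<in> S" "t' \<in> T" by blast
      then show "dotz w u \<le> hz S w + hz T w" using hz_ge[OF S(1)] hz_ge[OF T(1)] by (simp add: add_mono)
    qed (use st in simp)
  qed
  then show ?thesis unfolding mink_cv Lt_cv[OF fU] by (simp add: msum_def LL_def)
qed

text \<open>A real direction that takes the same value at two lattice points is a multiple of an
  integral one: it is parallel to \<open>rot e\<close>, where \<open>e\<close> is the primitive
  vector from \<open>s\<close> to \<open>t\<close>. The sign of \<open>c\<close> selects the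
  orientation.\<close>

lemma real_support_face:
  fixes w :: pt
  assumes S: "finite S" and s: "s \<in> S" "t \<in> S" "s \<noteq> t" "w \<bullet> lp s = w \<bullet> lp t" and w: "w \<noteq> 0"
    and le: "\<And>n. n \<in> S \<Longrightarrow> w \<bullet> lp n \<le> w \<bullet> lp s"
  obtains v where "prim v" "\<And>n. n \<in> S \<Longrightarrow> w \<bullet> lp n = w \<bullet> lp s \<Longrightarrow> n \<in> face S v"
proof -
  obtain g e where e: "g > 0" "prim e" "t - s = sm g e" using prim_part[of "t - s"] s by (metis eq_iff_diff_eq_0)
  have "w \<bullet> lp (t - s) = 0" using s by (simp add: lp_simps inner_diff_right)
  then have we: "w \<bullet> lp e = 0" unfolding e(3) using e(1) by (simp add: lp_simps)
  define c where "c = w \<bullet> lp (rot e)"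
  have id: "c * of_int (dotz (rot e) n) = (w \<bullet> lp n) * of_int (dotz e e)" for n
  proof -
    have "c * of_int (dotz (rot e) n) + (w \<bullet> lp e) * of_int (dotz e n) = (w \<bullet> lp n) * of_int (dotz e e)"
      by (simp add: c_def lattice_pt_def rot_def dotz_def inner_prod_def algebra_simps)
    then show ?thesis using we by simp
  qed
  have ee: "dotz e e > 0" using dotz_pos prim_nz e by blast
  have c0: "c \<noteq> 0"
  proof
    assume "c = 0"
    then have z: "w \<bullet> lp n = 0" for n using id[of n] ee by simp
    have "fst w = 0" using z[of "(1,0)"] by (simp add: lattice_pt_def inner_prod_def)
    moreover have "snd w = 0" using z[of "(0,1)"] by (simp add: lattice_pt_def inner_prod_def)
    ultimately show False using w by (simp add: prod_eq_iff)
  qed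
  define v where "v = (if c > 0 then rot e else - rot e)"
  have pv: "prim v" using e by (simp add: v_def)
  have iv: "\<bar>c\<bar> * of_int (dotz v n) = (w \<bullet> lp n) * of_int (dotz e e)" for n
    using id[of n] c0 by (simp add: v_def)
  have mono: "dotz v n \<le> dotz v m" if "w \<bullet> lp n \<le> w \<bullet> lp m" for n m
  proof -
    have "\<bar>c\<bar> * of_int (dotz v n) \<le> \<bar>c\<bar> * of_int (dotz v m)" unfolding iv using that ee by (simp add: mult_right_mono)
    then show ?thesis using c0 by simp
  qed
  show thesis
  proof (rule that[OF pv])
    fix n assume n: "n \<in> S" "w \<bullet> lp n = w \<bullet> lp s"
    have "hz S v = dotz v n" by (rule hz_eqI[OF S n(1) refl]) (use le n mono in simp)
    then show "n \<in> face S v" using n by (simp add: face_def)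
  qed
qed

text \<open>With a second maximal point the direction is integral up to scaling; otherwise the
  maximum is strict and survives rounding by \<open>integral_separation\<close>.\<close>

lemma real_support_bdz:
  fixes w :: pt
  assumes S: "pg S" and p: "p \<in> S" and w: "w \<noteq> 0" and le: "\<And>n. n \<in> S \<Longrightarrow> w \<bullet> lp n \<le> w \<bullet> lp p" and ne: "S \<noteq> {p}"
  shows "p \<in> bdz S"
proof (cases "\<exists>s\<in>S. s \<noteq> p \<and> w \<bullet> lp p = w \<bullet> lp s")
  case True
  then obtain s where s: "s \<in> S" "s \<noteq> p" "w \<bullet> lp p = w \<bullet> lp s" by blast
  obtain v where "prim v" "\<And>n. n \<in> S \<Longrightarrow> w \<bullet> lp n = w \<bullet> lp p \<Longrightarrow> n \<in> face S v"
    using real_support_face[OF pgD(1)[OF S] p s(1) _ s(3) w le] s(2) by metis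
  then show ?thesis using face_bdz p by blast
next
  case False
  have "w \<bullet> lp s < w \<bullet> lp p" if "s \<in> S - {p}" for s using le[of s] False that by force
  then obtain v where v: "\<And>s. s \<in> S - {p} \<Longrightarrow> dotz v s < dotz v p"
    using integral_separation[of "S - {p}" w p] pgD(1)[OF S] by blast
  have "S - {p} \<noteq> {}" using ne p by blast
  then have "v \<noteq> 0" using v by fastforce
  moreover have "hz S v = dotz v p"
  proof (rule hz_eqI[OF pgD(1)[OF S] p refl])
    fix s assume "s \<in> S" then show "dotz v s \<le> dotz v p" using v[of s] by (cases "s = p") (simp_all add: less_imp_le)
  qed
  ultimately show ?thesis using p unfolding bdz_def by (metis (mono_tags, lifting) mem_Collect_eq)
qed

lemma not_interior_support:
  assumes "interior (cv S) \<noteq> {}" "y \<in> cv S" "y \<notin> interior (cv S)"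
  obtains w where "w \<noteq> 0" "\<And>z. z \<in> cv S \<Longrightarrow> w \<bullet> z \<le> w \<bullet> y"
proof -
  have "y \<notin> rel_interior (cv S)" using assms rel_interior_nonempty_interior by blast
  then obtain a where "a \<noteq> 0" "\<And>z. z \<in> cv S \<Longrightarrow> a \<bullet> y \<le> a \<bullet> z"
    using supporting_hyperplane_rel_boundary[OF convex_cv assms(2)] by metis
  then show thesis using that[of "- a"] by simp
qed

lemma interior_lattice:
  assumes S: "pg S" and ne: "S \<noteq> {p}" and int: "interior (cv S) \<noteq> {}"
  shows "lp p \<in> interior (cv S) \<longleftrightarrow> p \<in> S - bdz S"
proof
  assume a: "lp p \<in> interior (cv S)"
  then have "lp p \<in> cv S" using interior_subset by blast
  then have pS: "p \<in> S" using lp_in_cv[OF pgD[OF S]] pg_LL[OF S] by blast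
  have "p \<notin> bdz S"
  proof
    assume "p \<in> bdz S"
    then obtain w where w: "w \<noteq> 0" "dotz w p = hz S w" unfolding bdz_def by blast
    have "cv S \<subseteq> {x. lp w \<bullet> x \<le> of_int (hz S w)}"
    proof
      fix x assume "x \<in> cv S"
      then have "lp w \<bullet> x \<le> of_int (hz S w)"
        by (rule cv_le[rotated]) (use hz_ge[OF pgD(1)[OF S]] in \<open>simp add: inner_lp\<close>)
      then show "x \<in> {x. lp w \<bullet> x \<le> of_int (hz S w)}" by simp
    qed
    then have "interior (cv S) \<subseteq> interior {x. lp w \<bullet> x \<le> of_int (hz S w)}" by (rule interior_mono)
    also have "\<dots> = {x. lp w \<bullet> x < of_int (hz S w)}"
    proof (rule interior_halfspace_le)
      have "lp w \<noteq> lp 0" using w(1) by (simp only: lp_eq) simp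
      then show "lp w \<noteq> 0" by (simp add: lp_simps)
    qed
    finally show False using a w(2) by (auto simp: inner_lp)
  qed
  then show "p \<in> S - bdz S" using pS by blast
next
  assume p: "p \<in> S - bdz S"
  show "lp p \<in> interior (cv S)"
  proof (rule ccontr)
    assume "lp p \<notin> interior (cv S)"
    then obtain w where w: "w \<noteq> 0" "\<And>z. z \<in> cv S \<Longrightarrow> w \<bullet> z \<le> w \<bullet> lp p"
      using not_interior_support[OF int cv_mem] p by blast
    then have "p \<in> bdz S" using real_support_bdz[OF S _ w(1) _ ne] p cv_mem by blast
    then show False using p by blast
  qed
qed

lemma fat_interior: assumes S: "pg S" and int: "interior (cv S) \<noteq> {}" shows "fat S"
  unfolding fat_def
proof (intro allI impI)
  fix w :: lat assume w: "w \<noteq> 0"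
  note f = pgD[OF S]
  have ge: "wd S w \<ge> 0" using hz_add_le[OF f, of w "- w"] f by (simp add: wd_def)
  show "wd S w > 0"
  proof (rule ccontr)
    assume "\<not> wd S w > 0"
    then have z: "hz S (- w) = - hz S w" using ge by (simp add: wd_def)
    have "lp w \<noteq> lp 0" using w by (simp only: lp_eq) simp
    then have nz: "lp w \<noteq> 0" by (simp add: lp_simps)
    have "cv S \<subseteq> {x. lp w \<bullet> x = of_int (hz S w)}"
    proof
      fix x assume x: "x \<in> cv S"
      have 1: "lp w \<bullet> x \<le> of_int (hz S w)" by (rule cv_le[OF _ x]) (use hz_ge[OF f(1)] in \<open>simp add: inner_lp\<close>)
      have "lp (- w) \<bullet> x \<le> of_int (hz S (- w))" by (rule cv_le[OF _ x]) (use hz_ge[OF f(1)] in \<open>simp only: inner_lp of_int_le_iff\<close>)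
      then show "x \<in> {x. lp w \<bullet> x = of_int (hz S w)}" using 1 z by (simp add: lp_simps)
    qed
    then have "interior (cv S) \<subseteq> interior {x. lp w \<bullet> x = of_int (hz S w)}" by (rule interior_mono)
    then show False using int interior_hyperplane[OF nz] by simp
  qed
qed

lemma cv_hull: assumes "finite T" "T \<noteq> {}" shows "cv (LL (hz T)) = cv T"
proof
  show "cv (LL (hz T)) \<subseteq> cv T" unfolding cv_def[of "LL (hz T)"]
    by (rule hull_minimal) (use lp_in_cv[OF assms] convex_cv in auto)
  have "T \<subseteq> LL (hz T)" using hz_ge[OF assms(1)] by (auto simp: LL_def)
  then show "cv T \<subseteq> cv (LL (hz T))" unfolding cv_def by (intro hull_mono image_mono)
qed

text \<open>A frontier point is a convex combination of the lattice points on one supporting line,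
  since the weights elsewhere must vanish. That face is a vertex or a chain of unit steps, and the
  integer part of the position \<open>\<tau>\<close> selects the step.\<close>

lemma frontier_cover:
  assumes S: "pg S" and int: "interior (cv S) \<noteq> {}" and y: "y \<in> cv S" "y \<notin> interior (cv S)"
  obtains p where "p \<in> bdz S" "y \<in> closed_segment (lp p) (lp (nx S p))"
proof -
  note f = pgD[OF S] and fat = fat_interior[OF S int]
  obtain w where w: "w \<noteq> 0" "\<And>z. z \<in> cv S \<Longrightarrow> w \<bullet> z \<le> w \<bullet> y" using not_interior_support[OF int y] by blast
  define F where "F = {s\<in>S. w \<bullet> lp s = w \<bullet> y}"
  have yF: "y \<in> cv F"
  proof -
    have "y \<in> convex hull (lp ` S)" using y by (simp add: cv_def)
    then obtain u where u: "\<forall>x\<in>lp ` S. 0 \<le> u x" "sum u (lp ` S) = 1" "(\<Sum>x\<in>lp ` S. u x *\<^sub>R x) = y"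
      unfolding convex_hull_finite[OF finite_imageI[OF f(1)]] by blast
    have "(\<Sum>x\<in>lp ` S. u x * (w \<bullet> y - w \<bullet> x)) = (w \<bullet> y) * sum u (lp ` S) - w \<bullet> (\<Sum>x\<in>lp ` S. u x *\<^sub>R x)"
      by (simp add: right_diff_distrib sum_subtractf sum_distrib_left inner_sum_right mult.commute)
    also have "\<dots> = 0" using u by simp
    finally have z: "(\<Sum>x\<in>lp ` S. u x * (w \<bullet> y - w \<bullet> x)) = 0" .
    have pos: "0 \<le> u x * (w \<bullet> y - w \<bullet> x)" if "x \<in> lp ` S" for x
      using that u(1) w(2)[of x] cv_mem by (intro mult_nonneg_nonneg) auto
    have u0: "u x = 0" if "x \<in> lp ` S - lp ` F" for x
    proof -
      have "u x * (w \<bullet> y - w \<bullet> x) = 0"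
        using z pos that by (subst (asm) sum_nonneg_eq_0_iff) (auto simp: f)
      then show ?thesis using that by (auto simp: F_def)
    qed
    have sub: "lp ` F \<subseteq> lp ` S" by (auto simp: F_def)
    have su: "sum u (lp ` F) = 1" "(\<Sum>x\<in>lp ` F. u x *\<^sub>R x) = y"
      using sum.mono_neutral_left[OF finite_imageI[OF f(1)] sub, of u] u0
        sum.mono_neutral_left[OF finite_imageI[OF f(1)] sub, of "\<lambda>x. u x *\<^sub>R x"] u(2,3) by simp_all
    have fF: "finite (lp ` F)" using f by (simp add: F_def)
    have nn: "\<forall>x\<in>lp ` F. 0 \<le> u x" using u(1) sub by blast
    show ?thesis unfolding cv_def convex_hull_finite[OF fF] using nn su by (intro CollectI exI[of _ u] conjI)
  qed
  then obtain p where p: "p \<in> F" unfolding cv_def by (metis convex_hull_empty empty_iff equals0I image_is_empty)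
  have pS: "p \<in> S" "w \<bullet> lp p = w \<bullet> y" using p by (auto simp: F_def)
  have le: "w \<bullet> lp n \<le> w \<bullet> lp p" if "n \<in> S" for n using w(2)[OF cv_mem[OF that]] pS by simp
  show thesis
  proof (cases "F = {p}")
    case True
    then have "y = lp p" using yF by (simp add: cv_def)
    moreover have "p \<in> bdz S" by (rule real_support_bdz[OF S pS(1) w(1) le fat_ne[OF fat]])
    ultimately show thesis using that by simp
  next
    case False
    then obtain t where t: "t \<in> F" "t \<noteq> p" using p by blast
    then have tS: "t \<in> S" "w \<bullet> lp p = w \<bullet> lp t" using pS by (auto simp: F_def)
    obtain v where v: "prim v" "\<And>n. n \<in> S \<Longrightarrow> w \<bullet> lp n = w \<bullet> lp p \<Longrightarrow> n \<in> face S v"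
      using real_support_face[OF f(1) pS(1) tS(1) t(2)[symmetric] tS(2) w(1) le] by blast
    have Fv: "F \<subseteq> face S v" using v(2) pS by (auto simp: F_def)
    define l E where "l = flen S v" and "E = rot v"
    obtain a where a: "face S v = (\<lambda>i. a + sm i E) ` {0..l}" using face_interval[OF S v(1)] unfolding l_def E_def by blast
    have "card {p, t} \<le> card (face S v)" by (rule card_mono) (use finite_face[OF f(1)] Fv p t in auto)
    then have l1: "l \<ge> 1" using t by (simp add: l_def flen_def)
    have "cv F \<subseteq> {x. \<exists>\<tau>. 0 \<le> \<tau> \<and> \<tau> \<le> of_int l \<and> x = lp a + \<tau> *\<^sub>R lp E}"
      unfolding cv_def
    proof (rule hull_minimal)
      show "lp ` F \<subseteq> {x. \<exists>\<tau>. 0 \<le> \<tau> \<and> \<tau> \<le> of_int l \<and> x = lp a + \<tau> *\<^sub>R lp E}"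
      proof (rule image_subsetI)
        fix n assume "n \<in> F"
        then have "n \<in> (\<lambda>i. a + sm i E) ` {0..l}" using Fv a by blast
        then obtain i where "n = a + sm i E" "i \<in> {0..l}" by (rule imageE)
        then show "lp n \<in> {x. \<exists>\<tau>. 0 \<le> \<tau> \<and> \<tau> \<le> of_int l \<and> x = lp a + \<tau> *\<^sub>R lp E}"
          by (intro CollectI exI[of _ "of_int i"]) (simp add: lp_simps)
      qed
      have "{x. \<exists>\<tau>. 0 \<le> \<tau> \<and> \<tau> \<le> of_int l \<and> x = lp a + \<tau> *\<^sub>R lp E} = (\<lambda>\<tau>. lp a + \<tau> *\<^sub>R lp E) ` {0..of_int l}" by auto
      moreover have "\<dots> = (+) (lp a) ` ((\<lambda>\<tau>. \<tau> *\<^sub>R lp E) ` {0..of_int l})" by (simp add: image_image)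
      moreover have "convex \<dots>"
        by (intro convex_translation convex_linear_image) (auto intro!: bounded_linear.linear bounded_linear_scaleR_left)
      ultimately show "convex {x. \<exists>\<tau>. 0 \<le> \<tau> \<and> \<tau> \<le> of_int l \<and> x = lp a + \<tau> *\<^sub>R lp E}" by simp
    qed
    then obtain \<tau> where \<tau>: "0 \<le> \<tau>" "\<tau> \<le> of_int l" "y = lp a + \<tau> *\<^sub>R lp E" using yF by blast
    \<comment> \<open>The minimum assigns the far end of the edge to the last unit step.\<close>
    define i where "i = min \<lfloor>\<tau>\<rfloor> (l - 1)"
    have i: "0 \<le> i" "i + 1 \<le> l" "of_int i \<le> \<tau>" "\<tau> \<le> of_int i + 1"
      using \<tau> l1 by (auto simp: i_def min_def; linarith)+
    have fi: "a + sm j E \<in> face S v" if "0 \<le> j" "j \<le> l" for j unfolding a by (rule imageI) (use that in simp)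
    have e: "(a + sm i E) + E = a + sm (i + 1) E" by (simp add: sm_add add.assoc)
    have "ostep S (a + sm i E) v"
      unfolding ostep_def E_def[symmetric] e using fi[of i] fi[of "i + 1"] i v(1) by (simp add: face_def)
    then have nxe: "nx S (a + sm i E) = a + sm (i + 1) E"
      using nw_eq[OF S fat] e by (simp add: nx_def E_def)
    have "y = (1 - (\<tau> - of_int i)) *\<^sub>R lp (a + sm i E) + (\<tau> - of_int i) *\<^sub>R lp (a + sm (i + 1) E)"
      unfolding \<tau>(3) by (simp add: lp_simps scaleR_add_right scaleR_add_left scaleR_diff_left algebra_simps)
    then have "y \<in> closed_segment (lp (a + sm i E)) (lp (nx S (a + sm i E)))"
      unfolding nxe closed_segment_def using i by (intro CollectI exI[of _ "\<tau> - of_int i"]) simp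
    moreover have "a + sm i E \<in> bdz S" using face_bdz[OF v(1) fi] i by simp
    ultimately show thesis using that by blast
  qed
qed

definition entries :: "lat set \<Rightarrow> pt set \<Rightarrow> lat set" where
  "entries S K = {p\<in>bdz S. lp p \<notin> K \<and> closed_segment (lp p) (lp (nx S p)) \<inter> K \<noteq> {}}"

text \<open>Walking along the boundary from a point of a component of \<open>cv S - K\<close> one stays in that component
  until \<open>K\<close> is entered; so every component contains an entry point, unless \<open>K\<close> misses the boundary.\<close>

lemma components_entries:
  assumes S: "pg S" and int: "interior (cv S) \<noteq> {}" and K: "convex K" "compact K" "cv S \<inter> K \<noteq> {}"
  shows "int (ncomp (cv S - K)) \<le> int (card (entries S K)) + (if K \<subseteq> interior (cv S) then 1 else 0)"
proof -
  note f = pgD[OF S] and fat = fat_interior[OF S int]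
  let ?R = "cv S - K"
  have bdS: "lp p \<in> cv S" if "p \<in> bdz S" for p using that cv_mem unfolding bdz_def by blast
  have fE: "finite (entries S K)" using finite_bdz[OF f(1)] by (simp add: entries_def)
  \<comment> \<open>A line separates \<open>x\<close> from \<open>K\<close>. The part of the polygon
    on the side of \<open>x\<close> is convex and misses \<open>K\<close>, hence stays in one
    component, and it contains a lattice point that is extreme in the separating direction.\<close>
  have start: "\<exists>p\<in>bdz S. lp p \<in> C" if C: "C \<in> components ?R" for C
  proof -
    obtain x where x: "x \<in> C" using C in_components_nonempty by blast
    then have xR: "x \<in> ?R" using C in_components_subset by blast
    obtain a b where ab: "a \<bullet> x < b" "\<And>z. z \<in> K \<Longrightarrow> a \<bullet> z > b"
      using separating_hyperplane_closed_point[OF K(1) compact_imp_closed[OF K(2)], of x] xR by auto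
    define w where "w = - a"
    have "\<exists>p\<in>S. \<forall>n\<in>S. w \<bullet> lp n \<le> w \<bullet> lp p"
    proof -
      let ?m = "Max ((\<lambda>n. w \<bullet> lp n) ` S)"
      have "?m \<in> (\<lambda>n. w \<bullet> lp n) ` S" using f by (intro Max_in) auto
      then obtain p where "p \<in> S" "?m = w \<bullet> lp p" by (rule imageE)
      then show ?thesis using f by (metis Max_ge finite_imageI imageI)
    qed
    then obtain p where p: "p \<in> S" "\<And>n. n \<in> S \<Longrightarrow> w \<bullet> lp n \<le> w \<bullet> lp p" by blast
    have "w \<noteq> 0"
    proof
      assume "w = 0"
      then have "a = 0" by (simp add: w_def)
      obtain z where "z \<in> K" using K(3) by blast
      then show False using ab \<open>a = 0\<close> by fastforce
    qed
    then have pb: "p \<in> bdz S" using real_support_bdz[OF S p(1) _ p(2) fat_ne[OF fat]] by blast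
    have wx: "w \<bullet> x \<le> w \<bullet> lp p" by (rule cv_le[OF p(2) DiffD1[OF xR]])
    let ?T = "cv S \<inter> {z. w \<bullet> z > - b}"
    have "convex ?T" by (intro convex_Int convex_cv convex_halfspace_gt)
    then have "connected ?T" by (rule convex_connected)
    moreover have "?T \<subseteq> ?R" using ab(2) by (force simp: w_def)
    moreover have "x \<in> ?T" using xR ab(1) by (simp add: w_def)
    ultimately have "?T \<subseteq> C" using components_maximal[OF C] x by blast
    moreover have "lp p \<in> ?T" using wx ab(1) cv_mem[OF p(1)] by (simp add: w_def)
    ultimately show ?thesis using pb by blast
  qed
  have main: "(\<exists>p\<in>entries S K. lp p \<in> C) \<or> (K \<subseteq> interior (cv S) \<and> (\<forall>p\<in>bdz S. lp p \<in> C))"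
    if C: "C \<in> components ?R" for C
  proof (cases "\<exists>p\<in>entries S K. lp p \<in> C")
    case False
    let ?O = "{p\<in>bdz S. lp p \<in> C}"
    have CR: "C \<subseteq> ?R" using C in_components_subset by blast
    have sgR: "closed_segment (lp p) (lp (nx S p)) \<inter> K = {}" if "p \<in> ?O" for p
    proof -
      have "p \<notin> entries S K" "lp p \<notin> K" using that False CR by blast+
      then show ?thesis using that unfolding entries_def by blast
    qed
    have "nx S p \<in> ?O" if p: "p \<in> ?O" for p
    proof -
      have pb: "p \<in> bdz S" "lp p \<in> C" using p by simp_all
      have nb: "nx S p \<in> bdz S" using nx_face(2)[OF S fat pb(1)] .
      let ?g = "closed_segment (lp p) (lp (nx S p))"
      have "?g \<subseteq> cv S" by (rule closed_segment_subset[OF bdS[OF pb(1)] bdS[OF nb] convex_cv])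
      then have "?g \<subseteq> ?R" using sgR[OF p] by blast
      then have "?g \<subseteq> C" using components_maximal[OF C connected_segment] pb(2) by blast
      then show ?thesis using nb by auto
    qed
    then have "nx S ` ?O \<subseteq> ?O" by blast
    moreover have "?O \<noteq> {}" using start[OF C] by blast
    ultimately have O: "?O = bdz S" using boundary_cycle[OF S fat, of ?O] by blast
    \<comment> \<open>Otherwise \<open>K\<close> contains a frontier point of the polygon, and by
      \<open>frontier_cover\<close> it meets one of the unit boundary segments, all of which avoid
      \<open>K\<close>.\<close>
    have "K \<subseteq> interior (cv S)"
    proof (rule ccontr)
      assume "\<not> K \<subseteq> interior (cv S)"
      then obtain z where z: "z \<in> K" "z \<notin> interior (cv S)" by blast
      obtain x where x: "x \<in> cv S" "x \<in> K" using K(3) by blast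
      have "\<exists>y. y \<in> K \<and> y \<in> cv S \<and> y \<notin> interior (cv S)"
      proof (cases "x \<in> interior (cv S) \<and> z \<notin> cv S")
        case True
        have "closed_segment x z \<inter> frontier (cv S) \<noteq> {}"
        proof (rule connected_Int_frontier[OF connected_segment])
          show "closed_segment x z \<inter> cv S \<noteq> {}" using x(1) ends_in_segment(1) by blast
          show "closed_segment x z - cv S \<noteq> {}" using True ends_in_segment(2) by blast
        qed
        then obtain y where y: "y \<in> frontier (cv S)" "y \<in> closed_segment x z" by blast
        have "y \<in> K" using closed_segment_subset[OF x(2) z(1) K(1)] y(2) by blast
        then show ?thesis using y(1) compact_imp_closed[OF compact_cv[OF f(1)]] by (auto simp: frontier_def)
      qed (use x z in blast)
      then obtain y where y: "y \<in> K" "y \<in> cv S" "y \<notin> interior (cv S)" by blast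
      obtain p where p: "p \<in> bdz S" "y \<in> closed_segment (lp p) (lp (nx S p))" using frontier_cover[OF S int y(2,3)] by blast
      have "p \<in> ?O" unfolding O by (rule p(1))
      then show False using sgR p(2) y(1) by blast
    qed
    then show ?thesis using O by blast
  qed blast
  have disj: "C = C'" if "C \<in> components ?R" "C' \<in> components ?R" "x \<in> C" "x \<in> C'" for C C' x
    using components_nonoverlap[OF that(1,2)] that(3,4) by blast
  show ?thesis
  proof (cases "\<forall>C\<in>components ?R. \<exists>p\<in>entries S K. lp p \<in> C")
    case True
    then obtain g where g: "\<And>C. C \<in> components ?R \<Longrightarrow> g C \<in> entries S K \<and> lp (g C) \<in> C" by metis
    have "inj_on g (components ?R)" by (rule inj_onI) (metis g disj)
    then have "card (components ?R) \<le> card (entries S K)" using g by (intro card_inj_on_le[OF _ _ fE]) auto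
    then show ?thesis by (simp add: ncomp_def)
  next
    case False
    then obtain C where C: "C \<in> components ?R" "\<not> (\<exists>p\<in>entries S K. lp p \<in> C)" by blast
    then have m: "K \<subseteq> interior (cv S)" "\<forall>p\<in>bdz S. lp p \<in> C" using main[OF C(1)] by blast+
    \<comment> \<open>Every component contains a boundary lattice point, and all of these are in
      \<open>C\<close>.\<close>
    have "components ?R \<subseteq> {C}" using start disj[OF _ C(1)] m(2) by blast
    then have "card (components ?R) \<le> card {C}" by (rule card_mono[rotated]) simp
    then show ?thesis using m(1) by (simp add: ncomp_def)
  qed
qed

lemma cv_neg: "cv (neg S) = uminus ` cv S"
proof -
  have "lp ` neg S = uminus ` (lp ` S)" by (simp add: neg_def image_image lp_simps)
  then show ?thesis unfolding cv_def
    using convex_hull_linear_image[of uminus "lp ` S"] by (simp add: linear_iff)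
qed

lemma ltrans_meets: "{m. cv S \<inter> ltrans (cv T) m \<noteq> {}} = Lt (mink (cv S) (cv (neg T)))"
proof (rule Set.set_eqI)
  fix m
  show "m \<in> {m. cv S \<inter> ltrans (cv T) m \<noteq> {}} \<longleftrightarrow> m \<in> Lt (mink (cv S) (cv (neg T)))"
  proof
    assume "m \<in> {m. cv S \<inter> ltrans (cv T) m \<noteq> {}}"
    then obtain y where y: "y \<in> cv T" "y + lp m \<in> cv S" unfolding ltrans_def by blast
    have "lp m = (y + lp m) + (- y)" by simp
    then show "m \<in> Lt (mink (cv S) (cv (neg T)))" using y unfolding Lt_def mink_def cv_neg by blast
  next
    assume "m \<in> Lt (mink (cv S) (cv (neg T)))"
    then obtain x y where xy: "lp m = x + (- y)" "x \<in> cv S" "y \<in> cv T" unfolding Lt_def mink_def cv_neg by blast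
    then have "x = y + lp m" by simp
    then show "m \<in> {m. cv S \<inter> ltrans (cv T) m \<noteq> {}}" using xy unfolding ltrans_def by blast
  qed
qed

section \<open>Counting entry points over all translates\<close>

lemma hz_plus: assumes "finite S" "S \<noteq> {}" shows "hz ((+) p ` S) w = dotz w p + hz S w"
proof -
  obtain s where s: "s \<in> S" "dotz w s = hz S w" using hz_attained assms by blast
  show ?thesis
  proof (rule hz_eqI[of _ "p + s"])
    fix x assume "x \<in> (+) p ` S"
    then obtain y where y: "x = p + y" "y \<in> S" by (rule imageE)
    then show "dotz w x \<le> dotz w p + hz S w" using hz_ge[OF assms(1) y(2), of w] by simp
  qed (use s assms in simp_all)
qed

lemma msum_translate:
  assumes "finite S" "S \<noteq> {}" "finite T" "T \<noteq> {}"
  shows "card (msum ((+) p ` S) T) = card (msum S T)"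
proof -
  have "(dotz w n \<le> hz ((+) p ` S) w + hz T w) = (dotz w (n - p) \<le> hz S w + hz T w)" for n w
    unfolding hz_plus[OF assms(1,2)] dotz_diff by linarith
  then have "n \<in> msum ((+) p ` S) T \<longleftrightarrow> n - p \<in> msum S T" for n unfolding msum_def LL_def by blast
  moreover have "n \<in> (+) p ` X \<longleftrightarrow> n - p \<in> X" for n X
  proof
    assume "n \<in> (+) p ` X"
    then obtain x where "n = p + x" "x \<in> X" by (rule imageE)
    then show "n - p \<in> X" by simp
  qed (intro image_eqI[of _ _ "n - p"], simp_all)
  ultimately have "msum ((+) p ` S) T = (+) p ` msum S T" by blast
  then show ?thesis by (simp add: card_image)
qed

lemma msum_zero: "pg T \<Longrightarrow> msum {0} T = T"
  using pg_LL[of T] by (simp add: msum_def hz_def[of "{0}"])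

lemma polygon_lattice:
  assumes "convex_lattice_polygon P"
  obtains S where "pg S" "P = cv S" "interior (cv S) \<noteq> {}"
proof -
  obtain S0 where S0: "finite S0" "S0 \<subseteq> range lp" "P = convex hull S0" "interior P \<noteq> {}"
    using assms unfolding convex_lattice_polygon_def by blast
  obtain T where T: "finite T" "S0 = lp ` T" using finite_subset_image[OF S0(1,2)] by blast
  have "T \<noteq> {}" using S0 T by auto
  then show thesis using that[of "LL (hz T)"] pg_hull(1)[OF T(1)] cv_hull[OF T(1)] S0 T by (simp add: cv_def)
qed

text \<open>For \<open>a\<close> minimal in \<open>A\<close> and \<open>b\<close> maximal in
  \<open>B\<close> with respect to \<open>\<theta>\<close>, the copies \<open>A + b\<close> and
  \<open>a + B\<close> share only the point \<open>a + b\<close>.\<close>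

lemma sumset_card:
  fixes A B :: "lat set"
  assumes A: "finite A" "A \<noteq> {}" and B: "finite B" "B \<noteq> {}" and C: "finite C" "\<And>a b. a \<in> A \<Longrightarrow> b \<in> B \<Longrightarrow> a + b \<in> C"
  shows "card A + card B \<le> card C + 1"
proof -
  have "(1::int, 0::int) \<noteq> 0" by (simp add: prod_eq_iff)
  then obtain a \<theta> where a: "a \<in> A" "\<And>n. n \<in> A - {a} \<Longrightarrow> dotz \<theta> (n - a) > 0" using exposed_max[OF A] by metis
  obtain b where b: "b \<in> B" "dotz \<theta> b = hz B \<theta>" using hz_attained B by blast
  let ?X = "(\<lambda>x. x + b) ` A" and ?Y = "(\<lambda>y. a + y) ` B"
  have "?X \<inter> ?Y \<subseteq> {a + b}"
  proof
    fix z assume "z \<in> ?X \<inter> ?Y"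
    then obtain x y where xy: "x \<in> A" "y \<in> B" "z = x + b" "z = a + y" by blast
    have "x = a"
    proof (rule ccontr)
      assume "x \<noteq> a"
      then have "dotz \<theta> (x - a) > 0" using a(2) xy(1) by blast
      moreover have "dotz \<theta> y \<le> dotz \<theta> b" using hz_ge[OF B(1) xy(2)] b(2) by simp
      moreover have "dotz \<theta> x + dotz \<theta> b = dotz \<theta> a + dotz \<theta> y" using xy(3,4) by (metis dotz_add(1))
      ultimately show False by simp
    qed
    then show "z \<in> {a + b}" using xy by simp
  qed
  then have "card (?X \<inter> ?Y) \<le> card {a + b}" by (rule card_mono[rotated]) simp
  moreover have "card ?X = card A" "card ?Y = card B" by (simp_all add: card_image)
  moreover have "card (?X \<union> ?Y) + card (?X \<inter> ?Y) = card ?X + card ?Y"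
    using card_Un_Int[of ?X ?Y] A B by simp
  moreover have "card (?X \<union> ?Y) \<le> card C" by (rule card_mono[OF C(1)]) (use C(2) a(1) b(1) in blast)
  ultimately show ?thesis by simp
qed

text \<open>The two sums are exchanged. For a fixed boundary point \<open>p\<close> the relevant
  shifts lie in the sum of the unit segment at \<open>p\<close> with \<open>neg T\<close>, but not
  in \<open>p + neg T\<close>; by \<open>card_msum_seg\<close> these are \<open>wd T w + 1\<close>
  lattice points.\<close>

lemma entries_sum:
  assumes S: "pg S" and fat: "fat S" and T: "pg T" and M: "finite M"
  shows "(\<Sum>m\<in>M. int (card (entries S (ltrans (cv T) m)))) \<le> (\<Sum>w\<in>normals S. flen S w * (wd T w + 1))"
proof -
  note f = pgD[OF S] and fT = pgD[OF T] and nT = neg_fin(1)[OF pgD(1)[OF T]] neg_fin(2)[OF pgD(2)[OF T]]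
  let ?c = "\<lambda>p m. lp p \<notin> ltrans (cv T) m \<and> closed_segment (lp p) (lp (nx S p)) \<inter> ltrans (cv T) m \<noteq> {}"
  have fb: "finite (bdz S)" using finite_bdz f by blast
  have "(\<Sum>m\<in>M. int (card (entries S (ltrans (cv T) m)))) = (\<Sum>m\<in>M. \<Sum>p\<in>bdz S. if ?c p m then 1 else 0)"
    unfolding entries_def using fb by (simp add: sum.If_cases Int_def)
  also have "\<dots> = (\<Sum>p\<in>bdz S. \<Sum>m\<in>M. if ?c p m then 1 else 0)" by (rule sum.swap)
  also have "\<dots> = (\<Sum>p\<in>bdz S. int (card {m\<in>M. ?c p m}))" using M by (simp add: sum.If_cases Int_def)
  also have "\<dots> \<le> (\<Sum>p\<in>bdz S. wd T (nw S p) + 1)"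
  proof (rule sum_mono)
    fix p assume p: "p \<in> bdz S"
    define w where "w = nw S p"
    have w: "prim w" using nw[OF S fat p] by (simp add: ostep_def w_def)
    let ?A = "msum {p, nx S p} (neg T)" and ?B = "msum {p} (neg T)"
    have sg: "closed_segment (lp p) (lp (nx S p)) = cv {p, nx S p}" by (simp add: cv_def segment_convex_hull)
    have A: "{m. closed_segment (lp p) (lp (nx S p)) \<inter> ltrans (cv T) m \<noteq> {}} = ?A"
      unfolding sg ltrans_meets by (rule Lt_mink) (simp_all add: nT)
    have "{m. cv {p} \<inter> ltrans (cv T) m \<noteq> {}} = ?B" unfolding ltrans_meets by (rule Lt_mink) (simp_all add: nT)
    then have B: "{m. lp p \<in> ltrans (cv T) m} = ?B" by (simp add: cv_def)
    have "{p, nx S p} = (+) p ` seg w" by (simp add: seg_def nx_def w_def)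
    then have "card ?A = card (msum (seg w) (neg T))" using msum_translate[of "seg w" "neg T" p] nT by (simp add: seg_def)
    then have cA: "int (card ?A) = int (card T) + wd T w + 1"
      using card_msum_seg[OF pg_neg[OF T] w] by (simp add: msum_commute wd_def)
    have "{p} = (+) p ` {0}" by simp
    then have cB: "card ?B = card T" using msum_translate[of "{0}" "neg T" p] nT msum_zero[OF pg_neg[OF T]] by simp
    have BA: "?B \<subseteq> ?A" unfolding A[symmetric] B[symmetric] using ends_in_segment(1) by blast
    have fA: "finite ?A" by (simp add: msum_def finite_LL)
    have "card {m\<in>M. ?c p m} \<le> card (?A - ?B)" by (rule card_mono) (use fA A B in blast)+
    also have "\<dots> = card ?A - card ?B" by (rule card_Diff_subset[OF finite_subset[OF BA fA] BA])
    finally show "int (card {m\<in>M. ?c p m}) \<le> wd T (nw S p) + 1"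
      using cA cB card_mono[OF fA BA] by (simp add: w_def)
  qed
  also have "\<dots> = (\<Sum>w\<in>normals S. flen S w * (wd T w + 1))" by (rule sum_bdz[OF S fat])
  finally show ?thesis .
qed

text \<open>A translate that misses the polygon leaves one component and contributes zero, so the
  sum runs over \<open>M\<close>. Each remaining term is at most the number of its entries, plus one
  for a translate inside the interior, minus one; the last part sums to
  \<open>card (msum S (neg T))\<close>.\<close>

lemma hcount_le:
  assumes S: "pg S" and int: "interior (cv S) \<noteq> {}" and T: "pg T" and no: "\<not> (\<exists>m. ltrans (cv S) m \<subseteq> cv T)"
  shows "hcount (cv S) (cv T) \<le> (\<Sum>w\<in>normals S. flen S w * (wd T w + 1)) - int (card (msum S (neg T)))
     + int (card {m. ltrans (cv T) m \<subseteq> interior (cv S)})"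
proof -
  note f = pgD[OF S] and fT = pgD[OF T] and nT = neg_fin(1)[OF pgD(1)[OF T]] neg_fin(2)[OF pgD(2)[OF T]]
  have fat: "fat S" by (rule fat_interior[OF S int])
  define M where "M = {m. cv S \<inter> ltrans (cv T) m \<noteq> {}}"
  have M: "M = msum S (neg T)" unfolding M_def ltrans_meets by (rule Lt_mink) (simp_all add: f nT)
  have fM: "finite M" unfolding M msum_def by (rule finite_LL)
  let ?t = "\<lambda>m. int (ncomp (cv S - ltrans (cv T) m)) - 1"
  have cS: "connected (cv S)" "cv S \<noteq> {}" using convex_connected[OF convex_cv] cv_mem f by blast+
  have out: "?t m = 0" if "m \<notin> M" for m
  proof -
    have "cv S - ltrans (cv T) m = cv S" using that by (auto simp: M_def)
    then show ?thesis using cS components_eq_sing_iff[of "cv S"] by (simp add: ncomp_def connected_eq_components_subset_sing_exists)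
  qed
  have tcomp: "compact (ltrans (cv T) m)" "convex (ltrans (cv T) m)" for m
  proof -
    have e: "ltrans (cv T) m = (+) (lp m) ` cv T" by (simp add: ltrans_def add.commute)
    show "compact (ltrans (cv T) m)" unfolding e by (intro compact_translation compact_cv fT)
    show "convex (ltrans (cv T) m)" unfolding e by (intro convex_translation convex_cv)
  qed
  let ?I = "{m. ltrans (cv T) m \<subseteq> interior (cv S)}"
  have IM: "?I \<subseteq> M"
  proof
    fix m assume m: "m \<in> ?I"
    obtain t where "t \<in> T" using fT by blast
    then have "lp t + lp m \<in> ltrans (cv T) m" unfolding ltrans_def using cv_mem by blast
    then show "m \<in> M" using m interior_subset unfolding M_def by blast
  qed
  have "hcount (cv S) (cv T) = sum ?t {m. ?t m \<noteq> 0}" by (simp add: hcount_def)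
  also have "\<dots> = sum ?t M" by (rule sum.mono_neutral_left[OF fM]) (use out in auto)
  also have "\<dots> \<le> (\<Sum>m\<in>M. int (card (entries S (ltrans (cv T) m))) + (if m \<in> ?I then 1 else 0) - 1)"
  proof (rule sum_mono)
    fix m assume "m \<in> M"
    then have "cv S \<inter> ltrans (cv T) m \<noteq> {}" unfolding M_def by blast
    from components_entries[OF S int tcomp(2,1) this]
    show "?t m \<le> int (card (entries S (ltrans (cv T) m))) + (if m \<in> ?I then 1 else 0) - 1"
      by (simp only: mem_Collect_eq)
  qed
  also have "\<dots> = (\<Sum>m\<in>M. int (card (entries S (ltrans (cv T) m)))) + (\<Sum>m\<in>M. if m \<in> ?I then 1 else 0) - int (card M)"
    by (simp add: sum_subtractf sum.distrib)
  also have "(\<Sum>m\<in>M. if m \<in> ?I then 1 else 0) = int (card ?I)"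
    using sum.inter_restrict[OF fM, of "\<lambda>_. 1::int" ?I] IM by (simp add: Int_absorb1)
  finally show ?thesis using entries_sum[OF S fat T fM] unfolding M by simp
qed

theorem polygon_inequality:
  assumes P: "pg S" "interior (cv S) \<noteq> {}" and Q: "pg T" "interior (cv T) \<noteq> {}"
    and no: "\<not> (\<exists>m. ltrans (cv S) m \<subseteq> cv T)"
    and hyp: "int (nlat (mink (cv T) (cv T))) + hcount (cv S) (cv T) > int (nlat (interior (mink (cv S) (cv T))))"
  shows "mv (msum S S) (msum S T) < 2 * (int (card (msum S T)) - 1)"
proof (rule mixed_count_inequality[OF P(1) Q(1) hcount_le[OF P Q(1) no]])
  note f = pgD[OF P(1)] and fT = pgD[OF Q(1)]
  have fatS: "fat S" and fatT: "fat T" using fat_interior P Q by blast+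
  let ?H = "msum S T"
  have pH: "pg ?H" using f fT by (intro pg_msum)
  have fatH: "fat ?H" using fatS fatT f fT by (simp add: fat_def wd_def algebra_simps add_pos_pos) (smt (verit))
  have mH: "mink (cv S) (cv T) = cv ?H"
  proof -
    let ?U = "{s + t |s t. s \<in> S \<and> t \<in> T}"
    have fU: "finite ?U" "?U \<noteq> {}" using f fT by (simp add: finite_image_set2, blast)
    have "cv ?U = cv (LL (hz ?U))" by (rule cv_hull[OF fU, symmetric])
    also have "LL (hz ?U) = ?H" using Lt_mink[OF f fT] Lt_cv[OF fU] unfolding mink_cv by simp
    finally show ?thesis unfolding mink_cv .
  qed
  have iH: "interior (cv ?H) \<noteq> {}"
  proof -
    obtain t where t: "t \<in> T" using fT by blast
    have "(+) (lp t) ` cv S \<subseteq> cv ?H" unfolding mH[symmetric] mink_def using cv_mem[OF t]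
    proof (rule_tac image_subsetI)
      fix x assume "x \<in> cv S"
      then show "lp t + x \<in> {p + q |p q. p \<in> cv S \<and> q \<in> cv T}" using cv_mem[OF t]
        by (intro CollectI exI[of _ x] exI[of _ "lp t"] conjI) (simp_all add: add.commute)
    qed
    then have "interior ((+) (lp t) ` cv S) \<subseteq> interior (cv ?H)" by (rule interior_mono)
    then show ?thesis using P(2) by (auto simp: interior_translation)
  qed
  have int_count: "int (nlat (interior (cv X))) = int (card X) - bS X" if X: "pg X" "fat X" "interior (cv X) \<noteq> {}" for X
  proof -
    have "Lt (interior (cv X)) = X - bdz X"
      unfolding Lt_def using interior_lattice[OF X(1) fat_ne[OF X(2)] X(3)] by blast
    moreover have bX: "bdz X \<subseteq> X" by (auto simp: bdz_def)
    moreover have "card (X - bdz X) = card X - card (bdz X)" "card (bdz X) \<le> card X"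
      using card_Diff_subset[OF finite_subset[OF bX] bX] card_mono[OF _ bX] pgD(1)[OF X(1)] by blast+
    ultimately show ?thesis using card_bdz[OF X(1,2)] by (simp add: nlat_Lt)
  qed
  have "nlat (mink (cv T) (cv T)) = card (msum T T)" using Lt_mink[OF fT fT] by (simp add: nlat_Lt)
  then show "int (card ?H) - bS ?H < int (card (msum T T)) + hcount (cv S) (cv T)"
    using hyp int_count[OF pH fatH iH] unfolding mH by simp
  let ?M = "{m. ltrans (cv T) m \<subseteq> interior (cv S)}"
  assume pos: "0 < int (card ?M)"
  let ?C = "S - bdz S"
  have in_int: "t + m \<in> ?C" if "t \<in> T" "m \<in> ?M" for t m
  proof -
    have "lp t + lp m \<in> ltrans (cv T) m" unfolding ltrans_def using cv_mem that(1) by blast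
    then have "lp (t + m) \<in> interior (cv S)" using that(2) by (auto simp: lp_simps)
    then show ?thesis using interior_lattice[OF P(1) fat_ne[OF fatS] P(2)] by blast
  qed
  \<comment> \<open>A point of \<open>T\<close> plus a shift in \<open>?M\<close> is an interior
    lattice point of the first polygon, so the sumset bound applies.\<close>
  have "card T + card ?M \<le> card ?C + 1"
    by (rule sumset_card[OF fT _ _ _ in_int]) (use pos f in \<open>auto simp: card_gt_0_iff\<close>)
  moreover have "int (card ?C) = int (card S) - bS S"
  proof -
    have "Lt (interior (cv S)) = ?C" unfolding Lt_def using interior_lattice[OF P(1) fat_ne[OF fatS] P(2)] by blast
    then show ?thesis using int_count[OF P(1) fatS P(2)] by (simp add: nlat_Lt)
  qed
  ultimately show "int (card T) + int (card ?M) - 1 \<le> int (card S) - bS S" by linarith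
qed simp

section \<open>Laurent polynomials and supports\<close>

type_synonym lau = "lat \<Rightarrow>\<^sub>0 complex"

abbreviation lk :: "lau \<Rightarrow> lat \<Rightarrow> complex" where "lk \<equiv> Poly_Mapping.lookup"
abbreviation kys :: "lau \<Rightarrow> lat set" where "kys \<equiv> Poly_Mapping.keys"

definition mon :: "lat \<Rightarrow> lau" where "mon n = Poly_Mapping.single n 1"
definition CC :: "complex \<Rightarrow> lau" where "CC c = Poly_Mapping.single 0 c"

lemma lau_decomp: "t = (\<Sum>n\<in>kys t. Poly_Mapping.single n (lk t n))"
  by (rule poly_mapping_eqI) (simp add: lookup_sum lookup_single when_def in_keys_iff)

lemma lk_single_mult: "lk (Poly_Mapping.single k c * t) n = c * lk t (n - k)"
proof -
  have "lk (Poly_Mapping.single k c * t) n = (\<Sum>m\<in>kys t. lk (Poly_Mapping.single (k + m) (c * lk t m)) n)"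
    by (subst lau_decomp[of t]) (simp add: sum_distrib_left mult_single lookup_sum)
  also have "\<dots> = (\<Sum>m\<in>kys t. if m = n - k then c * lk t m else 0)"
    by (rule sum.cong[OF refl]) (metis add_diff_cancel_left' diff_add_cancel add.commute lookup_single_eq lookup_single_not_eq)
  also have "\<dots> = c * lk t (n - k)" by (simp add: in_keys_iff)
  finally show ?thesis .
qed

lemma lk_mult: "lk (s * t) n = (\<Sum>k\<in>kys s. lk s k * lk t (n - k))"
  by (subst lau_decomp[of s]) (simp add: sum_distrib_right lookup_sum lk_single_mult)

lemma lk_mon_mult [simp]: "lk (mon m * t) n = lk t (n - m)" by (simp add: mon_def lk_single_mult)
lemma lk_CC_mult [simp]: "lk (CC c * t) n = c * lk t n" by (simp add: CC_def lk_single_mult)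
lemma mon_add: "mon (m + n) = mon m * mon n" by (simp add: mon_def mult_single)
lemma mon_0 [simp]: "mon 0 = 1" by (simp add: mon_def)
lemma mon_inv: "mon (- n) * mon n = 1" "mon n * mon (- n) = 1" by (simp_all flip: mon_add)
lemma mon_cancel: "mon (- n) * (mon n * t) = t" "mon n * (mon (- n) * t) = t"
  by (simp_all add: mult.assoc[symmetric] mon_inv)
lemma CC_simps: "CC (a + b) = CC a + CC b" "CC (a * b) = CC a * CC b" "CC 0 = 0" "CC 1 = 1" "CC (- a) = - CC a" "CC (a - b) = CC a - CC b"
  by (simp_all add: CC_def single_add mult_single single_diff) (simp add: single_uminus)

lemma kys_mon_mult: "n \<in> kys (mon m * t) \<longleftrightarrow> n - m \<in> kys t" by (simp add: in_keys_iff)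
lemma kys_mon: "kys (mon n) = {n}" by (simp add: mon_def)

lemma kys_mult_sub: "n \<in> kys (s * t) \<Longrightarrow> \<exists>a\<in>kys s. \<exists>b\<in>kys t. n = a + b"
  using keys_mult[of s t] by blast

lemma kys_add_sub: "n \<in> kys (s + t) \<Longrightarrow> n \<in> kys s \<or> n \<in> kys t" using keys_add[of s t] by blast
lemma kys_diff_sub: "n \<in> kys (s - t) \<Longrightarrow> n \<in> kys s \<or> n \<in> kys t" by (simp add: in_keys_iff lookup_minus) (metis diff_self)

lemma kys_ne: "t \<noteq> 0 \<Longrightarrow> kys t \<noteq> {}" by simp

lemma exposed_min:
  assumes "finite S" "S \<noteq> {}"
  obtains v \<theta> where "v \<in> S" "\<And>n. n \<in> S \<Longrightarrow> n \<noteq> v \<Longrightarrow> dotz \<theta> n > dotz \<theta> v"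
proof -
  have "(1::int, 0::int) \<noteq> 0" by (simp add: prod_eq_iff)
  then obtain v \<theta> where "v \<in> S" "\<And>n. n \<in> S - {v} \<Longrightarrow> dotz \<theta> (n - v) > 0" using exposed_max[OF assms] by metis
  then show thesis using that[of v \<theta>] by simp
qed

text \<open>The coefficient of an extreme exponent of a product is a product of extreme coefficients; the region
  \<open>R\<close> leaves room for the restriction to a cone needed when two charts are compared.\<close>

lemma extreme_coeff:
  fixes w w' :: pt
  assumes f: "a0 \<in> kys f" "\<And>k. k \<in> kys f \<Longrightarrow> w \<bullet> lp k \<le> w \<bullet> lp a0 \<and> w' \<bullet> lp k \<le> w' \<bullet> lp a0"
    and d: "kys d \<inter> R \<noteq> {}"
    and R: "\<And>m n. n \<in> R \<Longrightarrow> w \<bullet> lp n \<le> w \<bullet> lp m \<Longrightarrow> w' \<bullet> lp n \<le> w' \<bullet> lp m \<Longrightarrow> m \<in> R"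
  obtains a n where "a \<in> kys f" "w \<bullet> lp a = w \<bullet> lp a0" "w' \<bullet> lp a = w' \<bullet> lp a0" "n \<in> kys d" "n \<in> R"
    "\<And>m. m \<in> kys d \<inter> R \<Longrightarrow> (w + w') \<bullet> lp m \<le> (w + w') \<bullet> lp n" "lk (f * d) (a + n) = lk f a * lk d n"
proof -
  let ?F = "{k\<in>kys f. w \<bullet> lp k = w \<bullet> lp a0 \<and> w' \<bullet> lp k = w' \<bullet> lp a0}"
  have F: "finite ?F" "?F \<noteq> {}" using f(1) by (simp, blast)
  obtain a \<theta> where a: "a \<in> ?F" "\<And>k. k \<in> ?F \<Longrightarrow> k \<noteq> a \<Longrightarrow> dotz \<theta> k > dotz \<theta> a"
    using exposed_min[OF F] by blast
  define W where "W = Max ((\<lambda>m. (w + w') \<bullet> lp m) ` (kys d \<inter> R))"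
  let ?D = "{m\<in>kys d \<inter> R. (w + w') \<bullet> lp m = W}"
  have fin: "finite ((\<lambda>m. (w + w') \<bullet> lp m) ` (kys d \<inter> R))" by simp
  have "W \<in> (\<lambda>m. (w + w') \<bullet> lp m) ` (kys d \<inter> R)" unfolding W_def using d by (intro Max_in) auto
  then have Dne: "?D \<noteq> {}" by (rule imageE) blast
  have fD: "finite ?D" by simp
  \<comment> \<open>\<open>a\<close> and \<open>n\<close> both minimise the tie-breaking functional
    \<open>\<theta>\<close>. Any other pair of exponents with sum \<open>a + n\<close> would violate
    one of the two choices, so the coefficient is a single product.\<close>
  obtain n where n: "n \<in> ?D" "dotz (- \<theta>) n = hz ?D (- \<theta>)" by (rule hz_attained[OF fD Dne])
  have Wmax: "(w + w') \<bullet> lp m \<le> W" if "m \<in> kys d \<inter> R" for m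
    unfolding W_def by (rule Max_ge[OF fin imageI[OF that]])
  have "lk (f * d) (a + n) = (\<Sum>k\<in>kys f. lk f k * lk d (a + n - k))" by (rule lk_mult)
  also have "\<dots> = (\<Sum>k\<in>{a}. lk f k * lk d (a + n - k))"
  proof (rule sum.mono_neutral_right)
    show "\<forall>k\<in>kys f - {a}. lk f k * lk d (a + n - k) = 0"
    proof
      fix k assume k: "k \<in> kys f - {a}"
      let ?m = "a + n - k"
      have "lk d ?m = 0"
      proof (rule ccontr)
        assume "lk d ?m \<noteq> 0"
        then have md: "?m \<in> kys d" by (simp add: in_keys_iff)
        have e: "u \<bullet> lp ?m = u \<bullet> lp a + u \<bullet> lp n - u \<bullet> lp k" for u by (simp add: lp_simps inner_add_right inner_diff_right)
        have le: "w \<bullet> lp k \<le> w \<bullet> lp a" "w' \<bullet> lp k \<le> w' \<bullet> lp a" using f(2)[of k] k a(1) by simp_all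
        have mR: "?m \<in> R" by (rule R[of n]) (use n(1) e le in simp_all)
        have "(w + w') \<bullet> lp ?m \<le> W" using Wmax md mR by blast
        moreover have "(w + w') \<bullet> lp n = W" using n(1) by blast
        ultimately have eq: "w \<bullet> lp k = w \<bullet> lp a" "w' \<bullet> lp k = w' \<bullet> lp a" "(w + w') \<bullet> lp ?m = W"
          using le e[of w] e[of w'] e[of "w + w'"] by (simp_all add: inner_add_left)
        have "k \<in> ?F" using eq a(1) k by simp
        then have 1: "dotz \<theta> k > dotz \<theta> a" using a(2) k by blast
        have "?m \<in> ?D" using md mR eq(3) by blast
        then have "dotz (- \<theta>) ?m \<le> dotz (- \<theta>) n" unfolding n(2) by (intro hz_ge) simp_all
        then show False using 1 by simp
      qed
      then show "lk f k * lk d ?m = 0" by simp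
    qed
  qed (use a(1) in auto)
  also have "\<dots> = lk f a * lk d n" by simp
  finally have c: "lk (f * d) (a + n) = lk f a * lk d n" .
  show thesis by (rule that[OF _ _ _ _ _ _ c]) (use a(1) n(1) Wmax in auto)
qed

text \<open>Otherwise some exponent of \<open>d\<close> violates both bounds, and
  \<open>extreme_coeff\<close> on the region of such exponents yields a term of \<open>f * d\<close>
  violating both bounds as well. In applications \<open>d\<close> is the difference of two local
  corrections, and \<open>a0\<close> is an exponent of \<open>f\<close> maximal for both
  directions.\<close>

lemma adjacency:
  fixes w w' :: pt
  assumes f: "a0 \<in> kys f" "\<And>k. k \<in> kys f \<Longrightarrow> w \<bullet> lp k \<le> w \<bullet> lp a0 \<and> w' \<bullet> lp k \<le> w' \<bullet> lp a0"
    and fd: "\<And>n. n \<in> kys (f * d) \<Longrightarrow> w \<bullet> lp n \<le> w \<bullet> lp a0 + b \<or> w' \<bullet> lp n \<le> w' \<bullet> lp a0 + b'"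
    and n: "n \<in> kys d"
  shows "w \<bullet> lp n \<le> b \<or> w' \<bullet> lp n \<le> b'"
proof (rule ccontr)
  assume neg: "\<not> ?thesis"
  let ?R = "{n. w \<bullet> lp n > b \<and> w' \<bullet> lp n > b'}"
  have dR: "kys d \<inter> ?R \<noteq> {}" using n neg by auto
  obtain a m where am: "a \<in> kys f" "w \<bullet> lp a = w \<bullet> lp a0" "w' \<bullet> lp a = w' \<bullet> lp a0" "m \<in> kys d" "m \<in> ?R"
    "lk (f * d) (a + m) = lk f a * lk d m"
    by (rule extreme_coeff[OF f dR]) auto
  have "a + m \<in> kys (f * d)" using am by (simp add: in_keys_iff)
  then show False using fd[of "a + m"] am by (simp add: lp_simps inner_add_right)
qed

lemma extreme_product:
  fixes w :: pt
  assumes "s \<noteq> 0" "t \<noteq> 0"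
  obtains a b where "a \<in> kys s" "\<And>k. k \<in> kys s \<Longrightarrow> w \<bullet> lp k \<le> w \<bullet> lp a" "b \<in> kys t"
    "\<And>k. k \<in> kys t \<Longrightarrow> w \<bullet> lp k \<le> w \<bullet> lp b" "a + b \<in> kys (s * t)"
proof -
  let ?M = "Max ((\<lambda>k. w \<bullet> lp k) ` kys s)"
  have "?M \<in> (\<lambda>k. w \<bullet> lp k) ` kys s" using assms by (intro Max_in) auto
  then obtain a0 where a0: "?M = w \<bullet> lp a0" "a0 \<in> kys s" by (rule imageE)
  have le: "w \<bullet> lp k \<le> w \<bullet> lp a0" if "k \<in> kys s" for k unfolding a0(1)[symmetric] using that by (intro Max_ge) auto
  obtain a b where ab: "a \<in> kys s" "w \<bullet> lp a = w \<bullet> lp a0" "b \<in> kys t"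
    "\<And>m. m \<in> kys t \<Longrightarrow> (w + w) \<bullet> lp m \<le> (w + w) \<bullet> lp b" "lk (s * t) (a + b) = lk s a * lk t b"
    by (rule extreme_coeff[of a0 s w w t UNIV]) (use a0 le assms in auto)
  have "a + b \<in> kys (s * t)" using ab by (simp add: in_keys_iff)
  then show thesis using that[OF ab(1) _ ab(3)] le ab(2,4) by (simp add: inner_add_left)
qed

lemma lau_mult_nz: "(s::lau) \<noteq> 0 \<Longrightarrow> t \<noteq> 0 \<Longrightarrow> s * t \<noteq> 0"
  by (metis empty_iff extreme_product keys_zero)

lemma hz_mult: assumes "s \<noteq> 0" "t \<noteq> 0" shows "hz (kys (s * t)) w = hz (kys s) w + hz (kys t) w"
proof -
  obtain a b where ab: "a \<in> kys s" "\<And>k. k \<in> kys s \<Longrightarrow> lp w \<bullet> lp k \<le> lp w \<bullet> lp a" "b \<in> kys t"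
    "\<And>k. k \<in> kys t \<Longrightarrow> lp w \<bullet> lp k \<le> lp w \<bullet> lp b" "a + b \<in> kys (s * t)"
    using extreme_product[OF assms, of "lp w"] by metis
  have h: "hz (kys s) w = dotz w a" "hz (kys t) w = dotz w b"
    using ab by (auto intro!: hz_eqI simp: inner_lp)
  show ?thesis
  proof (rule hz_eqI[OF _ ab(5)])
    fix n assume "n \<in> kys (s * t)"
    then obtain x y where "x \<in> kys s" "y \<in> kys t" "n = x + y" using kys_mult_sub by blast
    then show "dotz w n \<le> hz (kys s) w + hz (kys t) w" using hz_ge[of "kys s" x w] hz_ge[of "kys t" y w] by simp
  qed (simp_all add: h)
qed

section \<open>Real support functions and gluing of local corrections\<close>

definition hR :: "lat set \<Rightarrow> pt \<Rightarrow> real" where "hR S w = Max ((\<lambda>n. w \<bullet> lp n) ` S)"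

lemma hR_ge: "finite S \<Longrightarrow> n \<in> S \<Longrightarrow> w \<bullet> lp n \<le> hR S w" unfolding hR_def by (intro Max_ge finite_imageI imageI)
lemma hR_attained: assumes "finite S" "S \<noteq> {}" obtains n where "n \<in> S" "w \<bullet> lp n = hR S w"
proof -
  have "hR S w \<in> (\<lambda>n. w \<bullet> lp n) ` S" unfolding hR_def using assms by (intro Max_in) auto
  then obtain n where "hR S w = w \<bullet> lp n" "n \<in> S" by (rule imageE)
  then show thesis using that by simp
qed

lemma msum_real:
  assumes "finite S" "S \<noteq> {}" "finite T" "T \<noteq> {}"
  shows "n \<in> msum S T \<longleftrightarrow> (\<forall>w. w \<bullet> lp n \<le> hR S w + hR T w)"
proof
  assume n: "n \<in> msum S T"
  show "\<forall>w. w \<bullet> lp n \<le> hR S w + hR T w"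
  proof (rule ccontr)
    assume "\<not> ?thesis"
    then obtain w where w: "w \<bullet> lp n > hR S w + hR T w" unfolding not_all not_le by blast
    let ?U = "(\<lambda>x. fst x + snd x) ` (S \<times> T)"
    have U: "finite ?U" using assms by simp
    have sep: "w \<bullet> lp u < w \<bullet> lp n" if uU: "u \<in> ?U" for u
    proof -
      from uU obtain x where x: "u = fst x + snd x" "x \<in> S \<times> T" by (rule imageE)
      have "fst x \<in> S" "snd x \<in> T" using x(2) by (simp_all add: mem_Times_iff)
      then show ?thesis using w hR_ge[OF assms(1), of "fst x" w] hR_ge[OF assms(3), of "snd x" w]
        unfolding x(1) lp_simps inner_add_right by linarith
    qed
    obtain v where v: "\<forall>u\<in>?U. dotz v u < dotz v n"
    proof (rule integral_separation[OF U sep])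
      fix v assume a: "\<And>s. s \<in> ?U \<Longrightarrow> dotz v s < dotz v n"
      show thesis by (rule that[of v]) (rule ballI, rule a)
    qed
    obtain s t where st: "s \<in> S" "dotz v s = hz S v" "t \<in> T" "dotz v t = hz T v" using hz_attained assms by metis
    have "s + t \<in> ?U" by (rule image_eqI[of _ _ "(s, t)"]) (use st in simp_all)
    then have "hz S v + hz T v < dotz v n" using bspec[OF v, of "s + t"] st by simp
    then show False using n unfolding msum_def LL_def by (metis (mono_tags, lifting) mem_Collect_eq not_le)
  qed
next
  assume a: "\<forall>w. w \<bullet> lp n \<le> hR S w + hR T w"
  have "dotz w n \<le> hz S w + hz T w" for w
  proof -
    have "of_int (dotz w n) \<le> hR S (lp w) + hR T (lp w)" using a by (metis inner_lp)
    moreover obtain s where "s \<in> S" "lp w \<bullet> lp s = hR S (lp w)" by (rule hR_attained[OF assms(1,2)])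
    moreover obtain t where "t \<in> T" "lp w \<bullet> lp t = hR T (lp w)" by (rule hR_attained[OF assms(3,4)])
    ultimately have "real_of_int (dotz w n) \<le> of_int (hz S w) + of_int (hz T w)"
      using hz_ge[OF assms(1), of s w] hz_ge[OF assms(3), of t w] unfolding inner_lp by linarith
    then show ?thesis by linarith
  qed
  then show "n \<in> msum S T" by (simp add: msum_def LL_def)
qed

lemma hR_convex:
  assumes "finite S" "S \<noteq> {}" "0 \<le> t" "t \<le> 1"
  shows "hR S ((1 - t) *\<^sub>R w + t *\<^sub>R v) \<le> (1 - t) * hR S w + t * hR S v"
proof -
  obtain n where n: "n \<in> S" "((1 - t) *\<^sub>R w + t *\<^sub>R v) \<bullet> lp n = hR S ((1 - t) *\<^sub>R w + t *\<^sub>R v)"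
    by (rule hR_attained[OF assms(1,2)])
  have "((1 - t) *\<^sub>R w + t *\<^sub>R v) \<bullet> lp n = (1 - t) * (w \<bullet> lp n) + t * (v \<bullet> lp n)" by (simp add: inner_add_left)
  also have "\<dots> \<le> (1 - t) * hR S w + t * hR S v"
    using assms n(1) by (intro add_mono mult_left_mono hR_ge) auto
  finally show ?thesis unfolding n(2) .
qed

text \<open>For a fixed exponent \<open>n\<close> outside \<open>B\<close> the directions violated by \<open>n\<close> form a convex, hence connected, cone, and
  the coefficient at \<open>n\<close> of the local corrections is locally constant on it.\<close>

lemma glue:
  fixes f s :: lau
  assumes f: "f \<noteq> 0" and B: "finite B" "B \<noteq> {}" and K: "finite K" "K \<noteq> {}"
    and loc: "\<And>v. v \<in> K \<Longrightarrow> \<exists>g. \<forall>w. w \<bullet> lp v = hR K w \<longrightarrow> (\<forall>n\<in>kys (s - f * g). w \<bullet> lp n \<le> hR (kys f) w + hR B w)"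
  shows "\<exists>g. \<forall>w. \<forall>n\<in>kys (s - f * g). w \<bullet> lp n \<le> hR (kys f) w + hR B w"
proof -
  let ?A = "kys f"
  have A: "finite ?A" "?A \<noteq> {}" using f by auto
  obtain g where g: "\<And>v w n. v \<in> K \<Longrightarrow> w \<bullet> lp v = hR K w \<Longrightarrow> n \<in> kys (s - f * g v) \<Longrightarrow> w \<bullet> lp n \<le> hR ?A w + hR B w"
    using loc by metis
  \<comment> \<open>Neighbouring charts: if an exponent of \<open>f\<close> is maximal for both
    directions, the two corrections agree at every exponent violated by both.\<close>
  have adj: "lk (g v) n = lk (g v') n"
    if v: "v \<in> K" "w \<bullet> lp v = hR K w" "v' \<in> K" "w' \<bullet> lp v' = hR K w'" and a: "a \<in> ?A" "w \<bullet> lp a = hR ?A w" "w' \<bullet> lp a = hR ?A w'"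
      and n: "w \<bullet> lp n > hR B w" "w' \<bullet> lp n > hR B w'" for v v' w w' a n
  proof (rule ccontr)
    assume "lk (g v) n \<noteq> lk (g v') n"
    then have nk: "n \<in> kys (g v - g v')" by (simp add: in_keys_iff lookup_minus)
    have "w \<bullet> lp n \<le> hR B w \<or> w' \<bullet> lp n \<le> hR B w'"
    proof (rule adjacency[OF a(1) _ _ nk])
      fix k assume "k \<in> kys f"
      then show "w \<bullet> lp k \<le> w \<bullet> lp a \<and> w' \<bullet> lp k \<le> w' \<bullet> lp a" using hR_ge[OF A(1)] a by simp
    next
      fix m assume "m \<in> kys (f * (g v - g v'))"
      moreover have "f * (g v - g v') = (s - f * g v') - (s - f * g v)" by (simp add: algebra_simps)
      ultimately have "m \<in> kys (s - f * g v') \<or> m \<in> kys (s - f * g v)" using kys_diff_sub by metis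
      then show "w \<bullet> lp m \<le> w \<bullet> lp a + hR B w \<or> w' \<bullet> lp m \<le> w' \<bullet> lp a + hR B w'"
        using g[OF v(1,2)] g[OF v(3,4)] a by fastforce
    qed
    then show False using n by linarith
  qed
  have vm: "\<exists>v\<in>K. w \<bullet> lp v = hR K w" for w using hR_attained[OF K] by metis
  have all: "lk (g v0) n = lk (g v1) n"
    if v: "v0 \<in> K" "w0 \<bullet> lp v0 = hR K w0" "v1 \<in> K" "w1 \<bullet> lp v1 = hR K w1" and n: "w0 \<bullet> lp n > hR B w0" "w1 \<bullet> lp n > hR B w1"
    for v0 v1 w0 w1 n
  proof -
    \<comment> \<open>Along the segment from \<open>w0\<close> to \<open>w1\<close> the exponent
      \<open>n\<close> stays violated, as \<open>hR B\<close> is convex. For \<open>t'\<close> near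
      \<open>t\<close> every exponent of \<open>f\<close> maximal at \<open>t'\<close> is already
      maximal at \<open>t\<close>, so \<open>adj\<close> makes the coefficient locally
      constant.\<close>
    define W where "W = (\<lambda>t. (1 - t) *\<^sub>R w0 + t *\<^sub>R w1)"
    have "\<forall>t. \<exists>v. v \<in> K \<and> W t \<bullet> lp v = hR K (W t)" using vm by blast
    then obtain V where "\<forall>t. V t \<in> K \<and> W t \<bullet> lp (V t) = hR K (W t)" by metis
    then have V: "\<And>t. V t \<in> K" "\<And>t. W t \<bullet> lp (V t) = hR K (W t)" by blast+
    have Wn: "W t \<bullet> lp n > hR B (W t)" if "t \<in> {0..1}" for t
    proof -
      have "hR B (W t) \<le> (1 - t) * hR B w0 + t * hR B w1" unfolding W_def using that by (intro hR_convex B) auto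
      also have "\<dots> < (1 - t) * (w0 \<bullet> lp n) + t * (w1 \<bullet> lp n)"
      proof (cases "t = 0")
        case False
        have "(1 - t) * hR B w0 \<le> (1 - t) * (w0 \<bullet> lp n)" using that n by (intro mult_left_mono) auto
        moreover have "t * hR B w1 < t * (w1 \<bullet> lp n)" using that n False by (intro mult_strict_left_mono) auto
        ultimately show ?thesis by linarith
      qed (use n in simp)
      also have "\<dots> = W t \<bullet> lp n" by (simp add: W_def inner_add_left)
      finally show ?thesis .
    qed
    have "(\<lambda>t. lk (g (V t)) n) 0 = (\<lambda>t. lk (g (V t)) n) 1"
    proof (rule connected_local_const[of "{0..1::real}"])
      show "\<forall>t\<in>{0..1}. \<forall>\<^sub>F t' in at t within {0..1}. lk (g (V t)) n = lk (g (V t')) n"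
      proof
        fix t :: real assume t: "t \<in> {0..1}"
        obtain a0 where a0: "a0 \<in> ?A" "W t \<bullet> lp a0 = hR ?A (W t)" by (rule hR_attained[OF A])
        have "\<forall>k\<in>{k\<in>?A. W t \<bullet> lp k \<noteq> hR ?A (W t)}. \<forall>\<^sub>F t' in at t within {0..1}. W t' \<bullet> lp k < W t' \<bullet> lp a0"
        proof
          fix k assume k: "k \<in> {k\<in>?A. W t \<bullet> lp k \<noteq> hR ?A (W t)}"
          have "W t \<bullet> lp k < W t \<bullet> lp a0" using k a0 hR_ge[OF A(1), of k "W t"] by simp
          then have "0 < W t \<bullet> lp a0 - W t \<bullet> lp k" by simp
          moreover have "((\<lambda>t'. W t' \<bullet> lp a0 - W t' \<bullet> lp k) \<longlongrightarrow> W t \<bullet> lp a0 - W t \<bullet> lp k) (at t within {0..1})"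
            unfolding W_def by (intro tendsto_intros)
          ultimately have "\<forall>\<^sub>F t' in at t within {0..1}. 0 < W t' \<bullet> lp a0 - W t' \<bullet> lp k" by (rule order_tendstoD(1)[rotated])
          then show "\<forall>\<^sub>F t' in at t within {0..1}. W t' \<bullet> lp k < W t' \<bullet> lp a0" by simp
        qed
        then have "\<forall>\<^sub>F t' in at t within {0..1}. \<forall>k\<in>{k\<in>?A. W t \<bullet> lp k \<noteq> hR ?A (W t)}. W t' \<bullet> lp k < W t' \<bullet> lp a0"
          by (subst eventually_ball_finite_distrib) simp_all
        moreover have "\<forall>\<^sub>F t' in at t within {0..1}. t' \<in> {0..1}" by (simp add: eventually_at_filter)
        ultimately show "\<forall>\<^sub>F t' in at t within {0..1}. lk (g (V t)) n = lk (g (V t')) n"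
        proof eventually_elim
          case (elim t')
          obtain a where a: "a \<in> ?A" "W t' \<bullet> lp a = hR ?A (W t')" by (rule hR_attained[OF A])
          have "W t \<bullet> lp a = hR ?A (W t)"
          proof (rule ccontr)
            assume "W t \<bullet> lp a \<noteq> hR ?A (W t)"
            then have "W t' \<bullet> lp a < W t' \<bullet> lp a0" using elim(1) a(1) by blast
            then show False using hR_ge[OF A(1) a0(1), of "W t'"] a(2) by simp
          qed
          then show ?case using adj[OF V(1) V(2) V(1) V(2) a(1) _ a(2)] Wn[OF t] Wn[OF elim(2)] by blast
        qed
      qed
    qed auto
    moreover have V0: "w0 \<bullet> lp (V 0) = hR K w0" using V(2)[of 0] by (simp add: W_def)
    moreover have V1: "w1 \<bullet> lp (V 1) = hR K w1" using V(2)[of 1] by (simp add: W_def)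
    moreover obtain a where a: "a \<in> ?A" "w0 \<bullet> lp a = hR ?A w0" by (rule hR_attained[OF A])
    have "lk (g v0) n = lk (g (V 0)) n" by (rule adj[OF v(1,2) V(1) V0 a a(2) n(1) n(1)])
    moreover obtain a' where a': "a' \<in> ?A" "w1 \<bullet> lp a' = hR ?A w1" by (rule hR_attained[OF A])
    have "lk (g (V 1)) n = lk (g v1) n" by (rule adj[OF V(1) V1 v(3,4) a' a'(2) n(2) n(2)])
    ultimately show ?thesis by simp
  qed
  \<comment> \<open>By \<open>all\<close> the local coefficient does not depend on the violated
    direction. Exponents violated by no direction receive zero: a change of the correction there
    keeps its product with \<open>f\<close> within the bound.\<close>
  define c where "c = (\<lambda>n. if \<exists>w. w \<bullet> lp n > hR B w then lk (g (SOME v. v \<in> K \<and> (\<exists>w. w \<bullet> lp n > hR B w \<and> w \<bullet> lp v = hR K w))) n else 0)"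
  have c: "c n = lk (g v) n" if "v \<in> K" "w \<bullet> lp v = hR K w" "w \<bullet> lp n > hR B w" for n v w
  proof -
    let ?P = "\<lambda>v. v \<in> K \<and> (\<exists>w. w \<bullet> lp n > hR B w \<and> w \<bullet> lp v = hR K w)"
    have "?P (SOME v. ?P v)" by (rule someI[of ?P v]) (use that in blast)
    then show ?thesis unfolding c_def using that all by (smt (verit))
  qed
  have "{n. c n \<noteq> 0} \<subseteq> (\<Union>v\<in>K. kys (g v))"
  proof
    fix n assume n: "n \<in> {n. c n \<noteq> 0}"
    have "\<exists>w. w \<bullet> lp n > hR B w"
    proof (rule ccontr)
      assume no: "\<not> (\<exists>w. w \<bullet> lp n > hR B w)"
      have "c n = 0" unfolding c_def using no by (simp only: if_False)
      then show False using n by simp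
    qed
    then obtain w where w: "w \<bullet> lp n > hR B w" by blast
    obtain v where v: "v \<in> K" "w \<bullet> lp v = hR K w" using vm by blast
    have "n \<in> kys (g v)" using c[OF v w] n by (simp add: in_keys_iff)
    then show "n \<in> (\<Union>v\<in>K. kys (g v))" using v(1) by blast
  qed
  then have "finite {n. c n \<noteq> 0}" by (rule finite_subset) (use K in simp)
  then have lkc: "lk (Abs_poly_mapping c) = c" by simp
  let ?g = "Abs_poly_mapping c"
  have "w \<bullet> lp n \<le> hR ?A w + hR B w" if n: "n \<in> kys (s - f * ?g)" for w n
  proof -
    obtain v where v: "v \<in> K" "w \<bullet> lp v = hR K w" using vm by blast
    have "s - f * ?g = (s - f * g v) + f * (g v - ?g)" by (simp add: algebra_simps)
    then have "n \<in> kys (s - f * g v) \<or> n \<in> kys (f * (g v - ?g))" using n kys_add_sub by metis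
    then show ?thesis
    proof
      assume "n \<in> kys (f * (g v - ?g))"
      then obtain a b where ab: "a \<in> ?A" "b \<in> kys (g v - ?g)" "n = a + b" using kys_mult_sub by blast
      have "w \<bullet> lp b \<le> hR B w"
      proof (rule ccontr)
        assume "\<not> w \<bullet> lp b \<le> hR B w"
        then have "lk ?g b = lk (g v) b" using c[OF v, of b] by (simp add: lkc)
        then show False using ab(2) by (simp add: in_keys_iff lookup_minus)
      qed
      then show ?thesis using hR_ge[OF A(1) ab(1), of w] unfolding ab(3) by (simp add: lp_simps inner_add_right)
    qed (rule g[OF v])
  qed
  then show ?thesis by blast
qed

text \<open>The Laurent polynomials congruent modulo \<open>f\<close> to one with exponents in
  \<open>X\<close>; the congruence class is kept instead of passing to a quotient ring.\<close>

definition Wm :: "lau \<Rightarrow> lat set \<Rightarrow> lau set" where "Wm f X = {t. \<exists>g. kys (t - f * g) \<subseteq> X}"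

text \<open>In a direction where \<open>v\<close> is maximal in \<open>K\<close>, the correction for
  \<open>mon v * s\<close>, divided by \<open>mon v\<close>, corrects \<open>s\<close> itself with
  the right bound. Such local corrections glue, which plays the part of a vanishing first cohomology
  group on the toric surface.\<close>

lemma saturate:
  assumes f: "f \<noteq> 0" and B: "finite B" "B \<noteq> {}" and K: "finite K" "K \<noteq> {}"
    and s: "\<And>v. v \<in> K \<Longrightarrow> mon v * s \<in> Wm f (msum (msum (kys f) B) K)"
  shows "s \<in> Wm f (msum (kys f) B)"
proof -
  let ?A = "kys f"
  have A: "finite ?A" "?A \<noteq> {}" using f by auto
  have AB: "finite (msum ?A B)" "msum ?A B \<noteq> {}" using pgD[OF pg_msum[OF A B]] by blast+
  have "\<exists>g. \<forall>w. \<forall>n\<in>kys (s - f * g). w \<bullet> lp n \<le> hR ?A w + hR B w"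
  proof (rule glue[OF f B K])
    fix v assume v: "v \<in> K"
    obtain g where g: "kys (mon v * s - f * g) \<subseteq> msum (msum ?A B) K" using s[OF v] unfolding Wm_def by blast
    have "\<forall>w. w \<bullet> lp v = hR K w \<longrightarrow> (\<forall>n\<in>kys (s - f * (mon (- v) * g)). w \<bullet> lp n \<le> hR ?A w + hR B w)"
    proof (intro allI impI ballI)
      fix w n assume w: "w \<bullet> lp v = hR K w" and n: "n \<in> kys (s - f * (mon (- v) * g))"
      have "mon v * (s - f * (mon (- v) * g)) = mon v * s - f * (mon v * (mon (- v) * g))"
        by (simp add: algebra_simps)
      also have "\<dots> = mon v * s - f * g" by (simp only: mon_cancel)
      finally have eq: "mon v * (s - f * (mon (- v) * g)) = mon v * s - f * g" .
      have "n + v \<in> kys (mon v * s - f * g)"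
        unfolding eq[symmetric] using n by (simp only: kys_mon_mult add_diff_cancel_right')
      then have "n + v \<in> msum (msum ?A B) K" using g by blast
      then have "w \<bullet> lp (n + v) \<le> hR (msum ?A B) w + hR K w" using msum_real[OF AB K] by blast
      moreover have "hR (msum ?A B) w \<le> hR ?A w + hR B w"
      proof -
        obtain m where "m \<in> msum ?A B" "w \<bullet> lp m = hR (msum ?A B) w" by (rule hR_attained[OF AB])
        then show ?thesis using msum_real[OF A B] by metis
      qed
      ultimately show "w \<bullet> lp n \<le> hR ?A w + hR B w" using w by (simp add: lp_simps inner_add_right)
    qed
    then show "\<exists>g. \<forall>w. w \<bullet> lp v = hR K w \<longrightarrow> (\<forall>n\<in>kys (s - f * g). w \<bullet> lp n \<le> hR ?A w + hR B w)" by blast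
  qed
  then obtain g where "\<And>w n. n \<in> kys (s - f * g) \<Longrightarrow> w \<bullet> lp n \<le> hR ?A w + hR B w" by blast
  then have "kys (s - f * g) \<subseteq> msum ?A B" using msum_real[OF A B] by blast
  then show ?thesis unfolding Wm_def by blast
qed

lemma pg_eqI: "pg S \<Longrightarrow> pg T \<Longrightarrow> (\<And>w. hz S w = hz T w) \<Longrightarrow> S = T"
  using pg_LL[of S] pg_LL[of T] by (simp add: LL_def)

section \<open>Leading forms in an edge direction\<close>

definition restr :: "lat set \<Rightarrow> lau \<Rightarrow> lau" where
  "restr R t = (\<Sum>n\<in>kys t \<inter> R. Poly_Mapping.single n (lk t n))"

lemma lk_restr: "lk (restr R t) n = (if n \<in> R then lk t n else 0)"
  unfolding restr_def by (simp add: lookup_sum lookup_single when_def in_keys_iff)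

lemma kys_restr: "kys (restr R t) = kys t \<inter> R"
  by (rule Set.set_eqI) (simp add: in_keys_iff lk_restr)

lemma kys_minus_restr: "kys (t - restr R t) = kys t - R"
  by (rule Set.set_eqI) (simp add: in_keys_iff lk_restr lookup_minus)

definition level :: "lat \<Rightarrow> int \<Rightarrow> lat set" where "level w c = {n. dotz w n = c}"
abbreviation row :: "lat \<Rightarrow> int \<Rightarrow> lau \<Rightarrow> lau" where "row w c t \<equiv> restr (level w c) t"
definition bd :: "lat \<Rightarrow> int \<Rightarrow> lau \<Rightarrow> bool" where "bd w b t \<longleftrightarrow> (\<forall>n\<in>kys t. dotz w n \<le> b)"

lemma bd_add: "bd w b s \<Longrightarrow> bd w b t \<Longrightarrow> bd w b (s + t)" unfolding bd_def using kys_add_sub by blast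
lemma bd_diff: "bd w b s \<Longrightarrow> bd w b t \<Longrightarrow> bd w b (s - t)" unfolding bd_def using kys_diff_sub by blast
lemma bd_mult: "bd w a s \<Longrightarrow> bd w b t \<Longrightarrow> bd w (a + b) (s * t)"
  unfolding bd_def
proof
  fix n assume st: "\<forall>n\<in>kys s. dotz w n \<le> a" "\<forall>n\<in>kys t. dotz w n \<le> b" and n: "n \<in> kys (s * t)"
  obtain x y where "x \<in> kys s" "y \<in> kys t" "n = x + y" using kys_mult_sub[OF n] by blast
  then show "dotz w n \<le> a + b" using st by (simp add: add_mono)
qed
lemma bd_mono: "bd w a t \<Longrightarrow> a \<le> b \<Longrightarrow> bd w b t" unfolding bd_def by fastforce

lemma row_mult:
  assumes s: "bd w a s" and t: "bd w b t" shows "row w (a + b) (s * t) = row w a s * row w b t"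
proof (rule poly_mapping_eqI)
  fix n
  have "lk (row w a s * row w b t) n = (\<Sum>k\<in>kys s \<inter> level w a. lk (row w a s) k * lk (row w b t) (n - k))"
    by (simp only: lk_mult kys_restr)
  also have "\<dots> = (\<Sum>k\<in>kys s \<inter> level w a. if dotz w n = a + b then lk s k * lk t (n - k) else 0)"
    by (rule sum.cong[OF refl]) (simp add: lk_restr level_def)
  also have "\<dots> = (\<Sum>k\<in>kys s. if dotz w n = a + b then lk s k * lk t (n - k) else 0)"
  proof (rule sum.mono_neutral_left)
    show "\<forall>k\<in>kys s - kys s \<inter> level w a. (if dotz w n = a + b then lk s k * lk t (n - k) else 0) = 0"
    proof
      fix k assume k: "k \<in> kys s - kys s \<inter> level w a"
      then have "dotz w k < a" using s unfolding bd_def level_def by force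
      then have "n - k \<notin> kys t" if "dotz w n = a + b" using that t unfolding bd_def by force
      then show "(if dotz w n = a + b then lk s k * lk t (n - k) else 0) = 0" by (simp add: in_keys_iff)
    qed
  qed simp_all
  also have "\<dots> = lk (row w (a + b) (s * t)) n" by (simp add: lk_restr level_def lk_mult)
  finally show "lk (row w (a + b) (s * t)) n = lk (row w a s * row w b t) n" by simp
qed

lemma row_homogeneous:
  assumes s: "kys s \<subseteq> level w a" shows "row w (a + b) (s * t) = s * row w b t"
proof (rule poly_mapping_eqI)
  fix n
  have "lk (s * row w b t) n = (\<Sum>k\<in>kys s. if dotz w n = a + b then lk s k * lk t (n - k) else 0)"
    unfolding lk_mult by (rule sum.cong[OF refl]) (use s in \<open>fastforce simp: lk_restr level_def\<close>)
  then show "lk (row w (a + b) (s * t)) n = lk (s * row w b t) n" by (simp add: lk_restr level_def lk_mult)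
qed

lemma row_self: "kys s \<subseteq> level w a \<Longrightarrow> row w a s = s"
  by (rule poly_mapping_eqI) (auto simp: lk_restr in_keys_iff)

lemma row_diff: "row w c (s - t) = row w c s - row w c t"
  by (rule poly_mapping_eqI) (simp add: lk_restr lookup_minus)

lemma row_zero_bd: assumes "bd w b t" "row w b t = 0" shows "bd w (b - 1) t"
  unfolding bd_def
proof
  fix n assume n: "n \<in> kys t"
  have "dotz w n \<noteq> b"
  proof
    assume "dotz w n = b"
    then have "lk (row w b t) n \<noteq> 0" using n by (simp add: lk_restr level_def in_keys_iff)
    then show False using assms(2) by simp
  qed
  then show "dotz w n \<le> b - 1" using assms(1) n unfolding bd_def by force
qed

text \<open>If the leading forms of \<open>f\<close> and \<open>u\<close> in direction \<open>w\<close> generate the unit ideal, then leading terms of \<open>r\<close>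
  that cancel in \<open>u r\<close> modulo \<open>f\<close> can be removed from \<open>r\<close> by multiples of \<open>f\<close>.\<close>

lemma row_cancel:
  assumes f: "f \<noteq> 0" and u: "bd w hu u'" "u - u' = f * s1"
    and co: "\<alpha> * row w (hz (kys f) w) f + \<beta> * row w hu u' = 1"
    and F: "u * r - F = f * s2" "bd w (hu + b) F"
  shows "\<exists>s. bd w b (r - f * s)"
proof -
  let ?a = "hz (kys f) w"
  let ?rf = "row w ?a f" and ?ru = "row w hu u'"
  have bf: "bd w ?a f" unfolding bd_def using hz_ge by simp
  have step: "\<exists>s'. bd w (b + int k) (r - f * s')" if r': "bd w (b + int (Suc k)) (r - f * s)" for k s
  proof -
    define r' c where "r' = r - f * s" and "c = b + int (Suc k)"
    have br: "bd w c r'" using r' by (simp add: r'_def c_def)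
    define g where "g = s2 - s1 * r' - u * s"
    have e: "u' * r' - F = f * g"
    proof -
      have u'e: "u' = u - f * s1" using u(2) by (simp add: algebra_simps)
      have Fe: "F = u * r - f * s2" using F(1) by (simp add: algebra_simps)
      show ?thesis unfolding Fe g_def u'e unfolding r'_def by (simp add: algebra_simps)
    qed
    have bu: "bd w (hu + c) (u' * r')" by (rule bd_mult[OF u(1) br])
    have bF: "bd w (hu + c - 1) F" by (rule bd_mono[OF F(2)]) (simp add: c_def)
    have bfg: "bd w (hu + c) (f * g)" unfolding e[symmetric] by (rule bd_diff[OF bu bd_mono[OF bF]]) simp
    have bg: "bd w (hu + c - ?a) g"
    proof (cases "g = 0")
      case False
      have "f * g \<noteq> 0" by (rule lau_mult_nz[OF f False])
      then have "hz (kys (f * g)) w \<le> hu + c" using bfg unfolding bd_def by (intro hz_leI) auto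
      then have "hz (kys g) w \<le> hu + c - ?a" unfolding hz_mult[OF f False] by simp
      then show ?thesis unfolding bd_def using hz_ge[of "kys g"] by (meson finite_keys order_trans)
    qed (simp add: bd_def)
    define q0 where "q0 = row w (hu + c - ?a) g"
    have "row w (hu + c) (u' * r') = ?ru * row w c r'" by (rule row_mult[OF u(1) br])
    moreover have "row w (hu + c) (f * g) = ?rf * q0" using row_mult[OF bf bg] by (simp add: q0_def)
    moreover have "row w (hu + c) F = 0"
    proof (rule poly_mapping_eqI)
      fix n show "lk (row w (hu + c) F) n = lk 0 n"
        using bF unfolding bd_def by (force simp: lk_restr level_def in_keys_iff)
    qed
    ultimately have e2: "?ru * row w c r' = ?rf * q0" using row_diff[of w "hu + c" "u' * r'" F] e by simp
    \<comment> \<open>The unit relation times the leading form of \<open>r'\<close>, together with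
      \<open>e2\<close>, shows that this form is a multiple of the leading form of \<open>f\<close>.
      \<open>q\<close> is the homogeneous part of the cofactor, so subtracting \<open>f * q\<close>
      lowers the bound on \<open>r'\<close>.\<close>
    define q where "q = row w (c - ?a) (\<alpha> * row w c r' + \<beta> * q0)"
    have "row w c r' = (\<alpha> * ?rf + \<beta> * ?ru) * row w c r'" unfolding co by simp
    also have "\<dots> = \<alpha> * ?rf * row w c r' + \<beta> * (?ru * row w c r')" by (simp add: algebra_simps)
    also have "\<dots> = ?rf * (\<alpha> * row w c r' + \<beta> * q0)" unfolding e2 by (simp add: algebra_simps)
    finally have "row w c r' = ?rf * (\<alpha> * row w c r' + \<beta> * q0)" .
    then have "row w c (row w c r') = row w (?a + (c - ?a)) (?rf * (\<alpha> * row w c r' + \<beta> * q0))" by simp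
    also have "\<dots> = ?rf * q" unfolding q_def by (rule row_homogeneous) (simp add: kys_restr)
    also have "row w c (row w c r') = row w c r'" by (rule row_self) (simp add: kys_restr)
    finally have e3: "row w c r' = ?rf * q" .
    have qk: "kys q \<subseteq> level w (c - ?a)" by (simp add: q_def kys_restr)
    have bq: "bd w (c - ?a) q" unfolding bd_def
    proof
      fix n assume "n \<in> kys q"
      then show "dotz w n \<le> c - ?a" using subsetD[OF qk] by (simp add: level_def)
    qed
    have "bd w c (f * q)" using bd_mult[OF bf bq] by simp
    moreover have "row w c (f * q) = ?rf * q" using row_mult[OF bf bq] row_self[OF qk] by simp
    ultimately have "row w c (r' - f * q) = 0" "bd w c (r' - f * q)"
      using row_diff[of w c r' "f * q"] e3 br by (simp, intro bd_diff)
    then have "bd w (c - 1) (r' - f * q)" by (intro row_zero_bd)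
    moreover have "r' - f * q = r - f * (s + q)" by (simp add: r'_def algebra_simps)
    ultimately show ?thesis by (intro exI[of _ "s + q"]) (simp add: c_def)
  qed
  have down: "\<exists>s. bd w (b + int k) (r - f * s) \<Longrightarrow> \<exists>s. bd w b (r - f * s)" for k
    by (induction k) (simp, use step in blast)
  have "bd w (b + int (nat (hz (kys r) w - b))) (r - f * 0)"
    unfolding bd_def
  proof
    fix n assume "n \<in> kys (r - f * 0)"
    then have "dotz w n \<le> hz (kys r) w" by (intro hz_ge) simp_all
    then show "dotz w n \<le> b + int (nat (hz (kys r) w - b))" by simp
  qed
  then show ?thesis using down by blast
qed

lemma Wm_keys: "kys t \<subseteq> X \<Longrightarrow> t \<in> Wm f X" unfolding Wm_def by (intro CollectI exI[of _ 0]) simp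
lemma Wm_mult_f: "f * g \<in> Wm f X" unfolding Wm_def by (intro CollectI exI[of _ g]) simp
lemma Wm_add: assumes "s \<in> Wm f X" "t \<in> Wm f X" shows "s + t \<in> Wm f X"
proof -
  obtain g h where gh: "kys (s - f * g) \<subseteq> X" "kys (t - f * h) \<subseteq> X" using assms unfolding Wm_def by blast
  have "(s + t) - f * (g + h) = (s - f * g) + (t - f * h)" by (simp add: algebra_simps)
  moreover have "kys ((s - f * g) + (t - f * h)) \<subseteq> X" by (rule subsetI) (use kys_add_sub gh in blast)
  ultimately have "kys ((s + t) - f * (g + h)) \<subseteq> X" by (simp only:)
  then show ?thesis unfolding Wm_def by blast
qed
lemma Wm_mult: assumes "finite X" "finite Y" "s \<in> Wm f X" "t \<in> Wm f Y" shows "s * t \<in> Wm f (msum X Y)"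
proof -
  obtain g h where gh: "kys (s - f * g) \<subseteq> X" "kys (t - f * h) \<subseteq> Y" using assms unfolding Wm_def by blast
  have "s * t - f * (g * t + (s - f * g) * h) = (s - f * g) * (t - f * h)" by (simp add: algebra_simps)
  moreover have "kys ((s - f * g) * (t - f * h)) \<subseteq> msum X Y"
  proof
    fix n assume "n \<in> kys ((s - f * g) * (t - f * h))"
    then obtain a b where "a \<in> kys (s - f * g)" "b \<in> kys (t - f * h)" "n = a + b" using kys_mult_sub by blast
    then show "n \<in> msum X Y" using msum_mem[OF assms(1,2)] gh by blast
  qed
  ultimately show ?thesis unfolding Wm_def by (intro CollectI exI[of _ "g * t + (s - f * g) * h"]) simp
qed
lemma Wm_CC: assumes "t \<in> Wm f X" shows "CC c * t \<in> Wm f X"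
proof -
  obtain g where g: "kys (t - f * g) \<subseteq> X" using assms unfolding Wm_def by blast
  have "CC c * t - f * (CC c * g) = CC c * (t - f * g)" by (simp add: algebra_simps)
  moreover have "kys (CC c * (t - f * g)) \<subseteq> kys (t - f * g)" by (auto simp: in_keys_iff)
  ultimately have "kys (CC c * t - f * (CC c * g)) \<subseteq> X" using g by simp
  then show ?thesis unfolding Wm_def by blast
qed

section \<open>Multiples of H modulo f\<close>

locale polygons =
  fixes SP SQ :: "lat set" and f :: lau
  assumes pP: "pg SP" and pQ: "pg SQ" and fatP: "fat SP" and fatQ: "fat SQ" and kf: "kys f = msum SP SP"
begin

definition "A = msum SP SP"
definition "H = msum SP SQ"

primrec kH :: "nat \<Rightarrow> lat set" where
  "kH 0 = {0}" | "kH (Suc k) = msum H (kH k)"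

text \<open>For \<open>m \<ge> 2\<close> the exponents by which \<open>f\<close> may be multiplied
  inside \<open>kH m\<close>: as \<open>2H\<close> is the sum of \<open>A\<close> and
  \<open>2 SQ\<close>, \<open>msum A (BB m) = kH m\<close> holds by \<open>AB\<close>. The
  subtraction \<open>m - 2\<close> is truncated, hence the recurring assumption on
  \<open>m\<close>.\<close>

definition BB :: "nat \<Rightarrow> lat set" where "BB m = msum (kH (m - 2)) (msum SQ SQ)"

abbreviation V :: "nat \<Rightarrow> lau set" where "V m \<equiv> Wm f (kH m)"
text \<open>Modulo \<open>f\<close>, the space \<open>V m\<close> consists of the Laurent polynomials with exponents in \<open>m H\<close>; the saturation \<open>V1\<close>
  can be larger than \<open>V 1\<close>.\<close>

definition V1 :: "lau set" where "V1 = {t. \<forall>v\<in>H. mon v * t \<in> V 2}"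

lemma fins: "finite SP" "SP \<noteq> {}" "finite SQ" "SQ \<noteq> {}" using pgD[OF pP] pgD[OF pQ] by blast+
lemma pgs: "pg A" "pg H" "pg (msum SQ SQ)" unfolding A_def H_def using fins by (intro pg_msum; simp)+
lemma hzH: "hz H w = hz SP w + hz SQ w" and hzA: "hz A w = 2 * hz SP w" using fins by (simp_all add: H_def A_def)
lemma kfA: "kys f = A" by (simp add: kf A_def)
lemma f0: "f \<noteq> 0" using pgD(2)[OF pgs(1)] by (auto simp flip: kfA)
lemma pg_zero: "pg {0}" unfolding pg_def
proof (intro conjI)
  show "LL (hz {0}) \<subseteq> {0}"
  proof
    fix n assume "n \<in> LL (hz {0})"
    then have "dotz n n \<le> hz {0} n" unfolding LL_def by blast
    then show "n \<in> {0}" using dotz_pos[of n] by (cases "n = 0") (simp_all add: hz_def)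
  qed
qed simp_all
lemma pgk: "pg (kH k)" by (induction k) (simp_all add: pg_zero pg_msum pgD pgs)
lemma hzk: "hz (kH k) w = int k * hz H w"
  by (induction k) (simp_all add: pgD[OF pgk] pgD[OF pgs(2)] hz_def[of "{0}"] algebra_simps)
lemma kH1: "kH 1 = H" by (rule pg_eqI[OF pgk pgs(2)]) (simp only: hzk of_nat_1 mult_1)
lemma kH_add: "msum (kH j) (kH k) = kH (j + k)"
  by (rule pg_eqI[OF pg_msum pgk]) (simp_all add: pgD[OF pgk] hzk algebra_simps)
lemma pgB: "pg (BB m)" unfolding BB_def using pgD[OF pgk] pgD[OF pgs(3)] by (intro pg_msum)
lemma hzB: "m \<ge> 2 \<Longrightarrow> hz (BB m) w = int m * hz H w - hz A w"
  using pgD[OF pgk] pgD[OF pgs(3)] fins by (simp add: BB_def hzk hzH hzA algebra_simps of_nat_diff)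
lemma AB: "m \<ge> 2 \<Longrightarrow> msum A (BB m) = kH m"
  using pgD[OF pgs(1)] pgD[OF pgB] by (intro pg_eqI[OF pg_msum pgk]) (simp_all add: hzk hzB)
lemma fatH: "fat H" unfolding fat_def wd_def hzH
proof (intro allI impI)
  fix w :: lat assume w: "w \<noteq> 0"
  then have "wd SP w > 0" "wd SQ w > 0" using fatP fatQ unfolding fat_def by blast+
  then show "hz SP w + hz SQ w + (hz SP (- w) + hz SQ (- w)) > 0" by (simp add: wd_def)
qed

lemma V_saturate: assumes m: "m \<ge> 2" and t: "\<And>v. v \<in> H \<Longrightarrow> mon v * t \<in> V (m + 1)" shows "t \<in> V m"
proof -
  have e: "msum (msum (kys f) (BB m)) H = kH (m + 1)"
    unfolding kfA AB[OF m] using kH_add[of m 1] by (simp only: kH1)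
  show ?thesis
    using saturate[OF f0 pgD[OF pgB, of m] pgD[OF pgs(2)], of t] t unfolding e unfolding kfA AB[OF m] by blast
qed

lemma V_mult: "s \<in> V j \<Longrightarrow> t \<in> V k \<Longrightarrow> s * t \<in> V (j + k)"
  using Wm_mult[OF pgD(1)[OF pgk] pgD(1)[OF pgk]] unfolding kH_add .

text \<open>Multiplying by \<open>mon v\<close> moves the first factor into \<open>V 2\<close> and
  the product into \<open>V (m + 2)\<close>; saturation then removes the shift.\<close>

lemma V1_V: assumes "t \<in> V1" "s \<in> V m" "m \<ge> 2" shows "t * s \<in> V (m + 1)"
proof (rule V_saturate)
  fix v assume "v \<in> H"
  then have "mon v * t \<in> V 2" using assms(1) unfolding V1_def by blast
  from V_mult[OF this assms(2)] show "mon v * (t * s) \<in> V (m + 1 + 1)" by (simp add: mult.assoc)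
qed (use assms(3) in simp)

lemma V1_V1: assumes "t \<in> V1" "s \<in> V1" shows "t * s \<in> V 2"
proof (rule V_saturate)
  fix v assume "v \<in> H"
  then have "mon v * s \<in> V 2" using assms(2) unfolding V1_def by blast
  from V1_V[OF assms(1) this] show "mon v * (t * s) \<in> V (2 + 1)" by (simp add: mult.left_commute)
qed simp

lemma mon_V: "n \<in> kH m \<Longrightarrow> mon n \<in> V m" by (rule Wm_keys) (simp add: kys_mon)

lemma keysH_V1: assumes "kys t \<subseteq> H" shows "t \<in> V1"
proof -
  have "mon v * t \<in> V (1 + 1)" if "v \<in> H" for v
  proof (rule V_mult)
    show "mon v \<in> V 1" using mon_V[of v 1] that by (simp only: kH1)
    show "t \<in> V 1" by (rule Wm_keys) (simp only: kH1 assms)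
  qed
  then show ?thesis unfolding V1_def by (simp add: numeral_2_eq_2)
qed

lemma V1_f: "f * g \<in> V1" unfolding V1_def using Wm_mult_f[of f] by (simp add: mult.left_commute)
lemma V1_add: "s \<in> V1 \<Longrightarrow> t \<in> V1 \<Longrightarrow> s + t \<in> V1" unfolding V1_def by (simp add: distrib_left Wm_add)
lemma V1_CC: "t \<in> V1 \<Longrightarrow> CC c * t \<in> V1" unfolding V1_def by (simp add: mult.left_commute[of "mon _"] Wm_CC)

text \<open>Shift by an exponent \<open>v\<close> of \<open>H\<close> maximal for \<open>w\<close>,
  reduce modulo \<open>f\<close> into \<open>2H\<close>, and shift back. The representative depends
  on \<open>w\<close>, which is why an element of \<open>V1\<close> need not lie in
  \<open>V 1\<close>.\<close>

lemma V1_bd: assumes u: "u \<in> V1" obtains u' s where "u - u' = f * s" "bd w (hz H w) u'"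
proof -
  obtain v where v: "v \<in> H" "dotz w v = hz H w" using hz_attained pgD[OF pgs(2)] by blast
  have "mon v * u \<in> V 2" using u v unfolding V1_def by blast
  then obtain g where g: "kys (mon v * u - f * g) \<subseteq> kH 2" unfolding Wm_def by blast
  let ?u = "u - f * (mon (- v) * g)"
  have "mon v * ?u = mon v * u - f * (mon v * (mon (- v) * g))" by (simp add: algebra_simps)
  also have "\<dots> = mon v * u - f * g" by (simp only: mon_cancel)
  finally have e: "mon v * ?u = mon v * u - f * g" .
  have "bd w (hz H w) ?u" unfolding bd_def
  proof
    fix n assume n: "n \<in> kys ?u"
    have "n + v \<in> kys (mon v * ?u)" using n by (simp only: kys_mon_mult add_diff_cancel_right')
    then have "n + v \<in> kH 2" using g unfolding e by blast
    then have "dotz w (n + v) \<le> 2 * hz H w" using hz_ge[OF pgD(1)[OF pgk], of "n + v" 2 w] by (simp add: hzk)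
    then show "dotz w n \<le> hz H w" using v(2) by simp
  qed
  then show thesis by (rule that[rotated]) simp
qed

text \<open>\<open>f\<close> and \<open>u\<close> have no common zeros on the boundary of the toric surface of \<open>H\<close>.\<close>

definition good :: "lau \<Rightarrow> bool" where
  "good u \<longleftrightarrow> (\<forall>w\<in>normals H. \<exists>u' s \<alpha> \<beta>. u - u' = f * s \<and> bd w (hz H w) u'
      \<and> \<alpha> * row w (hz A w) f + \<beta> * row w (hz H w) u' = 1)"

text \<open>A point of \<open>H\<close> maximal for \<open>w1\<close> and \<open>w2\<close> is
  maximal for their sum. Additivity of support functions then yields a point of \<open>SP\<close>
  maximal for both, and its double is an exponent of \<open>f\<close>.\<close>

lemma common_vertex:
  assumes "p \<in> face H w1" "p \<in> face H w2"
  obtains a where "a \<in> A" "dotz w1 a = hz A w1" "dotz w2 a = hz A w2"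
proof -
  have p: "dotz w1 p = hz H w1" "dotz w2 p = hz H w2" "p \<in> H" using assms by (simp_all add: face_def)
  have "hz H w1 + hz H w2 \<le> hz H (w1 + w2)" using hz_ge[OF pgD(1)[OF pgs(2)] p(3), of "w1 + w2"] p by simp
  then have le: "hz SP w1 + hz SP w2 \<le> hz SP (w1 + w2)"
    using hz_add_le[OF fins(3,4), of w1 w2] unfolding hzH by linarith
  obtain x where x: "x \<in> SP" "dotz (w1 + w2) x = hz SP (w1 + w2)" using hz_attained fins by blast
  have "dotz w1 x = hz SP w1" "dotz w2 x = hz SP w2"
    using le x(2) hz_ge[OF fins(1) x(1), of w1] hz_ge[OF fins(1) x(1), of w2] by simp_all
  moreover have "x + x \<in> A" unfolding A_def by (rule msum_mem[OF fins(1,1) x(1) x(1)])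
  ultimately show thesis using that[of "x + x"] by (simp add: hzA)
qed

text \<open>For each edge of \<open>H\<close>, \<open>row_cancel\<close> bounds \<open>r\<close> in
  the normal direction up to a multiple of \<open>f\<close>. At a boundary point the corrections of
  the incoming and the outgoing edge are merged into one that is valid in the whole normal cone, and
  \<open>glue\<close> joins the boundary points. The condition \<open>good\<close> is what prevents
  division by \<open>u\<close> from costing degree at an edge.\<close>

lemma good_cancel:
  assumes u: "u \<in> V1" "good u" and m: "m \<ge> 3" and ur: "u * r \<in> V m"
  shows "r \<in> V (m - 1)"
proof -
  let ?B = "BB (m - 1)"
  have m1: "m - 1 \<ge> 2" using m by simp
  note fH = pgD[OF pgs(2)] and fB = pgD[OF pgB, of "m - 1"] and fA = pgD[OF pgs(1)]
  obtain s2 where s2: "kys (u * r - f * s2) \<subseteq> kH m" using ur unfolding Wm_def by blast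
  have loc: "\<exists>s. bd w (hz A w + hz ?B w) (r - f * s)" if w: "w \<in> normals H" for w
  proof -
    obtain u' s \<alpha> \<beta> where u': "u - u' = f * s" "bd w (hz H w) u'" "\<alpha> * row w (hz A w) f + \<beta> * row w (hz H w) u' = 1"
      using u(2) w unfolding good_def by blast
    have "bd w (hz H w + (hz A w + hz ?B w)) (u * r - f * s2)"
      unfolding bd_def
    proof
      fix n assume "n \<in> kys (u * r - f * s2)"
      then have "n \<in> kH m" using s2 by blast
      then have "dotz w n \<le> int m * hz H w" using hz_ge[OF pgD(1)[OF pgk], of n m w] by (simp add: hzk)
      then show "dotz w n \<le> hz H w + (hz A w + hz ?B w)" using hzB[OF m1, of w] m by (simp add: of_nat_diff algebra_simps)
    qed
    then show ?thesis by (intro row_cancel[OF f0 u'(2,1) _, of \<alpha> \<beta> _ "u * r - f * s2" s2]) (use u'(3) in \<open>simp_all add: kfA\<close>)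
  qed
  have bne: "bdz H \<noteq> {}" "finite (bdz H)"
  proof -
    have "(1::int, 0::int) \<noteq> 0" by (simp add: prod_eq_iff)
    moreover obtain v where "v \<in> H" "dotz (1, 0) v = hz H (1, 0)" using hz_attained fH by blast
    ultimately show "bdz H \<noteq> {}" unfolding bdz_def by blast
    show "finite (bdz H)" using finite_bdz fH by blast
  qed
  have "\<exists>g. \<forall>w. \<forall>n\<in>kys (r - f * g). w \<bullet> lp n \<le> hR (kys f) w + hR ?B w"
  proof (rule glue[OF f0 fB bne(2,1)])
    fix p assume p: "p \<in> bdz H"
    obtain w1 where w1: "prim w1" "p \<in> face H w1" "p + rot w1 \<in> H"
      using steps_exist(1)[OF pgs(2) fatH p] unfolding ostep_def by blast
    obtain w2 where w2: "prim w2" "p \<in> face H w2" "p - rot w2 \<in> H"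
      using steps_exist(2)[OF pgs(2) fatH p] by blast
    have nrm: "w \<in> normals H" if "prim w" "p \<in> face H w" "x \<in> face H w" "x \<noteq> p" for w x
    proof -
      have "card {p, x} \<le> card (face H w)" by (rule card_mono[OF finite_face[OF fH(1)]]) (use that in simp)
      then show ?thesis using that by (simp add: normals_def flen_def)
    qed
    have n1: "w1 \<in> normals H"
      by (rule nrm[OF w1(1,2), of "p + rot w1"]) (use w1 rot_nz[OF prim_nz[OF w1(1)]] in \<open>simp_all add: face_def\<close>)
    have n2: "w2 \<in> normals H"
      by (rule nrm[OF w2(1,2), of "p - rot w2"]) (use w2 rot_nz[OF prim_nz[OF w2(1)]] in \<open>simp_all add: face_def\<close>)
    obtain t1 where t1: "bd w1 (hz A w1 + hz ?B w1) (r - f * t1)" using loc[OF n1] by blast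
    obtain t2 where t2: "bd w2 (hz A w2 + hz ?B w2) (r - f * t2)" using loc[OF n2] by blast
    obtain a where a: "a \<in> A" "dotz w1 a = hz A w1" "dotz w2 a = hz A w2" by (rule common_vertex[OF w1(2) w2(2)])
    let ?d = "t1 - t2"
    have split: "dotz w1 n \<le> hz ?B w1 \<or> dotz w2 n \<le> hz ?B w2" if n: "n \<in> kys ?d" for n
    proof -
      have "lp w1 \<bullet> lp n \<le> of_int (hz ?B w1) \<or> lp w2 \<bullet> lp n \<le> of_int (hz ?B w2)"
      proof (rule adjacency[of a f "lp w1" "lp w2" ?d, OF _ _ _ n])
        fix k assume "k \<in> kys f"
        then show "lp w1 \<bullet> lp k \<le> lp w1 \<bullet> lp a \<and> lp w2 \<bullet> lp k \<le> lp w2 \<bullet> lp a"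
          using hz_ge[OF fA(1), of k] a by (simp add: inner_lp kfA)
      next
        fix k assume "k \<in> kys (f * ?d)"
        moreover have "f * ?d = (r - f * t2) - (r - f * t1)" by (simp add: algebra_simps)
        ultimately have "k \<in> kys (r - f * t2) \<or> k \<in> kys (r - f * t1)" using kys_diff_sub by metis
        then have "dotz w1 k \<le> hz A w1 + hz ?B w1 \<or> dotz w2 k \<le> hz A w2 + hz ?B w2" using t1 t2 unfolding bd_def by blast
        then show "lp w1 \<bullet> lp k \<le> lp w1 \<bullet> lp a + of_int (hz ?B w1) \<or> lp w2 \<bullet> lp k \<le> lp w2 \<bullet> lp a + of_int (hz ?B w2)"
          unfolding inner_lp a by (simp only: of_int_add[symmetric] of_int_le_iff)
      qed (use a kfA in simp)
      then show ?thesis by (simp add: inner_lp)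
    qed
    \<comment> \<open>By \<open>split\<close> each exponent of \<open>t1 - t2\<close> obeys one of
      the two bounds. The part obeying the first is subtracted from \<open>t1\<close>; what remains
      differs from \<open>t2\<close> by the part obeying the second, so the single correction
      \<open>g\<close> satisfies both edge bounds.\<close>
    define d1 where "d1 = restr {n. dotz w1 n \<le> hz ?B w1} ?d"
    define g where "g = t1 - d1"
    have bf: "bd w (hz A w) f" for w unfolding bd_def kfA using hz_ge[OF fA(1)] by blast
    have "bd w1 (hz ?B w1) d1" unfolding bd_def d1_def kys_restr by blast
    then have "bd w1 (hz A w1 + hz ?B w1) ((r - f * t1) - f * (- d1))"
      by (intro bd_diff t1 bd_mult[OF bf]) (simp add: bd_def)
    then have b1: "bd w1 (hz A w1 + hz ?B w1) (r - f * g)" by (simp add: g_def algebra_simps)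
    have bd2: "bd w2 (hz ?B w2) (?d - d1)" unfolding bd_def d1_def kys_minus_restr using split by blast
    have "bd w2 (hz A w2 + hz ?B w2) ((r - f * t2) - f * (?d - d1))" by (rule bd_diff[OF t2 bd_mult[OF bf bd2]])
    then have b2: "bd w2 (hz A w2 + hz ?B w2) (r - f * g)" by (simp add: g_def algebra_simps)
    have "w \<bullet> lp n \<le> hR (kys f) w + hR ?B w"
      if w: "w \<bullet> lp p = hR (bdz H) w" and n: "n \<in> kys (r - f * g)" for w n
    proof -
      have pH: "p \<in> H" using p by (simp add: bdz_def)
      have pmax: "w \<bullet> lp q \<le> w \<bullet> lp p" if q: "q \<in> H" for q
      proof (cases "w = 0")
        case False
        obtain m0 where m0: "m0 \<in> H" "w \<bullet> lp m0 = hR H w" by (rule hR_attained[OF fH])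
        have "m0 \<in> bdz H" by (rule real_support_bdz[OF pgs(2) m0(1) False _ fat_ne[OF fatH]]) (use m0(2) hR_ge[OF fH(1)] in simp)
        then have "hR H w \<le> hR (bdz H) w" using hR_ge[OF bne(2), of m0 w] m0(2) by simp
        then show ?thesis using hR_ge[OF fH(1) q, of w] w by simp
      qed simp
      define x where "x = n - sm (int (m - 1)) p"
      have hsum: "hz A v + hz ?B v = int (m - 1) * hz H v" for v using hzB[OF m1] by simp
      have x1: "dotz w1 x \<le> 0" using b1 n w1(2) unfolding bd_def hsum x_def by (simp add: face_def)
      have x2: "dotz w2 x \<le> 0" using b2 n w2(2) unfolding bd_def hsum x_def by (simp add: face_def)
      have r1: "w \<bullet> lp (rot w1) \<le> 0" using pmax[OF w1(3)] by (simp add: lp_simps inner_add_right)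
      have r2: "w \<bullet> lp (rot w2) \<ge> 0" using pmax[OF w2(3)] by (simp add: lp_simps inner_diff_right)
      have d: "dotz w2 (rot w1) \<le> 0" using hz_ge[OF fH(1) w1(3), of w2] w2(2) by (simp add: face_def)
      \<comment> \<open>\<open>w\<close> lies in the cone spanned by \<open>w1\<close> and
        \<open>w2\<close>. If the two normals coincide, \<open>p\<close> is inside an edge and
        \<open>w\<close> is a nonnegative multiple of \<open>w1\<close>.\<close>
      have "w \<bullet> lp x \<le> 0"
      proof (cases "dotz w2 (rot w1) < 0")
        case True
        have id: "of_int (dotz w2 (rot w1)) * (w \<bullet> lp x)
            = (w \<bullet> lp (rot w1)) * of_int (dotz w2 x) - (w \<bullet> lp (rot w2)) * of_int (dotz w1 x)"
          unfolding dotz_def rot_def lattice_pt_def inner_prod_def by (simp add: algebra_simps)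
        have "0 \<le> (w \<bullet> lp (rot w1)) * of_int (dotz w2 x)" using r1 x2 by (intro mult_nonpos_nonpos) simp_all
        moreover have "(w \<bullet> lp (rot w2)) * of_int (dotz w1 x) \<le> 0" using r2 x1 by (intro mult_nonneg_nonpos) simp_all
        ultimately have "0 \<le> of_int (dotz w2 (rot w1)) * (w \<bullet> lp x)" unfolding id by linarith
        then show ?thesis using True by (simp add: zero_le_mult_iff)
      next
        case False
        then have "w2 = w1 \<or> w2 = - w1" using prim_parallel[OF w1(1) w2(1)] d by simp
        then have e: "w2 = w1" using fat_faces[OF fatH w1(1,2)] w2(2) by blast
        have z: "w \<bullet> lp (rot w1) = 0" using r1 r2 e by simp
        have id: "(w \<bullet> lp y) * of_int (dotz w1 w1) = (w \<bullet> lp w1) * of_int (dotz w1 y)" for y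
        proof -
          have "(w \<bullet> lp y) * of_int (dotz w1 w1) = (w \<bullet> lp w1) * of_int (dotz w1 y) + (w \<bullet> lp (rot w1)) * of_int (dotz (rot w1) y)"
            unfolding dotz_def rot_def lattice_pt_def inner_prod_def by (simp add: algebra_simps)
          then show ?thesis using z by simp
        qed
        have pos: "dotz w1 w1 > 0" using dotz_pos prim_nz w1(1) by blast
        have "w \<bullet> lp w1 \<ge> 0"
        proof (rule ccontr)
          assume neg: "\<not> w \<bullet> lp w1 \<ge> 0"
          have eq: "dotz w1 q = hz H w1" if q: "q \<in> H" for q
          proof -
            have "w \<bullet> lp (q - p) \<le> 0" using pmax[OF q] by (simp add: lp_simps inner_diff_right)
            then have "(w \<bullet> lp w1) * of_int (dotz w1 (q - p)) \<le> 0" unfolding id[symmetric] using pos by (simp add: mult_le_0_iff)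
            then have "dotz w1 (q - p) \<ge> 0" using neg by (simp add: mult_le_0_iff)
            then show ?thesis using hz_ge[OF fH(1) q, of w1] w1(2) by (simp add: face_def)
          qed
          have "p \<in> face H (- w1)" unfolding face_def
          proof (intro CollectI conjI pH)
            have "hz H (- w1) = dotz (- w1) p" by (rule hz_eqI[OF fH(1) pH refl]) (simp add: eq pH)
            then show "dotz (- w1) p = hz H (- w1)" by simp
          qed
          then show False using fat_faces[OF fatH w1(1,2)] by blast
        qed
        then have "(w \<bullet> lp x) * of_int (dotz w1 w1) \<le> 0" unfolding id using x1 by (intro mult_nonneg_nonpos) simp_all
        then show ?thesis using pos by (simp add: mult_le_0_iff)
      qed
      then have "w \<bullet> lp n \<le> w \<bullet> lp (sm (int (m - 1)) p)" unfolding x_def by (simp add: lp_simps inner_diff_right)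
      also have "sm (int (m - 1)) p \<in> kH (m - 1)"
      proof (rule pg_memI[OF pgk])
        fix v show "dotz v (sm (int (m - 1)) p) \<le> hz (kH (m - 1)) v"
          unfolding hzk dotz_sm using hz_ge[OF fH(1) pH] by (intro mult_left_mono) simp_all
      qed
      then have "w \<bullet> lp (sm (int (m - 1)) p) \<le> hR (kys f) w + hR ?B w"
        unfolding AB[OF m1, symmetric] kfA using msum_real[OF fA fB] by blast
      finally show ?thesis .
    qed
    then show "\<exists>g. \<forall>w. w \<bullet> lp p = hR (bdz H) w \<longrightarrow> (\<forall>n\<in>kys (r - f * g). w \<bullet> lp n \<le> hR (kys f) w + hR ?B w)" by blast
  qed
  then obtain g where "\<And>w n. n \<in> kys (r - f * g) \<Longrightarrow> w \<bullet> lp n \<le> hR A w + hR ?B w" unfolding kfA by blast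
  then have "kys (r - f * g) \<subseteq> kH (m - 1)" unfolding AB[OF m1, symmetric] using msum_real[OF fA fB] by blast
  then show ?thesis unfolding Wm_def by blast
qed

text \<open>\<open>good_cancel\<close> starts in degree three, so the hypothesis is multiplied by
  each \<open>mon v\<close> with \<open>v\<close> in \<open>H\<close>; the outcome is the condition
  that defines \<open>V1\<close>.\<close>

lemma good_cancel1: assumes u: "u \<in> V1" "good u" and ur: "u * r \<in> V 2" shows "r \<in> V1"
  unfolding V1_def
proof (intro CollectI ballI)
  fix v assume "v \<in> H"
  then have "mon v \<in> V 1" using mon_V[of v 1] by (simp only: kH1)
  from V_mult[OF this ur] have "u * (mon v * r) \<in> V (1 + 2)" by (simp only: mult.left_commute)
  moreover have "1 + 2 = (3::nat)" by simp
  ultimately have ur3: "u * (mon v * r) \<in> V 3" by (simp only:)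
  have "mon v * r \<in> V (3 - 1)" by (rule good_cancel[OF u _ ur3]) simp
  then show "mon v * r \<in> V 2" by simp
qed

end

section \<open>Points of the curve and the codimension of ideals\<close>

definition mp :: "complex \<times> complex \<Rightarrow> lat \<Rightarrow> complex" where
  "mp p n = fst p powi fst n * snd p powi snd n"

definition ev :: "complex \<times> complex \<Rightarrow> lau \<Rightarrow> complex" where
  "ev p t = (\<Sum>n\<in>kys t. lk t n * mp p n)"

definition torus :: "complex \<times> complex \<Rightarrow> bool" where "torus p \<longleftrightarrow> fst p \<noteq> 0 \<and> snd p \<noteq> 0"

lemma mp_add: "torus p \<Longrightarrow> mp p (m + n) = mp p m * mp p n"
  by (simp add: mp_def torus_def power_int_add)
lemma mp_0 [simp]: "mp p 0 = 1" by (simp add: mp_def)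
lemma mp_nz: "torus p \<Longrightarrow> mp p n \<noteq> 0" by (simp add: mp_def torus_def)

lemma ev_super: "finite N \<Longrightarrow> kys t \<subseteq> N \<Longrightarrow> ev p t = (\<Sum>n\<in>N. lk t n * mp p n)"
  unfolding ev_def by (rule sum.mono_neutral_left) (auto simp: in_keys_iff)

lemma ev_add [simp]: "ev p (s + t) = ev p s + ev p t"
proof -
  let ?N = "kys s \<union> kys t"
  have k: "kys (s + t) \<subseteq> ?N" by (rule subsetI) (use kys_add_sub in blast)
  have "ev p (s + t) = (\<Sum>n\<in>?N. lk (s + t) n * mp p n)" by (rule ev_super[OF _ k]) simp
  moreover have "ev p s = (\<Sum>n\<in>?N. lk s n * mp p n)" by (rule ev_super) simp_all
  moreover have "ev p t = (\<Sum>n\<in>?N. lk t n * mp p n)" by (rule ev_super) simp_all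
  ultimately show ?thesis by (simp add: lookup_add distrib_right sum.distrib)
qed

lemma ev_0 [simp]: "ev p 0 = 0" by (simp add: ev_def)
lemma ev_sum: "ev p (\<Sum>i\<in>I. t i) = (\<Sum>i\<in>I. ev p (t i))"
  by (induction I rule: infinite_finite_induct) simp_all

lemma ev_single [simp]: "ev p (Poly_Mapping.single n c) = c * mp p n"
  by (simp add: ev_def)
lemma ev_mon [simp]: "ev p (mon n) = mp p n" by (simp add: mon_def)
lemma ev_CC [simp]: "ev p (CC c) = c" by (simp add: CC_def)

lemma ev_single_mult:
  assumes "torus p" shows "ev p (Poly_Mapping.single n c * t) = c * mp p n * ev p t"
proof -
  have k: "kys (Poly_Mapping.single n c * t) \<subseteq> (+) n ` kys t"
  proof
    fix m assume "m \<in> kys (Poly_Mapping.single n c * t)"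
    then have "m - n \<in> kys t" by (auto simp: in_keys_iff lk_single_mult)
    then show "m \<in> (+) n ` kys t" by (intro image_eqI[of _ _ "m - n"]) simp_all
  qed
  have "ev p (Poly_Mapping.single n c * t) = (\<Sum>m\<in>(+) n ` kys t. c * lk t (m - n) * mp p m)"
    using ev_super[OF _ k, of p] by (simp add: lk_single_mult)
  also have "\<dots> = (\<Sum>k\<in>kys t. c * lk t k * mp p (n + k))" by (subst sum.reindex) (simp_all add: inj_on_def)
  also have "\<dots> = c * mp p n * ev p t"
    unfolding ev_def sum_distrib_left by (rule sum.cong[OF refl]) (simp add: mp_add[OF assms])
  finally show ?thesis .
qed

lemma ev_mult: assumes "torus p" shows "ev p (s * t) = ev p s * ev p t"
proof -
  have "ev p (s * t) = (\<Sum>n\<in>kys s. ev p (Poly_Mapping.single n (lk s n) * t))"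
    by (subst lau_decomp[of s]) (simp only: sum_distrib_right ev_sum)
  also have "\<dots> = ev p s * ev p t"
    unfolding ev_single_mult[OF assms] ev_def[of p s] sum_distrib_right ..
  finally show ?thesis .
qed

lemma ev_CC_mult [simp]: "ev p (CC c * t) = c * ev p t"
proof -
  have "ev p (CC c * t) = (\<Sum>n\<in>kys t. lk (CC c * t) n * mp p n)"
    by (rule ev_super) (auto simp: in_keys_iff)
  then show ?thesis by (simp add: ev_def sum_distrib_left mult.assoc)
qed

lemma ev_minus [simp]: "ev p (- t) = - ev p t" by (simp add: ev_def sum_negf)
lemma ev_diff [simp]: "ev p (s - t) = ev p s - ev p t"
  using ev_add[of p s "- t"] ev_minus[of p t] by simp

section \<open>Linear dependence and univariate Laurent polynomials\<close>

lemma underdetermined: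
  fixes a :: "'i \<Rightarrow> 'j \<Rightarrow> 'k::field"
  assumes "finite J" "finite I" "card J < card I"
  shows "\<exists>x. (\<exists>i\<in>I. x i \<noteq> 0) \<and> (\<forall>j\<in>J. (\<Sum>i\<in>I. x i * a i j) = 0)"
  using assms
proof (induction J arbitrary: I a rule: finite_induct)
  case empty
  then have "I \<noteq> {}" by auto
  then show ?case by (intro exI[of _ "\<lambda>_. 1"]) auto
next
  case (insert j J)
  show ?case
  proof (cases "\<forall>i\<in>I. a i j = 0")
    case True
    have "card J < card I" using insert.prems insert.hyps by simp
    then obtain x where "\<exists>i\<in>I. x i \<noteq> 0" "\<forall>j\<in>J. (\<Sum>i\<in>I. x i * a i j) = 0"
      using insert.IH[of I a] insert.prems(1) by blast
    then show ?thesis using True by (intro exI[of _ x]) simp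
  next
    case False
    then obtain i0 where i0: "i0 \<in> I" "a i0 j \<noteq> 0" by blast
    let ?I = "I - {i0}" and ?a = "\<lambda>i k. a i k - a i j / a i0 j * a i0 k"
    have "card J < card ?I" using insert.prems insert.hyps i0 by simp
    then obtain x where x: "\<exists>i\<in>?I. x i \<noteq> 0" "\<forall>k\<in>J. (\<Sum>i\<in>?I. x i * ?a i k) = 0"
      using insert.IH[of ?I ?a] insert.prems(1) by blast
    define c where "c = - (\<Sum>i\<in>?I. x i * a i j) / a i0 j"
    let ?x = "\<lambda>i. if i = i0 then c else x i"
    have S: "(\<Sum>i\<in>I. ?x i * a i k) = c * a i0 k + (\<Sum>i\<in>?I. x i * a i k)" for k
      using insert.prems(1) i0(1) by (subst sum.remove[OF _ i0(1)]) (auto intro!: sum.cong)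
    have "(\<Sum>i\<in>I. ?x i * a i k) = 0" if "k \<in> insert j J" for k
    proof (cases "k = j")
      case True then show ?thesis unfolding S using i0 by (simp add: c_def)
    next
      case False
      then have z: "0 = (\<Sum>i\<in>?I. x i * ?a i k)" using x(2) that by simp
      have "x i * ?a i k = x i * a i k - (x i * a i j) * (a i0 k / a i0 j)" for i by (simp add: right_diff_distrib)
      then have "(\<Sum>i\<in>?I. x i * ?a i k) = (\<Sum>i\<in>?I. x i * a i k) - (\<Sum>i\<in>?I. x i * a i j) * (a i0 k / a i0 j)"
        by (simp only: sum_subtractf sum_distrib_right)
      then have fin: "(\<Sum>i\<in>?I. x i * a i k) - (\<Sum>i\<in>?I. x i * a i j) * (a i0 k / a i0 j) = 0" using z by (rule trans[OF sym sym])
      show ?thesis unfolding S using fin by (simp add: c_def algebra_simps)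
    qed
    moreover have "\<exists>i\<in>I. ?x i \<noteq> 0" using x(1) by auto
    ultimately show ?thesis by (intro exI[of _ ?x]) blast
  qed
qed

lemma lau_dependent:
  fixes v :: "'i \<Rightarrow> lau"
  assumes "finite I" "finite X" "\<And>i. i \<in> I \<Longrightarrow> kys (v i) \<subseteq> X" "card X < card I"
  obtains x where "\<exists>i\<in>I. x i \<noteq> 0" "(\<Sum>i\<in>I. CC (x i) * v i) = 0"
proof -
  obtain x where x: "\<exists>i\<in>I. x i \<noteq> 0" "\<forall>n\<in>X. (\<Sum>i\<in>I. x i * lk (v i) n) = 0"
    using underdetermined[OF assms(2,1,4), of "\<lambda>i n. lk (v i) n"] by blast
  have "(\<Sum>i\<in>I. CC (x i) * v i) = 0"
  proof (rule poly_mapping_eqI)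
    fix n
    have "lk (v i) n = 0" if "n \<notin> X" "i \<in> I" for i using assms(3)[OF that(2)] that(1) by (auto simp: in_keys_iff)
    then show "lk (\<Sum>i\<in>I. CC (x i) * v i) n = lk 0 n" using x(2) by (cases "n \<in> X") (simp_all add: lookup_sum)
  qed
  then show thesis using that x(1) by blast
qed

lemma finite_laurent_zeros:
  fixes c :: "int \<Rightarrow> complex"
  assumes S: "finite S" "i0 \<in> S" "c i0 \<noteq> 0"
  shows "finite {x. x \<noteq> 0 \<and> (\<Sum>i\<in>S. c i * x powi i) = 0}"
    "i1 \<in> S \<Longrightarrow> i1 \<noteq> i0 \<Longrightarrow> c i1 \<noteq> 0 \<Longrightarrow> \<exists>x. x \<noteq> 0 \<and> (\<Sum>i\<in>S. c i * x powi i) = 0"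
proof -
  let ?T = "{i\<in>S. c i \<noteq> 0}"
  define L where "L = Min ?T"
  have T: "finite ?T" "?T \<noteq> {}" using S by auto
  have L: "L \<in> ?T" "\<And>i. i \<in> ?T \<Longrightarrow> L \<le> i" unfolding L_def by (rule Min_in[OF T], rule Min_le[OF T(1)])
  define q where "q = (\<Sum>i\<in>?T. monom (c i) (nat (i - L)))"
  have cq: "coeff q (nat (i - L)) = c i" if "i \<in> ?T" for i
  proof -
    have "coeff q (nat (i - L)) = (\<Sum>j\<in>?T. if j = i then c j else 0)"
      unfolding q_def coeff_sum
    proof (rule sum.cong[OF refl])
      fix x assume "x \<in> ?T"
      then have "nat (x - L) = nat (i - L) \<longleftrightarrow> x = i" using L(2)[of x] L(2)[OF that] by auto
      then show "coeff (monom (c x) (nat (x - L))) (nat (i - L)) = (if x = i then c x else 0)" by simp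
    qed
    then show ?thesis using that T by simp
  qed
  have pq: "(\<Sum>i\<in>S. c i * x powi i) = x powi L * poly q x" if x: "x \<noteq> 0" for x
  proof -
    have "(\<Sum>i\<in>S. c i * x powi i) = (\<Sum>i\<in>?T. c i * x powi i)" by (rule sum.mono_neutral_right) (use S in auto)
    also have "\<dots> = (\<Sum>i\<in>?T. x powi L * (c i * x ^ nat (i - L)))"
    proof (rule sum.cong[OF refl])
      fix i assume "i \<in> ?T"
      then have "L \<le> i" using L by blast
      then have "x powi i = x powi L * x powi (i - L)" using power_int_add[of x L "i - L"] x by simp
      also have "x powi (i - L) = x ^ nat (i - L)" using \<open>L \<le> i\<close> by (simp add: power_int_def)
      finally show "c i * x powi i = x powi L * (c i * x ^ nat (i - L))" by simp
    qed
    finally show ?thesis by (simp add: q_def poly_sum poly_monom sum_distrib_left)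
  qed
  have "q \<noteq> 0" using cq[of i0] S by auto
  moreover have "{x. x \<noteq> 0 \<and> (\<Sum>i\<in>S. c i * x powi i) = 0} \<subseteq> {x. poly q x = 0}" using pq by auto
  ultimately show "finite {x. x \<noteq> 0 \<and> (\<Sum>i\<in>S. c i * x powi i) = 0}" using finite_subset poly_roots_finite by blast
  assume i1: "i1 \<in> S" "i1 \<noteq> i0" "c i1 \<noteq> 0"
  then obtain i where i: "i \<in> ?T" "i \<noteq> L" using S by (cases "i0 = L") auto
  have "L < i" using i L(2)[OF i(1)] by simp
  then have "coeff q (nat (i - L)) \<noteq> 0" "nat (i - L) \<noteq> 0" using cq[OF i(1)] i(1) by auto
  then have "degree q \<noteq> 0" using le_degree[of q "nat (i - L)"] by linarith
  then have "\<not> constant (poly q)" by (simp add: constant_degree)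
  then obtain x where x: "poly q x = 0" using fundamental_theorem_of_algebra by blast
  have "poly q 0 \<noteq> 0" using cq[OF L(1)] L(1) by (simp add: poly_0_coeff_0)
  then have "x \<noteq> 0" using x by auto
  then show "\<exists>x. x \<noteq> 0 \<and> (\<Sum>i\<in>S. c i * x powi i) = 0" using pq x by auto
qed

context polygons
begin

text \<open>Three noncollinear points \<open>a\<close>, \<open>b\<close>, \<open>c\<close> of
  \<open>H\<close> span a triangle. Scaled by \<open>3 * R\<close>, its centre
  \<open>sm R (a + b + c)\<close> moves away from the sides in proportion to \<open>R\<close>, which
  leaves room for the finite set \<open>E\<close>.\<close>

lemma large_multiple:
  assumes E: "finite E"
  obtains z R where "R \<ge> R0" "\<And>e. e \<in> E \<Longrightarrow> z + e \<in> kH (3 * R)"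
proof -
  note fH = pgD[OF pgs(2)]
  obtain a where a: "a \<in> H" using fH by blast
  obtain b where b: "b \<in> H" "b \<noteq> a" using fat_ne[OF fatH, of a] a by blast
  have "wd H (rot (b - a)) > 0" using fatH rot_nz[of "b - a"] b unfolding fat_def by simp
  then have "\<exists>c\<in>H. dotz (rot (b - a)) (c - a) \<noteq> 0"
  proof (rule contrapos_pp)
    assume no: "\<not> (\<exists>c\<in>H. dotz (rot (b - a)) (c - a) \<noteq> 0)"
    then have "hz H (rot (b - a)) = dotz (rot (b - a)) a" by (intro hz_eqI[OF fH(1) a]) auto
    moreover have "hz H (- rot (b - a)) = dotz (- rot (b - a)) a" using no by (intro hz_eqI[OF fH(1) a]) auto
    ultimately show "\<not> wd H (rot (b - a)) > 0" by (simp add: wd_def)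
  qed
  then obtain c where c: "c \<in> H" "dotz (rot (b - a)) (c - a) \<noteq> 0" by blast
  define d1 d2 \<delta> where "d1 = b - a" and "d2 = c - a" and "\<delta> = dotz (rot d1) d2"
  have \<delta>: "\<bar>\<delta>\<bar> \<ge> 1" using c by (simp add: \<delta>_def d1_def d2_def del: dotz_diff)
  define N where "N = (\<lambda>e. \<bar>dotz (rot e) d2\<bar> + \<bar>dotz (rot d1) e\<bar>)"
  define R where "R = max R0 (nat (\<Sum>e\<in>E. N e))"
  have NR: "N e \<le> int R" if "e \<in> E" for e
  proof -
    have "N e \<le> (\<Sum>e\<in>E. N e)" by (rule member_le_sum[OF that _ E]) (simp add: N_def)
    then show ?thesis by (simp add: R_def)
  qed
  let ?o = "a + b + c"
  have "sm (int R) ?o + e \<in> kH (3 * R)" if e: "e \<in> E" for e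
  proof (rule pg_memI[OF pgk])
    fix w
    define S where "S = 3 * hz H w - dotz w ?o"
    have ge: "dotz w a \<le> hz H w" "dotz w b \<le> hz H w" "dotz w c \<le> hz H w" using hz_ge[OF fH(1)] a b c by blast+
    have w12: "\<bar>dotz w d1\<bar> \<le> S" "\<bar>dotz w d2\<bar> \<le> S" using ge by (simp_all add: S_def d1_def d2_def abs_le_iff)
    \<comment> \<open>Cramer's rule for the expansion of \<open>e\<close> in \<open>d1\<close> and
      \<open>d2\<close>; \<open>\<delta>\<close> is the determinant.\<close>
    have id: "\<delta> * dotz w e = dotz (rot e) d2 * dotz w d1 + dotz (rot d1) e * dotz w d2"
      unfolding \<delta>_def dotz_def rot_def by (simp add: algebra_simps)
    have "\<bar>dotz w e\<bar> \<le> \<bar>\<delta>\<bar> * \<bar>dotz w e\<bar>" using mult_right_mono[OF \<delta>, of "\<bar>dotz w e\<bar>"] by simp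
    also have "\<dots> = \<bar>\<delta> * dotz w e\<bar>" by (simp add: abs_mult)
    also have "\<dots> \<le> \<bar>dotz (rot e) d2 * dotz w d1\<bar> + \<bar>dotz (rot d1) e * dotz w d2\<bar>" unfolding id by (rule abs_triangle_ineq)
    also have "\<dots> \<le> \<bar>dotz (rot e) d2\<bar> * S + \<bar>dotz (rot d1) e\<bar> * S"
      unfolding abs_mult using w12 by (intro add_mono mult_left_mono) simp_all
    also have "\<dots> = N e * S" by (simp add: N_def distrib_right)
    also have "\<dots> \<le> int R * S" using NR[OF e] w12 by (intro mult_right_mono) simp_all
    finally have "dotz w e \<le> int R * S" by simp
    then show "dotz w (sm (int R) ?o + e) \<le> hz (kH (3 * R)) w" by (simp add: hzk S_def algebra_simps)
  qed
  then show thesis using that[of R "sm (int R) ?o"] by (simp add: R_def)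
qed

lemma mv_kH: "mv A (kH k) = int k * mv A H"
proof (induction k)
  case 0
  have "msum A {0} = A" using msum_zero[OF pgs(1)] by (simp add: msum_commute)
  then show ?case by (simp add: mv_def)
next
  case (Suc k)
  then show ?case using mv_msum[OF pgs(1,2) pgk[of k]] by (simp add: algebra_simps)
qed

text \<open>\<open>card (kH m) - card (BB m)\<close> is the dimension of the polynomials supported
  in \<open>kH m\<close> modulo multiples of \<open>f\<close>. It grows linearly with slope
  \<open>mv A H\<close>, the degree of the curve with respect to \<open>H\<close>.\<close>

lemma card_difference:
  assumes m: "m \<ge> 2"
  shows "int (card (kH (m + k))) - int (card (BB (m + k))) = int (card (kH m)) - int (card (BB m)) + int k * mv A H"
proof -
  have e: "BB (m + k) = msum (kH k) (BB m)"
    by (rule pg_eqI[OF pgB pg_msum]) (use m in \<open>simp_all add: pgD[OF pgk] pgD[OF pgB] hzB hzk algebra_simps\<close>)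
  have "int (card (kH j)) - int (card (BB j)) = mv A (BB j) + int (card A) - 1" if "j \<ge> 2" for j
    unfolding AB[OF that, symmetric] by (simp add: mv_def)
  moreover have "mv A (BB (m + k)) = int k * mv A H + mv A (BB m)"
    unfolding e mv_kH[symmetric] by (rule mv_msum[OF pgs(1) pgk pgB])
  ultimately show ?thesis using m by simp
qed

end

locale prime_curve = polygons +
  assumes prime: "\<And>a b. f dvd a * b \<Longrightarrow> f dvd a \<or> f dvd b"
begin

text \<open>Dimension count in \<open>R[(m+k)H] / (f, u)\<close> for large \<open>m\<close>; exponents in \<open>n0 + BB m\<close> are left out of the
  multiples of \<open>u\<close> so that the trivial relations \<open>u (f b) = f (u b)\<close> disappear.\<close>

lemma ideal_codimension:
  fixes ts :: "nat \<Rightarrow> lau"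
  assumes u: "\<And>m n. m \<ge> 2 \<Longrightarrow> n \<in> kH m \<Longrightarrow> mon n * u \<in> V (m + k)" and nd: "\<not> f dvd u"
    and N: "int N > int k * mv A H"
  obtains c g h where "\<exists>i<N. c i \<noteq> 0" "(\<Sum>i<N. CC (c i) * ts i) = f * g + u * h"
proof -
  obtain z R where zR: "R \<ge> k + 2" "\<And>e. e \<in> (\<Union>i<N. kys (ts i)) \<Longrightarrow> z + e \<in> kH (3 * R)"
    using large_multiple[of "\<Union>i<N. kys (ts i)" "k + 2"] by (metis finite_UN finite_keys finite_lessThan)
  define m where "m = 3 * R - k"
  have m: "m \<ge> 2" "m + k = 3 * R" using zR(1) by (simp_all add: m_def)
  let ?X = "kH (m + k)"
  have "\<forall>n\<in>kH m. \<exists>F g. kys F \<subseteq> ?X \<and> mon n * u = F + f * g"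
  proof
    fix n assume "n \<in> kH m"
    then obtain g where "kys (mon n * u - f * g) \<subseteq> ?X" using u[OF m(1)] unfolding Wm_def by blast
    then show "\<exists>F g. kys F \<subseteq> ?X \<and> mon n * u = F + f * g"
      by (intro exI[of _ "mon n * u - f * g"] exI[of _ g]) simp
  qed
  then obtain F G where FG: "\<And>n. n \<in> kH m \<Longrightarrow> kys (F n) \<subseteq> ?X" "\<And>n. n \<in> kH m \<Longrightarrow> mon n * u = F n + f * G n" by metis
  obtain n0 \<theta> where n0: "n0 \<in> A" "\<And>n. n \<in> A \<Longrightarrow> n \<noteq> n0 \<Longrightarrow> dotz \<theta> n > dotz \<theta> n0"
    using exposed_min pgD[OF pgs(1)] by blast
  have nB: "(+) n0 ` BB m \<subseteq> kH m"
    unfolding AB[OF m(1), symmetric] using msum_mem[OF pgD(1)[OF pgs(1)] pgD(1)[OF pgB] n0(1)] by blast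
  \<comment> \<open>\<open>n0\<close> is the unique lowest exponent of \<open>f\<close> for
    \<open>\<theta>\<close>, so every nonzero multiple of \<open>f\<close> supported in
    \<open>kH m\<close> has an exponent in \<open>n0 + BB m\<close>. Polynomials supported in
    \<open>Rs\<close> thus meet the multiples of \<open>f\<close> only in zero.\<close>
  define Rs where "Rs = kH m - (+) n0 ` BB m"
  have fRs: "finite Rs" using pgD(1)[OF pgk] by (simp add: Rs_def)
  have cR: "int (card Rs) = int (card (kH m)) - int (card (BB m))"
    using card_Diff_subset[OF _ nB] card_mono[OF pgD(1)[OF pgk] nB] pgD(1)[OF pgB]
    by (simp add: Rs_def card_image)
  have inj: "b' = 0" if b': "kys (f * b') \<subseteq> Rs" for b'
  proof (rule ccontr)
    assume nz: "b' \<noteq> 0"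
    obtain b0 where b0: "b0 \<in> kys b'" "dotz (- \<theta>) b0 = hz (kys b') (- \<theta>)"
    proof (rule hz_attained[of "kys b'" "- \<theta>"])
      show "kys b' \<noteq> {}" using nz by simp
    qed simp_all
    have "lk (f * b') (n0 + b0) = (\<Sum>k\<in>kys f. lk f k * lk b' (n0 + b0 - k))" by (rule lk_mult)
    also have "\<dots> = (\<Sum>k\<in>{n0}. lk f k * lk b' (n0 + b0 - k))"
    proof (rule sum.mono_neutral_right)
      show "\<forall>k\<in>kys f - {n0}. lk f k * lk b' (n0 + b0 - k) = 0"
      proof
        fix k assume k: "k \<in> kys f - {n0}"
        have "n0 + b0 - k \<notin> kys b'"
        proof
          assume "n0 + b0 - k \<in> kys b'"
          then have "dotz (- \<theta>) (n0 + b0 - k) \<le> dotz (- \<theta>) b0" unfolding b0(2) by (intro hz_ge) simp_all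
          moreover have "dotz \<theta> k > dotz \<theta> n0" using n0(2) k kfA by simp
          ultimately show False by simp
        qed
        then show "lk f k * lk b' (n0 + b0 - k) = 0" by (simp add: in_keys_iff)
      qed
    qed (simp_all add: kfA n0(1) pgD(1)[OF pgs(1)])
    also have "\<dots> = lk f n0 * lk b' b0" by simp
    finally have "n0 + b0 \<in> kys (f * b')" using b0(1) n0(1) kfA by (metis in_keys_iff mult_eq_0_iff)
    moreover have "b0 \<in> BB m"
    proof (rule pg_memI[OF pgB])
      fix w
      have "kys (f * b') \<noteq> {}" using lau_mult_nz[OF f0 nz] by simp
      moreover have "kys (f * b') \<subseteq> kH m" using b' by (auto simp: Rs_def)
      ultimately have "hz (kys (f * b')) w \<le> hz (kH m) w" by (intro hz_mono pgD(1)[OF pgk])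
      then have "hz (kys b') w \<le> hz (BB m) w" unfolding hz_mult[OF f0 nz] kfA hzB[OF m(1)] hzk by simp
      then show "dotz w b0 \<le> hz (BB m) w" using hz_ge[OF _ b0(1), of w] by simp
    qed
    ultimately show False using b' by (auto simp: Rs_def)
  qed
  let ?I = "(Inl ` (Inl ` {..<N} \<union> Inr ` BB (m + k)) \<union> Inr ` Rs) :: ((nat + lat) + lat) set"
  \<comment> \<open>Three families supported in \<open>kH (m + k)\<close>: the shifted
    \<open>ts\<close>, the multiples \<open>f * mon n\<close>, and the reduced multiples of
    \<open>u\<close>. By \<open>card_difference\<close> together they outnumber the exponents once
    \<open>N > k * mv A H\<close>.\<close>
  define v :: "(nat + lat) + lat \<Rightarrow> lau" where
    "v = case_sum (case_sum (\<lambda>i. mon z * ts i) (\<lambda>n. f * mon n)) F"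
  have fB: "finite (BB (m + k))" by (rule pgD(1)[OF pgB])
  have fI: "finite ?I" using fB fRs by simp
  have "card ?I = card (Inl ` {..<N} \<union> (Inr ` BB (m + k)) :: (nat + lat) set) + card Rs"
    using fB fRs by (subst card_Un_disjoint) (auto simp: card_image)
  also have "card (Inl ` {..<N} \<union> (Inr ` BB (m + k)) :: (nat + lat) set) = N + card (BB (m + k))"
    using fB by (subst card_Un_disjoint) (auto simp: card_image)
  finally have "int (card ?I) > int (card ?X)" using cR card_difference[OF m(1), of k] N by simp
  then have cI: "card ?X < card ?I" by simp
  have kv: "kys (v i) \<subseteq> ?X" if "i \<in> ?I" for i
    using that
  proof (elim UnE imageE)
    fix j l assume i: "i = Inl l" "l = Inl j" "j \<in> {..<N}"
    have "kys (mon z * ts j) \<subseteq> ?X"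
    proof
      fix x assume "x \<in> kys (mon z * ts j)"
      then have "x - z \<in> (\<Union>i<N. kys (ts i))" using i(3) by (simp only: kys_mon_mult) (rule UN_I)
      then have "z + (x - z) \<in> ?X" unfolding m(2) by (rule zR(2))
      then show "x \<in> ?X" by simp
    qed
    then show ?thesis unfolding i v_def by simp
  next
    fix n l assume i: "i = Inl l" "l = Inr n" "n \<in> BB (m + k)"
    have "x \<in> msum A (BB (m + k))" if xk: "x \<in> kys (f * mon n)" for x
    proof -
      obtain y where "y \<in> kys f" "x = y + n" using kys_mult_sub[OF xk] by (simp add: kys_mon) blast
      then show ?thesis using msum_mem[OF pgD(1)[OF pgs(1)] fB] i kfA by simp
    qed
    then have "kys (f * mon n) \<subseteq> ?X" using AB[of "m + k"] m(1) by (intro subsetI) simp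
    then show ?thesis unfolding i v_def by simp
  next
    fix n assume "i = Inr n" "n \<in> Rs"
    then show ?thesis using FG(1)[of n] by (simp add: v_def Rs_def)
  qed
  obtain x where x: "\<exists>i\<in>?I. x i \<noteq> 0" "(\<Sum>i\<in>?I. CC (x i) * v i) = 0"
    by (rule lau_dependent[OF fI pgD(1)[OF pgk] kv cI])
  define a where "a = (\<Sum>n\<in>BB (m + k). CC (x (Inl (Inr n))) * mon n)"
  define b where "b = (\<Sum>n\<in>Rs. CC (x (Inr n)) * mon n)"
  define bG where "bG = (\<Sum>n\<in>Rs. CC (x (Inr n)) * G n)"
  define c where "c = (\<lambda>i. x (Inl (Inl i)))"
  have bF: "(\<Sum>n\<in>Rs. CC (x (Inr n)) * F n) = u * b - f * bG"
  proof -
    have "(\<Sum>n\<in>Rs. CC (x (Inr n)) * F n) = (\<Sum>n\<in>Rs. CC (x (Inr n)) * (mon n * u - f * G n))"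
      by (rule sum.cong[OF refl]) (simp add: FG(2) Rs_def)
    then show ?thesis unfolding b_def bG_def by (simp add: right_diff_distrib sum_subtractf sum_distrib_left mult_ac)
  qed
  have "(\<Sum>i\<in>?I. CC (x i) * v i)
      = (\<Sum>i\<in>Inl ` {..<N} \<union> Inr ` BB (m + k). CC (x (Inl i)) * v (Inl i)) + (\<Sum>n\<in>Rs. CC (x (Inr n)) * v (Inr n))"
    using fB fRs by (subst sum.union_disjoint) (auto simp: sum.reindex)
  also have "(\<Sum>i\<in>Inl ` {..<N} \<union> Inr ` BB (m + k). CC (x (Inl i)) * v (Inl i))
      = (\<Sum>i<N. CC (c i) * (mon z * ts i)) + f * a"
    using fB by (subst sum.union_disjoint) (auto simp: sum.reindex v_def c_def a_def sum_distrib_left mult_ac)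
  also have "(\<Sum>n\<in>Rs. CC (x (Inr n)) * v (Inr n)) = u * b - f * bG" using bF by (simp add: v_def)
  finally have rel: "(\<Sum>i<N. CC (c i) * (mon z * ts i)) + f * a + (u * b - f * bG) = 0" using x(2) by simp
  have lka: "lk a n = x (Inl (Inr n))" if "n \<in> BB (m + k)" for n
  proof -
    have "lk a n = (\<Sum>j\<in>BB (m + k). if j = n then x (Inl (Inr j)) else 0)"
      unfolding a_def lookup_sum by (rule sum.cong[OF refl]) (simp add: mon_def lookup_single when_def)
    then show ?thesis using that fB by simp
  qed
  have lkb: "lk b n = (if n \<in> Rs then x (Inr n) else 0)" for n
  proof -
    have "lk b n = (\<Sum>j\<in>Rs. if j = n then x (Inr j) else 0)"
      unfolding b_def lookup_sum by (rule sum.cong[OF refl]) (simp add: mon_def lookup_single when_def)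
    then show ?thesis using fRs by simp
  qed
  \<comment> \<open>A relation without \<open>ts\<close> makes \<open>f\<close> divide
    \<open>u * b\<close>, hence \<open>b\<close> by primality; as \<open>b\<close> is supported in
    \<open>Rs\<close> it vanishes, and then so does \<open>a\<close>.\<close>
  have "\<exists>i<N. c i \<noteq> 0"
  proof (rule ccontr)
    assume no: "\<not> (\<exists>i<N. c i \<noteq> 0)"
    then have "(\<Sum>i<N. CC (c i) * (mon z * ts i)) = 0" by (intro sum.neutral) (simp add: CC_simps)
    then have ub: "u * b = f * (bG - a)" using rel by (simp add: algebra_simps)
    then have "f dvd u * b" by simp
    then have "f dvd b" using prime nd by blast
    then obtain b' where b': "b = f * b'" by (elim dvdE)
    have "kys b \<subseteq> Rs" by (rule subsetI) (simp add: in_keys_iff lkb split: if_splits)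
    then have "b' = 0" using inj unfolding b' by blast
    then have b0: "b = 0" using b' by simp
    then have xR: "x (Inr n) = 0" if "n \<in> Rs" for n using lkb[of n] that by simp
    have "bG = 0" unfolding bG_def by (intro sum.neutral) (simp add: xR CC_simps)
    then have "f * a = 0" using ub b0 by simp
    then have "a = 0" using lau_mult_nz[OF f0, of a] by blast
    then have "x (Inl (Inr n)) = 0" if "n \<in> BB (m + k)" for n using lka[OF that] by simp
    then show False using x(1) xR no by (auto simp: c_def)
  qed
  moreover have "(\<Sum>i<N. CC (c i) * ts i) = f * (mon (- z) * (bG - a)) + u * (mon (- z) * (- b))"
  proof -
    have "(\<Sum>i<N. CC (c i) * ts i) = mon (- z) * (\<Sum>i<N. CC (c i) * (mon z * ts i))"
      unfolding sum_distrib_left by (rule sum.cong[OF refl]) (simp add: mult.left_commute[of "mon _" "CC _"] mon_cancel)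
    also have "(\<Sum>i<N. CC (c i) * (mon z * ts i)) = f * (bG - a) + u * (- b)"
      using rel by (simp add: algebra_simps add_eq_0_iff)
    finally show ?thesis by (simp add: algebra_simps)
  qed
  ultimately show thesis by (rule that)
qed

end

section \<open>Polynomials in a Laurent polynomial, conjugation, and zeros on the curve\<close>

primrec pel :: "lau \<Rightarrow> complex list \<Rightarrow> lau" where
  "pel z [] = 0" | "pel z (a # as) = CC a + z * pel z as"

definition pe :: "lau \<Rightarrow> complex poly \<Rightarrow> lau" where "pe z p = pel z (coeffs p)"

lemma pe_0 [simp]: "pe z 0 = 0" by (simp add: pe_def)
lemma pe_pCons [simp]: "pe z (pCons a p) = CC a + z * pe z p"
  by (cases "p = 0 \<and> a = 0") (auto simp: pe_def cCons_def CC_simps)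
lemma pe_add: "pe z (p + q) = pe z p + pe z q"
proof (induction p arbitrary: q rule: pCons_induct)
  case (pCons a p)
  then show ?case by (cases q rule: pCons_cases) (simp add: CC_simps algebra_simps)
qed simp
lemma pe_smult: "pe z (Polynomial.smult c p) = CC c * pe z p"
  by (induction p) (simp_all add: CC_simps algebra_simps)
lemma pe_mult: "pe z (p * q) = pe z p * pe z q"
  by (induction p) (simp_all add: pe_add pe_smult CC_simps algebra_simps)
lemma pe_1 [simp]: "pe z 1 = 1" by (simp add: one_pCons CC_simps)
lemma pe_monom: "pe z (monom c n) = CC c * z ^ n"
  by (induction n) (simp_all add: monom_0 monom_Suc CC_simps mult_ac)
lemma pe_sum: "pe z (\<Sum>i\<in>I. p i) = (\<Sum>i\<in>I. pe z (p i))"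
  by (induction I rule: infinite_finite_induct) (simp_all add: pe_add)

lemma mon_power: "mon n ^ k = mon (sm (int k) n)"
  by (induction k) (simp_all add: sm_add mon_add[symmetric] algebra_simps)

definition cj :: "lau \<Rightarrow> lau" where "cj t = (\<Sum>n\<in>kys t. Poly_Mapping.single n (cnj (lk t n)))"

lemma lk_cj [simp]: "lk (cj t) n = cnj (lk t n)"
proof -
  have "lk (cj t) n = (\<Sum>m\<in>kys t. if m = n then cnj (lk t m) else 0)"
    unfolding cj_def lookup_sum by (rule sum.cong[OF refl]) (simp add: lookup_single when_def)
  then show ?thesis by (simp add: in_keys_iff)
qed

lemma kys_cj [simp]: "kys (cj t) = kys t" by (rule Set.set_eqI) (simp add: in_keys_iff)
lemma cj_cj [simp]: "cj (cj t) = t" by (rule poly_mapping_eqI) simp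
lemma cj_add [simp]: "cj (s + t) = cj s + cj t" by (rule poly_mapping_eqI) (simp add: lookup_add)
lemma cj_diff [simp]: "cj (s - t) = cj s - cj t" by (rule poly_mapping_eqI) (simp add: lookup_minus)
lemma cj_mult [simp]: "cj (s * t) = cj s * cj t" by (rule poly_mapping_eqI) (simp add: lk_mult)
lemma cj_0 [simp]: "cj 0 = 0" by (rule poly_mapping_eqI) simp
lemma cj_CC [simp]: "cj (CC c) = CC (cnj c)" by (rule poly_mapping_eqI) (simp add: CC_def lookup_single when_def)
lemma cj_mon [simp]: "cj (mon n) = mon n" by (rule poly_mapping_eqI) (simp add: mon_def lookup_single when_def)
lemma cj_1 [simp]: "cj 1 = 1" using cj_mon[of 0] by simp

definition cpt :: "complex \<times> complex \<Rightarrow> complex \<times> complex" where "cpt p = (cnj (fst p), cnj (snd p))"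

lemma cnj_powi: "cnj (x powi k) = cnj x powi k" by (simp add: power_int_def)
lemma mp_cpt: "mp (cpt p) n = cnj (mp p n)" by (simp add: mp_def cpt_def cnj_powi)
lemma torus_cpt [simp]: "torus (cpt p) = torus p" by (simp add: torus_def cpt_def)
lemma ev_cpt: "ev (cpt p) (cj t) = cnj (ev p t)" by (simp add: ev_def mp_cpt)

context polygons
begin

lemma V_cj: assumes "cj f = f" "t \<in> V m" shows "cj t \<in> V m"
proof -
  obtain g where g: "kys (t - f * g) \<subseteq> kH m" using assms(2) unfolding Wm_def by blast
  have "cj t - f * cj g = cj (t - f * g)" using assms(1) by simp
  then have "kys (cj t - f * cj g) \<subseteq> kH m" using g by (simp only: kys_cj)
  then show ?thesis unfolding Wm_def by blast
qed

lemma V1_cj: assumes "cj f = f" "t \<in> V1" shows "cj t \<in> V1"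
  unfolding V1_def
proof (intro CollectI ballI)
  fix v assume "v \<in> H"
  then have "cj (mon v * t) \<in> V 2" using assms V_cj unfolding V1_def by blast
  then show "mon v * cj t \<in> V 2" by simp
qed

lemma f_not_dvd_mon: "\<not> f dvd mon v"
proof
  assume "f dvd mon v"
  then obtain g where g: "mon v = f * g" by (elim dvdE)
  have "kys (mon v) \<noteq> {}" by (simp add: kys_mon)
  then have g0: "g \<noteq> 0" using g by auto
  have e: "dotz w v = hz A w + hz (kys g) w" for w
    using hz_mult[OF f0 g0, of w] unfolding g[symmetric] kys_mon kfA by (simp add: hz_def[of "{v}"])
  have "(1::int, 0::int) \<noteq> 0" by (simp add: prod_eq_iff)
  then have "wd SP (1, 0) > 0" using fatP unfolding fat_def by blast
  then have "wd A (1, 0) > 0" by (simp add: wd_def hzA)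
  moreover have "wd A (1, 0) + (hz (kys g) (1, 0) + hz (kys g) (- (1, 0))) = 0"
    using e[of "(1,0)"] e[of "- (1, 0)"] unfolding wd_def dotz_minus by linarith
  moreover have "hz (kys g) (1, 0) + hz (kys g) (- (1, 0)) \<ge> 0"
    using hz_add_le[of "kys g" "(1,0)" "- (1,0)"] hz_zero[of "kys g"] g0 by (simp only: add.right_inverse) simp
  ultimately show False by linarith
qed

end

lemma torusI: "x \<noteq> 0 \<Longrightarrow> y \<noteq> 0 \<Longrightarrow> torus (x, y)" by (simp add: torus_def)

context prime_curve
begin

text \<open>\<open>ideal_codimension\<close>, applied to powers of the first coordinate, yields a
  nonzero polynomial in \<open>x\<close> alone in the ideal of \<open>f\<close> and a shift of
  \<open>u\<close>. For all but finitely many \<open>x\<close> it is nonzero, and so are the lowest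
  and highest coefficients of \<open>f\<close> in \<open>y\<close>; then \<open>f\<close> has a zero
  in the torus over \<open>x\<close>, where \<open>u\<close> cannot vanish.\<close>

lemma curve_point:
  assumes nd: "\<not> f dvd u"
  obtains p where "torus p" "ev p f = 0" "ev p u \<noteq> 0"
proof -
  obtain z R where zR: "R \<ge> 1" "\<And>e. e \<in> kys u \<Longrightarrow> z + e \<in> kH (3 * R)" using large_multiple[OF finite_keys[of u], of 1] by blast
  define u1 where "u1 = mon z * u"
  have "kys u1 \<subseteq> kH (3 * R)"
  proof
    fix x assume "x \<in> kys u1"
    then have "x - z \<in> kys u" unfolding u1_def by (simp only: kys_mon_mult)
    then have "z + (x - z) \<in> kH (3 * R)" by (rule zR(2))
    then show "x \<in> kH (3 * R)" by simp
  qed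
  then have uV: "mon n * u1 \<in> V (m + 3 * R)" if "n \<in> kH m" for m n
    by (intro V_mult mon_V that Wm_keys)
  have nd1: "\<not> f dvd u1"
  proof
    assume "f dvd u1"
    then have "f dvd mon z \<or> f dvd u" unfolding u1_def by (rule prime)
    then show False using nd f_not_dvd_mon by blast
  qed
  define N where "N = nat (int (3 * R) * mv A H) + 1"
  have N: "int N > int (3 * R) * mv A H" by (simp add: N_def)
  obtain c g h where c: "\<exists>i<N. c i \<noteq> 0" and rel: "(\<Sum>i<N. CC (c i) * mon (int i, 0)) = f * g + u1 * h"
    by (rule ideal_codimension[of u1 "3 * R" N "\<lambda>i. mon (int i, 0)"]) (use uV nd1 N in blast)+
  define b where "b = hz A (0, 1)"
  define a where "a = - hz A (0, -1)"
  have w01: "(0::int, 1::int) \<noteq> 0" by (simp add: prod_eq_iff)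
  then have "wd SP (0, 1) > 0" using fatP unfolding fat_def by blast
  then have ab: "a < b" by (simp add: a_def b_def wd_def hzA)
  note fA = pgD[OF pgs(1)]
  have rng: "a \<le> snd n \<and> snd n \<le> b" if "n \<in> A" for n
    using hz_ge[OF fA(1) that, of "(0,1)"] hz_ge[OF fA(1) that, of "(0,-1)"] by (simp add: a_def b_def dotz_def)
  define fc where "fc = (\<lambda>x::complex. \<lambda>j. \<Sum>n\<in>{n\<in>A. snd n = j}. lk f n * x powi fst n)"
  have fcfin: "finite {x. x \<noteq> 0 \<and> fc x j = 0}" if "n0 \<in> A" "snd n0 = j" for n0 j
  proof -
    let ?S = "fst ` {n\<in>A. snd n = j}"
    have "fc x j = (\<Sum>i\<in>?S. lk f (i, j) * x powi i)" for x
      unfolding fc_def by (subst sum.reindex) (auto simp: inj_on_def intro!: sum.cong)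
    moreover have "finite {x. x \<noteq> 0 \<and> (\<Sum>i\<in>?S. lk f (i, j) * x powi i) = 0}"
    proof (rule finite_laurent_zeros(1))
      show "finite ?S" using fA by simp
      show "fst n0 \<in> ?S" using that by (intro imageI) simp
      have "n0 = (fst n0, j)" using that(2) by (simp add: prod_eq_iff)
      moreover have "lk f n0 \<noteq> 0" using that(1) kfA by (simp flip: in_keys_iff)
      ultimately show "lk f (fst n0, j) \<noteq> 0" by simp
    qed
    ultimately show ?thesis by simp
  qed
  obtain nb where nb: "nb \<in> A" "snd nb = b" using hz_attained[OF fA, of "(0,1)"] by (auto simp: b_def dotz_def)
  obtain na where na0: "na \<in> A" "dotz (0,-1) na = hz A (0,-1)" by (rule hz_attained[OF fA])
  then have na: "na \<in> A" "snd na = a" by (simp_all add: a_def dotz_def)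
  obtain i0 where i0: "i0 < N" "c i0 \<noteq> 0" using c by blast
  have "finite {x. x \<noteq> 0 \<and> (\<Sum>i\<in>int ` {..<N}. c (nat i) * x powi i) = 0}"
    by (rule finite_laurent_zeros(1)[of _ "int i0"]) (use i0 in simp_all)
  then have fin: "finite ({x. x \<noteq> 0 \<and> (\<Sum>i\<in>int ` {..<N}. c (nat i) * x powi i) = 0} \<union> {x. x \<noteq> 0 \<and> fc x a = 0}
     \<union> {x. x \<noteq> 0 \<and> fc x b = 0} \<union> {0})" using fcfin[OF na] fcfin[OF nb] by (simp only: finite_Un finite.intros)
  obtain x where "x \<notin> {x. x \<noteq> 0 \<and> (\<Sum>i\<in>int ` {..<N}. c (nat i) * x powi i) = 0} \<union> {x. x \<noteq> 0 \<and> fc x a = 0}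
     \<union> {x. x \<noteq> 0 \<and> fc x b = 0} \<union> {0}" using ex_new_if_finite[OF infinite_UNIV_char_0 fin] ..
  then have x: "x \<noteq> 0" "(\<Sum>i\<in>int ` {..<N}. c (nat i) * x powi i) \<noteq> 0" "fc x a \<noteq> 0" "fc x b \<noteq> 0"
    by (simp_all only: Un_iff mem_Collect_eq singleton_iff de_Morgan_disj de_Morgan_conj not_not) blast+
  have "\<exists>y. y \<noteq> 0 \<and> (\<Sum>j\<in>snd ` A. fc x j * y powi j) = 0"
    by (rule finite_laurent_zeros(2)[of _ a _ b]) (use fA x ab na nb in \<open>auto intro: image_eqI[of _ snd]\<close>)
  then obtain y where y: "y \<noteq> 0" "(\<Sum>j\<in>snd ` A. fc x j * y powi j) = 0" by blast
  have t: "torus (x, y)" using x y by (intro torusI)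
  have "ev (x, y) f = (\<Sum>n\<in>A. lk f n * x powi fst n * y powi snd n)" by (simp add: ev_def kfA mp_def mult.assoc)
  also have "\<dots> = (\<Sum>j\<in>snd ` A. \<Sum>n\<in>{n\<in>A. snd n = j}. lk f n * x powi fst n * y powi snd n)"
    by (rule sum.image_gen[OF fA(1)])
  also have "\<dots> = (\<Sum>j\<in>snd ` A. fc x j * y powi j)"
    unfolding fc_def by (rule sum.cong[OF refl]) (simp add: sum_distrib_right)
  finally have ef: "ev (x, y) f = 0" using y by simp
  have "ev (x, y) (\<Sum>i<N. CC (c i) * mon (int i, 0)) = (\<Sum>i<N. c i * x powi int i)"
    unfolding ev_sum by (simp add: mp_def)
  also have "\<dots> = (\<Sum>i\<in>int ` {..<N}. c (nat i) * x powi i)" by (subst sum.reindex) simp_all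
  finally have "ev (x, y) (f * g + u1 * h) \<noteq> 0" using x(2) unfolding rel[symmetric] by simp
  then have "ev (x, y) u1 \<noteq> 0" by (simp add: ev_mult[OF t] ef)
  then have "ev (x, y) u \<noteq> 0" by (simp add: u1_def ev_mult[OF t])
  then show thesis using that t ef by blast
qed

lemma ev_dvd: "torus p \<Longrightarrow> ev p f = 0 \<Longrightarrow> f dvd t \<Longrightarrow> ev p t = 0"
  by (elim dvdE) (simp add: ev_mult)

definition dual_basis :: "nat \<Rightarrow> (nat \<Rightarrow> complex \<times> complex) \<Rightarrow> (nat \<Rightarrow> lau) \<Rightarrow> bool" where
  "dual_basis d q b \<longleftrightarrow> (\<forall>j<d. torus (q j) \<and> ev (q j) f = 0 \<and> b j \<in> V1)
     \<and> (\<forall>i<d. \<forall>j<d. ev (q i) (b j) = (if i = j then 1 else 0))"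

lemma V1_sum: "(\<And>j. j \<in> I \<Longrightarrow> t j \<in> V1) \<Longrightarrow> (\<Sum>j\<in>I. t j) \<in> V1"
  using V1_f[of 0] by (induction I rule: infinite_finite_induct) (simp_all add: V1_add)

lemma V1_minus: "s \<in> V1 \<Longrightarrow> t \<in> V1 \<Longrightarrow> s - t \<in> V1"
  using V1_add[of s "CC (- 1) * t"] V1_CC[of t "- 1"] by (simp add: CC_simps)

lemma dual_basis_bound: assumes "dual_basis d q b" shows "d \<le> card (kH 2)"
proof (rule ccontr)
  assume n: "\<not> d \<le> card (kH 2)"
  obtain v where v: "v \<in> H" using pgD[OF pgs(2)] by blast
  have "\<forall>j<d. \<exists>g. kys (mon v * b j - f * g) \<subseteq> kH 2" using assms v unfolding dual_basis_def V1_def Wm_def by blast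
  then obtain g where g: "\<And>j. j < d \<Longrightarrow> kys (mon v * b j - f * g j) \<subseteq> kH 2" by metis
  obtain x where x: "\<exists>i\<in>{..<d}. x i \<noteq> 0" "(\<Sum>j\<in>{..<d}. CC (x j) * (mon v * b j - f * g j)) = 0"
    by (rule lau_dependent[of "{..<d}" "kH 2" "\<lambda>j. mon v * b j - f * g j"]) (use g n pgD[OF pgk] in auto)
  obtain i where i: "i < d" "x i \<noteq> 0" using x(1) by blast
  have q: "torus (q i)" "ev (q i) f = 0" using assms i(1) unfolding dual_basis_def by blast+
  have "0 = ev (q i) (\<Sum>j\<in>{..<d}. CC (x j) * (mon v * b j - f * g j))" unfolding x(2) by simp
  also have "\<dots> = (\<Sum>j<d. x j * (mp (q i) v * ev (q i) (b j)))" by (simp add: ev_sum ev_mult[OF q(1)] q(2))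
  also have "\<dots> = (\<Sum>j<d. if i = j then x j * mp (q i) v else 0)"
    by (rule sum.cong[OF refl]) (use assms i(1) in \<open>simp add: dual_basis_def\<close>)
  also have "\<dots> = x i * mp (q i) v" using i(1) by simp
  finally show False using i(2) mp_nz[OF q(1), of v] by simp
qed

text \<open>Take an interpolating family of maximal size, which exists by
  \<open>dual_basis_bound\<close>. If an element of \<open>V1\<close> is not expanded by it modulo
  \<open>f\<close>, the remainder vanishes at the chosen points, and \<open>curve_point\<close>
  finds a further point where it does not, so the family could be enlarged.\<close>

lemma dual_basis_exists:
  obtains d q b where "dual_basis d q b" "0 < d" "\<And>t. t \<in> V1 \<Longrightarrow> f dvd t - (\<Sum>j<d. CC (ev (q j) t) * b j)"
proof -
  let ?P = "\<lambda>d. \<exists>q b. dual_basis d q b"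
  have ext: "?P (Suc d)" if db: "dual_basis d q b" and t: "t \<in> V1" "\<not> f dvd t - (\<Sum>j<d. CC (ev (q j) t) * b j)" for d q b t
  proof -
    define t' where "t' = t - (\<Sum>j<d. CC (ev (q j) t) * b j)"
    obtain p where p: "torus p" "ev p f = 0" "ev p t' \<noteq> 0" using curve_point t(2) unfolding t'_def by blast
    have bV: "b j \<in> V1" if "j < d" for j using db that unfolding dual_basis_def by blast
    have t'V: "t' \<in> V1" unfolding t'_def by (intro V1_minus t V1_sum V1_CC bV) simp
    have t'q: "ev (q i) t' = 0" if "i < d" for i
    proof -
      have "(\<Sum>j<d. ev (q j) t * ev (q i) (b j)) = (\<Sum>j<d. if i = j then ev (q j) t else 0)"
        by (rule sum.cong[OF refl]) (use db that in \<open>simp add: dual_basis_def\<close>)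
      then show ?thesis using that by (simp add: t'_def ev_sum)
    qed
    define bd' where "bd' = CC (1 / ev p t') * t'"
    define q' where "q' = (\<lambda>j. if j = d then p else q j)"
    define b' where "b' = (\<lambda>j. if j = d then bd' else b j - CC (ev p (b j)) * bd')"
    have bdV: "bd' \<in> V1" unfolding bd'_def by (rule V1_CC[OF t'V])
    have bdq: "ev (q i) bd' = 0" if "i < d" for i using t'q[OF that] by (simp add: bd'_def)
    have bdp: "ev p bd' = 1" using p(3) by (simp add: bd'_def)
    have "dual_basis (Suc d) q' b'" unfolding dual_basis_def
    proof (intro conjI allI impI)
      fix j assume j: "j < Suc d"
      show "torus (q' j)" "ev (q' j) f = 0" using j db p by (auto simp: q'_def dual_basis_def less_Suc_eq)
      show "b' j \<in> V1" using j bdV bV by (auto simp: b'_def less_Suc_eq intro: V1_minus V1_CC)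
    next
      fix i j assume ij: "i < Suc d" "j < Suc d"
      show "ev (q' i) (b' j) = (if i = j then 1 else 0)"
        using ij db by (cases "i = d"; cases "j = d") (auto simp: q'_def b'_def bdq bdp less_Suc_eq dual_basis_def)
    qed
    then show ?thesis by blast
  qed
  define d where "d = (GREATEST d. ?P d)"
  have P0: "?P 0" by (simp add: dual_basis_def)
  have bnd: "\<forall>y. ?P y \<longrightarrow> y \<le> card (kH 2)" using dual_basis_bound by blast
  have "?P d" unfolding d_def by (rule GreatestI_nat[of ?P 0 "card (kH 2)", OF P0]) (use bnd in blast)
  then obtain q b where db: "dual_basis d q b" by blast
  have gr: "\<not> ?P (Suc d)" using Greatest_le_nat[of ?P "Suc d" "card (kH 2)"] bnd unfolding d_def[symmetric] by force
  have all: "f dvd t - (\<Sum>j<d. CC (ev (q j) t) * b j)" if "t \<in> V1" for t using ext[OF db that] gr by blast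
  have "0 < d"
  proof (rule ccontr)
    assume d0: "\<not> 0 < d"
    obtain v where v: "v \<in> H" using pgD[OF pgs(2)] by blast
    have "mon v \<in> V1" by (rule keysH_V1) (simp add: kys_mon v)
    then show False using all[of "mon v"] d0 f_not_dvd_mon by simp
  qed
  then show thesis using that db all by blast
qed

end

lemma complex_bezout:
  fixes p q :: "complex poly"
  assumes "\<And>x. poly p x = 0 \<Longrightarrow> poly q x \<noteq> 0"
  obtains s t where "s * p + t * q = 1"
proof -
  define I where "I = {s * p + t * q | s t. True}"
  have pI: "p \<in> I" "q \<in> I" unfolding I_def by (intro CollectI exI[of _ 1] exI[of _ 0]; simp)+
  have "p \<noteq> 0 \<or> q \<noteq> 0" using assms[of 0] by auto
  then have "\<exists>g. g \<in> I \<and> g \<noteq> 0" using pI by blast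
  then obtain g where g: "g \<in> I \<and> g \<noteq> 0" "\<And>h. h \<in> I \<and> h \<noteq> 0 \<Longrightarrow> degree g \<le> degree h"
    using exists_least_iff[of "\<lambda>n. \<exists>g. (g \<in> I \<and> g \<noteq> 0) \<and> degree g = n"] by (metis not_le_imp_less)
  obtain s t where st: "g = s * p + t * q" using g(1) unfolding I_def by blast
  have dv: "g dvd h" if "h \<in> I" for h
  proof -
    obtain s' t' where st': "h = s' * p + t' * q" using \<open>h \<in> I\<close> unfolding I_def mem_Collect_eq by (elim exE conjE)
    have "h mod g = h - (h div g) * g" by (simp add: minus_div_mult_eq_mod)
    also have "\<dots> = (s' - (h div g) * s) * p + (t' - (h div g) * t) * q" unfolding st' st by (simp add: algebra_simps)
    finally have "h mod g \<in> I" unfolding I_def by blast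
    then have "h mod g = 0" using g(2)[of "h mod g"] degree_mod_less[of g h] g(1) by (cases "h mod g = 0") auto
    then show ?thesis by (rule mod_0_imp_dvd)
  qed
  have "degree g = 0"
  proof (rule ccontr)
    assume "degree g \<noteq> 0"
    then have "\<not> constant (poly g)" by (simp add: constant_degree)
    then obtain x where "poly g x = 0" using fundamental_theorem_of_algebra by blast
    then have "poly p x = 0" "poly q x = 0" using dv[OF pI(1)] dv[OF pI(2)] by (auto elim!: dvdE)
    then show False using assms by blast
  qed
  then obtain c where c: "g = [:c:]" "c \<noteq> 0" using g(1) by (metis degree_eq_zeroE pCons_0_0)
  have "([:1 / c:] * s) * p + ([:1 / c:] * t) * q = [:1 / c:] * g" unfolding st by (simp add: algebra_simps)
  also have "\<dots> = 1" using c by (simp add: one_pCons)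
  finally show thesis by (rule that)
qed

lemma mon_absorb: "(mon (- n) * s) * (mon n * t) = s * t"
proof -
  have "(mon (- n) * s) * (mon n * t) = mon (- n) * (mon n * (s * t))" by (simp only: mult_ac)
  then show ?thesis by (simp only: mon_cancel)
qed

text \<open>Exponents on one line differ by multiples of \<open>rot w\<close>, so the form is a
  monomial times a polynomial in \<open>mon (rot w)\<close>. Starting at the lowest exponent makes
  the constant term nonzero, and all roots are then values in the torus.\<close>

lemma homogeneous_poly:
  assumes w: "prim w" and k: "kys \<rho> \<subseteq> level w a" "kys \<rho> \<noteq> {}" and e: "dotz e (rot w) = 1"
  obtains n p where "\<rho> = mon n * pe (mon (rot w)) p" "poly p 0 \<noteq> 0"
    "\<forall>q. torus q \<longrightarrow> ev q \<rho> = mp q n * poly p (mp q (rot w))"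
proof -
  define L where "L = - hz (kys \<rho>) (- e)"
  obtain n where n: "n \<in> kys \<rho>" "dotz (- e) n = hz (kys \<rho>) (- e)" by (rule hz_attained[OF finite_keys k(2)])
  have nL: "dotz e n = L" using n by (simp add: L_def)
  have le: "dotz e m \<ge> L" if "m \<in> kys \<rho>" for m using hz_ge[OF _ that, of "- e"] by (simp add: L_def)
  have mn: "m = n + sm (int (nat (dotz e m - L))) (rot w)" if m: "m \<in> kys \<rho>" for m
  proof -
    have "dotz w (m - n) = 0" using k(1) m n(1) by (auto simp: level_def)
    then obtain j where j: "m - n = sm j (rot w)" using orth_prim[OF w] by blast
    have "dotz e (m - n) = j" unfolding j by (simp add: e)
    then have "dotz e m - L = j" using nL by simp
    then show ?thesis using j le[OF m] by (simp add: algebra_simps)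
  qed
  define p where "p = (\<Sum>m\<in>kys \<rho>. Polynomial.monom (lk \<rho> m) (nat (dotz e m - L)))"
  have "mon n * pe (mon (rot w)) p = (\<Sum>m\<in>kys \<rho>. CC (lk \<rho> m) * mon (n + sm (int (nat (dotz e m - L))) (rot w)))"
    by (simp add: p_def pe_sum pe_monom mon_power sum_distrib_left mon_add mult_ac)
  also have "\<dots> = (\<Sum>m\<in>kys \<rho>. CC (lk \<rho> m) * mon m)" by (rule sum.cong[OF refl]) (metis mn)
  also have "\<dots> = \<rho>" by (subst (3) lau_decomp) (simp add: CC_def mon_def mult_single)
  finally have e1: "\<rho> = mon n * pe (mon (rot w)) p" by simp
  have "poly p 0 = (\<Sum>m\<in>kys \<rho>. if m = n then lk \<rho> m else 0)"
    unfolding p_def poly_sum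
  proof (rule sum.cong[OF refl])
    fix m assume m: "m \<in> kys \<rho>"
    show "poly (Polynomial.monom (lk \<rho> m) (nat (dotz e m - L))) 0 = (if m = n then lk \<rho> m else 0)"
    proof (cases "dotz e m = L")
      case True then show ?thesis using mn[OF m] by (simp add: poly_monom)
    next
      case False
      then have "m \<noteq> n" "nat (dotz e m - L) \<noteq> 0" using nL le[OF m] by auto
      then show ?thesis by (simp add: poly_monom)
    qed
  qed
  then have e2: "poly p 0 \<noteq> 0" using n(1) by (simp add: in_keys_iff)
  have e3: "ev q \<rho> = mp q n * poly p (mp q (rot w))" if q: "torus q" for q
  proof -
    have "ev q (pe z r) = poly r (ev q z)" for z r by (induction r) (simp_all add: ev_mult[OF q])
    then show ?thesis by (subst e1) (simp add: ev_mult[OF q])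
  qed
  show thesis by (rule that[OF e1 e2]) (use e3 in blast)
qed

section \<open>Values of sections at the boundary points of the curve\<close>

context prime_curve
begin

text \<open>The value at a boundary point \<open>q\<close> of the curve; by \<open>zt_rep\<close> the choice does not matter.\<close>

definition zt :: "lat \<Rightarrow> complex \<times> complex \<Rightarrow> lau \<Rightarrow> complex" where
  "zt w q t = ev q (row w (hz H w) (SOME t'. bd w (hz H w) t' \<and> f dvd t - t'))"

lemma row_add: "row w c (s + t) = row w c s + row w c t"
  by (rule poly_mapping_eqI) (simp add: lk_restr lookup_add)
lemma row_CC: "row w c (CC a * t) = CC a * row w c t"
  by (rule poly_mapping_eqI) (simp add: lk_restr)

lemma bd_f: "bd w (hz A w) f" unfolding bd_def kfA using hz_ge[OF pgD(1)[OF pgs(1)]] by blast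

text \<open>Two admissible representatives differ by some \<open>f * s\<close>. The top row of this
  difference is a multiple of the top row of \<open>f\<close>, which vanishes at
  \<open>q\<close>.\<close>

lemma zt_rep:
  assumes q: "torus q" "ev q (row w (hz A w) f) = 0" and t': "bd w (hz H w) t'" "f dvd t - t'"
  shows "zt w q t = ev q (row w (hz H w) t')"
proof -
  let ?P = "\<lambda>t'. bd w (hz H w) t' \<and> f dvd t - t'"
  define t'' where "t'' = (SOME t'. ?P t')"
  have t'': "?P t''" unfolding t''_def by (rule someI[of ?P t']) (use t' in blast)
  have "f dvd (t - t') - (t - t'')" by (rule dvd_diff[OF t'(2)]) (use t'' in blast)
  then obtain s where s: "t'' - t' = f * s" by (auto elim: dvdE)
  have bs: "bd w (hz H w) (f * s)" unfolding s[symmetric] using t' t'' by (intro bd_diff) blast+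
  have "bd w (hz H w - hz A w) s"
  proof (cases "s = 0")
    case False
    have "f * s \<noteq> 0" by (rule lau_mult_nz[OF f0 False])
    then have "hz (kys (f * s)) w \<le> hz H w" using bs unfolding bd_def by (intro hz_leI) auto
    then have "hz (kys s) w \<le> hz H w - hz A w" unfolding hz_mult[OF f0 False] kfA by simp
    then show ?thesis unfolding bd_def using hz_ge[of "kys s"] by (meson finite_keys order_trans)
  qed (simp add: bd_def)
  then have "row w (hz H w) (f * s) = row w (hz A w) f * row w (hz H w - hz A w) s"
    using row_mult[OF bd_f, of w "hz H w - hz A w" s] by simp
  then have "ev q (row w (hz H w) (t'' - t')) = 0" unfolding s by (simp add: ev_mult[OF q(1)] q(2))
  then show ?thesis unfolding zt_def t''_def[symmetric] row_diff by simp
qed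

lemma V1_rep: assumes "t \<in> V1" obtains t' where "bd w (hz H w) t'" "f dvd t - t'"
  using V1_bd[OF assms, of w] by (metis dvd_triv_left)

lemma zt_linear:
  assumes q: "torus q" "ev q (row w (hz A w) f) = 0"
  shows "s \<in> V1 \<Longrightarrow> t \<in> V1 \<Longrightarrow> zt w q (s + t) = zt w q s + zt w q t"
    "t \<in> V1 \<Longrightarrow> zt w q (CC c * t) = c * zt w q t" "zt w q (f * g) = 0"
proof -
  assume s: "s \<in> V1" and t: "t \<in> V1"
  obtain s' where s': "bd w (hz H w) s'" "f dvd s - s'" using V1_rep s by blast
  obtain t' where t': "bd w (hz H w) t'" "f dvd t - t'" using V1_rep t by blast
  have "(s + t) - (s' + t') = (s - s') + (t - t')" by simp
  then have d: "f dvd (s + t) - (s' + t')" using s'(2) t'(2) by (simp only: dvd_add)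
  show "zt w q (s + t) = zt w q s + zt w q t"
    unfolding zt_rep[OF q bd_add[OF s'(1) t'(1)] d] zt_rep[OF q s'] zt_rep[OF q t'] row_add by simp
next
  assume t: "t \<in> V1"
  obtain t' where t': "bd w (hz H w) t'" "f dvd t - t'" using V1_rep t by blast
  have b: "bd w (hz H w) (CC c * t')" using t'(1) unfolding bd_def by (auto simp: in_keys_iff)
  have "CC c * t - CC c * t' = CC c * (t - t')" by (simp add: algebra_simps)
  then have d: "f dvd CC c * t - CC c * t'" using t'(2) by simp
  show "zt w q (CC c * t) = c * zt w q t" unfolding zt_rep[OF q b d] zt_rep[OF q t'] row_CC by simp
next
  have "row w (hz H w) 0 = 0" by (rule poly_mapping_eqI) (simp add: lk_restr)
  then show "zt w q (f * g) = 0" using zt_rep[OF q, of 0 "f * g"] by (simp add: bd_def)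
qed

lemma zt_mon:
  assumes q: "torus q" "ev q (row w (hz A w) f) = 0"
  obtains v where "v \<in> H" "zt w q (mon v) \<noteq> 0"
proof -
  obtain v where v: "v \<in> H" "dotz w v = hz H w" using hz_attained pgD[OF pgs(2)] by blast
  have "row w (hz H w) (mon v) = mon v" by (rule row_self) (simp add: kys_mon level_def v)
  then have "zt w q (mon v) = mp q v" using zt_rep[OF q, of "mon v" "mon v"] v(2) by (simp add: bd_def kys_mon)
  then show thesis using that v(1) mp_nz[OF q(1)] by simp
qed

text \<open>\<open>Z\<close> collects the boundary points of the curve, the zeros of the leading forms of \<open>f\<close> in the edge directions
  of \<open>H\<close>.\<close>

lemma good_if_boundary_values:
  obtains Z where "finite Z" "\<And>w q. (w, q) \<in> Z \<Longrightarrow> torus q \<and> ev q (row w (hz A w) f) = 0"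
    "\<And>u. u \<in> V1 \<Longrightarrow> (\<And>w q. (w, q) \<in> Z \<Longrightarrow> zt w q u \<noteq> 0) \<Longrightarrow> good u"
proof -
  have "\<exists>Q. finite Q \<and> (\<forall>q\<in>Q. torus q \<and> ev q (row w (hz A w) f) = 0) \<and>
     (\<forall>u'. (\<forall>q\<in>Q. ev q (row w (hz H w) u') \<noteq> 0) \<longrightarrow> (\<exists>\<alpha> \<beta>. \<alpha> * row w (hz A w) f + \<beta> * row w (hz H w) u' = 1))"
    if w: "w \<in> normals H" for w
  proof -
    have pw: "prim w" using w by (rule normals_prim)
    obtain e where e: "dotz e (rot w) = 1" using prim_bezout[of "rot w"] pw by (auto simp: dotz_commute)
    let ?E = "rot w" and ?rf = "row w (hz A w) f"
    have krf: "kys ?rf \<subseteq> level w (hz A w)" by (simp add: kys_restr)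
    obtain a where a: "a \<in> A" "dotz w a = hz A w" using hz_attained pgD[OF pgs(1)] by blast
    have ne: "kys ?rf \<noteq> {}" using a by (auto simp: kys_restr kfA level_def)
    obtain nf pf where pf: "?rf = mon nf * pe (mon ?E) pf" "poly pf 0 \<noteq> 0"
      "\<forall>q. torus q \<longrightarrow> ev q ?rf = mp q nf * poly pf (mp q ?E)"
      by (rule homogeneous_poly[OF pw krf ne e])
    \<comment> \<open>A torus point with \<open>mp (qr x) (rot w) = x\<close>, since
      \<open>e\<close> pairs to one with \<open>rot w\<close>; every root of \<open>pf\<close> is
      realised in this way.\<close>
    define qr where "qr = (\<lambda>x::complex. (x powi fst e, x powi snd e))"
    have qt: "torus (qr x)" if "x \<noteq> 0" for x using that by (simp add: qr_def torus_def)
    have qE: "mp (qr x) ?E = x" if "x \<noteq> 0" for x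
    proof -
      have "mp (qr x) ?E = x powi (dotz e ?E)"
        using that by (simp add: mp_def qr_def dotz_def power_int_mult power_int_add)
      then show ?thesis using e by simp
    qed
    have pf0: "pf \<noteq> 0" using pf(2) by auto
    let ?Q = "qr ` {x. poly pf x = 0}"
    have nz: "x \<noteq> 0" if "poly pf x = 0" for x using that pf(2) by auto
    have "\<exists>\<alpha> \<beta>. \<alpha> * ?rf + \<beta> * row w (hz H w) u' = 1" if u': "\<forall>q\<in>?Q. ev q (row w (hz H w) u') \<noteq> 0" for u'
    proof -
      let ?ru = "row w (hz H w) u'"
      have "\<exists>nu pu. ?ru = mon nu * pe (mon ?E) pu \<and> (\<forall>q. torus q \<longrightarrow> ev q ?ru = mp q nu * poly pu (mp q ?E))"
      proof (cases "kys ?ru = {}")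
        case True then show ?thesis by (intro exI[of _ 0]) simp
      next
        case False
        have "kys ?ru \<subseteq> level w (hz H w)" by (simp add: kys_restr)
        from homogeneous_poly[OF pw this False e] show ?thesis by metis
      qed
      then obtain nu pu where pu: "?ru = mon nu * pe (mon ?E) pu" "\<And>q. torus q \<Longrightarrow> ev q ?ru = mp q nu * poly pu (mp q ?E)" by blast
      have "poly pu x \<noteq> 0" if x: "poly pf x = 0" for x
      proof -
        have "qr x \<in> ?Q" using x by (intro imageI) simp
        then have "ev (qr x) ?ru \<noteq> 0" using u' by blast
        then show ?thesis using pu(2)[OF qt[OF nz[OF x]]] qE[OF nz[OF x]] by auto
      qed
      then obtain s t where "s * pf + t * pu = 1" by (rule complex_bezout)
      then have "pe (mon ?E) s * pe (mon ?E) pf + pe (mon ?E) t * pe (mon ?E) pu = 1" by (simp flip: pe_mult pe_add)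
      then have "(mon (- nf) * pe (mon ?E) s) * ?rf + (mon (- nu) * pe (mon ?E) t) * ?ru = 1"
        unfolding pf(1) pu(1) mon_absorb .
      then show ?thesis by (intro exI)
    qed
    moreover have "finite ?Q" using poly_roots_finite[OF pf0] by simp
    moreover have "\<forall>q\<in>?Q. torus q \<and> ev q ?rf = 0" using qt qE nz pf(3) by auto
    ultimately show ?thesis by blast
  qed
  then obtain Q where Q: "\<And>w. w \<in> normals H \<Longrightarrow> finite (Q w)"
    "\<And>w q. w \<in> normals H \<Longrightarrow> q \<in> Q w \<Longrightarrow> torus q \<and> ev q (row w (hz A w) f) = 0"
    "\<And>w u'. w \<in> normals H \<Longrightarrow> (\<forall>q\<in>Q w. ev q (row w (hz H w) u') \<noteq> 0) \<Longrightarrow> \<exists>\<alpha> \<beta>. \<alpha> * row w (hz A w) f + \<beta> * row w (hz H w) u' = 1"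
    by metis
  let ?Z = "Sigma (normals H) Q"
  show thesis
  proof (rule that[of ?Z])
    show "finite ?Z" using finite_normals[OF pgD(1)[OF pgs(2)]] Q(1) by (rule finite_SigmaI)
    show "\<And>w q. (w, q) \<in> ?Z \<Longrightarrow> torus q \<and> ev q (row w (hz A w) f) = 0" using Q(2) by blast
    fix u assume u: "u \<in> V1" "\<And>w q. (w, q) \<in> ?Z \<Longrightarrow> zt w q u \<noteq> 0"
    show "good u" unfolding good_def
    proof
      fix w assume w: "w \<in> normals H"
      obtain u' s where u': "u - u' = f * s" "bd w (hz H w) u'" by (rule V1_bd[OF u(1)])
      have "ev q (row w (hz H w) u') \<noteq> 0" if "q \<in> Q w" for q
        using u(2)[of w q] w that zt_rep[of q w u' u] Q(2)[OF w that] u' by simp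
      then show "\<exists>u' s \<alpha> \<beta>. u - u' = f * s \<and> bd w (hz H w) u' \<and> \<alpha> * row w (hz A w) f + \<beta> * row w (hz H w) u' = 1"
        using Q(3)[OF w, of u'] u' by blast
    qed
  qed
qed

end

section \<open>Perturbing a functional\<close>

definition nd :: "nat \<Rightarrow> (nat \<Rightarrow> nat \<Rightarrow> complex) \<Rightarrow> bool" where
  "nd n M \<longleftrightarrow> (\<forall>x. (\<forall>i<n. (\<Sum>j<n. M i j * x j) = 0) \<longrightarrow> (\<forall>j<n. x j = 0))"

lemma nd_det: "nd n M \<longleftrightarrow> Determinant.det (Matrix.mat n n (\<lambda>(i, j). M i j)) \<noteq> 0"
proof -
  let ?A = "Matrix.mat n n (\<lambda>(i, j). M i j)"
  have mv: "(?A *\<^sub>v v = 0\<^sub>v n) \<longleftrightarrow> (\<forall>i<n. (\<Sum>j<n. M i j * vec_index v j) = 0)" if "v \<in> carrier_vec n" for v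
    using that by (simp add: Matrix.vec_eq_iff Matrix.scalar_prod_def atLeast0LessThan)
  have "(\<not> nd n M) \<longleftrightarrow> (\<exists>v\<in>carrier_vec n. v \<noteq> 0\<^sub>v n \<and> ?A *\<^sub>v v = 0\<^sub>v n)"
  proof
    assume "\<not> nd n M"
    then obtain x j where x: "\<forall>i<n. (\<Sum>j<n. M i j * x j) = 0" "j < n" "x j \<noteq> 0" unfolding nd_def by blast
    let ?v = "Matrix.vec n x"
    have c: "?v \<in> carrier_vec n" by simp
    have "?v \<noteq> 0\<^sub>v n" using x(2,3) by (metis index_vec index_zero_vec(1))
    moreover have "?A *\<^sub>v ?v = 0\<^sub>v n" unfolding mv[OF c] using x(1) by simp
    ultimately show "\<exists>v\<in>carrier_vec n. v \<noteq> 0\<^sub>v n \<and> ?A *\<^sub>v v = 0\<^sub>v n" using c by blast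
  next
    assume "\<exists>v\<in>carrier_vec n. v \<noteq> 0\<^sub>v n \<and> ?A *\<^sub>v v = 0\<^sub>v n"
    then obtain v where v: "v \<in> carrier_vec n" "v \<noteq> 0\<^sub>v n" "?A *\<^sub>v v = 0\<^sub>v n" by blast
    then obtain j where "j < n" "vec_index v j \<noteq> 0" by (metis carrier_vecD eq_vecI index_zero_vec)
    then show "\<not> nd n M" using v(3) unfolding mv[OF v(1)] nd_def by blast
  qed
  then show ?thesis using det_0_iff_vec_prod_zero[of ?A n] by auto
qed

text \<open>The determinant is a polynomial in \<open>\<mu>\<close> that is nonzero at zero.\<close>

lemma nd_perturb: assumes "nd n M" shows "finite {\<mu>. \<not> nd n (\<lambda>i j. M i j + \<mu> * B i j)}"
proof -
  define P where "P = (\<Sum>p | p permutes {0..<n}. signof p * (\<Prod>i = 0..<n. [:M i (p i), B i (p i):]))"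
  have "Determinant.det (Matrix.mat n n (\<lambda>(i, j). M i j + \<mu> * B i j)) = poly P \<mu>" for \<mu>
  proof -
    have s: "poly (signof p :: complex poly) \<mu> = signof p" for p :: "nat \<Rightarrow> nat" by (simp add: sign_def)
    show ?thesis unfolding P_def poly_sum det_def'[OF mat_carrier]
    proof (rule sum.cong[OF refl])
      fix p assume "p \<in> {p. p permutes {0..<n}}"
      then have pn: "p i < n" if "i < n" for i using that permutes_in_image[of p "{0..<n}" i] by simp
      have "(\<Prod>i = 0..<n. Matrix.mat n n (\<lambda>(i, j). M i j + \<mu> * B i j) $$ (i, p i)) = (\<Prod>i = 0..<n. M i (p i) + \<mu> * B i (p i))"
        by (rule prod.cong[OF refl]) (simp add: pn)
      then show "signof p * (\<Prod>i = 0..<n. Matrix.mat n n (\<lambda>(i, j). M i j + \<mu> * B i j) $$ (i, p i))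
          = poly (signof p * (\<Prod>i = 0..<n. [:M i (p i), B i (p i):])) \<mu>" by (simp add: poly_prod s)
    qed
  qed
  then have e: "(\<not> nd n (\<lambda>i j. M i j + \<mu> * B i j)) \<longleftrightarrow> poly P \<mu> = 0" for \<mu> unfolding nd_det by simp
  have "poly P 0 \<noteq> 0" using e[of 0] assms by simp
  then have "P \<noteq> 0" by auto
  then show ?thesis unfolding e by (rule poly_roots_finite)
qed


lemma nd_solve:
  assumes "nd n M" obtains y where "\<And>i. i < n \<Longrightarrow> (\<Sum>j<n. M i j * y j) = z i"
proof -
  obtain x where x: "\<exists>i\<in>{..n}. x i \<noteq> 0" "\<forall>j\<in>{..<n}. (\<Sum>i\<in>{..n}. x i * (if i < n then M j i else - z j)) = 0"
    using underdetermined[of "{..<n}" "{..n}" "\<lambda>i j. if i < n then M j i else - z j"] by auto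
  have e: "(\<Sum>i<n. M j i * x i) = x n * z j" if "j < n" for j
  proof -
    have "(\<Sum>i\<le>n. x i * (if i < n then M j i else - z j)) = (\<Sum>i<n. M j i * x i) - x n * z j"
      by (simp add: lessThan_Suc_atMost[symmetric] mult.commute)
    then show ?thesis using x(2) that by simp
  qed
  have "x n \<noteq> 0"
  proof
    assume "x n = 0"
    then have "\<forall>i<n. x i = 0" using assms e unfolding nd_def by simp
    then show False using x(1) \<open>x n = 0\<close> by (metis atMost_iff le_neq_implies_less)
  qed
  then have "(\<Sum>j<n. M i j * (x j / x n)) = z i" if "i < n" for i
    using e[OF that] by (simp add: sum_divide_distrib[symmetric])
  then show thesis by (rule that)
qed

lemma real_avoid: fixes B :: "complex set" assumes "finite B" obtains r :: real where "r > K" "complex_of_real r + c \<notin> B"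
proof -
  let ?g = "\<lambda>r. complex_of_real r + c"
  have "inj ?g" by (simp add: inj_def)
  then have "finite (?g -` B)" using assms by (rule finite_vimageI[rotated])
  then have "\<not> {K<..} \<subseteq> ?g -` B" using infinite_Ioi[of K] finite_subset by blast
  then show thesis using that by blast
qed

text \<open>With \<open>l = 1 + \<i> * s\<close> each forbidden equation is a polynomial of degree
  at most one in the real parameter \<open>s\<close>; it is not identically zero because
  \<open>a\<close> is nonzero.\<close>

lemma unit_avoid:
  assumes "finite AB" "\<And>a b. (a, b) \<in> AB \<Longrightarrow> a \<noteq> 0"
  obtains l :: complex where "\<And>a b. (a, b) \<in> AB \<Longrightarrow> l * a + cnj l * b \<noteq> 0"
proof -
  define pp where "pp = (\<lambda>z. [:fst z + snd z, \<i> * (fst z - snd z):] :: complex poly)"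
  have "pp z \<noteq> 0" if "z \<in> AB" for z using assms(2)[of "fst z" "snd z"] that by (auto simp: pp_def)
  then have "finite (\<Union>z\<in>AB. {x. poly (pp z) x = 0})" using assms(1) poly_roots_finite by blast
  then obtain s :: real where s: "s > 0" "complex_of_real s + 0 \<notin> (\<Union>z\<in>AB. {x. poly (pp z) x = 0})" by (rule real_avoid)
  show thesis
  proof (rule that[of "1 + \<i> * of_real s"])
    fix a b assume ab: "(a, b) \<in> AB"
    have "poly (pp (a, b)) (of_real s) \<noteq> 0" using s(2) ab by auto
    then show "(1 + \<i> * of_real s) * a + cnj (1 + \<i> * of_real s) * b \<noteq> 0" by (simp add: pp_def algebra_simps)
  qed
qed

lemma square_sum_bound: fixes g :: "'a \<Rightarrow> real" shows "(\<Sum>i\<in>I. g i)\<^sup>2 \<le> card I * (\<Sum>i\<in>I. (g i)\<^sup>2)"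
  using sum_squared_le_sum_of_squares[of g I] by (simp add: mult.commute)

lemma ev_square_bound:
  assumes q: "torus q" and H: "finite H"
  obtains C where "\<And>v. kys v \<subseteq> H \<Longrightarrow> cmod (ev q (v * cj v)) \<le> C * (\<Sum>n\<in>H. (cmod (lk v n))\<^sup>2)"
proof -
  define K where "K = (\<Sum>n\<in>H. cmod (mp q n))"
  have b: "cmod (ev q v) \<le> K * (\<Sum>n\<in>H. cmod (lk v n))" if "kys v \<subseteq> H" for v
  proof -
    have "cmod (ev q v) \<le> (\<Sum>n\<in>H. cmod (lk v n * mp q n))" unfolding ev_super[OF H that] by (rule norm_sum)
    also have "\<dots> \<le> (\<Sum>n\<in>H. K * cmod (lk v n))"
    proof (rule sum_mono)
      fix n assume n: "n \<in> H"
      have "cmod (mp q n) \<le> K" unfolding K_def by (rule member_le_sum[OF n _ H]) simp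
      then show "cmod (lk v n * mp q n) \<le> K * cmod (lk v n)" unfolding norm_mult by (subst mult.commute) (rule mult_right_mono[OF _ norm_ge_zero])
    qed
    finally show ?thesis by (simp add: sum_distrib_left)
  qed
  have K0: "K \<ge> 0" unfolding K_def by (simp add: sum_nonneg)
  show thesis
  proof (rule that[of "K\<^sup>2 * card H"])
    fix v assume v: "kys v \<subseteq> H"
    let ?S = "\<Sum>n\<in>H. cmod (lk v n)"
    have S0: "?S \<ge> 0" by (simp add: sum_nonneg)
    have 1: "cmod (ev q (cj v)) \<le> K * ?S" using b[of "cj v"] v by simp
    have "cmod (ev q (v * cj v)) \<le> (K * ?S) * (K * ?S)"
      unfolding ev_mult[OF q] norm_mult by (intro mult_mono b v 1 mult_nonneg_nonneg K0 S0 norm_ge_zero)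
    also have "\<dots> = K\<^sup>2 * ?S\<^sup>2" by (simp add: power2_eq_square)
    also have "\<dots> \<le> K\<^sup>2 * (card H * (\<Sum>n\<in>H. (cmod (lk v n))\<^sup>2))" by (intro mult_left_mono square_sum_bound) simp
    finally show "cmod (ev q (v * cj v)) \<le> K\<^sup>2 * card H * (\<Sum>n\<in>H. (cmod (lk v n))\<^sup>2)" by simp
  qed
qed

section \<open>Functionals on products of sections\<close>

context prime_curve
begin

text \<open>Total functions stand for functionals on \<open>V 2\<close>, and with
  \<open>lin1\<close> on \<open>V1\<close>, that vanish on the multiples of \<open>f\<close>; values
  elsewhere are arbitrary.\<close>

definition lin :: "(lau \<Rightarrow> complex) \<Rightarrow> bool" where
  "lin L \<longleftrightarrow> (\<forall>s\<in>V 2. \<forall>t\<in>V 2. L (s + t) = L s + L t) \<and> (\<forall>c. \<forall>t\<in>V 2. L (CC c * t) = c * L t) \<and> (\<forall>g. L (f * g) = 0)"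
definition lin1 :: "(lau \<Rightarrow> complex) \<Rightarrow> bool" where
  "lin1 L \<longleftrightarrow> (\<forall>s\<in>V1. \<forall>t\<in>V1. L (s + t) = L s + L t) \<and> (\<forall>c. \<forall>t\<in>V1. L (CC c * t) = c * L t) \<and> (\<forall>g. L (f * g) = 0)"

lemma linD: assumes "lin L"
  shows "s \<in> V 2 \<Longrightarrow> t \<in> V 2 \<Longrightarrow> L (s + t) = L s + L t" "t \<in> V 2 \<Longrightarrow> L (CC c * t) = c * L t" "L (f * g) = 0"
  using assms unfolding lin_def by blast+
lemma lin1D: assumes "lin1 L"
  shows "s \<in> V1 \<Longrightarrow> t \<in> V1 \<Longrightarrow> L (s + t) = L s + L t" "t \<in> V1 \<Longrightarrow> L (CC c * t) = c * L t" "L (f * g) = 0"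
  using assms unfolding lin1_def by blast+

lemma lin_comb: "lin L \<Longrightarrow> lin M \<Longrightarrow> lin (\<lambda>t. a * L t + b * M t)"
  unfolding lin_def by (simp add: algebra_simps)
lemma lin_ev: "torus p \<Longrightarrow> ev p f = 0 \<Longrightarrow> lin (ev p)"
  unfolding lin_def by (simp add: ev_mult)
lemma lin1_ev: "torus p \<Longrightarrow> ev p f = 0 \<Longrightarrow> lin1 (ev p)"
  unfolding lin1_def by (simp add: ev_mult)
lemma lin_sum: "(\<And>k. k \<in> K \<Longrightarrow> lin (L k)) \<Longrightarrow> lin (\<lambda>t. \<Sum>k\<in>K. L k t)"
  unfolding lin_def by (simp add: sum.distrib sum_distrib_left)

lemma lin1_mult: assumes L: "lin L" and s: "s \<in> V1" shows "lin1 (\<lambda>t. L (s * t))"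
proof -
  have "L (s * (f * g)) = 0" for g using linD(3)[OF L, of "s * g"] by (simp only: mult.left_commute)
  moreover have "L (s * (x + y)) = L (s * x) + L (s * y)" if "x \<in> V1" "y \<in> V1" for x y
    unfolding distrib_left by (rule linD(1)[OF L]) (intro V1_V1 s that)+
  moreover have "L (s * (CC c * x)) = c * L (s * x)" if "x \<in> V1" for c x
    unfolding mult.left_commute[of s] by (rule linD(2)[OF L]) (intro V1_V1 s that)
  ultimately show ?thesis unfolding lin1_def by blast
qed

lemma lin1_sum: assumes L: "lin1 L" and t: "\<And>j. j \<in> J \<Longrightarrow> t j \<in> V1" shows "L (\<Sum>j\<in>J. CC (c j) * t j) = (\<Sum>j\<in>J. c j * L (t j))"
  using t
proof (induction J rule: infinite_finite_induct)
  case (insert j J)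
  have "(\<Sum>j\<in>J. CC (c j) * t j) \<in> V1" by (intro V1_sum V1_CC) (use insert in blast)
  moreover have tj: "t j \<in> V1" using insert by blast
  moreover have "L (\<Sum>j\<in>J. CC (c j) * t j) = (\<Sum>j\<in>J. c j * L (t j))" using insert by blast
  ultimately show ?case unfolding sum.insert[OF insert(1,2)] by (simp only: lin1D[OF L] V1_CC)
qed (use lin1D(3)[OF L, of 0] in simp_all)

definition full_basis :: "nat \<Rightarrow> (nat \<Rightarrow> complex \<times> complex) \<Rightarrow> (nat \<Rightarrow> lau) \<Rightarrow> bool" where
  "full_basis d q b \<longleftrightarrow> dual_basis d q b \<and> 0 < d \<and> (\<forall>t\<in>V1. f dvd t - (\<Sum>j<d. CC (ev (q j) t) * b j))"

lemma lin1_expand: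
  assumes fb: "full_basis d q b" and L: "lin1 L" and t: "t \<in> V1"
  shows "L t = (\<Sum>j<d. ev (q j) t * L (b j))"
proof -
  have bV: "b j \<in> V1" if "j < d" for j using fb that unfolding full_basis_def dual_basis_def by blast
  have "f dvd t - (\<Sum>j<d. CC (ev (q j) t) * b j)" using fb t unfolding full_basis_def by blast
  then obtain g where g: "t - (\<Sum>j<d. CC (ev (q j) t) * b j) = f * g" by (elim dvdE)
  have "(\<Sum>j<d. CC (ev (q j) t) * b j) \<in> V1" by (intro V1_sum V1_CC bV) simp
  then have "L (f * g + (\<Sum>j<d. CC (ev (q j) t) * b j)) = L (f * g) + L (\<Sum>j<d. CC (ev (q j) t) * b j)"
    by (intro lin1D(1)[OF L] V1_f)
  also have "\<dots> = (\<Sum>j<d. ev (q j) t * L (b j))" using lin1_sum[OF L, of "{..<d}" b] bV lin1D(3)[OF L] by simp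
  finally show ?thesis unfolding g[symmetric] by simp
qed

lemma riesz:
  assumes fb: "full_basis d q b" and L: "lin L" and n: "nd d (\<lambda>i j. L (b i * b j))" and Z: "lin1 Z"
  obtains w where "w \<in> V1" "\<And>t. t \<in> V1 \<Longrightarrow> L (w * t) = Z t"
proof -
  have bV: "b j \<in> V1" if "j < d" for j using fb that unfolding full_basis_def dual_basis_def by blast
  obtain y where y: "\<And>i. i < d \<Longrightarrow> (\<Sum>j<d. L (b i * b j) * y j) = Z (b i)" using nd_solve[OF n, of "\<lambda>i. Z (b i)"] by metis
  define w where "w = (\<Sum>j<d. CC (y j) * b j)"
  have wV: "w \<in> V1" unfolding w_def by (intro V1_sum V1_CC bV) simp
  have wb: "L (w * b i) = Z (b i)" if i: "i < d" for i
  proof -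
    have "L (b i * w) = (\<Sum>j<d. y j * L (b i * b j))"
      unfolding w_def using lin1_sum[OF lin1_mult[OF L bV[OF i]], of "{..<d}" b y] bV by simp
    then show ?thesis using y[OF i] by (simp add: mult.commute)
  qed
  show thesis
  proof (rule that[OF wV])
    fix t assume t: "t \<in> V1"
    show "L (w * t) = Z t"
      unfolding lin1_expand[OF fb lin1_mult[OF L wV] t] lin1_expand[OF fb Z t] using wb by simp
  qed
qed

definition real_functional :: "(lau \<Rightarrow> complex) \<Rightarrow> bool" where
  "real_functional L \<longleftrightarrow> lin L \<and> (\<forall>t\<in>V 2. L (cj t) = cnj (L t))"

text \<open>In a dual basis the sum \<open>L1\<close> of the evaluations has the identity as Gram
  matrix. It need not be real, so it is combined with its conjugate \<open>L2\<close>; for almost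
  all \<open>s\<close> the real functional \<open>M s\<close> is still nondegenerate. A large
  multiple \<open>r\<close> of \<open>L\<close> restores positivity, and a generic \<open>r\<close>
  keeps both determinants nonzero. The minor without index zero later makes the diagonal of the
  kernel of \<open>L'\<close> nonzero at a point.\<close>

lemma generic_functional:
  assumes cf: "cj f = f" and L: "real_functional L" and \<kappa>: "\<kappa> > 0"
    and pos: "\<And>v. kys v \<subseteq> H \<Longrightarrow> Re (L (v * cj v)) \<ge> \<kappa> * (\<Sum>n\<in>H. (cmod (lk v n))\<^sup>2)"
  obtains L' d q b where "real_functional L'" "full_basis d q b" "nd d (\<lambda>i j. L' (b i * b j))"
    "nd (d - 1) (\<lambda>i j. L' (b (Suc i) * b (Suc j)))"
    "\<And>v. kys v \<subseteq> H \<Longrightarrow> v \<noteq> 0 \<Longrightarrow> Re (L' (v * cj v)) > 0"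
proof -
  obtain d q b where db: "dual_basis d q b" "0 < d" "\<And>t. t \<in> V1 \<Longrightarrow> f dvd t - (\<Sum>j<d. CC (ev (q j) t) * b j)"
    by (rule dual_basis_exists) blast
  then have fb: "full_basis d q b" unfolding full_basis_def by blast
  have q: "torus (q j)" "ev (q j) f = 0" if "j < d" for j using fb that unfolding full_basis_def dual_basis_def by blast+
  have qc: "torus (cpt (q j))" "ev (cpt (q j)) f = 0" if "j < d" for j using q[OF that] ev_cpt[of "q j" f] cf by simp_all
  have dl: "ev (q i) (b j) = (if i = j then 1 else 0)" if "i < d" "j < d" for i j
    using fb that unfolding full_basis_def dual_basis_def by blast
  define L1 where "L1 = (\<lambda>t. \<Sum>k<d. ev (q k) t)"
  define L2 where "L2 = (\<lambda>t. \<Sum>k<d. ev (cpt (q k)) t)"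
  have l1: "lin L1" unfolding L1_def by (intro lin_sum lin_ev q) simp_all
  have l2: "lin L2" unfolding L2_def by (intro lin_sum lin_ev qc) simp_all
  have L1b: "L1 (b i * b j) = (if i = j then 1 else 0)" if ij: "i < d" "j < d" for i j
  proof -
    have "L1 (b i * b j) = (\<Sum>k<d. if k = i then (if i = j then 1 else 0) else 0)"
      unfolding L1_def by (rule sum.cong[OF refl]) (use q dl ij in \<open>auto simp: ev_mult\<close>)
    then show ?thesis using ij by simp
  qed
  have idn: "nd n (\<lambda>i j. 2 * L1 (b (g i) * b (g j)))" if g: "inj g" "\<And>i. i < n \<Longrightarrow> g i < d" for n g
  proof -
    have "(\<Sum>j<n. 2 * L1 (b (g i) * b (g j)) * x j) = 2 * x i" if i: "i < n" for i x
    proof -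
      have "(\<Sum>j<n. 2 * L1 (b (g i) * b (g j)) * x j) = (\<Sum>j<n. if i = j then 2 * x j else 0)"
        by (rule sum.cong[OF refl]) (use L1b g i in \<open>auto dest: injD\<close>)
      then show ?thesis using i by simp
    qed
    then show ?thesis unfolding nd_def by simp
  qed
  define M where "M = (\<lambda>s::real. \<lambda>t. (1 + \<i> * of_real s) * L1 t + (1 - \<i> * of_real s) * L2 t)"
  have Mfin: "finite {\<mu>. \<not> nd n (\<lambda>i j. 2 * L1 (b (g i) * b (g j)) + \<mu> * (\<i> * (L1 (b (g i) * b (g j)) - L2 (b (g i) * b (g j)))))}"
    if g: "inj g" "\<And>i. i < n \<Longrightarrow> g i < d" for n g
    by (rule nd_perturb[OF idn[OF g]])
  \<comment> \<open>The parameter value \<open>s + \<i>\<close> in the pencil through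
    \<open>2 * L1\<close> gives a functional compatible with conjugation.\<close>
  have Mid: "2 * L1 t + (of_real s + \<i>) * (\<i> * (L1 t - L2 t)) = M s t" for s t
    by (simp add: M_def algebra_simps)
  have g1: "inj (\<lambda>i. i)" "\<And>i. i < d \<Longrightarrow> i < d" by simp_all
  have g2: "inj Suc" "\<And>i. i < d - 1 \<Longrightarrow> Suc i < d" by auto
  obtain s :: real where "s > 0" and s: "of_real s + \<i> \<notin>
     {\<mu>. \<not> nd d (\<lambda>i j. 2 * L1 (b i * b j) + \<mu> * (\<i> * (L1 (b i * b j) - L2 (b i * b j))))} \<union>
     {\<mu>. \<not> nd (d - 1) (\<lambda>i j. 2 * L1 (b (Suc i) * b (Suc j)) + \<mu> * (\<i> * (L1 (b (Suc i) * b (Suc j)) - L2 (b (Suc i) * b (Suc j)))))}"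
    by (rule real_avoid[OF finite_UnI[OF Mfin[OF g1] Mfin[OF g2]]])
  have M1: "nd d (\<lambda>i j. M s (b i * b j))" and M2: "nd (d - 1) (\<lambda>i j. M s (b (Suc i) * b (Suc j)))"
    using s unfolding Un_iff mem_Collect_eq de_Morgan_disj not_not Mid by blast+
  have lL: "lin L" and rL: "\<And>t. t \<in> V 2 \<Longrightarrow> L (cj t) = cnj (L t)" using L unfolding real_functional_def by blast+
  have lM: "lin (M s)" unfolding M_def by (rule lin_comb[OF l1 l2])
  have c1: "L1 (cj t) = cnj (L2 t)" for t unfolding L1_def L2_def by (simp add: ev_cpt flip: ev_cpt) (simp add: cpt_def ev_cpt[unfolded cpt_def, symmetric])
  have c2: "L2 (cj t) = cnj (L1 t)" for t unfolding L1_def L2_def by (simp add: ev_cpt)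
  have rM: "M s (cj t) = cnj (M s t)" for t unfolding M_def c1 c2 by simp
  have fH: "finite H" using pgD[OF pgs(2)] by blast
  have "\<exists>C. \<forall>v. kys v \<subseteq> H \<longrightarrow> cmod (ev p (v * cj v)) \<le> C * (\<Sum>n\<in>H. (cmod (lk v n))\<^sup>2)" if "torus p" for p
    using ev_square_bound[OF that fH] by metis
  then obtain C where C: "\<And>p v. torus p \<Longrightarrow> kys v \<subseteq> H \<Longrightarrow> cmod (ev p (v * cj v)) \<le> C p * (\<Sum>n\<in>H. (cmod (lk v n))\<^sup>2)" by metis
  define C' where "C' = cmod (1 + \<i> * of_real s) * (\<Sum>k<d. C (q k)) + cmod (1 - \<i> * of_real s) * (\<Sum>k<d. C (cpt (q k)))"
  have Mb: "cmod (M s (v * cj v)) \<le> C' * (\<Sum>n\<in>H. (cmod (lk v n))\<^sup>2)" if v: "kys v \<subseteq> H" for v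
  proof -
    have 1: "cmod (L1 (v * cj v)) \<le> (\<Sum>k<d. C (q k)) * (\<Sum>n\<in>H. (cmod (lk v n))\<^sup>2)"
      unfolding L1_def sum_distrib_right by (rule order_trans[OF norm_sum sum_mono]) (use C q v in simp)
    have 2: "cmod (L2 (v * cj v)) \<le> (\<Sum>k<d. C (cpt (q k))) * (\<Sum>n\<in>H. (cmod (lk v n))\<^sup>2)"
      unfolding L2_def sum_distrib_right by (rule order_trans[OF norm_sum sum_mono]) (use C qc v in simp)
    have "cmod (M s (v * cj v)) \<le> cmod (1 + \<i> * of_real s) * cmod (L1 (v * cj v)) + cmod (1 - \<i> * of_real s) * cmod (L2 (v * cj v))"
      unfolding M_def by (rule order_trans[OF norm_triangle_ineq]) (simp only: norm_mult order_refl)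
    also have "\<dots> \<le> cmod (1 + \<i> * of_real s) * ((\<Sum>k<d. C (q k)) * (\<Sum>n\<in>H. (cmod (lk v n))\<^sup>2))
       + cmod (1 - \<i> * of_real s) * ((\<Sum>k<d. C (cpt (q k))) * (\<Sum>n\<in>H. (cmod (lk v n))\<^sup>2))"
      by (intro add_mono mult_left_mono 1 2 norm_ge_zero)
    also have "\<dots> = C' * (\<Sum>n\<in>H. (cmod (lk v n))\<^sup>2)" by (simp only: C'_def distrib_right mult.assoc)
    finally show ?thesis .
  qed
  obtain r :: real where r: "r > \<bar>C'\<bar> / \<kappa>" and r': "of_real r + 0 \<notin>
     {\<mu>. \<not> nd d (\<lambda>i j. M s (b i * b j) + \<mu> * L (b i * b j))} \<union>
     {\<mu>. \<not> nd (d - 1) (\<lambda>i j. M s (b (Suc i) * b (Suc j)) + \<mu> * L (b (Suc i) * b (Suc j)))}"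
    by (rule real_avoid[OF finite_UnI[OF nd_perturb[OF M1] nd_perturb[OF M2]]])
  define L' where "L' = (\<lambda>t. 1 * M s t + of_real r * L t)"
  show thesis
  proof (rule that[of L' d q b])
    show "real_functional L'" unfolding real_functional_def
    proof (intro conjI ballI)
      show "lin L'" unfolding L'_def by (rule lin_comb[OF lM lL])
      show "L' (cj t) = cnj (L' t)" if "t \<in> V 2" for t unfolding L'_def rM rL[OF that] by simp
    qed
    show "full_basis d q b" by (rule fb)
    show "nd d (\<lambda>i j. L' (b i * b j))" "nd (d - 1) (\<lambda>i j. L' (b (Suc i) * b (Suc j)))"
      using r' unfolding L'_def Un_iff mem_Collect_eq de_Morgan_disj not_not add_0_right mult_1 by blast+
    fix v assume v: "kys v \<subseteq> H" "v \<noteq> 0"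
    let ?S = "\<Sum>n\<in>H. (cmod (lk v n))\<^sup>2"
    obtain n where n: "n \<in> kys v" using v(2) by (metis ex_in_conv keys_eq_empty)
    have "?S > 0" by (rule sum_pos2[OF fH]) (use n v(1) in \<open>auto simp: in_keys_iff\<close>)
    have r0: "r > 0" using r \<kappa> by (meson abs_ge_zero divide_nonneg_pos order_le_less_trans)
    have "Re (L' (v * cj v)) = Re (M s (v * cj v)) + r * Re (L (v * cj v))" by (simp add: L'_def)
    also have "\<dots> \<ge> - (C' * ?S) + r * (\<kappa> * ?S)"
      using Mb[OF v(1)] abs_Re_le_cmod[of "M s (v * cj v)"] pos[OF v(1)] r0
      by (intro add_mono mult_left_mono) linarith+
    also have "- (C' * ?S) + r * (\<kappa> * ?S) = (r * \<kappa> - C') * ?S" by (simp add: algebra_simps)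
    finally have "Re (L' (v * cj v)) \<ge> (r * \<kappa> - C') * ?S" .
    moreover have "\<bar>C'\<bar> < r * \<kappa>" using r \<kappa> by (simp add: pos_divide_less_eq)
    then have "r * \<kappa> - C' > 0" by linarith
    ultimately show "Re (L' (v * cj v)) > 0" using \<open>?S > 0\<close> by (meson mult_pos_pos order_less_le_trans)
  qed
qed

lemma prime_prod: "finite Z \<Longrightarrow> (\<And>z. z \<in> Z \<Longrightarrow> \<not> f dvd g z) \<Longrightarrow> \<not> f dvd (\<Prod>z\<in>Z. g z)"
proof (induction Z rule: finite_induct)
  case empty
  then show ?case using f_not_dvd_mon[of 0] by simp
next
  case (insert z Z)
  then show ?case using prime[of "g z" "\<Prod>z\<in>Z. g z"] by auto
qed

lemma ev_prod: assumes "torus p" shows "ev p (\<Prod>z\<in>Z. g z) = (\<Prod>z\<in>Z. ev p (g z))"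
proof (induction Z rule: infinite_finite_induct)
  case (insert z Z) then show ?case by (simp add: ev_mult[OF assms])
qed (use ev_CC[of p 1] in \<open>simp_all add: CC_simps\<close>)

text \<open>\<open>wp p\<close> represents evaluation at \<open>p\<close> under \<open>L\<close>.
  For \<open>u\<close> the combination of \<open>wp p\<close> and its conjugate with coefficients
  \<open>l\<close> and \<open>cnj l\<close>, \<open>L (u * t)\<close> is \<open>l * t(p)\<close>
  plus \<open>cnj l\<close> times the value of \<open>t\<close> at the conjugate point. Adding
  evaluations with coefficients \<open>c = - l / u(p)\<close> and \<open>cnj c\<close> cancels this.
  The generic conditions on \<open>p\<close> are collected in one product not divisible by
  \<open>f\<close>.\<close>

lemma degenerate_functional:
  assumes cf: "cj f = f" and L0: "real_functional L0" and \<kappa>: "\<kappa> > 0"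
    and pos0: "\<And>v. kys v \<subseteq> H \<Longrightarrow> Re (L0 (v * cj v)) \<ge> \<kappa> * (\<Sum>n\<in>H. (cmod (lk v n))\<^sup>2)"
  obtains L' u p where "torus p" "ev p f = 0" "u \<in> V1" "cj u = u" "good u" "ev p u \<noteq> 0" "lin L'"
    "\<And>t. t \<in> V1 \<Longrightarrow> L' (u * t) = 0" "\<And>v. kys v \<subseteq> H \<Longrightarrow> v \<noteq> 0 \<Longrightarrow> ev p v = 0 \<Longrightarrow> Re (L' (v * cj v)) > 0"
proof -
  obtain L d q b where rL: "real_functional L" and fb: "full_basis d q b" and n1: "nd d (\<lambda>i j. L (b i * b j))"
    and n2: "nd (d - 1) (\<lambda>i j. L (b (Suc i) * b (Suc j)))"
    and pos: "\<And>v. kys v \<subseteq> H \<Longrightarrow> v \<noteq> 0 \<Longrightarrow> Re (L (v * cj v)) > 0"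
    by (rule generic_functional[OF cf L0 \<kappa> pos0]) blast+
  have L: "lin L" and cL: "\<And>t. t \<in> V 2 \<Longrightarrow> L (cj t) = cnj (L t)" using rL unfolding real_functional_def by blast+
  have d0: "0 < d" and bV: "\<And>j. j < d \<Longrightarrow> b j \<in> V1" and q: "\<And>j. j < d \<Longrightarrow> torus (q j)" "\<And>j. j < d \<Longrightarrow> ev (q j) f = 0"
    and dl: "\<And>i j. i < d \<Longrightarrow> j < d \<Longrightarrow> ev (q i) (b j) = (if i = j then 1 else 0)"
    using fb unfolding full_basis_def dual_basis_def by blast+
  have "\<exists>w. w \<in> V1 \<and> (\<forall>t\<in>V1. L (w * t) = ev (q j) t)" if "j < d" for j
    using riesz[OF fb L n1 lin1_ev[OF q(1)[OF that] q(2)[OF that]]] by metis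
  then obtain W where W: "\<And>j. j < d \<Longrightarrow> W j \<in> V1" "\<And>j t. j < d \<Longrightarrow> t \<in> V1 \<Longrightarrow> L (W j * t) = ev (q j) t" by metis
  \<comment> \<open>The diagonal of the reproducing kernel: at \<open>p\<close> it takes the value
    of \<open>wp p\<close> at \<open>p\<close>.\<close>
  define kap where "kap = (\<Sum>j<d. b j * W j)"
  define wp where "wp = (\<lambda>p. \<Sum>j<d. CC (ev p (b j)) * W j)"
  have wpV: "wp p \<in> V1" for p unfolding wp_def by (intro V1_sum V1_CC W) simp
  have wpL: "L (wp p * t) = ev p t" if p: "torus p" "ev p f = 0" and t: "t \<in> V1" for p t
  proof -
    have "L (t * wp p) = (\<Sum>j<d. ev p (b j) * L (t * W j))"
      unfolding wp_def using lin1_sum[OF lin1_mult[OF L t], of "{..<d}" W] W(1) by simp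
    also have "\<dots> = (\<Sum>j<d. ev (q j) t * ev p (b j))"
      by (rule sum.cong[OF refl]) (use W(2)[OF _ t] in \<open>simp add: mult.commute\<close>)
    also have "\<dots> = ev p t" by (rule lin1_expand[OF fb lin1_ev[OF p] t, symmetric])
    finally show ?thesis by (simp add: mult.commute)
  qed
  have kapwp: "ev p kap = ev p (wp p)" if "torus p" for p
    unfolding kap_def wp_def ev_sum by (simp add: ev_mult[OF that])
  \<comment> \<open>At \<open>q 0\<close> this is the corner entry of the inverse Gram matrix. If it
    were zero, the other coordinates of \<open>W 0\<close> would lie in the kernel of the minor,
    which is excluded by \<open>n2\<close>.\<close>
  have "ev (q 0) kap \<noteq> 0"
  proof
    assume z: "ev (q 0) kap = 0"
    have "ev (q 0) kap = (\<Sum>j<d. if j = 0 then ev (q 0) (W 0) else 0)"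
      unfolding kap_def ev_sum by (rule sum.cong[OF refl]) (use d0 q dl[of 0] in \<open>auto simp: ev_mult\<close>)
    then have z0: "ev (q 0) (W 0) = 0" using z d0 by simp
    have e: "(\<Sum>j<d. ev (q j) (W 0) * L (b i * b j)) = (if i = 0 then 1 else 0)" if i: "i < d" for i
    proof -
      have "L (b i * W 0) = (\<Sum>j<d. ev (q j) (W 0) * L (b i * b j))"
        by (rule lin1_expand[OF fb lin1_mult[OF L bV[OF i]] W(1)[OF d0]])
      moreover have "L (W 0 * b i) = ev (q 0) (b i)" by (rule W(2)[OF d0 bV[OF i]])
      ultimately show ?thesis using dl[OF d0 i] by (auto simp: mult.commute[of "W 0"])
    qed
    obtain d' where d': "d = Suc d'" using d0 by (cases d) auto
    have s: "(\<Sum>j<d'. L (b i * b (Suc j)) * ev (q (Suc j)) (W 0)) = (if i = 0 then 1 else 0)" if i: "i < d" for i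
      using e[OF i] z0 unfolding d' sum.lessThan_Suc_shift by (simp add: mult.commute[of "ev _ _"])
    have "\<forall>i<d'. (\<Sum>j<d'. L (b (Suc i) * b (Suc j)) * ev (q (Suc j)) (W 0)) = 0" using s d' by simp
    then have "\<forall>j<d'. ev (q (Suc j)) (W 0) = 0"
      using n2 unfolding nd_def d' diff_Suc_1 by (elim allE[of _ "\<lambda>j. ev (q (Suc j)) (W 0)"]) (rule mp)
    then show False using s[OF d0] by simp
  qed
  then have nk: "\<not> f dvd kap" using ev_dvd[OF q(1)[OF d0] q(2)[OF d0]] by blast
  obtain Z where Z: "finite Z" "\<And>w x. (w, x) \<in> Z \<Longrightarrow> torus x \<and> ev x (row w (hz A w) f) = 0"
    "\<And>u. u \<in> V1 \<Longrightarrow> (\<And>w x. (w, x) \<in> Z \<Longrightarrow> zt w x u \<noteq> 0) \<Longrightarrow> good u" by (rule good_if_boundary_values) blast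
  have ztl: "lin1 (zt w x)" if "(w, x) \<in> Z" for w x
    unfolding lin1_def using zt_linear[of x w] Z(2)[OF that] by blast
  \<comment> \<open>By symmetry the boundary value of \<open>wp p\<close> at \<open>z\<close> is the
    value of \<open>Y z\<close> at \<open>p\<close>, so nonvanishing at the boundary becomes a
    condition on \<open>p\<close>.\<close>
  have "\<exists>y. y \<in> V1 \<and> (\<forall>t\<in>V1. L (y * t) = zt (fst z) (snd z) t)" if "z \<in> Z" for z
  proof -
    have "lin1 (zt (fst z) (snd z))" using ztl[of "fst z" "snd z"] that by simp
    then show ?thesis using riesz[OF fb L n1] by metis
  qed
  then obtain Y where Y: "\<And>z. z \<in> Z \<Longrightarrow> Y z \<in> V1" "\<And>z t. z \<in> Z \<Longrightarrow> t \<in> V1 \<Longrightarrow> L (Y z * t) = zt (fst z) (snd z) t" by metis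
  have nY: "\<not> f dvd Y z" if z: "z \<in> Z" for z
  proof
    assume "f dvd Y z"
    then obtain g where g: "Y z = f * g" by (elim dvdE)
    have zz: "torus (snd z) \<and> ev (snd z) (row (fst z) (hz A (fst z)) f) = 0" using Z(2)[of "fst z" "snd z"] z by simp
    obtain v where v: "v \<in> H" "zt (fst z) (snd z) (mon v) \<noteq> 0" by (rule zt_mon[of "snd z" "fst z"]) (use zz in blast)+
    have "mon v \<in> V1" by (rule keysH_V1) (simp add: kys_mon v)
    from Y(2)[OF z this] show False using v(2) linD(3)[OF L, of "g * mon v"] by (simp add: g mult.assoc)
  qed
  have "\<not> f dvd kap * (\<Prod>z\<in>Z. Y z)" using prime[of kap "\<Prod>z\<in>Z. Y z"] nk prime_prod[of Z Y, OF Z(1) nY] by blast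
  then obtain p where p: "torus p" "ev p f = 0" "ev p (kap * (\<Prod>z\<in>Z. Y z)) \<noteq> 0" by (rule curve_point)
  have pk: "ev p (wp p) \<noteq> 0" using p(3) kapwp[OF p(1)] by (simp add: ev_mult[OF p(1)])
  have pY: "ev p (Y z) \<noteq> 0" if "z \<in> Z" for z
    using p(3) that Z(1) by (simp add: ev_mult[OF p(1)] ev_prod[OF p(1)] prod_zero_iff)
  let ?w = "wp p" and ?w' = "cj (wp p)"
  have w'V: "?w' \<in> V1" by (rule V1_cj[OF cf wpV])
  have tc: "torus (cpt p)" "ev (cpt p) f = 0" using p ev_cpt[of p f] cf by simp_all
  have w'L: "L (?w' * t) = ev (cpt p) t" if t: "t \<in> V1" for t
  proof -
    have ct: "cj t \<in> V1" by (rule V1_cj[OF cf t])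
    have "L (cj (?w * cj t)) = cnj (L (?w * cj t))" by (rule cL) (intro V1_V1 wpV ct)
    also have "\<dots> = ev (cpt p) (cj (cj t))" unfolding wpL[OF p(1,2) ct] by (rule ev_cpt[symmetric])
    finally show ?thesis by simp
  qed
  have zw: "zt (fst z) (snd z) ?w \<noteq> 0" if z: "z \<in> Z" for z
    using Y(2)[OF z wpV, of p] wpL[OF p(1,2) Y(1)[OF z]] pY[OF z] by (simp add: mult.commute)
  \<comment> \<open>Pairs of values of \<open>wp p\<close> and its conjugate; avoiding their zeros
    with \<open>l\<close> keeps the real combination \<open>u\<close> nonzero at \<open>p\<close>
    and at each boundary point.\<close>
  let ?AB = "insert (ev p ?w, ev p ?w') ((\<lambda>z. (zt (fst z) (snd z) ?w, zt (fst z) (snd z) ?w')) ` Z)"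
  have "finite ?AB" using Z(1) by simp
  then obtain l :: complex where l: "\<And>\<alpha> \<beta>. (\<alpha>, \<beta>) \<in> ?AB \<Longrightarrow> l * \<alpha> + cnj l * \<beta> \<noteq> 0"
    by (rule unit_avoid[of ?AB]) (use pk zw in auto)
  define u where "u = CC l * ?w + CC (cnj l) * ?w'"
  have uV: "u \<in> V1" unfolding u_def by (intro V1_add V1_CC wpV w'V)
  have cu: "cj u = u" by (simp add: u_def add.commute)
  have up: "ev p u \<noteq> 0" unfolding u_def using l[of "ev p ?w" "ev p ?w'"] by simp
  have gu: "good u"
  proof (rule Z(3)[OF uV])
    fix w x assume wx: "(w, x) \<in> Z"
    have "(zt w x ?w, zt w x ?w') \<in> ?AB" by (rule insertI2, rule image_eqI[OF _ wx]) simp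
    then have "l * zt w x ?w + cnj l * zt w x ?w' \<noteq> 0" by (rule l)
    moreover have "zt w x u = l * zt w x ?w + cnj l * zt w x ?w'"
      unfolding u_def using lin1D[OF ztl[OF wx]] V1_CC wpV w'V by simp
    ultimately show "zt w x u \<noteq> 0" by simp
  qed
  define c where "c = - l / ev p u"
  define L' where "L' = (\<lambda>t. 1 * L t + 1 * (c * ev p t + cnj c * ev (cpt p) t))"
  have lL': "lin L'" unfolding L'_def by (intro lin_comb L lin_ev p tc)
  have Lu: "L (u * t) = l * ev p t + cnj l * ev (cpt p) t" if t: "t \<in> V1" for t
  proof -
    have "L (t * u) = L (t * (CC l * ?w)) + L (t * (CC (cnj l) * ?w'))"
      unfolding u_def by (rule lin1D(1)[OF lin1_mult[OF L t]]) (intro V1_CC wpV w'V)+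
    also have "\<dots> = l * L (t * ?w) + cnj l * L (t * ?w')"
      using lin1D(2)[OF lin1_mult[OF L t]] wpV w'V by simp
    finally show ?thesis using wpL[OF p(1,2) t] w'L[OF t] by (simp add: mult.commute)
  qed
  have ucp: "ev (cpt p) u = cnj (ev p u)" using ev_cpt[of p u] cu by simp
  have k0: "L' (u * t) = 0" if t: "t \<in> V1" for t
    unfolding L'_def Lu[OF t] ev_mult[OF p(1)] ev_mult[OF tc(1)] ucp c_def using up by (simp add: field_simps)
  have "Re (L' (v * cj v)) > 0" if v: "kys v \<subseteq> H" "v \<noteq> 0" "ev p v = 0" for v
  proof -
    have "ev (cpt p) (cj v) = 0" unfolding ev_cpt v(3) by simp
    then have "L' (v * cj v) = L (v * cj v)" unfolding L'_def ev_mult[OF p(1)] ev_mult[OF tc(1)] v(3) by simp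
    then show ?thesis using pos[OF v(1,2)] by simp
  qed
  then show thesis using that[OF p(1,2) uV cu gu up lL' k0] by blast
qed

end

section \<open>Splitting the ideal of non-real points\<close>

lemma ev_pe: "torus q \<Longrightarrow> ev q (pe z r) = poly r (ev q z)"
  by (induction r) (simp_all add: ev_mult)

text \<open>Each root is recorded together with its conjugate, one in either half plane, so that
  \<open>Q2\<close> is \<open>Q1\<close> with conjugated coefficients. The product may be larger
  than \<open>q\<close>; divisibility is enough for it to annihilate whatever \<open>q\<close>
  annihilates.\<close>

lemma half_plane_factor:
  fixes q :: "complex poly"
  assumes "q \<noteq> 0" "\<And>x. Im x = 0 \<Longrightarrow> poly q x \<noteq> 0"
  shows "\<exists>Q1 Q2. q dvd Q1 * Q2 \<and> (\<forall>x. poly Q1 x = 0 \<longrightarrow> Im x > 0) \<and> (\<forall>x. poly Q2 x = 0 \<longrightarrow> Im x < 0)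
     \<and> (\<forall>z. cj z = z \<longrightarrow> cj (pe z Q1) = pe z Q2)"
  using assms
proof (induction "degree q" arbitrary: q)
  case 0
  then obtain c where c: "q = [:c:]" "c \<noteq> 0" by (metis degree_eq_zeroE pCons_0_0)
  have "1 = q * [:1 / c:]" using c by (simp add: one_pCons)
  then have "q dvd 1 * 1" unfolding mult_1 by (rule dvdI)
  then show ?case by (intro exI[of _ 1]) simp
next
  case (Suc n)
  have "\<not> constant (poly q)" using Suc(2) by (simp add: constant_degree)
  then obtain r where r: "poly q r = 0" using fundamental_theorem_of_algebra by blast
  then obtain q' where q': "q = [:- r, 1:] * q'" by (metis dvdE poly_eq_0_iff_dvd)
  have q'0: "q' \<noteq> 0" using Suc(3) q' by auto
  have "degree q = Suc (degree q')" unfolding q' by (subst degree_mult_eq) (use q'0 in simp_all)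
  then have "n = degree q'" using Suc(2) by simp
  moreover have "poly q' x \<noteq> 0" if "Im x = 0" for x using Suc(4)[OF that] q' by auto
  ultimately obtain Q1 Q2 where Q: "q' dvd Q1 * Q2" "\<forall>x. poly Q1 x = 0 \<longrightarrow> Im x > 0" "\<forall>x. poly Q2 x = 0 \<longrightarrow> Im x < 0"
    "\<forall>z. cj z = z \<longrightarrow> cj (pe z Q1) = pe z Q2" using Suc(1)[of q'] q'0 by blast
  define s where "s = (if Im r > 0 then r else cnj r)"
  have ir: "Im r \<noteq> 0" using r Suc(4) by blast
  have s: "Im s > 0" "s = r \<or> cnj s = r" using ir by (auto simp: s_def)
  have "[:- r, 1:] dvd [:- s, 1:] * [:- cnj s, 1:]" using s(2) by (metis dvd_triv_left dvd_triv_right)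
  then have "q dvd ([:- s, 1:] * [:- cnj s, 1:]) * (Q1 * Q2)" unfolding q' using Q(1) by (rule mult_dvd_mono)
  then have 1: "q dvd ([:- s, 1:] * Q1) * ([:- cnj s, 1:] * Q2)" by (simp only: mult_ac)
  have 2: "cj (pe z ([:- s, 1:] * Q1)) = pe z ([:- cnj s, 1:] * Q2)" if z: "cj z = z" for z
  proof -
    have "cj (pe z Q1) = pe z Q2" using Q(4) z by blast
    then show ?thesis using z by (simp only: pe_mult cj_mult) (simp add: CC_simps)
  qed
  have 3: "Im x > 0" if "poly ([:- s, 1:] * Q1) x = 0" for x using that s(1) Q(2) by auto
  have 4: "Im x < 0" if "poly ([:- cnj s, 1:] * Q2) x = 0" for x using that s(1) Q(3) by auto
  show ?case by (intro exI[of _ "[:- s, 1:] * Q1"] exI[of _ "[:- cnj s, 1:] * Q2"]) (use 1 2 3 4 in blast)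
qed

section \<open>The ideal generated by f and u\<close>

context prime_curve
begin

definition Ide :: "lau \<Rightarrow> lau set" where "Ide u = {t. \<exists>a b. t = f * a + u * b}"

lemma IdeI: "t = f * a + u * b \<Longrightarrow> t \<in> Ide u" unfolding Ide_def by blast
lemma IdeE: assumes "t \<in> Ide u" obtains a b where "t = f * a + u * b" using assms unfolding Ide_def by blast
lemma Ide_add: assumes "s \<in> Ide u" "t \<in> Ide u" shows "s + t \<in> Ide u"
proof -
  obtain a b a' b' where "s = f * a + u * b" "t = f * a' + u * b'" using assms by (metis IdeE)
  then show ?thesis by (intro IdeI[of _ "a + a'" _ "b + b'"]) (simp add: algebra_simps)
qed
lemma Ide_mult: assumes "t \<in> Ide u" shows "s * t \<in> Ide u"
proof -
  obtain a b where "t = f * a + u * b" using assms by (rule IdeE)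
  then show ?thesis by (intro IdeI[of _ "s * a" _ "s * b"]) (simp add: algebra_simps)
qed
lemma Ide_diff: "s \<in> Ide u \<Longrightarrow> t \<in> Ide u \<Longrightarrow> s - t \<in> Ide u"
  using Ide_add[of s u "- 1 * t"] Ide_mult[of t u "- 1"] by simp
lemma Ide_f: "f \<in> Ide u" by (rule IdeI[of _ 1 _ 0]) simp
lemma Ide_cj: assumes "cj f = f" "cj u = u" "t \<in> Ide u" shows "cj t \<in> Ide u"
proof -
  obtain a b where "t = f * a + u * b" using assms(3) by (rule IdeE)
  then show ?thesis using assms by (intro IdeI[of _ "cj a" _ "cj b"]) simp
qed
lemma Ide_unit: assumes "s * t \<in> Ide u" "r * s = 1" shows "t \<in> Ide u"
proof -
  have "r * (s * t) \<in> Ide u" by (rule Ide_mult[OF assms(1)])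
  then show ?thesis by (simp flip: mult.assoc add: assms(2))
qed
lemma CC_inv: "c \<noteq> 0 \<Longrightarrow> CC (1 / c) * CC c = 1" by (simp flip: CC_simps(2) add: CC_simps)

lemma codim_V1:
  fixes ts :: "nat \<Rightarrow> lau"
  assumes u: "u \<in> V1" and nd: "\<not> f dvd u" and N: "int N > mv A H"
  obtains c where "\<exists>i<N. c i \<noteq> 0" "(\<Sum>i<N. CC (c i) * ts i) \<in> Ide u"
proof -
  have uu: "mon n * u \<in> V (m + 1)" if "m \<ge> 2" "n \<in> kH m" for m n
    using V1_V[OF u mon_V[OF that(2)] that(1)] by (simp add: mult.commute)
  have "int N > int 1 * mv A H" using N by simp
  obtain c g h where "\<exists>i<N. c i \<noteq> 0" "(\<Sum>i<N. CC (c i) * ts i) = f * g + u * h"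
    by (rule ideal_codimension[where u = u and k = 1 and N = N and ts = ts]) (use uu nd \<open>int N > int 1 * mv A H\<close> in blast)+
  then show thesis using that IdeI by blast
qed

text \<open>Finite codimension makes the elements \<open>z ^ i * a\<close> dependent modulo the
  ideal; a relation of least degree is the minimal polynomial of \<open>z\<close> acting on
  \<open>a\<close>.\<close>

lemma minimal_annihilator:
  assumes u: "u \<in> V1" and nd: "\<not> f dvd u"
  obtains q where "q \<noteq> 0" "pe z q * a \<in> Ide u" "\<And>q'. q' \<noteq> 0 \<Longrightarrow> pe z q' * a \<in> Ide u \<Longrightarrow> degree q \<le> degree q'"
proof -
  define N where "N = nat (mv A H) + 1"
  have "int N > mv A H" by (simp add: N_def)
  then obtain c where c: "\<exists>i<N. c i \<noteq> 0" "(\<Sum>i<N. CC (c i) * (z ^ i * a)) \<in> Ide u" by (rule codim_V1[OF u nd])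
  define q where "q = (\<Sum>i<N. Polynomial.monom (c i) i)"
  have "coeff q i = c i" if "i < N" for i unfolding q_def by (simp add: coeff_sum that)
  then have q0: "q \<noteq> 0" using c(1) by auto
  have "pe z q * a = (\<Sum>i<N. CC (c i) * (z ^ i * a))" by (simp add: q_def pe_sum pe_monom sum_distrib_right mult.assoc)
  then have "q \<noteq> 0 \<and> pe z q * a \<in> Ide u" using c(2) q0 by simp
  then obtain q1 where "(q1 \<noteq> 0 \<and> pe z q1 * a \<in> Ide u) \<and> (\<forall>q'. (q' \<noteq> 0 \<and> pe z q' * a \<in> Ide u) \<longrightarrow> degree q1 \<le> degree q')"
    using ex_has_least_nat[of "\<lambda>q. q \<noteq> 0 \<and> pe z q * a \<in> Ide u" q degree] by blast
  then show thesis using that by blast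
qed

text \<open>Omitting one factor \<open>z - CC r\<close> from the minimal annihilator leaves an
  element outside the ideal which that factor sends into it.\<close>

lemma eigenvector:
  assumes q: "q \<noteq> 0" "pe z q * a \<in> Ide u" "\<And>q'. q' \<noteq> 0 \<Longrightarrow> pe z q' * a \<in> Ide u \<Longrightarrow> degree q \<le> degree q'"
    and r: "poly q r = 0"
  obtains t where "t * a \<notin> Ide u" "(z - CC r) * (t * a) \<in> Ide u"
proof -
  obtain q' where q': "q = [:- r, 1:] * q'" using r by (metis dvdE poly_eq_0_iff_dvd)
  have q'0: "q' \<noteq> 0" using q(1) q' by auto
  have "degree q = Suc (degree q')" unfolding q' by (subst degree_mult_eq) (use q'0 in simp_all)
  then have 1: "pe z q' * a \<notin> Ide u" using q(3)[OF q'0] by force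
  have "pe z q = (z - CC r) * pe z q'" unfolding q' pe_mult by (simp add: CC_simps)
  then have "(z - CC r) * (pe z q' * a) \<in> Ide u" using q(2) by (simp only: mult.assoc)
  then show thesis using that 1 by blast
qed

lemma annihilator_root:
  assumes q: "q \<noteq> 0" "pe z q * a \<in> Ide u" and a: "a \<notin> Ide u"
  obtains r where "poly q r = 0"
proof (cases "constant (poly q)")
  case True
  then obtain c where c: "q = [:c:]" "c \<noteq> 0" using q(1) by (metis constant_degree degree_eq_zeroE pCons_0_0)
  have "CC c * a \<in> Ide u" using q(2) c(1) by simp
  then have "a \<in> Ide u" by (rule Ide_unit[OF _ CC_inv[OF c(2)]])
  then show thesis using a by blast
next
  case False
  then show thesis using that fundamental_theorem_of_algebra by blast
qed

lemma eigenvalue_step: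
  assumes "(s - CC c) * a \<in> Ide u" "(t - CC d) * a \<in> Ide u" shows "(s * t - CC (c * d)) * a \<in> Ide u"
proof -
  have "s * ((t - CC d) * a) + CC d * ((s - CC c) * a) \<in> Ide u" by (intro Ide_add Ide_mult assms)
  then show ?thesis by (simp add: CC_simps algebra_simps)
qed

lemma eigenvalue_mon:
  assumes a: "a \<notin> Ide u" and x: "(mon n - CC x) * a \<in> Ide u"
  shows "x \<noteq> 0" "(mon (sm k n) - CC (x powi k)) * a \<in> Ide u"
proof -
  show x0: "x \<noteq> 0"
  proof
    assume "x = 0"
    then have "mon n * a \<in> Ide u" using x by (simp add: CC_simps)
    then show False using a Ide_unit mon_inv by blast
  qed
  have "CC (1 / x) * (- mon (- n)) * ((mon n - CC x) * a) \<in> Ide u" by (intro Ide_mult x)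
  moreover have "CC (1 / x) * (- mon (- n)) * ((mon n - CC x) * a) = (CC (1 / x) * CC x * mon (- n) - CC (1 / x) * (mon (- n) * mon n)) * a"
    by (simp add: algebra_simps)
  ultimately have inv: "(mon (- n) - CC (1 / x)) * a \<in> Ide u" by (simp add: mon_inv CC_inv[OF x0])
  show "(mon (sm k n) - CC (x powi k)) * a \<in> Ide u"
  proof (induction k rule: int_induct[where k = 0])
    case base
    have "0 \<in> Ide u" by (rule IdeI[of _ 0 _ 0]) simp
    then show ?case by (simp add: CC_simps)
  next
    case (step1 i)
    have "mon (sm i n) * mon n = mon (sm (i + 1) n)" by (simp flip: mon_add add: sm_add)
    then show ?case using eigenvalue_step[OF step1(2) x] x0 by (simp add: power_int_add_1)
  next
    case (step2 i)
    have "mon (sm i n) * mon (- n) = mon (sm (i - 1) n)" by (simp flip: mon_add add: sm_diff)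
    then show ?case using eigenvalue_step[OF step2(2) inv] x0 by (simp add: power_int_diff)
  qed
qed

text \<open>Modulo the ideal, \<open>a\<close> is an eigenvector of every \<open>t\<close> with
  eigenvalue \<open>ev (x, y) t\<close>. For \<open>t\<close> in the ideal the product
  \<open>t * a\<close> is in the ideal, and since \<open>a\<close> is not, the eigenvalue
  vanishes.\<close>

lemma common_zero:
  assumes a: "a \<notin> Ide u" and x: "(mon (1, 0) - CC x) * a \<in> Ide u" and y: "(mon (0, 1) - CC y) * a \<in> Ide u"
  shows "torus (x, y)" "t \<in> Ide u \<Longrightarrow> ev (x, y) t = 0"
proof -
  show "torus (x, y)" using eigenvalue_mon(1)[OF a x] eigenvalue_mon(1)[OF a y] by (rule torusI)
  have m: "(mon n - CC (mp (x, y) n)) * a \<in> Ide u" for n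
  proof -
    have "sm (fst n) (1, 0) + sm (snd n) (0, 1) = n" by (simp add: prod_eq_iff sm_def)
    then show ?thesis
      using eigenvalue_step[OF eigenvalue_mon(2)[OF a x, of "fst n"] eigenvalue_mon(2)[OF a y, of "snd n"]]
      unfolding mon_add[symmetric] mp_def fst_conv snd_conv by simp
  qed
  have 0: "0 \<in> Ide u" by (rule IdeI[of _ 0 _ 0]) simp
  have sumI: "(\<Sum>n\<in>K. g n) \<in> Ide u" if "\<And>n. n \<in> K \<Longrightarrow> g n \<in> Ide u" for K and g :: "lat \<Rightarrow> lau"
    using that by (induction K rule: infinite_finite_induct) (simp_all add: 0 Ide_add)
  assume t: "t \<in> Ide u"
  have CCs: "CC (\<Sum>n\<in>K. g n) = (\<Sum>n\<in>K. CC (g n))" for K and g :: "lat \<Rightarrow> complex"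
    by (induction K rule: infinite_finite_induct) (simp_all add: CC_simps)
  have t1: "t = (\<Sum>n\<in>kys t. CC (lk t n) * mon n)" by (subst lau_decomp) (simp add: CC_def mon_def mult_single)
  have "(\<Sum>n\<in>kys t. CC (lk t n) * ((mon n - CC (mp (x, y) n)) * a)) \<in> Ide u" by (intro sumI Ide_mult m)
  also have "(\<Sum>n\<in>kys t. CC (lk t n) * ((mon n - CC (mp (x, y) n)) * a)) =
      (\<Sum>n\<in>kys t. CC (lk t n) * mon n) * a - CC (ev (x, y) t) * a"
    unfolding ev_def CCs CC_simps sum_distrib_right sum_subtractf[symmetric]
    by (rule sum.cong[OF refl]) (simp add: algebra_simps CC_simps)
  also have "\<dots> = a * t - CC (ev (x, y) t) * a" unfolding t1[symmetric] by simp
  finally have "a * t - CC (ev (x, y) t) * a \<in> Ide u" .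
  then have "a * t - (a * t - CC (ev (x, y) t) * a) \<in> Ide u" by (rule Ide_diff[OF Ide_mult[OF t]])
  then have "CC (ev (x, y) t) * a \<in> Ide u" by simp
  then show "ev (x, y) t = 0" using a Ide_unit CC_inv by blast
qed

text \<open>A real linear form \<open>z\<close> is chosen whose values at the common zeros of
  \<open>f\<close> and \<open>u\<close> are not real. Its minimal polynomial has no real roots and
  divides a product of \<open>Q1\<close> and \<open>Q2\<close> with roots in opposite half planes; a
  Bezout relation gives \<open>e\<close> congruent to zero modulo \<open>Q1\<close> and to one
  modulo \<open>Q2\<close>.\<close>

lemma splitting_idempotent:
  assumes cf: "cj f = f" and nonreal: "\<And>x y::real. x \<noteq> 0 \<Longrightarrow> y \<noteq> 0 \<Longrightarrow> ev (of_real x, of_real y) f \<noteq> 0"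
    and u: "u \<in> V1" "cj u = u" "\<not> f dvd u"
  obtains e where "e + cj e - 1 \<in> Ide u" "e * cj e \<in> Ide u"
proof -
  let ?X = "mon (1, 0)" and ?Y = "mon (0, 1)"
  obtain px where px: "px \<noteq> 0" "pe ?X px * 1 \<in> Ide u" using minimal_annihilator[OF u(1,3)] by blast
  obtain py where py: "py \<noteq> 0" "pe ?Y py * 1 \<in> Ide u" using minimal_annihilator[OF u(1,3)] by blast
  define ZZ where "ZZ = {z \<in> {x. poly px x = 0} \<times> {y. poly py y = 0}. Im (fst z) \<noteq> 0 \<or> Im (snd z) \<noteq> 0}"
  \<comment> \<open>The imaginary part of \<open>x + \<beta> * y\<close> as a polynomial in the real
    parameter \<open>\<beta>\<close>; its zeros over the finitely many nonreal candidates are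
    avoided.\<close>
  define lp where "lp = (\<lambda>z. [:of_real (Im (fst z)), of_real (Im (snd z)):] :: complex poly)"
  have "finite ({x. poly px x = 0} \<times> {y. poly py y = 0})" using px py by (intro finite_cartesian_product poly_roots_finite)
  then have "finite ZZ" unfolding ZZ_def by simp
  moreover have "lp z \<noteq> 0" if "z \<in> ZZ" for z using that unfolding ZZ_def lp_def by auto
  ultimately have "finite (\<Union>z\<in>ZZ. {x. poly (lp z) x = 0})" using poly_roots_finite by blast
  then obtain \<beta> :: real where b: "\<beta> > 0" "complex_of_real \<beta> + 0 \<notin> (\<Union>z\<in>ZZ. {x. poly (lp z) x = 0})" by (rule real_avoid)
  define z where "z = ?X + CC (of_real \<beta>) * ?Y"
  have cz: "cj z = z" by (simp add: z_def)
  obtain q where q: "q \<noteq> 0" "pe z q * 1 \<in> Ide u" "\<And>q'. q' \<noteq> 0 \<Longrightarrow> pe z q' * 1 \<in> Ide u \<Longrightarrow> degree q \<le> degree q'"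
    by (rule minimal_annihilator[OF u(1,3), of z 1]) blast
  have nr: "poly q r \<noteq> 0" if r: "Im r = 0" for r
  proof
    assume qr: "poly q r = 0"
    obtain t where t: "t * 1 \<notin> Ide u" "(z - CC r) * (t * 1) \<in> Ide u"
      by (rule eigenvector[where q = q and a = 1 and z = z and u = u and r = r]) (use q qr in blast)+
    let ?a = "t * 1"
    obtain p where p: "p \<noteq> 0" "pe ?X p * ?a \<in> Ide u" "\<And>q'. q' \<noteq> 0 \<Longrightarrow> pe ?X q' * ?a \<in> Ide u \<Longrightarrow> degree p \<le> degree q'"
      by (rule minimal_annihilator[OF u(1,3), of ?X ?a]) blast
    obtain x where x: "poly p x = 0" by (rule annihilator_root[OF p(1,2) t(1)])
    obtain s where s: "s * ?a \<notin> Ide u" "(?X - CC x) * (s * ?a) \<in> Ide u"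
      by (rule eigenvector[where q = p and a = ?a and z = ?X and u = u and r = x]) (use p x in blast)+
    \<comment> \<open>The eigenvalue of the second coordinate is forced by those of \<open>z\<close>
      and of the first.\<close>
    define y where "y = (r - x) / of_real \<beta>"
    have "s * ((z - CC r) * ?a) - (?X - CC x) * (s * ?a) \<in> Ide u" by (intro Ide_diff Ide_mult t s)
    moreover have "CC r = CC x + CC (of_real \<beta>) * CC y" using b(1) by (simp flip: CC_simps add: y_def)
    then have "s * ((z - CC r) * ?a) - (?X - CC x) * (s * ?a) = CC (of_real \<beta>) * ((?Y - CC y) * (s * ?a))"
      by (simp add: z_def algebra_simps)
    ultimately have "CC (of_real \<beta>) * ((?Y - CC y) * (s * ?a)) \<in> Ide u" by simp
    then have y': "(?Y - CC y) * (s * ?a) \<in> Ide u" using Ide_unit[OF _ CC_inv] b(1) by auto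
    note cz = common_zero[OF s(1,2) y']
    have "poly px x = 0" using cz(2)[OF px(2)] by (simp add: ev_pe[OF cz(1)] mp_def)
    moreover have "poly py y = 0" using cz(2)[OF py(2)] by (simp add: ev_pe[OF cz(1)] mp_def)
    moreover have r': "r = x + of_real \<beta> * y" using b(1) by (simp add: y_def)
    moreover have "Im x = 0 \<and> Im y = 0"
    proof (rule ccontr)
      assume "\<not> (Im x = 0 \<and> Im y = 0)"
      then have "(x, y) \<in> ZZ" using calculation unfolding ZZ_def by auto
      then have "poly (lp (x, y)) (of_real \<beta>) \<noteq> 0" using b(2) by auto
      then have "Im x + \<beta> * Im y \<noteq> 0" unfolding lp_def by (simp flip: of_real_mult of_real_add)
      then show False using r r' by simp
    qed
    then have "x = of_real (Re x)" "y = of_real (Re y)" by (simp_all add: complex_eq_iff)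
    moreover have "x \<noteq> 0" "y \<noteq> 0" using cz(1) by (simp_all add: torus_def)
    ultimately show False using nonreal[of "Re x" "Re y"] cz(2)[OF Ide_f] by (metis of_real_0)
  qed
  obtain Q1 Q2 where Q: "q dvd Q1 * Q2" "\<forall>x. poly Q1 x = 0 \<longrightarrow> Im x > 0" "\<forall>x. poly Q2 x = 0 \<longrightarrow> Im x < 0"
    "\<forall>z. cj z = z \<longrightarrow> cj (pe z Q1) = pe z Q2" using half_plane_factor[OF q(1) nr] by blast
  have "poly Q2 x \<noteq> 0" if "poly Q1 x = 0" for x using Q(2,3) that by fastforce
  then obtain s t where st: "s * Q1 + t * Q2 = 1" by (rule complex_bezout)
  define a b \<sigma> \<tau> where "a = pe z Q1" and "b = pe z Q2" and "\<sigma> = pe z s" and "\<tau> = pe z t"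
  have one: "\<sigma> * a + \<tau> * b = 1" unfolding a_def b_def \<sigma>_def \<tau>_def using st by (simp flip: pe_mult pe_add)
  have ca: "cj a = b" unfolding a_def b_def using Q(4) cz by blast
  then have cb: "cj b = a" by (metis cj_cj)
  have one': "cj \<sigma> * b + cj \<tau> * a = 1" using arg_cong[OF one, of cj] by (simp add: ca cb)
  obtain k where k: "Q1 * Q2 = q * k" using Q(1) by (elim dvdE)
  have "a * b = pe z k * (pe z q * 1)" unfolding a_def b_def pe_mult[symmetric] k by (simp add: pe_mult mult.commute)
  then have ab: "a * b \<in> Ide u" using Ide_mult q(2) by simp
  define e where "e = \<sigma> * a"
  have ce: "cj e = cj \<sigma> * b" by (simp add: e_def ca)
  have e1: "e + cj e - 1 = b * (cj \<sigma> - \<tau>)" unfolding e_def one[symmetric] by (simp add: ca algebra_simps)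
  have e2: "e + cj e - 1 = a * (\<sigma> - cj \<tau>)" unfolding e_def one'[symmetric] by (simp add: ca algebra_simps)
  \<comment> \<open>Both forms of the defect are used: \<open>e1\<close> supplies the factor
    \<open>b\<close> where \<open>a\<close> stands, \<open>e2\<close> the factor \<open>a\<close>
    where \<open>b\<close> stands, so the defect is a multiple of \<open>a * b\<close>.\<close>
  have "e + cj e - 1 = \<sigma> * a * (e + cj e - 1) + \<tau> * b * (e + cj e - 1)"
    unfolding distrib_right[symmetric] one by simp
  also have "\<dots> = \<sigma> * a * (b * (cj \<sigma> - \<tau>)) + \<tau> * b * (a * (\<sigma> - cj \<tau>))" by (metis e1 e2)
  also have "\<dots> = (\<sigma> * (cj \<sigma> - \<tau>) + \<tau> * (\<sigma> - cj \<tau>)) * (a * b)" by (simp add: algebra_simps)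
  finally have r1: "e + cj e - 1 \<in> Ide u" using Ide_mult[OF ab] by simp
  have "e * cj e = (\<sigma> * cj \<sigma>) * (a * b)" unfolding e_def by (simp add: ca mult_ac)
  then have r2: "e * cj e \<in> Ide u" using Ide_mult[OF ab] by simp
  show thesis using that r1 r2 by blast
qed

theorem no_positive_functional:
  assumes cf: "cj f = f" and nonreal: "\<And>x y::real. x \<noteq> 0 \<Longrightarrow> y \<noteq> 0 \<Longrightarrow> ev (of_real x, of_real y) f \<noteq> 0"
    and big: "mv A H < 2 * (int (card H) - 1)"
    and L0: "real_functional L0" and \<kappa>: "\<kappa> > 0"
    and pos0: "\<And>v. kys v \<subseteq> H \<Longrightarrow> Re (L0 (v * cj v)) \<ge> \<kappa> * (\<Sum>n\<in>H. (cmod (lk v n))\<^sup>2)"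
  shows False
proof -
  obtain L u p where p: "torus p" "ev p f = 0" and u: "u \<in> V1" "cj u = u" "good u" "ev p u \<noteq> 0" and L: "lin L"
    and k: "\<And>t. t \<in> V1 \<Longrightarrow> L (u * t) = 0" and pos: "\<And>v. kys v \<subseteq> H \<Longrightarrow> v \<noteq> 0 \<Longrightarrow> ev p v = 0 \<Longrightarrow> Re (L (v * cj v)) > 0"
    by (rule degenerate_functional[OF cf L0 \<kappa> pos0]) blast+
  have nd: "\<not> f dvd u" using ev_dvd[OF p] u(4) by blast
  obtain e where e: "e + cj e - 1 \<in> Ide u" "e * cj e \<in> Ide u" by (rule splitting_idempotent[OF cf nonreal u(1,2) nd])
  \<comment> \<open>Conjugation of \<open>e * v\<close> in the ideal puts \<open>cj e * cj v\<close>
    there, and each term of \<open>v * cj v * (e + cj e)\<close> contains one of the two; the other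
    case is symmetric. The cofactor \<open>r\<close> of \<open>u\<close> is then in
    \<open>V1\<close>, where \<open>L (u * r)\<close> is zero.\<close>
  have none: False if v: "kys v \<subseteq> H" "v \<noteq> 0" "ev p v = 0" and ev: "e * v \<in> Ide u \<or> cj e * v \<in> Ide u" for v
  proof -
    have "v * cj v * (e + cj e) \<in> Ide u"
    proof -
      have "cj e * cj v \<in> Ide u \<and> e * v \<in> Ide u \<or> e * cj v \<in> Ide u \<and> cj e * v \<in> Ide u"
        using ev Ide_cj[OF cf u(2), of "e * v"] Ide_cj[OF cf u(2), of "cj e * v"] by auto
      moreover have "v * cj v * (e + cj e) = cj v * (e * v) + v * (cj e * cj v)"
        "v * cj v * (e + cj e) = v * (e * cj v) + cj v * (cj e * v)" by (simp_all add: algebra_simps)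
      ultimately show ?thesis by (metis Ide_add Ide_mult)
    qed
    moreover have "v * cj v = v * cj v * (e + cj e) - v * cj v * (e + cj e - 1)" by (simp add: algebra_simps)
    ultimately have "v * cj v \<in> Ide u" using Ide_diff Ide_mult[OF e(1)] by metis
    then obtain a r where ar: "v * cj v = f * a + u * r" by (rule IdeE)
    have vV: "v * cj v \<in> V 2" by (intro V1_V1 keysH_V1) (use v(1) in simp_all)
    have "u * r = v * cj v + CC (- 1) * (f * a)" unfolding ar by (simp add: CC_simps)
    then have ur: "u * r \<in> V 2" using Wm_add[OF vV Wm_CC[OF Wm_mult_f]] by simp
    then have rV: "r \<in> V1" by (rule good_cancel1[OF u(1,3)])
    have "L (v * cj v) = L (f * a) + L (u * r)" unfolding ar by (rule linD(1)[OF L Wm_mult_f ur])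
    then have "L (v * cj v) = 0" using k[OF rV] linD(3)[OF L] by simp
    then show False using pos[OF v] by simp
  qed
  have fH: "finite H" using pgD[OF pgs(2)] by blast
  obtain n0 where n0: "n0 \<in> H" using pgD[OF pgs(2)] by blast
  define M where "M = card (H - {n0})"
  have cM: "int M = int (card H) - 1" unfolding M_def using n0 fH by (simp add: card_Diff_singleton of_nat_diff card_gt_0_iff Suc_le_eq) (metis One_nat_def Suc_leI card_gt_0_iff empty_iff of_nat_1 of_nat_diff)
  obtain h where "bij_betw h {0..<M} (H - {n0})" using ex_bij_betw_nat_finite[of "H - {n0}"] fH unfolding M_def by blast
  then have hH: "h i \<in> H" "h i \<noteq> n0" and hi: "h i = h j \<Longrightarrow> j < M \<Longrightarrow> i = j" if "i < M" for i j
    using that by (auto simp: bij_betw_def inj_on_def)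
  \<comment> \<open>A basis of the polynomials supported in \<open>H\<close> that vanish at
    \<open>p\<close>: each monomial is corrected by a multiple of \<open>mon n0\<close>.\<close>
  define w where "w = (\<lambda>i. mon (h i) - CC (mp p (h i) / mp p n0) * mon n0)"
  define vv where "vv = (\<lambda>c. \<Sum>i<M. CC (c i) * w i)"
  have lw: "lk (w i) n = (if n = h i then 1 else 0) - (mp p (h i) / mp p n0) * (if n = n0 then 1 else 0)" for i n
    by (simp add: w_def lookup_minus) (simp add: mon_def lookup_single when_def)
  have kvv: "kys (vv c) \<subseteq> H" for c
  proof
    fix n assume "n \<in> kys (vv c)"
    then have "(\<Sum>i<M. c i * lk (w i) n) \<noteq> 0" by (simp add: vv_def in_keys_iff lookup_sum)
    then obtain i where "i < M" "lk (w i) n \<noteq> 0" by (metis (no_types, lifting) lessThan_iff mult_zero_right sum.neutral)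
    then show "n \<in> H" using hH(1)[of i] n0 lw[of i n] by (auto split: if_splits)
  qed
  have pvv: "ev p (vv c) = 0" for c
    using mp_nz[OF p(1), of n0] by (simp add: vv_def ev_sum w_def)
  have lvv: "lk (vv c) (h j) = c j" if j: "j < M" for c j
  proof -
    have "lk (vv c) (h j) = (\<Sum>i<M. if i = j then c i else 0)" unfolding vv_def lookup_sum
    proof (rule sum.cong[OF refl])
      fix i assume "i \<in> {..<M}"
      then have "h j = h i \<longleftrightarrow> i = j" using hi[of i j] j by auto
      then show "lk (CC (c i) * w i) (h j) = (if i = j then c i else 0)" using lw[of i "h j"] hH(2)[OF j] by simp
    qed
    then show ?thesis using j by simp
  qed
  define ts where "ts = (\<lambda>i. if i < M then e * w i else cj e * w (i - M))"
  have "int (M + M) > mv A H" using big cM by simp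
  then obtain c where c: "\<exists>i<M + M. c i \<noteq> 0" "(\<Sum>i<M + M. CC (c i) * ts i) \<in> Ide u" by (rule codim_V1[OF u(1) nd])
  let ?v = "vv c" and ?v' = "vv (\<lambda>i. c (M + i))"
  have "(\<Sum>i<M + M. CC (c i) * ts i) = (\<Sum>i<M. CC (c i) * ts i) + (\<Sum>i<M. CC (c (M + i)) * ts (M + i))"
    by (rule sum.nat_group[of _ M, symmetric, THEN trans] | simp add: lessThan_atLeast0 sum.atLeastLessThan_concat[of 0 M "M + M", symmetric] sum.shift_bounds_nat_ivl[of _ 0 M M, simplified] add.commute)+
  also have "\<dots> = e * ?v + cj e * ?v'"
    unfolding vv_def ts_def by (simp add: sum_distrib_left mult.left_commute)
  finally have I: "e * ?v + cj e * ?v' \<in> Ide u" using c(2) by simp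
  \<comment> \<open>Modulo the ideal, multiplication by \<open>e\<close> kills the second summand
    and fixes the first, so both summands lie in the ideal separately.\<close>
  have "e * ?v = e * (e * ?v + cj e * ?v') - ?v' * (e * cj e) + ?v * (e * cj e) - (e * ?v) * (e + cj e - 1)" by (simp add: algebra_simps)
  also have "\<dots> \<in> Ide u" by (intro Ide_add Ide_diff Ide_mult I e)
  finally have I1: "e * ?v \<in> Ide u" .
  have "cj e * ?v' = (e * ?v + cj e * ?v') - e * ?v" by simp
  then have I2: "cj e * ?v' \<in> Ide u" using Ide_diff[OF I I1] by simp
  have "?v \<noteq> 0 \<or> ?v' \<noteq> 0"
  proof -
    obtain i where i: "i < M + M" "c i \<noteq> 0" using c(1) by blast
    show ?thesis
    proof (cases "i < M")
      case True
      then have "lk ?v (h i) \<noteq> 0" using lvv[OF True, of c] i by simp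
      then show ?thesis by auto
    next
      case False
      then have "lk ?v' (h (i - M)) \<noteq> 0" using lvv[of "i - M" "\<lambda>i. c (M + i)"] i by simp
      then show ?thesis by auto
    qed
  qed
  then show False using none[OF kvv _ pvv] I1 I2 by blast
qed

end

section \<open>Generic polynomials are irreducible\<close>

text \<open>Seen from the exposed vertex \<open>v\<close>, the point \<open>m\<close> of greatest
  slope with respect to \<open>\<theta>\<close> spans an edge with \<open>v\<close>, and
  \<open>w\<close> is its normal.\<close>

lemma edge_direction:
  assumes S: "finite S" and two: "a \<in> S" "b \<in> S" "a \<noteq> b"
  obtains w where "w \<noteq> 0" "card (face S w) \<ge> 2"
proof -
  have "S \<noteq> {}" using two by blast
  then obtain v \<theta> where v: "v \<in> S" "\<And>n. n \<in> S \<Longrightarrow> n \<noteq> v \<Longrightarrow> dotz \<theta> n > dotz \<theta> v" using exposed_min[OF S] by metis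
  define D where "D = (\<lambda>n. dotz \<theta> n - dotz \<theta> v)"
  define E where "E = (\<lambda>n. dotz (rot \<theta>) n - dotz (rot \<theta>) v)"
  define r where "r = (\<lambda>n. real_of_int (E n) / real_of_int (D n))"
  have Dp: "D n > 0" if "n \<in> S - {v}" for n using v(2)[of n] that by (simp add: D_def)
  have T: "finite (S - {v})" "S - {v} \<noteq> {}" using S two by auto
  have "Max (r ` (S - {v})) \<in> r ` (S - {v})" using T by (intro Max_in finite_imageI) simp_all
  then obtain m where m: "m \<in> S - {v}" "r m = Max (r ` (S - {v}))" by (elim imageE) simp
  have le: "D m * E n \<le> E m * D n" if n: "n \<in> S - {v}" for n
  proof -
    have "r n \<le> r m" unfolding m(2) using T n by (intro Max_ge finite_imageI imageI)
    then have "real_of_int (E n) * real_of_int (D m) \<le> real_of_int (E m) * real_of_int (D n)"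
      unfolding r_def using Dp[OF n] Dp[OF m(1)] by (simp add: divide_simps mult.commute)
    then show ?thesis by (simp flip: of_int_mult add: mult.commute)
  qed
  define w where "w = sm (D m) (rot \<theta>) - sm (E m) \<theta>"
  have dw: "dotz w n = D m * dotz (rot \<theta>) n - E m * dotz \<theta> n" for n by (simp add: w_def)
  have diff: "dotz w n - dotz w v = D m * E n - E m * D n" for n unfolding dw by (simp add: D_def E_def algebra_simps)
  have wn: "dotz w n \<le> dotz w v" if "n \<in> S" for n using le[of n] diff[of n] that by (cases "n = v") auto
  have hv: "hz S w = dotz w v" by (rule hz_eqI[OF S v(1) refl wn])
  have "dotz w m = dotz w v" using diff[of m] by simp
  then have sub: "{v, m} \<subseteq> face S w" unfolding face_def hv using v(1) m(1) by auto
  have "w \<noteq> 0"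
  proof
    assume "w = 0"
    moreover have "\<theta> \<noteq> 0" using Dp[OF m(1)] by (auto simp: D_def)
    then have "dotz \<theta> \<theta> > 0" by (rule dotz_pos)
    moreover have "dotz w (rot \<theta>) = D m * dotz \<theta> \<theta>" unfolding dw by simp
    ultimately show False using Dp[OF m(1)] by simp
  qed
  moreover have "card {v, m} \<le> card (face S w)" by (rule card_mono[OF finite_face[OF S] sub])
  moreover have "card {v, m} = 2" using m(1) by auto
  ultimately show thesis using that by simp
qed

text \<open>Sums on the top level, from the two faces, and sums below it, from the rest of
  \<open>A\<close> and all of \<open>B\<close>, are counted separately by
  \<open>sumset_card\<close>. The loss of one in each count is made up by the two points of
  \<open>face B w\<close>.\<close>

lemma sumset_card_face:
  assumes A: "finite A" "A \<noteq> {}" and B: "finite B" "B \<noteq> {}" and C: "finite C" "\<And>a b. a \<in> A \<Longrightarrow> b \<in> B \<Longrightarrow> a + b \<in> C"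
    and w: "card (face B w) \<ge> 2" "A \<noteq> face A w"
  shows "card A + card B \<le> card C"
proof -
  define T where "T = {n. dotz w n = hz A w + hz B w}"
  have fA: "face A w \<subseteq> A" "face B w \<subseteq> B" by (auto simp: face_def)
  have "card (face A w) + card (face B w) \<le> card (C \<inter> T) + 1"
  proof (rule sumset_card[OF finite_face[OF A(1)] face_ne[OF A] finite_face[OF B(1)] face_ne[OF B]])
    show "finite (C \<inter> T)" using C(1) by simp
    fix a b assume "a \<in> face A w" "b \<in> face B w"
    then show "a + b \<in> C \<inter> T" using C(2) by (simp add: face_def T_def)
  qed
  moreover have "card (A - face A w) + card B \<le> card (C - T) + 1"
  proof (rule sumset_card[OF _ _ B])
    show "finite (A - face A w)" "finite (C - T)" using A C by simp_all
    show "A - face A w \<noteq> {}" using w(2) fA by blast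
    fix a b assume ab: "a \<in> A - face A w" "b \<in> B"
    then have "a \<in> A" "dotz w a \<noteq> hz A w" by (simp_all add: face_def)
    then have "dotz w a < hz A w" using hz_ge[OF A(1), of a w] by simp
    then have "a + b \<notin> T" using hz_ge[OF B(1) ab(2), of w] by (simp add: T_def)
    then show "a + b \<in> C - T" using ab C(2) by simp
  qed
  moreover have "card A = card (face A w) + card (A - face A w)"
    using card_Un_disjoint[of "face A w" "A - face A w"] fA finite_face[OF A(1)] A(1) by (simp add: Un_absorb1)
  moreover have "card C = card (C \<inter> T) + card (C - T)"
  proof -
    have "card (C \<inter> T \<union> (C - T)) = card (C \<inter> T) + card (C - T)" by (rule card_Un_disjoint) (use C(1) in auto)
    moreover have "C \<inter> T \<union> (C - T) = C" by blast
    ultimately show ?thesis by simp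
  qed
  ultimately show ?thesis using w(1) by linarith
qed

lemma two_elements: assumes "card S \<ge> 2" obtains a b where "a \<in> S" "b \<in> S" "a \<noteq> b"
  using assms by (metis card_le_Suc0_iff_eq card.infinite not_less_eq_eq numeral_2_eq_2 zero_le)

text \<open>An edge direction of \<open>B\<close> serves unless \<open>A\<close> lies on one of its
  levels; then \<open>B\<close> does not, and the roles are exchanged with \<open>A\<close> as its
  own face.\<close>

lemma sumset_card_nonparallel:
  assumes A: "finite A" "card A \<ge> 2" and B: "finite B" "card B \<ge> 2" and C: "finite C" "\<And>a b. a \<in> A \<Longrightarrow> b \<in> B \<Longrightarrow> a + b \<in> C"
    and np: "\<And>w c c'. w \<noteq> 0 \<Longrightarrow> A \<subseteq> level w c \<Longrightarrow> B \<subseteq> level w c' \<Longrightarrow> False"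
  shows "card A + card B \<le> card C"
proof -
  obtain b b' where "b \<in> B" "b' \<in> B" "b \<noteq> b'" by (rule two_elements[OF B(2)])
  then obtain w where w: "w \<noteq> 0" "card (face B w) \<ge> 2" by (rule edge_direction[OF B(1)])
  have ne: "A \<noteq> {}" "B \<noteq> {}" using A(2) B(2) by auto
  have fl: "face S w = S \<Longrightarrow> S \<subseteq> level w (hz S w)" for S by (auto simp: face_def level_def)
  show ?thesis
  proof (cases "face A w = A")
    case False
    then show ?thesis using sumset_card_face[of A B C w] A(1) B(1) ne C w(2) by auto
  next
    case True
    then have "face B w \<noteq> B" using np[OF w(1) fl fl] by blast
    moreover have "b + a \<in> C" if "b \<in> B" "a \<in> A" for a b using C(2)[OF that(2,1)] by (simp add: add.commute)
    ultimately have "card B + card A \<le> card C" using sumset_card_face[of B A C w] A B(1) ne C(1) True by auto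
    then show ?thesis by simp
  qed
qed

section \<open>Polynomial functions and algebraic dependence\<close>

definition pf :: "'p set \<Rightarrow> nat \<Rightarrow> (('p \<Rightarrow> complex) \<Rightarrow> complex) \<Rightarrow> bool" where
  "pf R D \<phi> \<longleftrightarrow> (\<exists>k. \<forall>x. \<phi> x = (\<Sum>e\<in>Pi\<^sub>E R (\<lambda>_. {..D}). k e * (\<Prod>p\<in>R. x p ^ e p)))"

lemma fin_exps: "finite R \<Longrightarrow> finite (Pi\<^sub>E R (\<lambda>_. {..D::nat}))" by (rule finite_PiE) simp_all

lemma pf_const: assumes "finite R" shows "pf R D (\<lambda>_. c)"
proof -
  let ?z = "\<lambda>q\<in>R. 0::nat"
  have z: "?z \<in> Pi\<^sub>E R (\<lambda>_. {..D})" by simp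
  have "(\<Sum>e\<in>Pi\<^sub>E R (\<lambda>_. {..D}). (if e = ?z then c else 0) * (\<Prod>p\<in>R. x p ^ e p)) = c" for x :: "'a \<Rightarrow> complex"
  proof -
    have "(\<Sum>e\<in>Pi\<^sub>E R (\<lambda>_. {..D}). (if e = ?z then c else 0) * (\<Prod>p\<in>R. x p ^ e p)) = (\<Sum>e\<in>Pi\<^sub>E R (\<lambda>_. {..D}). if e = ?z then c else 0)"
      by (rule sum.cong[OF refl]) simp
    then show ?thesis using z fin_exps[OF assms, of D] by simp
  qed
  then show ?thesis unfolding pf_def by (intro exI[of _ "\<lambda>e. if e = ?z then c else 0"]) simp
qed

lemma pf_var: assumes R: "finite R" "p \<in> R" shows "pf R 1 (\<lambda>x. x p)"
proof -
  let ?z = "\<lambda>q\<in>R. if q = p then 1::nat else 0"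
  have z: "?z \<in> Pi\<^sub>E R (\<lambda>_. {..1})" by auto
  have pr: "(\<Prod>q\<in>R. x q ^ ?z q) = x p" for x :: "'a \<Rightarrow> complex"
  proof -
    have "(\<Prod>q\<in>R. x q ^ ?z q) = (\<Prod>q\<in>R. if q = p then x q else 1)" by (rule prod.cong[OF refl]) simp
    then show ?thesis using R by simp
  qed
  have "(\<Sum>e\<in>Pi\<^sub>E R (\<lambda>_. {..1}). (if e = ?z then 1 else 0) * (\<Prod>p\<in>R. x p ^ e p)) = x p" for x :: "'a \<Rightarrow> complex"
  proof -
    have "(\<Sum>e\<in>Pi\<^sub>E R (\<lambda>_. {..1}). (if e = ?z then 1 else 0) * (\<Prod>p\<in>R. x p ^ e p)) = (\<Sum>e\<in>Pi\<^sub>E R (\<lambda>_. {..1}). if e = ?z then x p else 0)"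
      by (rule sum.cong[OF refl]) (use pr[of x] in auto)
    then show ?thesis using z fin_exps[OF R(1), of 1] by simp
  qed
  then show ?thesis unfolding pf_def by (intro exI[of _ "\<lambda>e. if e = ?z then 1 else 0"]) simp
qed

lemma pf_sum: assumes "\<And>j. j \<in> J \<Longrightarrow> pf R D (\<phi> j)" shows "pf R D (\<lambda>x. \<Sum>j\<in>J. \<phi> j x)"
proof -
  have "\<forall>j\<in>J. \<exists>k. \<forall>x. \<phi> j x = (\<Sum>e\<in>Pi\<^sub>E R (\<lambda>_. {..D}). k e * (\<Prod>p\<in>R. x p ^ e p))" using assms unfolding pf_def by blast
  then obtain k where k: "\<And>j x. j \<in> J \<Longrightarrow> \<phi> j x = (\<Sum>e\<in>Pi\<^sub>E R (\<lambda>_. {..D}). k j e * (\<Prod>p\<in>R. x p ^ e p))" by metis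
  have "(\<Sum>j\<in>J. \<phi> j x) = (\<Sum>e\<in>Pi\<^sub>E R (\<lambda>_. {..D}). (\<Sum>j\<in>J. k j e) * (\<Prod>p\<in>R. x p ^ e p))" for x
    unfolding sum_distrib_right by (subst sum.swap) (rule sum.cong[OF refl k])
  then show ?thesis unfolding pf_def by (intro exI allI)
qed

lemma pf_mult: assumes R: "finite R" and a: "pf R D \<phi>" and b: "pf R D' \<psi>" shows "pf R (D + D') (\<lambda>x. \<phi> x * \<psi> x)"
proof -
  let ?E = "Pi\<^sub>E R (\<lambda>_. {..D})" and ?F = "Pi\<^sub>E R (\<lambda>_. {..D'})" and ?G = "Pi\<^sub>E R (\<lambda>_. {..D + D'})"
  obtain k where k: "\<And>x. \<phi> x = (\<Sum>e\<in>?E. k e * (\<Prod>p\<in>R. x p ^ e p))" using a unfolding pf_def by blast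
  obtain l where l: "\<And>x. \<psi> x = (\<Sum>e\<in>?F. l e * (\<Prod>p\<in>R. x p ^ e p))" using b unfolding pf_def by blast
  define s where "s = (\<lambda>z. \<lambda>p\<in>R. fst z p + (snd z p :: nat))"
  have sG: "s ` (?E \<times> ?F) \<subseteq> ?G"
  proof
    fix t assume "t \<in> s ` (?E \<times> ?F)"
    then obtain e e' where ee: "e \<in> ?E" "e' \<in> ?F" "t = s (e, e')" by (elim imageE) auto
    have "e p + e' p \<le> D + D'" if "p \<in> R" for p
      using PiE_mem[OF ee(1) that] PiE_mem[OF ee(2) that] by simp
    then show "t \<in> ?G" unfolding ee(3) s_def by auto
  qed
  have "\<phi> x * \<psi> x = (\<Sum>g\<in>?G. (\<Sum>z\<in>{z\<in>?E \<times> ?F. s z = g}. k (fst z) * l (snd z)) * (\<Prod>p\<in>R. x p ^ g p))" for x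
  proof -
    have m: "(\<Prod>p\<in>R. x p ^ fst z p) * (\<Prod>p\<in>R. x p ^ snd z p) = (\<Prod>p\<in>R. x p ^ s z p)" for z
      unfolding prod.distrib[symmetric] by (rule prod.cong[OF refl]) (simp add: s_def power_add)
    have "\<phi> x * \<psi> x = (\<Sum>z\<in>?E \<times> ?F. k (fst z) * l (snd z) * (\<Prod>p\<in>R. x p ^ s z p))"
      unfolding k l sum_product sum.cartesian_product m[symmetric]
      by (rule sum.cong[OF refl]) (simp add: split_beta mult_ac)
    also have "\<dots> = (\<Sum>g\<in>?G. \<Sum>z\<in>{z\<in>?E \<times> ?F. s z = g}. k (fst z) * l (snd z) * (\<Prod>p\<in>R. x p ^ s z p))"
      by (rule sum.group[symmetric]) (use fin_exps[OF R] sG in simp_all)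
    also have "\<dots> = (\<Sum>g\<in>?G. (\<Sum>z\<in>{z\<in>?E \<times> ?F. s z = g}. k (fst z) * l (snd z)) * (\<Prod>p\<in>R. x p ^ g p))"
      unfolding sum_distrib_right by (intro sum.cong[OF refl]) simp
    finally show ?thesis .
  qed
  then show ?thesis unfolding pf_def by (intro exI allI)
qed

lemma pf_mono: assumes "finite R" "pf R D \<phi>" "D \<le> D'" shows "pf R D' \<phi>"
  using pf_mult[OF assms(1,2) pf_const[OF assms(1), of "D' - D" 1]] assms(3) by simp

lemma pf_power: assumes "finite R" "pf R D \<phi>" shows "pf R (n * D) (\<lambda>x. \<phi> x ^ n)"
  by (induction n) (use pf_const[OF assms(1)] pf_mult[OF assms] in simp_all)

lemma pf_prod: assumes R: "finite R" and J: "finite J" and p: "\<And>j. j \<in> J \<Longrightarrow> pf R D (\<phi> j)" shows "pf R (card J * D) (\<lambda>x. \<Prod>j\<in>J. \<phi> j x)"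
  using J p
proof (induction J rule: finite_induct)
  case empty then show ?case using pf_const[OF R] by simp
next
  case (insert j J)
  have "pf R (D + card J * D) (\<lambda>x. \<phi> j x * (\<Prod>j\<in>J. \<phi> j x))" by (rule pf_mult[OF R]) (use insert in blast)+
  then show ?case using insert by simp
qed

text \<open>There are \<open>d ^ card I\<close> products of powers less than \<open>d\<close>, but only \<open>(2 * card I * d) ^ card R\<close> monomials.\<close>

lemma pf_dependent:
  assumes R: "finite R" and I: "finite I" and c: "card R < card I" and p: "\<And>i. i \<in> I \<Longrightarrow> pf R 2 (\<Phi> i)"
  shows "\<exists>d k. (\<exists>\<alpha>\<in>Pi\<^sub>E I (\<lambda>_. {..<d::nat}). k \<alpha> \<noteq> 0) \<and> (\<forall>x. (\<Sum>\<alpha>\<in>Pi\<^sub>E I (\<lambda>_. {..<d}). k \<alpha> * (\<Prod>i\<in>I. \<Phi> i x ^ \<alpha> i)) = 0)"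
proof -
  define m where "m = card I"
  \<comment> \<open>Chosen so that \<open>(2 * m) ^ card R < d\<close>: the number of monomials is
    then below \<open>d ^ (card R + 1)\<close> and hence below the number \<open>d ^ m\<close> of
    products.\<close>
  define d where "d = (2 * m) ^ m + 1"
  define D where "D = m * (2 * (d - 1))"
  let ?P = "Pi\<^sub>E I (\<lambda>_. {..<d})" and ?E = "Pi\<^sub>E R (\<lambda>_. {..D})"
  have m1: "m \<ge> 1" using c by (simp add: m_def)
  have "pf R D (\<lambda>x. \<Prod>i\<in>I. \<Phi> i x ^ \<alpha> i)" if \<alpha>: "\<alpha> \<in> ?P" for \<alpha>
    unfolding D_def m_def
  proof (rule pf_prod[OF R I])
    fix i assume i: "i \<in> I"
    have "\<alpha> i * 2 \<le> 2 * (d - 1)" using PiE_mem[OF \<alpha> i] by simp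
    then show "pf R (2 * (d - 1)) (\<lambda>x. \<Phi> i x ^ \<alpha> i)" by (rule pf_mono[OF R pf_power[OF R p[OF i]]])
  qed
  then have "\<forall>\<alpha>\<in>?P. \<exists>K. \<forall>x. (\<Prod>i\<in>I. \<Phi> i x ^ \<alpha> i) = (\<Sum>e\<in>?E. K e * (\<Prod>p\<in>R. x p ^ e p))" unfolding pf_def by blast
  from bchoice[OF this] obtain K where K: "\<forall>\<alpha>\<in>?P. \<forall>x. (\<Prod>i\<in>I. \<Phi> i x ^ \<alpha> i) = (\<Sum>e\<in>?E. K \<alpha> e * (\<Prod>p\<in>R. x p ^ e p))" ..
  have fP: "finite ?P" by (rule finite_PiE[OF I]) simp
  have "card ?E = (D + 1) ^ card R" using R by (simp add: card_PiE)
  also have "\<dots> \<le> (2 * m * d) ^ card R"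
  proof (rule power_mono)
    have "D + 1 \<le> m * (2 * (d - 1)) + 2 * m" using m1 by (simp add: D_def)
    also have "\<dots> = m * (2 * (d - 1) + 2)" by (simp add: distrib_left)
    also have "2 * (d - 1) + 2 = 2 * d" by (simp add: d_def)
    finally show "D + 1 \<le> 2 * m * d" by (simp add: mult_ac)
  qed simp
  also have "\<dots> = (2 * m) ^ card R * d ^ card R" by (rule power_mult_distrib)
  also have "\<dots> < d * d ^ card R"
  proof -
    have "(2 * m) ^ card R \<le> (2 * m) ^ m" using c m1 by (intro power_increasing) (simp_all add: m_def)
    then have "(2 * m) ^ card R < d" by (simp add: d_def)
    then show ?thesis by (rule mult_strict_right_mono) (simp add: d_def)
  qed
  also have "\<dots> = d ^ Suc (card R)" by simp
  also have "\<dots> \<le> d ^ m" using c by (intro power_increasing) (simp_all add: m_def d_def)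
  also have "\<dots> = card ?P" using I by (simp add: card_PiE m_def)
  finally have cc: "card ?E < card ?P" .
  obtain k where k: "\<exists>\<alpha>\<in>?P. k \<alpha> \<noteq> 0" "\<forall>e\<in>?E. (\<Sum>\<alpha>\<in>?P. k \<alpha> * K \<alpha> e) = 0"
    using underdetermined[OF fin_exps[OF R] fP cc, of K] by blast
  have "(\<Sum>\<alpha>\<in>?P. k \<alpha> * (\<Prod>i\<in>I. \<Phi> i x ^ \<alpha> i)) = 0" for x
  proof -
    have "(\<Sum>\<alpha>\<in>?P. k \<alpha> * (\<Prod>i\<in>I. \<Phi> i x ^ \<alpha> i)) = (\<Sum>\<alpha>\<in>?P. \<Sum>e\<in>?E. k \<alpha> * K \<alpha> e * (\<Prod>p\<in>R. x p ^ e p))"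
      by (rule sum.cong[OF refl]) (simp add: K sum_distrib_left mult.assoc)
    also have "\<dots> = (\<Sum>e\<in>?E. (\<Sum>\<alpha>\<in>?P. k \<alpha> * K \<alpha> e) * (\<Prod>p\<in>R. x p ^ e p))"
      unfolding sum_distrib_right by (rule sum.swap)
    also have "\<dots> = 0" using k(2) by simp
    finally show ?thesis .
  qed
  then show ?thesis using k(1) by blast
qed

text \<open>Induction on the variables: the other values are chosen so that for each
  \<open>j\<close> some coefficient in the new variable stays nonzero, and each \<open>j\<close>
  then excludes finitely many elements of \<open>S i\<close>.\<close>

lemma pf_nonvanishing:
  fixes S :: "'i \<Rightarrow> complex set" and k :: "'j \<Rightarrow> ('i \<Rightarrow> nat) \<Rightarrow> complex"
  assumes I: "finite I" and J: "finite J" and k: "\<And>j. j \<in> J \<Longrightarrow> \<exists>\<alpha>\<in>Pi\<^sub>E I (\<lambda>_. {..<d j}). k j \<alpha> \<noteq> 0"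
    and S: "\<And>i. i \<in> I \<Longrightarrow> infinite (S i)"
  shows "\<exists>c. (\<forall>i\<in>I. c i \<in> S i) \<and> (\<forall>j\<in>J. (\<Sum>\<alpha>\<in>Pi\<^sub>E I (\<lambda>_. {..<d j}). k j \<alpha> * (\<Prod>i\<in>I. c i ^ \<alpha> i)) \<noteq> 0)"
  using I k S
proof (induction I arbitrary: k rule: finite_induct)
  case empty
  then show ?case by simp
next
  case (insert i I)
  have "\<forall>j\<in>J. \<exists>y. y < d j \<and> (\<exists>g\<in>Pi\<^sub>E I (\<lambda>_. {..<d j}). k j (g(i := y)) \<noteq> 0)"
  proof
    fix j assume "j \<in> J"
    then obtain \<alpha> where a: "\<alpha> \<in> Pi\<^sub>E (insert i I) (\<lambda>_. {..<d j})" "k j \<alpha> \<noteq> 0" using insert(4) by blast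
    then obtain z where z: "z \<in> {..<d j} \<times> Pi\<^sub>E I (\<lambda>_. {..<d j})" "\<alpha> = (\<lambda>(y, g). g(i := y)) z" unfolding PiE_insert_eq by (elim imageE)
    then show "\<exists>y. y < d j \<and> (\<exists>g\<in>Pi\<^sub>E I (\<lambda>_. {..<d j}). k j (g(i := y)) \<noteq> 0)"
      using a(2) by (intro exI[of _ "fst z"]) (auto simp: split_beta)
  qed
  then obtain y where y: "\<And>j. j \<in> J \<Longrightarrow> y j < d j" "\<And>j. j \<in> J \<Longrightarrow> \<exists>g\<in>Pi\<^sub>E I (\<lambda>_. {..<d j}). k j (g(i := y j)) \<noteq> 0" by metis
  obtain c where c: "\<forall>n\<in>I. c n \<in> S n" "\<forall>j\<in>J. (\<Sum>g\<in>Pi\<^sub>E I (\<lambda>_. {..<d j}). k j (g(i := y j)) * (\<Prod>n\<in>I. c n ^ g n)) \<noteq> 0"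
    using insert(3)[of "\<lambda>j g. k j (g(i := y j))"] y(2) insert(5) by blast
  define q where "q = (\<lambda>j. \<Sum>x<d j. Polynomial.monom (\<Sum>g\<in>Pi\<^sub>E I (\<lambda>_. {..<d j}). k j (g(i := x)) * (\<Prod>n\<in>I. c n ^ g n)) x)"
  have q0: "q j \<noteq> 0" if j: "j \<in> J" for j
  proof
    assume "q j = 0"
    moreover have "coeff (q j) (y j) = (\<Sum>g\<in>Pi\<^sub>E I (\<lambda>_. {..<d j}). k j (g(i := y j)) * (\<Prod>n\<in>I. c n ^ g n))"
      unfolding q_def coeff_sum using y(1)[OF j] by simp
    ultimately show False using c(2) j by simp
  qed
  have "finite (\<Union>j\<in>J. {s. poly (q j) s = 0})" using J q0 by (intro finite_UN_I poly_roots_finite)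
  then have "\<not> S i \<subseteq> (\<Union>j\<in>J. {s. poly (q j) s = 0})" using insert(5)[of i] finite_subset by blast
  then obtain s where s: "s \<in> S i" "\<And>j. j \<in> J \<Longrightarrow> poly (q j) s \<noteq> 0" by blast
  define c' where "c' = c(i := s)"
  have "(\<Sum>\<alpha>\<in>Pi\<^sub>E (insert i I) (\<lambda>_. {..<d j}). k j \<alpha> * (\<Prod>n\<in>insert i I. c' n ^ \<alpha> n)) = poly (q j) s" for j
  proof -
    let ?P = "Pi\<^sub>E I (\<lambda>_. {..<d j})"
    have pr: "(\<Prod>n\<in>insert i I. c' n ^ (g(i := x)) n) = s ^ x * (\<Prod>n\<in>I. c n ^ g n)" for g x
    proof -
      have "(\<Prod>n\<in>I. c' n ^ (g(i := x)) n) = (\<Prod>n\<in>I. c n ^ g n)"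
        by (rule prod.cong[OF refl]) (use insert(2) in \<open>auto simp: c'_def\<close>)
      then show ?thesis using insert(1,2) by (simp add: c'_def)
    qed
    have "(\<Sum>\<alpha>\<in>Pi\<^sub>E (insert i I) (\<lambda>_. {..<d j}). k j \<alpha> * (\<Prod>n\<in>insert i I. c' n ^ \<alpha> n))
       = (\<Sum>z\<in>{..<d j} \<times> ?P. k j ((snd z)(i := fst z)) * (\<Prod>n\<in>insert i I. c' n ^ ((snd z)(i := fst z)) n))"
      unfolding PiE_insert_eq by (subst sum.reindex[OF inj_combinator[OF insert(2)]]) (simp add: split_beta)
    also have "\<dots> = (\<Sum>x<d j. \<Sum>g\<in>?P. k j (g(i := x)) * (s ^ x * (\<Prod>n\<in>I. c n ^ g n)))"
      unfolding pr sum.cartesian_product by (simp add: split_beta)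
    also have "\<dots> = poly (q j) s" unfolding q_def poly_sum poly_monom sum_distrib_right by (intro sum.cong[OF refl]) (simp add: mult_ac)
    finally show ?thesis .
  qed
  then show ?case using s c(1) insert(2) by (intro exI[of _ c']) (auto simp: c'_def)
qed

text \<open>The first factor is normalised to have coefficient one at exponent zero. For a fixed
  pair of supports, products then depend on one parameter fewer than the two supports have elements,
  hence on fewer than \<open>card A\<close> by \<open>sumset_card_nonparallel\<close>, and their
  coefficients satisfy a nontrivial polynomial relation. There are finitely many pairs of supports,
  and \<open>c\<close> violates all these relations.\<close>

lemma generic_coefficients:
  assumes A: "pg A" "fat A" and S: "\<And>n. n \<in> A \<Longrightarrow> infinite (S n)"
  obtains c where "\<And>n. n \<in> A \<Longrightarrow> c n \<in> S n"
    "\<And>g h. kys (g * h) = A \<Longrightarrow> (\<And>n. n \<in> A \<Longrightarrow> lk (g * h) n = c n) \<Longrightarrow> card (kys g) \<le> 1 \<or> card (kys h) \<le> 1"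
proof -
  note fA = pgD[OF A(1)]
  define DD where "DD = (\<lambda>z. fst z - snd z) ` (A \<times> A)"
  define PP where "PP = {z \<in> Pow DD \<times> Pow A. 0 \<in> fst z \<and> card (fst z) + card (snd z) \<le> card A}"
  have fPP: "finite PP" unfolding PP_def DD_def using fA by simp
  define \<Phi> where "\<Phi> = (\<lambda>z n (x :: lat + lat \<Rightarrow> complex). \<Sum>a\<in>fst z. (if a = 0 then 1 else x (Inl a)) * (if n - a \<in> snd z then x (Inr (n - a)) else 0))"
  define RR where "RR = (\<lambda>z :: lat set \<times> lat set. (fst z - {0}) <+> snd z)"
  have fin: "finite (fst z)" "finite (snd z)" "0 \<in> fst z" "card (fst z) + card (snd z) \<le> card A" if "z \<in> PP" for z
    using that fA finite_subset[of "fst z" DD] finite_subset[of "snd z" A] unfolding PP_def DD_def by auto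
  define QQ where "QQ = (\<lambda>z d k. (\<exists>\<alpha>\<in>Pi\<^sub>E A (\<lambda>_. {..<d::nat}). k \<alpha> \<noteq> 0) \<and> (\<forall>x. (\<Sum>\<alpha>\<in>Pi\<^sub>E A (\<lambda>_. {..<d}). k \<alpha> * (\<Prod>n\<in>A. \<Phi> z n x ^ \<alpha> n)) = 0))"
  have "\<forall>z\<in>PP. \<exists>d. \<exists>k. QQ z d k" unfolding QQ_def
  proof (rule ballI, rule pf_dependent)
    fix z assume z: "z \<in> PP"
    show fR: "finite (RR z)" unfolding RR_def using fin[OF z] by simp
    show "finite A" by (rule fA)
    have "card (fst z) > 0" using fin[OF z] by (auto simp: card_gt_0_iff)
    then show "card (RR z) < card A" unfolding RR_def using fin[OF z] by (simp add: card_Plus card_Diff_singleton)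
    fix n
    have 1: "pf (RR z) 1 (\<lambda>x. if a = 0 then 1 else x (Inl a))" if "a \<in> fst z" for a
    proof (cases "a = 0")
      case True then show ?thesis using pf_const[OF fR] by simp
    next
      case False
      then have "Inl a \<in> RR z" unfolding RR_def using that by (intro InlI) simp
      then show ?thesis using pf_var[OF fR, of "Inl a"] False by simp
    qed
    have 2: "pf (RR z) 1 (\<lambda>x. if b \<in> snd z then x (Inr b) else 0)" for b
    proof (cases "b \<in> snd z")
      case True
      then have "Inr b \<in> RR z" unfolding RR_def by (rule InrI)
      then show ?thesis using pf_var[OF fR, of "Inr b"] True by simp
    next
      case False then show ?thesis using pf_const[OF fR] by simp
    qed
    show "pf (RR z) 2 (\<Phi> z n)" unfolding \<Phi>_def
      using pf_mult[OF fR 1 2] by (intro pf_sum) (simp add: numeral_2_eq_2)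
  qed
  from bchoice[OF this] obtain d where d: "\<forall>z\<in>PP. \<exists>k. QQ z (d z) k" ..
  from bchoice[OF d] obtain k where k: "\<forall>z\<in>PP. QQ z (d z) (k z)" ..
  have dk: "\<exists>\<alpha>\<in>Pi\<^sub>E A (\<lambda>_. {..<d z}). k z \<alpha> \<noteq> 0"
    "(\<Sum>\<alpha>\<in>Pi\<^sub>E A (\<lambda>_. {..<d z}). k z \<alpha> * (\<Prod>n\<in>A. \<Phi> z n x ^ \<alpha> n)) = 0" if "z \<in> PP" for z x
    using bspec[OF k that] unfolding QQ_def by simp_all
  have "\<exists>c. (\<forall>n\<in>A. c n \<in> S n) \<and> (\<forall>z\<in>PP. (\<Sum>\<alpha>\<in>Pi\<^sub>E A (\<lambda>_. {..<d z}). k z \<alpha> * (\<Prod>n\<in>A. c n ^ \<alpha> n)) \<noteq> 0)"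
    by (rule pf_nonvanishing[OF fA(1) fPP dk(1) S])
  then obtain c where c: "\<forall>n\<in>A. c n \<in> S n" "\<forall>z\<in>PP. (\<Sum>\<alpha>\<in>Pi\<^sub>E A (\<lambda>_. {..<d z}). k z \<alpha> * (\<Prod>n\<in>A. c n ^ \<alpha> n)) \<noteq> 0"
    by (elim exE conjE)
  show thesis
  proof (rule that[of c])
    show "c n \<in> S n" if "n \<in> A" for n using c(1) that by blast
    fix g0 h0 assume k0: "kys (g0 * h0) = A" and l0: "\<And>n. n \<in> A \<Longrightarrow> lk (g0 * h0) n = c n"
    show "card (kys g0) \<le> 1 \<or> card (kys h0) \<le> 1"
    proof (rule ccontr)
      assume "\<not> ?thesis"
      then have two: "card (kys g0) \<ge> 2" "card (kys h0) \<ge> 2" by simp_all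
      obtain a0 where a0: "a0 \<in> kys g0" using two(1) by fastforce
      define r where "r = lk g0 a0"
      have r: "r \<noteq> 0" using a0 by (simp add: r_def in_keys_iff)
      define g where "g = CC (1 / r) * (mon (- a0) * g0)"
      define h where "h = CC r * (mon a0 * h0)"
      have "g * h = (CC (1 / r) * CC r) * ((mon (- a0) * mon a0) * (g0 * h0))" unfolding g_def h_def by (simp only: mult_ac)
      moreover have "CC (1 / r) * CC r = 1" using r by (simp flip: CC_simps(2) add: CC_simps(4))
      ultimately have gh: "g * h = g0 * h0" by (simp only: mon_inv mult_1)
      have kg: "n \<in> kys g \<longleftrightarrow> n + a0 \<in> kys g0" and kh: "n \<in> kys h \<longleftrightarrow> n - a0 \<in> kys h0" for n
        using r by (simp_all add: g_def h_def in_keys_iff)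
      have "kys g = (\<lambda>n. n - a0) ` kys g0"
      proof (rule Set.set_eqI, rule iffI)
        fix n assume "n \<in> kys g" then show "n \<in> (\<lambda>n. n - a0) ` kys g0" unfolding kg by (intro image_eqI[of _ _ "n + a0"]) simp_all
      next
        fix n assume "n \<in> (\<lambda>n. n - a0) ` kys g0" then show "n \<in> kys g" unfolding kg by (elim imageE) simp
      qed
      then have cg: "card (kys g) = card (kys g0)" by (simp add: card_image inj_on_def)
      have "kys h = (\<lambda>n. n + a0) ` kys h0"
      proof (rule Set.set_eqI, rule iffI)
        fix n assume "n \<in> kys h" then show "n \<in> (\<lambda>n. n + a0) ` kys h0" unfolding kh by (intro image_eqI[of _ _ "n - a0"]) simp_all
      next
        fix n assume "n \<in> (\<lambda>n. n + a0) ` kys h0" then show "n \<in> kys h" unfolding kh by (elim imageE) simp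
      qed
      then have ch: "card (kys h) = card (kys h0)" by (simp add: card_image inj_on_def)
      have g0: "0 \<in> kys g" unfolding kg using a0 by simp
      have l1: "lk g 0 = 1" using r by (simp add: g_def r_def)
      have nz: "g \<noteq> 0" "h \<noteq> 0" using two cg ch by auto
      have hzA: "hz A w = hz (kys g) w + hz (kys h) w" for w using hz_mult[OF nz] gh k0 by simp
      have sum: "a + b \<in> A" if "a \<in> kys g" "b \<in> kys h" for a b
      proof (rule pg_memI[OF A(1)])
        fix w show "dotz w (a + b) \<le> hz A w"
          using hz_ge[OF finite_keys that(1), of w] hz_ge[OF finite_keys that(2), of w] unfolding hzA by simp
      qed
      have hA: "kys h \<subseteq> A" using sum[OF g0] by fastforce
      have gD: "kys g \<subseteq> DD"
      proof
        fix a assume a: "a \<in> kys g"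
        obtain b where b: "b \<in> kys h" using nz(2) kys_ne by blast
        have "(a + b, b) \<in> A \<times> A" using sum[OF a b] hA b by blast
        then show "a \<in> DD" unfolding DD_def by (rule image_eqI[rotated]) simp
      qed
      have "card (kys g) + card (kys h) \<le> card A"
      proof (rule sumset_card_nonparallel[OF finite_keys _ finite_keys _ fA(1) sum])
        show "card (kys g) \<ge> 2" "card (kys h) \<ge> 2" using two cg ch by simp_all
        fix w c c' assume w: "w \<noteq> 0" "kys g \<subseteq> level w c" "kys h \<subseteq> level w c'"

        have e: "hz S w = c \<and> hz S (- w) = - c" if "finite S" "S \<noteq> {}" "S \<subseteq> level w c" for S c
        proof -
          obtain s where s: "s \<in> S" using \<open>S \<noteq> {}\<close> by blast
          have l: "dotz w n = c" if "n \<in> S" for n using that \<open>S \<subseteq> level w c\<close> by (auto simp: level_def)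
          show ?thesis using hz_eqI[OF \<open>finite S\<close> s, of w c] hz_eqI[OF \<open>finite S\<close> s, of "- w" "- c"] l s by simp
        qed
        have "wd A w = 0" unfolding wd_def hzA using e[OF finite_keys kys_ne[OF nz(1)] w(2)] e[OF finite_keys kys_ne[OF nz(2)] w(3)] by simp
        then show False using A(2) w(1) unfolding fat_def by force
      qed
      then have PP: "(kys g, kys h) \<in> PP" unfolding PP_def using g0 hA gD by simp
      define x where "x = case_sum (lk g) (lk h)"
      have "\<Phi> (kys g, kys h) n x = c n" if n: "n \<in> A" for n
      proof -
        have "\<Phi> (kys g, kys h) n x = (\<Sum>a\<in>kys g. lk g a * lk h (n - a))"
          unfolding \<Phi>_def fst_conv snd_conv by (rule sum.cong[OF refl]) (simp add: x_def l1 in_keys_iff)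
        then show ?thesis using l0[OF n] by (simp add: lk_mult flip: gh)
      qed
      then have "(\<Sum>\<alpha>\<in>Pi\<^sub>E A (\<lambda>_. {..<d (kys g, kys h)}). k (kys g, kys h) \<alpha> * (\<Prod>n\<in>A. c n ^ \<alpha> n)) = 0"
        using dk(2)[OF PP, of x] by simp
      then show False using c(2) PP by blast
    qed
  qed
qed

section \<open>Bivariate polynomials inside the Laurent polynomials\<close>

primrec ppl :: "complex poly list \<Rightarrow> lau" where
  "ppl [] = 0" | "ppl (a # as) = pe (mon (1, 0)) a + mon (0, 1) * ppl as"

definition pp :: "complex poly poly \<Rightarrow> lau" where "pp P = ppl (coeffs P)"

lemma pp_0 [simp]: "pp 0 = 0" by (simp add: pp_def)
lemma pp_pCons [simp]: "pp (pCons a P) = pe (mon (1, 0)) a + mon (0, 1) * pp P"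
  by (cases "P = 0 \<and> a = 0") (auto simp: pp_def cCons_def)
lemma pp_add: "pp (P + Q) = pp P + pp Q"
proof (induction P arbitrary: Q rule: pCons_induct)
  case (pCons a P)
  then show ?case by (cases Q rule: pCons_cases) (simp add: pe_add algebra_simps)
qed simp
lemma pp_smult: "pp (Polynomial.smult c P) = pe (mon (1, 0)) c * pp P"
  by (induction P) (simp_all add: pe_mult algebra_simps)
lemma pp_mult: "pp (P * Q) = pp P * pp Q"
  by (induction P) (simp_all add: pp_add pp_smult algebra_simps)
lemma pp_sum: "pp (\<Sum>i\<in>I. P i) = (\<Sum>i\<in>I. pp (P i))"
  by (induction I rule: infinite_finite_induct) (simp_all add: pp_add)
lemma pp_1: "pp 1 = 1" by (simp add: one_pCons CC_simps)

lemma pp_monom: "pp (Polynomial.monom (Polynomial.monom c i) j) = CC c * mon (int i, int j)"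
proof (induction j)
  case 0
  have "sm (int i) (1, 0) = (int i, int 0)" by (simp add: sm_def)
  then show ?case by (simp add: monom_0 pe_monom mon_power)
next
  case (Suc j)
  have "mon (0, 1) * mon (int i, int j) = mon (int i, int (Suc j))" by (simp flip: mon_add)
  then show ?case using Suc by (simp add: monom_Suc mult.left_commute[of "mon (0,1)"])
qed

lemma lk_pe: "lk (pe (mon (1, 0)) p) (i, j) = (if i \<ge> 0 \<and> j = 0 then coeff p (nat i) else 0)"
proof (induction p arbitrary: i rule: pCons_induct)
  case (pCons a p)
  have c: "lk (CC a) (i, j) = (if i = 0 \<and> j = 0 then a else 0)" by (simp add: CC_def lookup_single when_def zero_prod_def)
  have "lk (pe (mon (1, 0)) (pCons a p)) (i, j) = lk (CC a) (i, j) + lk (pe (mon (1, 0)) p) (i - 1, j)"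
    by (simp add: lookup_add)
  moreover have "nat i = Suc (nat (i - 1))" if "i > 0" using that by simp
  ultimately show ?case unfolding pCons.IH c by (cases "i > 0") (auto simp: coeff_pCons)
qed simp

lemma lk_pp: "lk (pp P) (i, j) = (if i \<ge> 0 \<and> j \<ge> 0 then coeff (coeff P (nat j)) (nat i) else 0)"
proof (induction P arbitrary: j rule: pCons_induct)
  case (pCons a P)
  have "lk (pp (pCons a P)) (i, j) = lk (pe (mon (1, 0)) a) (i, j) + lk (pp P) (i, j - 1)" by (simp add: lookup_add)
  moreover have "nat j = Suc (nat (j - 1))" if "j > 0" using that by simp
  ultimately show ?case unfolding pCons.IH lk_pe by (cases "j > 0") (auto simp: coeff_pCons)
qed simp

lemma pp_inj: assumes "pp P = pp Q" shows "P = Q"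
proof (intro poly_eqI)
  fix j i
  have "lk (pp P) (int i, int j) = lk (pp Q) (int i, int j)" using assms by simp
  then show "coeff (coeff P j) i = coeff (coeff Q j) i" by (simp add: lk_pp)
qed

lemma pp_shift: obtains n P where "pp P = mon n * a"
proof -
  define n where "n = (\<Sum>k\<in>kys a. \<bar>fst k\<bar>, \<Sum>k\<in>kys a. \<bar>snd k\<bar>)"
  have n: "fst (n + k) \<ge> 0 \<and> snd (n + k) \<ge> 0" if k: "k \<in> kys a" for k
  proof -
    have "\<bar>fst k\<bar> \<le> (\<Sum>k\<in>kys a. \<bar>fst k\<bar>)" "\<bar>snd k\<bar> \<le> (\<Sum>k\<in>kys a. \<bar>snd k\<bar>)"
      using member_le_sum[OF k, of "\<lambda>k. \<bar>fst k\<bar>"] member_le_sum[OF k, of "\<lambda>k. \<bar>snd k\<bar>"] by simp_all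
    then show ?thesis unfolding n_def by (simp only: fst_add snd_add fst_conv snd_conv) linarith
  qed
  have pm: "pp (Polynomial.monom (Polynomial.monom c (nat (fst m))) (nat (snd m))) = CC c * mon m" if "fst m \<ge> 0 \<and> snd m \<ge> 0" for c m
    using that by (simp add: pp_monom)
  have "pp (\<Sum>k\<in>kys a. Polynomial.monom (Polynomial.monom (lk a k) (nat (fst (n + k)))) (nat (snd (n + k)))) = (\<Sum>k\<in>kys a. CC (lk a k) * mon (n + k))"
    unfolding pp_sum by (rule sum.cong[OF refl pm[OF n]])
  also have "\<dots> = mon n * (\<Sum>k\<in>kys a. CC (lk a k) * mon k)"
    unfolding sum_distrib_left mon_add by (rule sum.cong[OF refl]) (simp only: mult_ac)
  also have "(\<Sum>k\<in>kys a. CC (lk a k) * mon k) = a" by (subst (3) lau_decomp) (simp add: CC_def mon_def mult_single)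
  finally show thesis by (rule that)
qed

lemma monomial_form: assumes "card (kys t) \<le> 1" "t \<noteq> 0" obtains c n where "c \<noteq> 0" "t = CC c * mon n"
proof -
  have "card (kys t) = 1" using assms kys_ne by (simp add: le_Suc_eq)
  then obtain n where n: "kys t = {n}" by (rule card_1_singletonE)
  have "t = CC (lk t n) * mon n" by (subst lau_decomp) (simp add: n CC_def mon_def mult_single)
  moreover have "lk t n \<noteq> 0" using n by (metis in_keys_iff singletonI)
  ultimately show thesis using that by blast
qed

definition pdeg :: "complex poly poly \<Rightarrow> nat" where "pdeg P = degree P + degree (lead_coeff P)"

lemma pdeg_mult: "P \<noteq> 0 \<Longrightarrow> Q \<noteq> 0 \<Longrightarrow> pdeg (P * Q) = pdeg P + pdeg Q"
  unfolding pdeg_def lead_coeff_mult by (subst (1 2) degree_mult_eq) simp_all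

lemma pdeg_0_unit: assumes "pdeg P = 0" "P \<noteq> 0" shows "P dvd 1"
proof -
  have d: "degree P = 0" "degree (lead_coeff P) = 0"
    using conjunct1[OF assms(1)[unfolded pdeg_def add_is_0]] conjunct2[OF assms(1)[unfolded pdeg_def add_is_0]] .
  obtain p where p: "P = [:p:]" using d(1) by (rule degree_eq_zeroE)
  then have "degree p = 0" using d(2) by simp
  then obtain c where c: "p = [:c:]" by (rule degree_eq_zeroE)
  have "c \<noteq> 0" using assms p c by auto
  then have "[:[:c:]:] * [:[:1 / c:]:] = 1" by (simp add: one_pCons)
  then show ?thesis unfolding p c by (metis dvd_triv_left)
qed

context polygons
begin

text \<open>The ring of polynomials over \<open>complex poly\<close> is factorial; a polynomial of least degree among those which agree
  with \<open>f\<close> up to a monomial factor is irreducible there.\<close>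

lemma prime_if_irreducible:
  assumes irr: "\<And>g h. f = g * h \<Longrightarrow> card (kys g) \<le> 1 \<or> card (kys h) \<le> 1" and ab: "f dvd a * b"
  shows "f dvd a \<or> f dvd b"
proof -
  obtain n0 F0 where "pp F0 = mon n0 * f" by (rule pp_shift)
  then have "\<exists>n. pp F0 = mon n * f" by blast
  then obtain F where F: "\<exists>n. pp F = mon n * f" "\<forall>G. (\<exists>n. pp G = mon n * f) \<longrightarrow> pdeg F \<le> pdeg G"
    using ex_has_least_nat[of "\<lambda>F. \<exists>n. pp F = mon n * f" F0 pdeg] by blast
  then obtain n where n: "pp F = mon n * f" by blast
  have mnz: "mon m \<noteq> 0" for m
  proof
    assume "mon m = 0"
    then have "kys (mon m) = {}" by simp
    then show False by (simp add: kys_mon)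
  qed
  have F0: "F \<noteq> 0" using n lau_mult_nz[OF mnz f0, of n] by (metis pp_0)
  have f_F: "f = mon (- n) * pp F" unfolding n mon_cancel ..
  have small: "H dvd 1" if GH: "F = G * H" and H: "pp H = CC c * mon m" "c \<noteq> 0" for G H c m
  proof -
    have nz: "G \<noteq> 0" "H \<noteq> 0" using F0 GH by auto
    have "mon n * f = pp G * (CC c * mon m)" unfolding n[symmetric] GH pp_mult H ..
    then have "mon (- m) * (mon n * f) = CC c * pp G * (mon (- m) * mon m)" by (simp only: mult_ac)
    then have "CC c * pp G = mon (- m) * (mon n * f)" by (simp only: mon_inv mult_1_right)
    moreover have "pp (Polynomial.smult [:c:] G) = CC c * pp G" by (simp add: pp_smult)
    ultimately have "pp (Polynomial.smult [:c:] G) = mon (- m + n) * f" by (simp only: mon_add mult.assoc)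
    then have "pdeg F \<le> pdeg (Polynomial.smult [:c:] G)" using F(2) by blast
    also have "\<dots> = pdeg G" using H(2) by (simp add: pdeg_def)
    finally have "pdeg H = 0" unfolding GH pdeg_mult[OF nz] by simp
    then show ?thesis using nz(2) by (rule pdeg_0_unit)
  qed
  have "Factorial_Ring.irreducible F"
  proof (rule Factorial_Ring.irreducibleI[OF F0])
    show "\<not> F dvd 1"
    proof
      assume "F dvd 1"
      then obtain G where "1 = F * G" by (elim dvdE)
      then have "pp 1 = pp F * pp G" unfolding pp_mult[symmetric] by (rule arg_cong)
      then have "1 = mon n * f * pp G" unfolding pp_1 n .
      then have "mon 0 = f * (mon n * pp G)" by (simp add: mult_ac)
      then have "f dvd mon 0" by (rule dvdI)
      then show False using f_not_dvd_mon by blast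
    qed
    fix G H assume GH: "F = G * H"
    have nz: "G \<noteq> 0" "H \<noteq> 0" using F0 GH by auto
    have pnz: "pp P \<noteq> 0" if "P \<noteq> 0" for P using pp_inj[of P 0] that by auto
    have "f = (mon (- n) * pp G) * pp H" unfolding f_F GH pp_mult mult.assoc ..
    then consider "card (kys (mon (- n) * pp G)) \<le> 1" | "card (kys (pp H)) \<le> 1" using irr by blast
    then show "G dvd 1 \<or> H dvd 1"
    proof cases
      case 1
      obtain c m where c: "c \<noteq> 0" "mon (- n) * pp G = CC c * mon m"
        by (rule monomial_form[OF 1 lau_mult_nz[OF mnz pnz[OF nz(1)]]])
      have "pp G = mon n * (CC c * mon m)" unfolding c(2)[symmetric] mon_cancel ..
      also have "\<dots> = CC c * mon (n + m)" by (simp only: mon_add mult_ac)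
      finally have pG: "pp G = CC c * mon (n + m)" .
      have "F = H * G" unfolding GH by (rule mult.commute)
      then show ?thesis using small[OF _ pG c(1)] by blast
    next
      case 2
      obtain c m where c: "c \<noteq> 0" "pp H = CC c * mon m" by (rule monomial_form[OF 2 pnz[OF nz(2)]])
      then show ?thesis using small[OF GH] by blast
    qed
  qed
  then have pF: "prime_elem F" by (rule Factorial_Ring.irreducible_imp_prime_elem)
  obtain c where c: "a * b = f * c" using ab by (elim dvdE)
  obtain na PA where PA: "pp PA = mon na * a" by (rule pp_shift)
  obtain nb PB where PB: "pp PB = mon nb * b" by (rule pp_shift)
  obtain nc PC where PC: "pp PC = mon nc * c" by (rule pp_shift)
  \<comment> \<open>The factors of \<open>a * b = f * c\<close> are cleared of denominators by
    independent shifts. \<open>d\<close> is their mismatch, and its positive and negative parts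
    \<open>M d\<close> and \<open>M (- d)\<close> balance the two sides as polynomials.\<close>
  define d where "d = (n + nc) - (na + nb)"
  define M where "M = (\<lambda>e :: lat. Polynomial.monom (Polynomial.monom (1::complex) (nat (fst e))) (nat (snd e)))"
  have ppM: "pp (M e) = mon (max (fst e) 0, max (snd e) 0)" for e
  proof -
    have "int (nat x) = max x 0" for x by simp
    then show ?thesis unfolding M_def pp_monom by (simp add: CC_simps)
  qed
  have sh: "(max (fst d) 0, max (snd d) 0) + (na + nb) = (max (fst (- d)) 0, max (snd (- d)) 0) + (n + nc)"
    by (simp add: prod_eq_iff d_def max_def)
  have "pp (M d * (PA * PB)) = mon ((max (fst d) 0, max (snd d) 0) + (na + nb)) * (a * b)"
    unfolding pp_mult ppM PA PB mon_add by (simp only: mult_ac)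
  also have "\<dots> = pp (M (- d) * (F * PC))" unfolding sh c pp_mult ppM n PC mon_add by (simp only: mult_ac)
  finally have "M d * (PA * PB) = M (- d) * (F * PC)" by (rule pp_inj)
  then have "F dvd M d * (PA * PB)" by simp
  then consider "F dvd M d" | "F dvd PA" | "F dvd PB" using pF by (auto simp: prime_elem_dvd_mult_iff)
  then show ?thesis
  proof cases
    case 1
    then obtain G where "M d = F * G" by (elim dvdE)
    then have "pp (M d) = f * (mon n * pp G)" by (simp add: pp_mult n mult_ac)
    then have "f dvd mon (max (fst d) 0, max (snd d) 0)" unfolding ppM by (rule dvdI)
    then show ?thesis using f_not_dvd_mon by blast
  next
    case 2
    then obtain G where "PA = F * G" by (elim dvdE)
    then have "mon na * a = f * (mon n * pp G)" using PA by (simp add: pp_mult n mult_ac)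
    then have "mon (- na) * (mon na * a) = f * (mon (- na) * (mon n * pp G))" by (simp add: mult_ac)
    then have "f dvd a" unfolding mon_cancel by (rule dvdI)
    then show ?thesis ..
  next
    case 3
    then obtain G where "PB = F * G" by (elim dvdE)
    then have "mon nb * b = f * (mon n * pp G)" using PB by (simp add: pp_mult n mult_ac)
    then have "mon (- nb) * (mon nb * b) = f * (mon (- nb) * (mon n * pp G))" by (simp add: mult_ac)
    then have "f dvd b" unfolding mon_cancel by (rule dvdI)
    then show ?thesis ..
  qed
qed

end

section \<open>Sums of squares and separating functionals\<close>

lemma bounded_subsequence:
  fixes X :: "nat \<Rightarrow> 'i \<Rightarrow> real"
  assumes "finite I" "\<And>i k. i \<in> I \<Longrightarrow> \<bar>X k i\<bar> \<le> B"
  shows "\<exists>r l. strict_mono (r :: nat \<Rightarrow> nat) \<and> (\<forall>i\<in>I. (\<lambda>k. X (r k) i) \<longlonglongrightarrow> l i)"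
  using assms
proof (induction I rule: finite_induct)
  case empty
  then show ?case using strict_mono_id by (intro exI[of _ "\<lambda>x. x"]) (auto simp: strict_mono_def)
next
  case (insert i I)
  then obtain r l where r: "strict_mono (r :: nat \<Rightarrow> nat)" "\<forall>i\<in>I. (\<lambda>k. X (r k) i) \<longlonglongrightarrow> l i" by blast
  have "bounded (range (\<lambda>k. X (r k) i))" unfolding bounded_iff using insert(4)[of i] by (intro exI[of _ B]) auto
  then obtain y s where s: "strict_mono (s :: nat \<Rightarrow> nat)" "((\<lambda>k. X (r k) i) \<circ> s) \<longlonglongrightarrow> y"
    using bounded_imp_convergent_subsequence by blast
  have 1: "strict_mono (r \<circ> s)" using r(1) s(1) by (rule strict_mono_o)
  have "(\<lambda>k. X ((r \<circ> s) k) j) \<longlonglongrightarrow> (l(i := y)) j" if j: "j \<in> insert i I" for j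
  proof (cases "j = i")
    case True then show ?thesis using s(2) by (simp add: o_def)
  next
    case False
    then have "(\<lambda>k. X (r k) j) \<longlonglongrightarrow> l j" using r(2) j by blast
    from LIMSEQ_subseq_LIMSEQ[OF this s(1)] show ?thesis using False by (simp add: o_def)
  qed
  then show ?case using 1 by blast
qed

text \<open>A linear dependence among the generators is subtracted until the first weight becomes
  zero; the least ratio \<open>t\<close> keeps all weights nonnegative.\<close>

lemma conic_caratheodory:
  fixes \<phi> :: "'j \<Rightarrow> 'x \<Rightarrow> real"
  assumes X: "finite X" and "finite J" "\<And>j. j \<in> J \<Longrightarrow> w j \<ge> 0"
  shows "\<exists>J' w'. J' \<subseteq> J \<and> card J' \<le> card X \<and> (\<forall>j\<in>J'. w' j \<ge> 0) \<and> (\<forall>x\<in>X. (\<Sum>j\<in>J'. w' j * \<phi> j x) = (\<Sum>j\<in>J. w j * \<phi> j x))"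
  using assms(2,3)
proof (induction "card J" arbitrary: J w rule: less_induct)
  case less
  show ?case
  proof (cases "card J \<le> card X")
    case True then show ?thesis using less(3) by (intro exI[of _ J] exI[of _ w]) simp
  next
    case False
    then obtain c0 where c0: "\<exists>j\<in>J. c0 j \<noteq> 0" "\<forall>x\<in>X. (\<Sum>j\<in>J. c0 j * \<phi> j x) = 0"
      using underdetermined[OF X less(2), of \<phi>] by auto
    define c where "c = (if \<exists>j\<in>J. c0 j > 0 then c0 else (\<lambda>j. - c0 j))"
    have c: "\<exists>j\<in>J. c j > 0" "\<forall>x\<in>X. (\<Sum>j\<in>J. c j * \<phi> j x) = 0"
      using c0 by (auto simp: c_def sum_negf) (metis linorder_neqE_linordered_idom)
    let ?P = "{j\<in>J. c j > 0}"
    have P: "finite ?P" "?P \<noteq> {}" using c(1) less(2) by auto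
    define t where "t = Min ((\<lambda>j. w j / c j) ` ?P)"
    have "t \<in> (\<lambda>j. w j / c j) ` ?P" unfolding t_def using P by (intro Min_in) auto
    then obtain j0 where j0: "j0 \<in> J" "c j0 > 0" "t = w j0 / c j0" by auto
    have t0: "t \<ge> 0" using j0 less(3) by simp
    define w' where "w' = (\<lambda>j. w j - t * c j)"
    have w'0: "w' j \<ge> 0" if j: "j \<in> J" for j
    proof (cases "c j > 0")
      case True
      then have "t \<le> w j / c j" unfolding t_def using P j by (intro Min_le) auto
      then show ?thesis using True by (simp add: w'_def pos_le_divide_eq)
    next
      case False
      then have "t * c j \<le> 0" using t0 by (simp add: mult_nonneg_nonpos)
      then show ?thesis using less(3)[OF j] by (simp add: w'_def)
    qed
    have z: "w' j0 = 0" using j0 by (simp add: w'_def)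
    have "card (J - {j0}) < card J" using j0(1) less(2) by (metis card_Diff1_less)
    then obtain J' w'' where J': "J' \<subseteq> J - {j0}" "card J' \<le> card X" "\<forall>j\<in>J'. w'' j \<ge> 0"
      "\<forall>x\<in>X. (\<Sum>j\<in>J'. w'' j * \<phi> j x) = (\<Sum>j\<in>J - {j0}. w' j * \<phi> j x)"
      using less(1)[of "J - {j0}" w'] w'0 less(2) by blast
    have "(\<Sum>j\<in>J - {j0}. w' j * \<phi> j x) = (\<Sum>j\<in>J. w j * \<phi> j x)" if x: "x \<in> X" for x
    proof -
      have "(\<Sum>j\<in>J. w' j * \<phi> j x) = (\<Sum>j\<in>J. w j * \<phi> j x) - t * (\<Sum>j\<in>J. c j * \<phi> j x)"
        by (simp add: w'_def left_diff_distrib sum_subtractf sum_distrib_left mult.assoc)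
      then show ?thesis using c(2) x z j0(1) less(2) by (simp add: sum_diff1)
    qed
    then show ?thesis using J' by (intro exI[of _ J'] exI[of _ w'']) (use J'(1) in auto)
  qed
qed

lemma quadratic_first_order:
  fixes D v :: "'a \<Rightarrow> real"
  assumes "\<And>t. 0 < t \<Longrightarrow> t \<le> 1 \<Longrightarrow> (\<Sum>n\<in>N. (D n + t * v n)\<^sup>2) \<ge> (\<Sum>n\<in>N. (D n)\<^sup>2)"
  shows "(\<Sum>n\<in>N. D n * v n) \<ge> 0"
proof (rule ccontr)
  define a where "a = (\<Sum>n\<in>N. D n * v n)"
  define b where "b = (\<Sum>n\<in>N. (v n)\<^sup>2)"
  assume "\<not> ?thesis"
  then have a: "a < 0" by (simp add: a_def)
  have b: "b \<ge> 0" by (simp add: b_def sum_nonneg)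
  define t where "t = min 1 (- a / (b + 1))"
  have t: "0 < t" "t \<le> 1" using divide_neg_pos[of a "b + 1"] a b by (simp_all add: t_def)
  have "t * (b + 1) \<le> - a / (b + 1) * (b + 1)" using b by (intro mult_right_mono) (simp_all add: t_def)
  then have t3: "t * (b + 1) \<le> - a" using b by simp
  have "(\<Sum>n\<in>N. (D n + t * v n)\<^sup>2) = (\<Sum>n\<in>N. (D n)\<^sup>2) + 2 * t * a + t\<^sup>2 * b"
    unfolding a_def b_def by (simp add: power2_eq_square algebra_simps sum.distrib sum_distrib_left)
  then have "2 * t * a + t\<^sup>2 * b \<ge> 0" using assms[OF t(1,2)] by simp
  then have "t * (2 * a + t * b) \<ge> 0" by (simp add: power2_eq_square algebra_simps)
  then have "2 * a + t * b \<ge> 0" using t(1) by (simp add: zero_le_mult_iff)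
  moreover have "t * b \<le> - a" using t(1) t3 by (simp add: algebra_simps)
  ultimately show False using a by linarith
qed

section \<open>Sums of a bounded number of squares\<close>

definition cnv :: "lat set \<Rightarrow> (lat \<Rightarrow> real) \<Rightarrow> (lat \<Rightarrow> real) \<Rightarrow> lat \<Rightarrow> real" where
  "cnv S \<phi> \<psi> n = (\<Sum>a\<in>S. \<phi> a * \<psi> (n - a))"
definition vof :: "lat set \<Rightarrow> (lat \<Rightarrow> real) \<Rightarrow> bool" where "vof S \<phi> \<longleftrightarrow> (\<forall>n. n \<notin> S \<longrightarrow> \<phi> n = 0)"
lemma vofD: "vof S \<phi> \<Longrightarrow> n \<notin> S \<Longrightarrow> \<phi> n = 0" unfolding vof_def by blast
definition trc :: "lat set \<Rightarrow> (lat \<Rightarrow> real) \<Rightarrow> real" where "trc S \<phi> = (\<Sum>n\<in>S. (\<phi> n)\<^sup>2)"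

lemma cnv_scale: "cnv S (\<lambda>n. c * \<phi> n) (\<lambda>n. d * \<psi> n) n = c * d * cnv S \<phi> \<psi> n"
  by (simp add: cnv_def sum_distrib_left mult_ac)
lemma cnv_scale_right: "cnv S \<phi> (\<lambda>n. d * \<psi> n) n = d * cnv S \<phi> \<psi> n"
  by (simp add: cnv_def sum_distrib_left mult_ac)
lemma trc_scale: "trc S (\<lambda>n. c * \<phi> n) = c\<^sup>2 * trc S \<phi>"
  by (simp add: trc_def sum_distrib_left power_mult_distrib)
lemma cnv_zero_out: assumes "vof T \<psi>" "\<And>a b. a \<in> S \<Longrightarrow> b \<in> T \<Longrightarrow> a + b \<in> U" "n \<notin> U" shows "cnv S \<phi> \<psi> n = 0"
  unfolding cnv_def
proof (rule sum.neutral, rule ballI)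
  fix a assume "a \<in> S"
  then have "n - a \<notin> T" using assms(2)[of a "n - a"] assms(3) by auto
  then show "\<phi> a * \<psi> (n - a) = 0" using vofD[OF assms(1)] by simp
qed

locale square_sums =
  fixes A G H HH :: "lat set"
  assumes fin: "finite A" "finite G" "finite H" "finite HH"
    and HH: "\<And>a b. a \<in> H \<Longrightarrow> b \<in> H \<Longrightarrow> a + b \<in> HH" and AG: "\<And>a b. a \<in> A \<Longrightarrow> b \<in> G \<Longrightarrow> a + b \<in> HH"
begin

text \<open>The number of coefficients of a product, plus one for the trace, which has to be
  preserved when sums of squares are shortened.\<close>

definition "M = card HH + 1"
definition sos :: "(nat \<Rightarrow> lat \<Rightarrow> real) \<Rightarrow> lat \<Rightarrow> real" where "sos h n = (\<Sum>j<M. cnv H (h j) (h j) n)"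
definition tuple :: "(nat \<Rightarrow> lat \<Rightarrow> real) \<Rightarrow> bool" where "tuple h \<longleftrightarrow> (\<forall>j. vof H (h j))"
definition tr :: "(nat \<Rightarrow> lat \<Rightarrow> real) \<Rightarrow> real" where "tr h = (\<Sum>j<M. trc H (h j))"
definition multiplier :: "(lat \<Rightarrow> real) \<Rightarrow> (lat \<Rightarrow> real) \<Rightarrow> bool" where
  "multiplier f g \<longleftrightarrow> vof G g \<and> g \<noteq> (\<lambda>_. 0) \<and> (\<exists>h. tuple h \<and> (\<forall>n. cnv A f g n = sos h n))"

text \<open>\<open>conic_caratheodory\<close> is applied to the vectors of coefficients extended by
  the trace in coordinate \<open>None\<close>; the new weights enter the squares as square
  roots.\<close>

lemma sos_tuple:
  assumes J: "finite J" and h: "\<And>j. j \<in> J \<Longrightarrow> vof H (h j)"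
  obtains h' where "tuple h'" "\<And>n. sos h' n = (\<Sum>j\<in>J. cnv H (h j) (h j) n)" "tr h' = (\<Sum>j\<in>J. trc H (h j))"
proof -
  define \<Phi> where "\<Phi> = (\<lambda>\<phi>. case_option (trc H \<phi>) (cnv H \<phi> \<phi>))"
  define X where "X = insert None (Some ` HH)"
  have cX: "card X = M" unfolding X_def M_def using fin(4) by (simp add: card_image)
  have sc: "\<Phi> (\<lambda>n. c * \<phi> n) x = c\<^sup>2 * \<Phi> \<phi> x" for c \<phi> x
    unfolding \<Phi>_def by (cases x) (simp_all add: trc_scale cnv_scale power2_eq_square)
  have \<Phi>0: "\<Phi> (\<lambda>n. 0) x = 0" for x using sc[of 0 "\<lambda>_. 0" x] by simp
  have "finite X" using fin(4) by (simp add: X_def)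
  then obtain J' w where J': "J' \<subseteq> J" "card J' \<le> M" "\<forall>j\<in>J'. w j \<ge> 0" "\<forall>x\<in>X. (\<Sum>j\<in>J'. w j * \<Phi> (h j) x) = (\<Sum>j\<in>J. 1 * \<Phi> (h j) x)"
    using conic_caratheodory[of X J "\<lambda>_. 1" "\<lambda>j. \<Phi> (h j)"] J cX by auto
  obtain e where e: "bij_betw e {0..<card J'} J'" using ex_bij_betw_nat_finite finite_subset[OF J'(1) J] by blast
  have eJ: "e i \<in> J'" if "i < card J'" for i using bij_betwE[OF e] that by simp
  define h' where "h' = (\<lambda>i n. (if i < card J' then sqrt (w (e i)) else 0) * h (if i < card J' then e i else undefined) n)"
  have t: "tuple h'" unfolding tuple_def
  proof
    fix i show "vof H (h' i)"
      using h[of "e i"] eJ[of i] J'(1) by (cases "i < card J'") (auto simp: h'_def vof_def)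
  qed
  have s: "(\<Sum>i<M. \<Phi> (h' i) x) = (\<Sum>j\<in>J. \<Phi> (h j) x)" if x: "x \<in> X" for x
  proof -
    have "(\<Sum>i<M. \<Phi> (h' i) x) = (\<Sum>i\<in>{0..<card J'}. \<Phi> (h' i) x)"
      by (rule sum.mono_neutral_right) (use J'(2) in \<open>auto simp: h'_def sc \<Phi>0\<close>)
    also have "\<dots> = (\<Sum>i\<in>{0..<card J'}. w (e i) * \<Phi> (h (e i)) x)"
      by (rule sum.cong[OF refl]) (use J'(3) eJ in \<open>simp add: h'_def sc\<close>)
    also have "\<dots> = (\<Sum>j\<in>J'. w j * \<Phi> (h j) x)" by (rule sum.reindex_bij_betw[OF e])
    finally show ?thesis using J'(4) x by simp
  qed
  show thesis
  proof (rule that[OF t])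
    show "tr h' = (\<Sum>j\<in>J. trc H (h j))" using s[of None] by (simp add: X_def \<Phi>_def tr_def)
    fix n show "sos h' n = (\<Sum>j\<in>J. cnv H (h j) (h j) n)"
    proof (cases "n \<in> HH")
      case True then show ?thesis using s[of "Some n"] by (simp add: X_def \<Phi>_def sos_def)
    next
      case False
      then have "cnv H (h' i) (h' i) n = 0" for i using t HH by (intro cnv_zero_out[of H _ H HH]) (simp_all add: tuple_def)
      moreover have "cnv H (h j) (h j) n = 0" if "j \<in> J" for j using h[OF that] HH False by (intro cnv_zero_out[of H _ H HH]) simp_all
      ultimately show ?thesis by (simp add: sos_def)
    qed
  qed
qed

lemma tr_nonneg: "tr h \<ge> 0" by (simp add: tr_def trc_def sum_nonneg)

lemma tr_coeff: assumes "j < M" "n \<in> H" shows "(h j n)\<^sup>2 \<le> tr h"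
proof -
  have "(h j n)\<^sup>2 \<le> trc H (h j)" unfolding trc_def by (rule member_le_sum[OF assms(2) _ fin(3)]) simp
  also have "\<dots> \<le> tr h" unfolding tr_def by (rule member_le_sum[of j "{..<M}"]) (use assms(1) in \<open>simp_all add: trc_def sum_nonneg\<close>)
  finally show ?thesis .
qed

text \<open>At an exposed exponent \<open>v\<close> of the union of the supports, the coefficient of
  the sum at \<open>v + v\<close> is the sum of the squares of the coefficients at \<open>v\<close>,
  so nothing cancels.\<close>

lemma sos_zero: assumes t: "tuple h" and z: "\<And>n. sos h n = 0" shows "tr h = 0"
proof (rule ccontr)
  assume nz: "tr h \<noteq> 0"
  define S where "S = {n\<in>H. \<exists>j<M. h j n \<noteq> 0}"
  have "S \<noteq> {}"
  proof
    assume "S = {}"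
    then have "h j n = 0" if "j < M" "n \<in> H" for j n using that unfolding S_def by blast
    then show False using nz by (simp add: tr_def trc_def)
  qed
  moreover have "finite S" using fin by (simp add: S_def)
  ultimately obtain v \<theta> where v: "v \<in> S" "\<And>n. n \<in> S \<Longrightarrow> n \<noteq> v \<Longrightarrow> dotz \<theta> n > dotz \<theta> v" using exposed_min by metis
  have "cnv H (h j) (h j) (v + v) = (h j v)\<^sup>2" if j: "j < M" for j
  proof -
    have "cnv H (h j) (h j) (v + v) = (\<Sum>a\<in>H. if a = v then (h j v)\<^sup>2 else 0)"
      unfolding cnv_def
    proof (rule sum.cong[OF refl])
      fix a assume a: "a \<in> H"
      show "h j a * h j (v + v - a) = (if a = v then (h j v)\<^sup>2 else 0)"
      proof (cases "a = v")
        case True then show ?thesis by (simp add: power2_eq_square)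
      next
        case False
        have "h j a = 0 \<or> h j (v + v - a) = 0"
        proof (rule ccontr)
          assume n: "\<not> ?thesis"
          have "v + v - a \<in> H" using n t unfolding tuple_def vof_def by blast
          then have S: "a \<in> S" "v + v - a \<in> S" using a n j by (auto simp: S_def)
          have "v + v - a \<noteq> v" using False by (simp add: algebra_simps)
          then show False using v(2)[OF S(1) False] v(2)[OF S(2)] by simp
        qed
        then show ?thesis using False by auto
      qed
    qed
    then show ?thesis using v(1) fin(3) by (simp add: S_def)
  qed
  then have "(\<Sum>j<M. (h j v)\<^sup>2) = 0" using z[of "v + v"] by (simp add: sos_def)
  then have "h j v = 0" if "j < M" for j using that by (simp add: sum_nonneg_eq_0_iff)
  then show False using v(1) by (auto simp: S_def)
qed

definition nrm :: "(lat \<Rightarrow> real) \<Rightarrow> real" where "nrm g = (\<Sum>n\<in>G. \<bar>g n\<bar>)"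

lemma nrm_nonneg: "nrm g \<ge> 0" by (simp add: nrm_def sum_nonneg)
lemma nrm_pos: assumes "vof G g" "g \<noteq> (\<lambda>_. 0)" shows "nrm g > 0"
proof -
  obtain n where n: "g n \<noteq> 0" using assms(2) by blast
  then have "n \<in> G" using vofD[OF assms(1)] by blast
  then show ?thesis unfolding nrm_def using n fin(2) by (intro sum_pos2) auto
qed
lemma nrm_coeff: "n \<in> G \<Longrightarrow> \<bar>g n\<bar> \<le> nrm g" unfolding nrm_def by (rule member_le_sum) (simp_all add: fin)

text \<open>The pairs are rescaled to \<open>tr h + nrm g = 1\<close>, with square roots for
  \<open>h\<close> because it enters quadratically. In a convergent subsequence the limit multiplier
  is nonzero: otherwise the limit sum of squares is zero, and by \<open>sos_zero\<close> the total
  would be zero instead of one.\<close>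

lemma multiplier_closed:
  assumes F: "\<And>a. a \<in> A \<Longrightarrow> (\<lambda>k. F k a) \<longlonglongrightarrow> f a" and m: "\<And>k::nat. \<exists>g. multiplier (F k) g"
  shows "\<exists>g. multiplier f g"
proof -
  have "\<forall>k. \<exists>g h. vof G g \<and> g \<noteq> (\<lambda>_. 0) \<and> tuple h \<and> (\<forall>n. cnv A (F k) g n = sos h n)" using m unfolding multiplier_def by blast
  then obtain g h where g: "\<And>k. vof G (g k)" "\<And>k. g k \<noteq> (\<lambda>_. 0)" and h: "\<And>k. tuple (h k)" and gh: "\<And>k n. cnv A (F k) (g k) n = sos (h k) n" by metis
  define s where "s = (\<lambda>k. tr (h k) + nrm (g k))"
  have s0: "s k > 0" for k unfolding s_def using tr_nonneg nrm_pos[OF g] by (simp add: add_nonneg_pos)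
  define X where "X = (\<lambda>k. case_sum (\<lambda>z. (1 / sqrt (s k)) * h k (fst z) (snd z)) (\<lambda>n. (1 / s k) * g k n))"
  have "\<bar>X k i\<bar> \<le> 1" if "i \<in> ({..<M} \<times> H) <+> G" for k i
    using that
  proof (rule PlusE)
    fix z assume z: "z \<in> {..<M} \<times> H" "i = Inl z"
    have "(h k (fst z) (snd z))\<^sup>2 \<le> tr (h k)" using z(1) by (intro tr_coeff) auto
    also have "\<dots> \<le> s k" using nrm_nonneg by (simp add: s_def)
    finally have "\<bar>h k (fst z) (snd z)\<bar> \<le> sqrt (s k)" by (metis real_sqrt_abs real_sqrt_le_mono)
    then show ?thesis using z(2) s0[of k] by (simp add: X_def abs_mult)
  next
    fix n assume n: "n \<in> G" "i = Inr n"
    have "\<bar>g k n\<bar> \<le> s k" using nrm_coeff[OF n(1), of "g k"] tr_nonneg[of "h k"] by (simp add: s_def)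
    then show ?thesis using n(2) s0[of k] by (simp add: X_def abs_mult)
  qed
  moreover have "finite (({..<M} \<times> H) <+> G)" using fin by simp
  ultimately obtain r l where r: "strict_mono (r :: nat \<Rightarrow> nat)" and l: "\<forall>i\<in>({..<M} \<times> H) <+> G. (\<lambda>k. X (r k) i) \<longlonglongrightarrow> l i"
    using bounded_subsequence[of "({..<M} \<times> H) <+> G" X 1] by blast
  define \<eta> where "\<eta> = (\<lambda>j n. if j < M \<and> n \<in> H then l (Inl (j, n)) else 0)"
  define \<gamma> where "\<gamma> = (\<lambda>n. if n \<in> G then l (Inr n) else 0)"
  define h' where "h' = (\<lambda>k j n. (1 / sqrt (s (r k))) * h (r k) j n)"
  define g' where "g' = (\<lambda>k n. (1 / s (r k)) * g (r k) n)"
  have hl: "(\<lambda>k. h' k j n) \<longlonglongrightarrow> \<eta> j n" if "j < M" for j n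
  proof (cases "n \<in> H")
    case True
    then have "Inl (j, n) \<in> ({..<M} \<times> H) <+> G" using that by (intro InlI) simp
    from bspec[OF l this] show ?thesis using that True by (simp add: \<eta>_def h'_def X_def)
  next
    case False
    then have "h (r k) j n = 0" for k using h[of "r k"] by (simp add: tuple_def vof_def)
    then show ?thesis using False by (simp add: h'_def \<eta>_def)
  qed
  have gl: "(\<lambda>k. g' k n) \<longlonglongrightarrow> \<gamma> n" for n
  proof (cases "n \<in> G")
    case True
    then have "Inr n \<in> ({..<M} \<times> H) <+> G" by (rule InrI)
    from bspec[OF l this] show ?thesis using True by (simp add: \<gamma>_def g'_def X_def)
  next
    case False
    then have "g (r k) n = 0" for k using g(1)[of "r k"] by (simp add: vof_def)
    then show ?thesis using False by (simp add: g'_def \<gamma>_def)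
  qed
  have Fl: "(\<lambda>k. F (r k) a) \<longlonglongrightarrow> f a" if "a \<in> A" for a using LIMSEQ_subseq_LIMSEQ[OF F[OF that] r] by (simp add: o_def)
  have e: "cnv A (F (r k)) (g' k) n = sos (h' k) n" for k n
    unfolding g'_def h'_def sos_def cnv_scale cnv_scale_right using gh[of "r k" n] s0[of "r k"]
    by (simp add: sos_def sum_divide_distrib)
  have ef: "cnv A f \<gamma> n = sos \<eta> n" for n
  proof (rule LIMSEQ_unique)
    show "(\<lambda>k. cnv A (F (r k)) (g' k) n) \<longlonglongrightarrow> cnv A f \<gamma> n" unfolding cnv_def by (intro tendsto_sum tendsto_mult Fl gl)
    show "(\<lambda>k. cnv A (F (r k)) (g' k) n) \<longlonglongrightarrow> sos \<eta> n" unfolding e unfolding sos_def cnv_def by (intro tendsto_sum tendsto_mult hl) simp_all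
  qed
  have "tr (h' k) + nrm (g' k) = 1" for k
  proof -
    have "tr (h' k) = tr (h (r k)) / s (r k)" unfolding h'_def tr_def trc_scale using s0[of "r k"] by (simp add: power_divide sum_divide_distrib)
    moreover have "nrm (g' k) = nrm (g (r k)) / s (r k)" unfolding g'_def nrm_def using s0[of "r k"] by (simp add: abs_mult sum_divide_distrib)
    ultimately show ?thesis using s0[of "r k"] by (simp add: s_def add_divide_distrib[symmetric])
  qed
  moreover have "(\<lambda>k. tr (h' k) + nrm (g' k)) \<longlonglongrightarrow> tr \<eta> + nrm \<gamma>"
    unfolding tr_def trc_def nrm_def by (intro tendsto_add tendsto_sum tendsto_power tendsto_rabs hl gl) simp
  ultimately have one: "tr \<eta> + nrm \<gamma> = 1" by (simp add: LIMSEQ_const_iff)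
  have t\<eta>: "tuple \<eta>" by (simp add: tuple_def vof_def \<eta>_def)
  have "\<gamma> \<noteq> (\<lambda>_. 0)"
  proof
    assume g0: "\<gamma> = (\<lambda>_. 0)"
    then have "sos \<eta> n = 0" for n unfolding ef[symmetric] by (simp add: cnv_def)
    then have "tr \<eta> = 0" by (rule sos_zero[OF t\<eta>])
    then show False using one g0 by (simp add: nrm_def)
  qed
  moreover have "vof G \<gamma>" by (simp add: vof_def \<gamma>_def)
  ultimately show ?thesis unfolding multiplier_def using t\<eta> ef by blast
qed

definition err :: "(lat \<Rightarrow> real) \<Rightarrow> (nat \<Rightarrow> lat \<Rightarrow> real) \<Rightarrow> (lat \<Rightarrow> real) \<Rightarrow> real" where
  "err f h g = (\<Sum>n\<in>HH. (sos h n - cnv A f g n)\<^sup>2)"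

text \<open>The bounded auxiliary coordinate \<open>1 / s\<close> with \<open>s = 1 + nrm g\<close> keeps the multipliers of a minimising
  sequence from escaping to infinity: in the limit it cannot vanish because \<open>f\<close> is not a zero divisor.\<close>

lemma minimiser:
  assumes inj: "\<And>g. vof G g \<Longrightarrow> (\<And>n. n \<in> HH \<Longrightarrow> cnv A f g n = 0) \<Longrightarrow> g = (\<lambda>_. 0)" and H: "H \<noteq> {}"
  obtains h g where "tuple h" "vof G g" "tr h = 1"
    "\<And>h' g'. tuple h' \<Longrightarrow> vof G g' \<Longrightarrow> tr h' = 1 \<Longrightarrow> err f h g \<le> err f h' g'"
proof -
  define E where "E = {err f h g | h g. tuple h \<and> vof G g \<and> tr h = 1}"
  define m where "m = Inf E"
  obtain n0 where n0: "n0 \<in> H" using H by blast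
  define h0 where "h0 = (\<lambda>j n. if j = (0::nat) \<and> n = n0 then 1 else 0::real)"
  have "tr h0 = (\<Sum>j<M. if j = 0 then 1 else 0)" unfolding tr_def
  proof (rule sum.cong[OF refl])
    fix j show "trc H (h0 j) = (if j = 0 then 1 else 0)"
      unfolding trc_def h0_def using n0 fin(3) by (cases "j = 0") (simp_all add: if_distrib[of "\<lambda>x. x\<^sup>2"] cong: if_cong)
  qed
  then have "tr h0 = 1" by (simp add: M_def)
  moreover have "tuple h0" using n0 by (auto simp: tuple_def vof_def h0_def)
  moreover have "vof G (\<lambda>_. 0)" by (simp add: vof_def)
  ultimately have Ene: "E \<noteq> {}" unfolding E_def by blast
  have bb: "bdd_below E" unfolding E_def by (rule bdd_belowI[of _ 0]) (auto simp: err_def sum_nonneg)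
  have low: "m \<le> err f h' g'" if "tuple h'" "vof G g'" "tr h' = 1" for h' g'
    unfolding m_def by (rule cInf_lower[OF _ bb]) (use that in \<open>auto simp: E_def\<close>)
  have "\<forall>k::nat. \<exists>h g. tuple h \<and> vof G g \<and> tr h = 1 \<and> err f h g < m + 1 / real (Suc k)"
  proof
    fix k :: nat
    have "Inf E < m + 1 / real (Suc k)" by (simp add: m_def)
    then obtain x where "x \<in> E" "x < m + 1 / real (Suc k)" using cInf_lessD[OF Ene] by blast
    then show "\<exists>h g. tuple h \<and> vof G g \<and> tr h = 1 \<and> err f h g < m + 1 / real (Suc k)" unfolding E_def by blast
  qed
  then obtain h g where h: "\<And>k. tuple (h k)" "\<And>k. tr (h k) = 1" and g: "\<And>k. vof G (g k)"
    and hg: "\<And>k. err f (h k) (g k) < m + 1 / real (Suc k)" by metis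
  define s where "s = (\<lambda>k. 1 + nrm (g k))"
  have s1: "s k \<ge> 1" for k using nrm_nonneg by (simp add: s_def)
  have s0: "s k > 0" for k using s1[of k] by linarith
  let ?I = "({..<M} \<times> H) <+> (G <+> {()})"
  define X where "X = (\<lambda>k. case_sum (\<lambda>z. h k (fst z) (snd z)) (case_sum (\<lambda>n. (1 / s k) * g k n) (\<lambda>_ :: unit. 1 / s k)))"
  have "\<bar>X k i\<bar> \<le> 1" if "i \<in> ?I" for k i
    using that
  proof (rule PlusE)
    fix z assume z: "z \<in> {..<M} \<times> H" "i = Inl z"
    have "(h k (fst z) (snd z))\<^sup>2 \<le> tr (h k)" using z(1) by (intro tr_coeff) auto
    then have "\<bar>h k (fst z) (snd z)\<bar> \<le> 1" unfolding h(2) by (simp add: abs_square_le_1)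
    then show ?thesis using z(2) by (simp add: X_def)
  next
    fix y assume "y \<in> G <+> {()}" and i: "i = Inr y"
    then show ?thesis
    proof (elim PlusE)
      fix n assume n: "n \<in> G" "y = Inl n"
      have "\<bar>g k n\<bar> \<le> s k" using nrm_coeff[OF n(1), of "g k"] by (simp add: s_def)
      then show ?thesis using n(2) i s0[of k] by (simp add: X_def abs_mult)
    next
      fix u assume "y = Inr u"
      then show ?thesis using i s1[of k] by (simp add: X_def)
    qed
  qed
  moreover have "finite ?I" using fin by simp
  ultimately obtain r l where r: "strict_mono (r :: nat \<Rightarrow> nat)" and l: "\<forall>i\<in>?I. (\<lambda>k. X (r k) i) \<longlonglongrightarrow> l i"
    using bounded_subsequence[of ?I X 1] by blast
  define \<eta> where "\<eta> = (\<lambda>j n. if j < M \<and> n \<in> H then l (Inl (j, n)) else 0)"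
  define \<gamma> where "\<gamma> = (\<lambda>n. if n \<in> G then l (Inr (Inl n)) else 0)"
  define \<theta> where "\<theta> = l (Inr (Inr ()))"
  have hl: "(\<lambda>k. h (r k) j n) \<longlonglongrightarrow> \<eta> j n" if "j < M" for j n
  proof (cases "n \<in> H")
    case True
    then have "Inl (j, n) \<in> ?I" using that by (intro InlI) simp
    from bspec[OF l this] show ?thesis using that True by (simp add: \<eta>_def X_def)
  next
    case False
    then have "h (r k) j n = 0" for k using h(1)[of "r k"] by (simp add: tuple_def vof_def)
    then show ?thesis using False by (simp add: \<eta>_def)
  qed
  have gl: "(\<lambda>k. (1 / s (r k)) * g (r k) n) \<longlonglongrightarrow> \<gamma> n" for n
  proof (cases "n \<in> G")
    case True
    then have "Inr (Inl n) \<in> ?I" by (intro InrI InlI)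
    from bspec[OF l this] show ?thesis using True by (simp add: \<gamma>_def X_def)
  next
    case False
    then have "g (r k) n = 0" for k using g(1)[of "r k"] by (simp add: vof_def)
    then show ?thesis using False by (simp add: \<gamma>_def)
  qed
  have "Inr (Inr ()) \<in> ?I" by (intro InrI) simp
  from bspec[OF l this] have tl: "(\<lambda>k. 1 / s (r k)) \<longlonglongrightarrow> \<theta>" by (simp add: \<theta>_def X_def)
  have th0: "\<theta> \<ge> 0" by (rule LIMSEQ_le_const[OF tl]) (use s0 in \<open>auto intro!: exI[of _ 0] simp: less_imp_le\<close>)
  have em: "(\<lambda>k. err f (h (r k)) (g (r k))) \<longlonglongrightarrow> m"
  proof (rule tendsto_sandwich)
    show "\<forall>\<^sub>F k in sequentially. m \<le> err f (h (r k)) (g (r k))" using low[OF h(1) g h(2)] by simp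
    show "\<forall>\<^sub>F k in sequentially. err f (h (r k)) (g (r k)) \<le> m + inverse (real (Suc k))"
    proof (rule always_eventually, rule allI)
      fix k
      have "inverse (real (Suc (r k))) \<le> inverse (real (Suc k))" using seq_suble[OF r, of k] by (simp add: le_imp_inverse_le)
      then show "err f (h (r k)) (g (r k)) \<le> m + inverse (real (Suc k))" using hg[of "r k"] by (simp add: inverse_eq_divide)
    qed
    show "(\<lambda>k. m + inverse (real (Suc k))) \<longlonglongrightarrow> m" using tendsto_add[OF tendsto_const LIMSEQ_inverse_real_of_nat, of m] by simp
  qed simp
  \<comment> \<open>The error is multiplied by the square of \<open>1 / s\<close> before passing to
    the limit, so that the relation remains meaningful if \<open>\<theta>\<close> is zero.\<close>
  have "(\<Sum>n\<in>HH. (\<theta> * sos \<eta> n - cnv A f \<gamma> n)\<^sup>2) = \<theta>\<^sup>2 * m"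
  proof (rule LIMSEQ_unique)
    have "(\<lambda>k. \<Sum>n\<in>HH. ((1 / s (r k)) * sos (h (r k)) n - cnv A f (\<lambda>n. (1 / s (r k)) * g (r k) n) n)\<^sup>2)
      \<longlonglongrightarrow> (\<Sum>n\<in>HH. (\<theta> * sos \<eta> n - cnv A f \<gamma> n)\<^sup>2)"
      unfolding sos_def cnv_def by (intro tendsto_sum tendsto_power tendsto_diff tendsto_mult tl gl hl tendsto_const) simp_all
    moreover have "(\<Sum>n\<in>HH. ((1 / s (r k)) * sos (h (r k)) n - cnv A f (\<lambda>n. (1 / s (r k)) * g (r k) n) n)\<^sup>2)
      = (1 / s (r k))\<^sup>2 * err f (h (r k)) (g (r k))" for k
      unfolding cnv_scale_right err_def sum_distrib_left right_diff_distrib[symmetric] power_mult_distrib ..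
    ultimately show "(\<lambda>k. (1 / s (r k))\<^sup>2 * err f (h (r k)) (g (r k))) \<longlonglongrightarrow> (\<Sum>n\<in>HH. (\<theta> * sos \<eta> n - cnv A f \<gamma> n)\<^sup>2)" by simp
    show "(\<lambda>k. (1 / s (r k))\<^sup>2 * err f (h (r k)) (g (r k))) \<longlonglongrightarrow> \<theta>\<^sup>2 * m" by (intro tendsto_mult tendsto_power tl em)
  qed
  note lim = this
  have v\<gamma>: "vof G \<gamma>" by (simp add: vof_def \<gamma>_def)
  have "nrm \<gamma> = 1 - \<theta>"
  proof (rule LIMSEQ_unique)
    show "(\<lambda>k. nrm (\<lambda>n. (1 / s (r k)) * g (r k) n)) \<longlonglongrightarrow> nrm \<gamma>" unfolding nrm_def by (intro tendsto_sum tendsto_rabs gl)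
    have "nrm (\<lambda>n. (1 / s (r k)) * g (r k) n) = 1 - 1 / s (r k)" for k
    proof -
      have "nrm (\<lambda>n. (1 / s (r k)) * g (r k) n) = nrm (g (r k)) / s (r k)"
        unfolding nrm_def using s0[of "r k"] by (simp add: abs_mult sum_divide_distrib)
      also have "\<dots> = (s (r k) - 1) / s (r k)" by (simp add: s_def)
      finally show ?thesis using s0[of "r k"] by (simp add: diff_divide_distrib)
    qed
    then show "(\<lambda>k. nrm (\<lambda>n. (1 / s (r k)) * g (r k) n)) \<longlonglongrightarrow> 1 - \<theta>" using tendsto_diff[OF tendsto_const tl] by simp
  qed
  have "\<theta> \<noteq> 0"
  proof
    assume t0: "\<theta> = 0"
    then have "\<forall>n\<in>HH. cnv A f \<gamma> n = 0" using lim fin(4) by (simp add: sum_nonneg_eq_0_iff)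
    then have "\<gamma> = (\<lambda>_. 0)" using inj[OF v\<gamma>] by blast
    then show False using \<open>nrm \<gamma> = 1 - \<theta>\<close> t0 by (simp add: nrm_def)
  qed
  then have tp: "\<theta> > 0" using th0 by simp
  define g' where "g' = (\<lambda>n. (1 / \<theta>) * \<gamma> n)"
  have "err f \<eta> g' = (1 / \<theta>)\<^sup>2 * (\<Sum>n\<in>HH. (\<theta> * sos \<eta> n - cnv A f \<gamma> n)\<^sup>2)"
    unfolding err_def g'_def cnv_scale_right sum_distrib_left power_mult_distrib[symmetric] right_diff_distrib
    using tp by (simp add: mult.assoc[symmetric])
  also have "\<dots> = m" unfolding lim using tp by (simp add: power_divide)
  finally have me: "err f \<eta> g' = m" .
  have "tr \<eta> = 1"
  proof (rule LIMSEQ_unique)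
    show "(\<lambda>k. tr (h (r k))) \<longlonglongrightarrow> tr \<eta>" unfolding tr_def trc_def by (intro tendsto_sum tendsto_power hl) simp
    show "(\<lambda>k. tr (h (r k))) \<longlonglongrightarrow> 1" by (simp add: h(2))
  qed
  moreover have "tuple \<eta>" by (simp add: tuple_def vof_def \<eta>_def)
  moreover have "vof G g'" using v\<gamma> by (simp add: vof_def g'_def)
  ultimately show thesis using that[of \<eta> g'] low me by simp
qed

text \<open>\<open>D\<close> is the shortest difference between a sum of squares of trace one and a
  multiple of \<open>f\<close>, and it is nonzero as there is no multiplier. First order optimality
  in \<open>g\<close> makes \<open>D\<close> orthogonal to all multiples; optimality in the
  direction of one square of trace one gives the bound \<open>\<kappa>\<close>, the squared length
  of \<open>D\<close>.\<close>

lemma separating_functional: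
  assumes inj: "\<And>g. vof G g \<Longrightarrow> (\<And>n. n \<in> HH \<Longrightarrow> cnv A f g n = 0) \<Longrightarrow> g = (\<lambda>_. 0)" and H: "H \<noteq> {}"
    and none: "\<not> (\<exists>g. multiplier f g)"
  obtains D \<kappa> where "\<kappa> > 0" "\<And>g. vof G g \<Longrightarrow> (\<Sum>n\<in>HH. D n * cnv A f g n) = 0"
    "\<And>v. vof H v \<Longrightarrow> (\<Sum>n\<in>HH. D n * cnv H v v n) \<ge> \<kappa> * trc H v"
proof -
  obtain h g where h: "tuple h" "tr h = 1" and g: "vof G g"
    and min: "\<And>h' g'. tuple h' \<Longrightarrow> vof G g' \<Longrightarrow> tr h' = 1 \<Longrightarrow> err f h g \<le> err f h' g'" by (rule minimiser[OF inj H]) blast+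
  define D where "D = (\<lambda>n. sos h n - cnv A f g n)"
  define \<kappa> where "\<kappa> = (\<Sum>n\<in>HH. (D n)\<^sup>2)"
  have eD: "err f h g = \<kappa>" by (simp add: err_def \<kappa>_def D_def)
  have "\<kappa> \<noteq> 0"
  proof
    assume "\<kappa> = 0"
    then have "\<forall>n\<in>HH. D n = 0" unfolding \<kappa>_def using fin(4) by (simp add: sum_nonneg_eq_0_iff)
    moreover have "sos h n = 0 \<and> cnv A f g n = 0" if "n \<notin> HH" for n
      using h(1) g HH AG that cnv_zero_out[of H _ H HH n] cnv_zero_out[of G g A HH n f]
      by (auto simp: sos_def tuple_def intro!: sum.neutral)
    ultimately have e: "cnv A f g n = sos h n" for n by (cases "n \<in> HH") (simp_all add: D_def)
    have "g \<noteq> (\<lambda>_. 0)"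
    proof
      assume "g = (\<lambda>_. 0)"
      then have "sos h n = 0" for n unfolding e[symmetric] by (simp add: cnv_def)
      then show False using sos_zero[OF h(1)] h(2) by simp
    qed
    then show False using none g h(1) e unfolding multiplier_def by blast
  qed
  then have kp: "\<kappa> > 0" unfolding \<kappa>_def by (simp add: sum_nonneg less_le)
  have half: "(\<Sum>n\<in>HH. D n * cnv A f g' n) \<ge> 0" if g': "vof G g'" for g'
  proof (rule quadratic_first_order)
    fix t :: real
    have v: "vof G (\<lambda>n. g n - t * g' n)" using g g' by (simp add: vof_def)
    have "err f h (\<lambda>n. g n - t * g' n) = (\<Sum>n\<in>HH. (D n + t * cnv A f g' n)\<^sup>2)"
      unfolding err_def D_def by (simp add: cnv_def algebra_simps sum_subtractf sum_distrib_left)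
    then show "(\<Sum>n\<in>HH. (D n)\<^sup>2) \<le> (\<Sum>n\<in>HH. (D n + t * cnv A f g' n)\<^sup>2)" using min[OF h(1) v h(2)] unfolding eD \<kappa>_def by simp
  qed
  have o: "(\<Sum>n\<in>HH. D n * cnv A f g' n) = 0" if g': "vof G g'" for g'
  proof -
    have "vof G (\<lambda>n. (- 1) * g' n)" using g' by (simp add: vof_def)
    from half[OF this] have "(\<Sum>n\<in>HH. D n * cnv A f g' n) \<le> 0" unfolding cnv_scale_right by (simp add: sum_negf)
    then show ?thesis using half[OF g'] by simp
  qed
  have unit: "(\<Sum>n\<in>HH. D n * cnv H v v n) \<ge> \<kappa>" if v: "vof H v" "trc H v = 1" for v
  proof -
    have "(\<Sum>n\<in>HH. D n * (cnv H v v n - D n)) \<ge> 0"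
    proof (rule quadratic_first_order)
      fix t :: real assume t: "0 < t" "t \<le> 1"
      \<comment> \<open>The convex combination of the minimiser with the new square has trace one
        but \<open>M + 1\<close> squares; \<open>sos_tuple\<close> shortens it.\<close>
      define w where "w = (\<lambda>j n. if j < M then sqrt (1 - t) * h j n else sqrt t * v n)"
      have vw: "vof H (w j)" for j using h(1) v(1) by (auto simp: tuple_def vof_def w_def)
      obtain h' where h': "tuple h'" "\<And>n. sos h' n = (\<Sum>j<Suc M. cnv H (w j) (w j) n)" "tr h' = (\<Sum>j<Suc M. trc H (w j))"
        using sos_tuple[of "{..<Suc M}" w] vw by blast
      have wj: "w j = (if j < M then (\<lambda>n. sqrt (1 - t) * h j n) else (\<lambda>n. sqrt t * v n))" for j by (auto simp: w_def)
      have e1: "sos h' n = (1 - t) * sos h n + t * cnv H v v n" for n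
        unfolding h'(2) sum.lessThan_Suc using t by (simp add: wj cnv_scale sos_def sum_distrib_left)
      have e2: "tr h' = 1"
        unfolding h'(3) sum.lessThan_Suc using t v(2) h(2) by (simp add: wj trc_scale tr_def flip: sum_distrib_left)
      have v': "vof G (\<lambda>n. (1 - t) * g n)" using g by (simp add: vof_def)
      have "err f h' (\<lambda>n. (1 - t) * g n) = (\<Sum>n\<in>HH. (D n + t * (cnv H v v n - D n))\<^sup>2)"
        unfolding err_def e1 cnv_scale_right D_def by (simp add: algebra_simps)
      then show "(\<Sum>n\<in>HH. (D n)\<^sup>2) \<le> (\<Sum>n\<in>HH. (D n + t * (cnv H v v n - D n))\<^sup>2)"
        using min[OF h'(1) v' e2] unfolding eD \<kappa>_def by simp
    qed
    then show ?thesis by (simp add: \<kappa>_def right_diff_distrib sum_subtractf power2_eq_square)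
  qed
  have "(\<Sum>n\<in>HH. D n * cnv H v v n) \<ge> \<kappa> * trc H v" if v: "vof H v" for v
  proof (cases "trc H v = 0")
    case True
    then have "v n = 0" for n using vofD[OF v] fin(3) by (cases "n \<in> H") (simp_all add: trc_def sum_nonneg_eq_0_iff)
    then show ?thesis using True by (simp add: cnv_def)
  next
    case False
    then have tp: "trc H v > 0" by (simp add: trc_def sum_nonneg less_le)
    define c where "c = 1 / sqrt (trc H v)"
    have c2: "c * c = 1 / trc H v" using tp by (simp add: c_def)
    have "vof H (\<lambda>n. c * v n)" using v by (simp add: vof_def)
    moreover have "trc H (\<lambda>n. c * v n) = 1" unfolding trc_scale power2_eq_square c2 using tp by simp
    ultimately have "\<kappa> \<le> (\<Sum>n\<in>HH. D n * cnv H (\<lambda>n. c * v n) (\<lambda>n. c * v n) n)" by (rule unit)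
    also have "\<dots> = (\<Sum>n\<in>HH. D n * cnv H v v n) / trc H v"
      unfolding cnv_scale c2 by (simp add: sum_divide_distrib mult.commute)
    finally show ?thesis using tp by (simp add: pos_le_divide_eq)
  qed
  then show thesis using that kp o by blast
qed

end

section \<open>Multipliers\<close>

definition lau_of :: "lat set \<Rightarrow> (lat \<Rightarrow> real) \<Rightarrow> lau" where
  "lau_of S \<phi> = (\<Sum>n\<in>S. Poly_Mapping.single n (of_real (\<phi> n)))"

lemma lk_lau_of: assumes "finite S" "vof S \<phi>" shows "lk (lau_of S \<phi>) n = of_real (\<phi> n)"
proof -
  have "lk (lau_of S \<phi>) n = (\<Sum>m\<in>S. if m = n then of_real (\<phi> m) else 0)"
    unfolding lau_of_def lookup_sum by (rule sum.cong[OF refl]) (simp add: lookup_single when_def)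
  then show ?thesis using assms(1) vofD[OF assms(2), of n] by simp
qed

lemma lk_super: assumes "finite S" "kys s \<subseteq> S" shows "lk (s * t) n = (\<Sum>a\<in>S. lk s a * lk t (n - a))"
  unfolding lk_mult by (rule sum.mono_neutral_left) (use assms in \<open>auto simp: in_keys_iff\<close>)

lemma vof_parts: assumes "kys t \<subseteq> S" shows "vof S (\<lambda>n. Re (lk t n))" "vof S (\<lambda>n. Im (lk t n))"
proof -
  have "lk t n = 0" if "n \<notin> S" for n using that assms unfolding subset_iff in_keys_iff by blast
  then show "vof S (\<lambda>n. Re (lk t n))" "vof S (\<lambda>n. Im (lk t n))" unfolding vof_def by simp_all
qed

lemma kys_lau_of: "finite S \<Longrightarrow> kys (lau_of S \<phi>) \<subseteq> S"
  unfolding lau_of_def by (rule order_trans[OF keys_sum]) auto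

lemma lk_lau_of_mult: assumes "finite S" "vof S \<phi>" shows "lk (lau_of S \<phi> * t) n = (\<Sum>a\<in>S. of_real (\<phi> a) * lk t (n - a))"
  unfolding lk_super[OF assms(1) kys_lau_of[OF assms(1)]] lk_lau_of[OF assms] ..

definition rm :: "real \<Rightarrow> real \<Rightarrow> lat \<Rightarrow> real" where "rm x y n = x powi fst n * y powi snd n"

lemma rm_add: "x \<noteq> 0 \<Longrightarrow> y \<noteq> 0 \<Longrightarrow> rm x y (m + n) = rm x y m * rm x y n"
  by (simp add: rm_def power_int_add mult_ac)

lemma abs_rm:
  assumes "x \<noteq> 0" "y \<noteq> 0" shows "\<bar>rm x y n\<bar> = exp ((ln \<bar>x\<bar>, ln \<bar>y\<bar>) \<bullet> lp n)"
proof -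
  have "\<bar>z powi k\<bar> = exp (ln \<bar>z\<bar> * of_int k)" if "z \<noteq> 0" for z :: real and k
  proof -
    have "\<bar>z powi k\<bar> = exp (ln \<bar>z\<bar>) powi k" using that by (simp add: power_int_abs)
    then show ?thesis by (simp add: exp_power_int mult.commute)
  qed
  then show ?thesis using assms by (simp add: rm_def abs_mult exp_add lattice_pt_def inner_prod_def)
qed

text \<open>In logarithmic coordinates the absolute value of a monomial is the exponential of a
  linear form, which on twice the polygon is at most twice its maximum over
  \<open>S\<close>.\<close>

lemma rm_bound:
  assumes S: "finite S" "S \<noteq> {}" and n: "n \<in> msum S S" and xy: "x \<noteq> 0" "y \<noteq> 0"
  shows "\<bar>rm x y n\<bar> \<le> (\<Sum>s\<in>S. (rm x y s)\<^sup>2)"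
proof -
  let ?w = "(ln \<bar>x\<bar>, ln \<bar>y\<bar>)"
  obtain s where s: "s \<in> S" "?w \<bullet> lp s = hR S ?w" by (rule hR_attained[OF S])
  have "?w \<bullet> lp n \<le> hR S ?w + hR S ?w" using n unfolding msum_real[OF S S] by blast
  then have "\<bar>rm x y n\<bar> \<le> exp (?w \<bullet> lp s + ?w \<bullet> lp s)" unfolding abs_rm[OF xy] s(2) by simp
  also have "\<dots> = \<bar>rm x y s\<bar>\<^sup>2" unfolding abs_rm[OF xy] by (simp only: exp_add power2_eq_square)
  also have "\<dots> = (rm x y s)\<^sup>2" by simp
  also have "\<dots> \<le> (\<Sum>s\<in>S. (rm x y s)\<^sup>2)" by (rule member_le_sum[OF s(1) _ S(1)]) simp
  finally show ?thesis .
qed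

locale polygon_pair =
  fixes SP SQ :: "lat set"
  assumes pgP: "pg SP" and pgQ: "pg SQ" and ftP: "fat SP" and ftQ: "fat SQ"
begin

abbreviation "AA \<equiv> msum SP SP"
abbreviation "GG \<equiv> msum SQ SQ"
abbreviation "HS \<equiv> msum SP SQ"
abbreviation "H2 \<equiv> msum HS HS"

lemma fPQ: "finite SP" "SP \<noteq> {}" "finite SQ" "SQ \<noteq> {}" using pgD[OF pgP] pgD[OF pgQ] by blast+
lemma pgA: "pg AA" and pgG: "pg GG" and pgH: "pg HS" using fPQ by (simp_all add: pg_msum)
lemma pgH2: "pg H2" using pgD[OF pgH] by (simp add: pg_msum)

sublocale square_sums AA GG HS H2
proof
  show "finite AA" "finite GG" "finite HS" "finite H2" using pgD pgA pgG pgH pgH2 by blast+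
  show "a + b \<in> H2" if "a \<in> HS" "b \<in> HS" for a b using msum_mem that pgD(1)[OF pgH] by blast
  fix a b assume ab: "a \<in> AA" "b \<in> GG"
  show "a + b \<in> H2"
  proof (rule pg_memI[OF pgH2])
    fix w
    have "dotz w (a + b) \<le> hz AA w + hz GG w" using hz_ge[OF pgD(1)[OF pgA] ab(1), of w] hz_ge[OF pgD(1)[OF pgG] ab(2), of w] by simp
    also have "\<dots> = hz H2 w" using fPQ pgD[OF pgH] by simp
    finally show "dotz w (a + b) \<le> hz H2 w" .
  qed
qed

lemma generic_multiplier:
  assumes \<phi>: "vof AA \<phi>" "\<And>n. n \<in> AA \<Longrightarrow> \<phi> n \<noteq> 0"
    and irr: "\<And>g h. kys (g * h) = AA \<Longrightarrow> (\<And>n. n \<in> AA \<Longrightarrow> lk (g * h) n = of_real (\<phi> n)) \<Longrightarrow> card (kys g) \<le> 1 \<or> card (kys h) \<le> 1"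
    and nz: "\<And>x y. x \<noteq> 0 \<Longrightarrow> y \<noteq> 0 \<Longrightarrow> (\<Sum>n\<in>AA. \<phi> n * rm x y n) \<noteq> 0"
    and big: "mv AA HS < 2 * (int (card HS) - 1)"
  shows "\<exists>g. multiplier \<phi> g"
proof (rule ccontr)
  assume none: "\<not> ?thesis"
  define f where "f = lau_of AA \<phi>"
  have lf: "lk f n = of_real (\<phi> n)" for n unfolding f_def by (rule lk_lau_of[OF fin(1) \<phi>(1)])
  have kf: "kys f = AA"
  proof (rule Set.set_eqI)
    fix n show "n \<in> kys f \<longleftrightarrow> n \<in> AA" using \<phi>(2)[of n] vofD[OF \<phi>(1), of n] unfolding in_keys_iff lf by (cases "n \<in> AA") simp_all
  qed
  interpret polygons SP SQ f by unfold_locales (fact pgP pgQ ftP ftQ kf)+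
  have fgh: "card (kys g) \<le> 1 \<or> card (kys h) \<le> 1" if "f = g * h" for g h
    using irr[of g h] kf lf unfolding that by blast
  interpret prime_curve SP SQ f by unfold_locales (rule prime_if_irreducible[OF fgh])
  have cf: "cj f = f" by (rule poly_mapping_eqI) (simp add: lf)

  have k2: "kH 2 = H2"
    by (rule pg_eqI[OF pgk pgH2]) (use pgD[OF pgH] in \<open>simp add: hzk H_def\<close>)
  have B2: "BB 2 = GG"
    by (rule pg_eqI[OF pgB pgG]) (use fPQ in \<open>simp add: hzB hzH hzA\<close>)
  have mlt: "lk (f * s) n = (\<Sum>a\<in>AA. of_real (\<phi> a) * lk s (n - a))" for s n unfolding f_def by (rule lk_lau_of_mult[OF fin(1) \<phi>(1)])
  have inj: "g = (\<lambda>_. 0)" if g: "vof GG g" and z: "\<And>n. n \<in> H2 \<Longrightarrow> cnv AA \<phi> g n = 0" for g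
  proof -
    have "cnv AA \<phi> g n = 0" if "n \<notin> H2" for n by (rule cnv_zero_out[OF g _ that]) (rule AG)
    then have z': "cnv AA \<phi> g n = 0" for n using z by blast
    have "lk (f * lau_of GG g) n = of_real (cnv AA \<phi> g n)" for n unfolding mlt lk_lau_of[OF fin(2) g] cnv_def by simp
    then have "f * lau_of GG g = 0" unfolding z' by (intro poly_mapping_eqI) simp
    then have "lau_of GG g = 0" using lau_mult_nz[OF f0] by blast
    then show ?thesis using lk_lau_of[OF fin(2) g] by (intro ext) (metis lookup_zero of_real_eq_0_iff)
  qed
  obtain D \<kappa> where \<kappa>: "\<kappa> > 0" and D0: "\<And>g. vof GG g \<Longrightarrow> (\<Sum>n\<in>H2. D n * cnv AA \<phi> g n) = 0"
    and Dp: "\<And>v. vof HS v \<Longrightarrow> (\<Sum>n\<in>H2. D n * cnv HS v v n) \<ge> \<kappa> * trc HS v"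
    by (rule separating_functional[OF inj pgD(2)[OF pgH] none]) blast+
  define ell where "ell = (\<lambda>t::lau. \<Sum>n\<in>H2. of_real (D n) * lk t n)"
  \<comment> \<open>If \<open>f * s\<close> is supported in \<open>2H\<close>, additivity of support
    functions puts \<open>s\<close> into \<open>GG\<close>, and the orthogonality of
    \<open>D\<close> applies to its real and imaginary parts.\<close>
  have ell0: "ell (f * s) = 0" if k: "kys (f * s) \<subseteq> H2" for s
  proof (cases "s = 0")
    case False
    have "kys s \<subseteq> GG"
    proof
      fix n assume n: "n \<in> kys s"
      show "n \<in> GG"
      proof (rule pg_memI[OF pgG])
        fix w
        have "hz (kys (f * s)) w \<le> hz H2 w" by (rule hz_mono[OF fin(4) kys_ne[OF lau_mult_nz[OF f0 False]] k])
        then have "hz (kys s) w \<le> hz GG w" unfolding hz_mult[OF f0 False] kf using fPQ pgD[OF pgH] by simp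
        then show "dotz w n \<le> hz GG w" using hz_ge[OF finite_keys n, of w] by simp
      qed
    qed
    then have v: "vof GG (\<lambda>n. Re (lk s n))" "vof GG (\<lambda>n. Im (lk s n))" by (rule vof_parts)+
    have "Re (ell (f * s)) = (\<Sum>n\<in>H2. D n * cnv AA \<phi> (\<lambda>n. Re (lk s n)) n)" "Im (ell (f * s)) = (\<Sum>n\<in>H2. D n * cnv AA \<phi> (\<lambda>n. Im (lk s n)) n)"
      by (simp_all add: ell_def mlt cnv_def)
    then show ?thesis using D0[OF v(1)] D0[OF v(2)] by (simp add: complex_eq_iff)
  qed (simp add: ell_def)
  \<comment> \<open>\<open>ell\<close> only reads exponents in \<open>2H\<close>, so a
    representative modulo \<open>f\<close> supported there is chosen; by \<open>ell0\<close> the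
    choice does not affect the value.\<close>
  define L where "L = (\<lambda>t. ell (SOME t'. kys t' \<subseteq> H2 \<and> f dvd t - t'))"
  have L: "L t = ell t'" if t': "kys t' \<subseteq> H2" "f dvd t - t'" for t t'
  proof -
    let ?P = "\<lambda>t'. kys t' \<subseteq> H2 \<and> f dvd t - t'"
    have t'': "?P (SOME t'. ?P t')" by (rule someI[of ?P t']) (use t' in blast)
    define t2 where "t2 = (SOME t'. ?P t')"
    have "f dvd (t - t') - (t - t2)" by (rule dvd_diff[OF t'(2)]) (use t'' in \<open>simp add: t2_def\<close>)
    then obtain s where s: "t2 - t' = f * s" by (auto elim: dvdE)
    have "kys (f * s) \<subseteq> H2" unfolding s[symmetric] using kys_diff_sub t'(1) t'' t2_def by blast
    then have "ell (t2 - t') = 0" unfolding s by (rule ell0)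
    then have "ell t2 = ell t'" by (simp add: ell_def lookup_minus right_diff_distrib sum_subtractf)
    then show ?thesis by (simp add: L_def t2_def)
  qed
  have rep: "\<exists>t'. kys t' \<subseteq> H2 \<and> f dvd t - t'" if tV: "t \<in> V 2" for t
  proof -
    obtain g where "kys (t - f * g) \<subseteq> kH 2" using tV unfolding Wm_def by blast
    then show ?thesis unfolding k2 by (intro exI[of _ "t - f * g"]) simp
  qed
  have rL: "real_functional L" unfolding real_functional_def lin_def
  proof (intro conjI ballI allI)
    fix t assume t: "t \<in> V 2"
    obtain t' where t': "kys t' \<subseteq> H2" "f dvd t - t'" using rep[OF t] by blast
    have "cj t - cj t' = cj (t - t')" by simp
    moreover have "f dvd cj (t - t')" using t'(2) cf by (metis cj_mult dvd_def)
    ultimately have "L (cj t) = ell (cj t')" using t'(1) by (intro L) simp_all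
    then show "L (cj t) = cnj (L t)" unfolding L[OF t'] by (simp add: ell_def)
    fix c
    have "CC c * t - CC c * t' = CC c * (t - t')" by (simp add: algebra_simps)
    moreover have "kys (CC c * t') \<subseteq> H2" using t'(1) by (auto simp: in_keys_iff)
    ultimately have "L (CC c * t) = ell (CC c * t')" using t'(2) by (intro L) simp_all
    then show "L (CC c * t) = c * L t" unfolding L[OF t'] by (simp only: ell_def lk_CC_mult sum_distrib_left mult.left_commute)
  next
    fix s t assume st: "s \<in> V 2" "t \<in> V 2"
    obtain s' where s': "kys s' \<subseteq> H2" "f dvd s - s'" using rep[OF st(1)] by blast
    obtain t' where t': "kys t' \<subseteq> H2" "f dvd t - t'" using rep[OF st(2)] by blast
    have "s + t - (s' + t') = (s - s') + (t - t')" by simp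
    moreover have "kys (s' + t') \<subseteq> H2" using kys_add_sub s'(1) t'(1) by blast
    ultimately have "L (s + t) = ell (s' + t')" using s'(2) t'(2) by (intro L) (simp_all only: dvd_add)
    then show "L (s + t) = L s + L t" unfolding L[OF s'] L[OF t'] by (simp add: ell_def lookup_add distrib_left sum.distrib)
  next
    fix g show "L (f * g) = 0" using L[of 0 "f * g"] by (simp add: ell_def)
  qed
  \<comment> \<open>The real parts of the coefficients of \<open>v * cj v\<close> are those of the
    sum of the squares of the real and the imaginary part of \<open>v\<close>, so \<open>Dp\<close>
    applies to each.\<close>
  have pos: "Re (L (v * cj v)) \<ge> \<kappa> * (\<Sum>n\<in>H. (cmod (lk v n))\<^sup>2)" if v: "kys v \<subseteq> H" for v
  proof -
    have vH: "kys v \<subseteq> HS" using v by (simp add: H_def)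
    have "kys (v * cj v) \<subseteq> H2"
    proof
      fix n assume "n \<in> kys (v * cj v)"
      then obtain a b where ab: "a \<in> kys v" "b \<in> kys (cj v)" "n = a + b" using kys_mult_sub by blast
      then have "a \<in> HS" "b \<in> HS" using vH unfolding kys_cj by blast+
      then show "n \<in> H2" unfolding ab(3) by (rule HH)
    qed
    then have "L (v * cj v) = ell (v * cj v)" by (rule L) simp
    moreover have "Re (lk (v * cj v) n) = cnv HS (\<lambda>n. Re (lk v n)) (\<lambda>n. Re (lk v n)) n + cnv HS (\<lambda>n. Im (lk v n)) (\<lambda>n. Im (lk v n)) n" for n
      unfolding lk_super[OF fin(3) vH] cnv_def by (simp add: sum.distrib)
    ultimately have "Re (L (v * cj v)) = (\<Sum>n\<in>H2. D n * cnv HS (\<lambda>n. Re (lk v n)) (\<lambda>n. Re (lk v n)) n)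
       + (\<Sum>n\<in>H2. D n * cnv HS (\<lambda>n. Im (lk v n)) (\<lambda>n. Im (lk v n)) n)"
      by (simp add: ell_def distrib_left sum.distrib)
    moreover have "\<kappa> * trc HS (\<lambda>n. Re (lk v n)) \<le> (\<Sum>n\<in>H2. D n * cnv HS (\<lambda>n. Re (lk v n)) (\<lambda>n. Re (lk v n)) n)"
      "\<kappa> * trc HS (\<lambda>n. Im (lk v n)) \<le> (\<Sum>n\<in>H2. D n * cnv HS (\<lambda>n. Im (lk v n)) (\<lambda>n. Im (lk v n)) n)"
      by (intro Dp vof_parts[OF vH])+
    moreover have "(\<Sum>n\<in>H. (cmod (lk v n))\<^sup>2) = trc HS (\<lambda>n. Re (lk v n)) + trc HS (\<lambda>n. Im (lk v n))"
      unfolding trc_def H_def by (simp add: cmod_power2 sum.distrib)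
    ultimately show ?thesis by (simp add: distrib_left)
  qed
  have nr: "ev (of_real x, of_real y) f \<noteq> 0" if xy: "x \<noteq> 0" "y \<noteq> 0" for x y :: real
  proof -
    have "ev (of_real x, of_real y) f = of_real (\<Sum>n\<in>AA. \<phi> n * rm x y n)"
      unfolding ev_def kf lf by (simp add: mp_def rm_def of_real_power_int)
    then show ?thesis using nz[OF xy] by (metis of_real_eq_0_iff)
  qed
  have "mv A H < 2 * (int (card H) - 1)" using big by (simp add: A_def H_def)
  from no_positive_functional[OF cf nr this rL \<kappa> pos] show False .
qed

text \<open>Adding \<open>\<delta>\<close> times the sum of the squared monomials of
  \<open>SP\<close> makes the polynomial positive. By \<open>rm_bound\<close> further changes of
  each coefficient by less than \<open>\<eta>\<close> together consume at most half of this margin;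
  they serve to make the coefficients nonzero and generic.\<close>

lemma generic_neighbour:
  assumes \<phi>: "vof AA \<phi>" "\<And>x y. x \<noteq> 0 \<Longrightarrow> y \<noteq> 0 \<Longrightarrow> (\<Sum>n\<in>AA. \<phi> n * rm x y n) \<ge> 0" and d: "\<delta> > 0"
    and big: "mv AA HS < 2 * (int (card HS) - 1)"
  obtains \<psi> where "\<And>n. \<bar>\<psi> n - \<phi> n\<bar> \<le> 2 * \<delta>" "\<exists>g. multiplier \<psi> g"
proof -
  define T where "T = (\<lambda>s. s + s) ` SP"
  define b where "b = (\<lambda>n. \<phi> n + (if n \<in> T then \<delta> else 0))"
  define \<eta> where "\<eta> = \<delta> / (2 * real (card AA))"
  have cA: "card AA > 0" using pgD[OF pgA] by (simp add: card_gt_0_iff)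
  have c1: "real (card AA) \<ge> 1" using cA by linarith
  have "\<delta> * 1 \<le> \<delta> * (2 * real (card AA))" by (rule mult_left_mono) (use c1 d in simp_all)
  then have e0: "\<eta> > 0" "\<eta> \<le> \<delta>" using d cA by (simp_all add: \<eta>_def pos_divide_le_eq)
  define S where "S = (\<lambda>n. complex_of_real ` ({b n<..<b n + \<eta>} - {0}))"
  have "infinite (S n)" for n
  proof -
    have "infinite ({b n<..<b n + \<eta>} - {0})" using e0(1) by (simp add: infinite_Ioo)
    then show ?thesis unfolding S_def by (simp add: finite_image_iff inj_on_def)
  qed
  moreover have "fat AA" using ftP fPQ unfolding fat_def wd_def by (simp add: add_pos_pos algebra_simps) (smt (verit))
  ultimately obtain c where c: "\<And>n. n \<in> AA \<Longrightarrow> c n \<in> S n"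
    "\<And>g h. kys (g * h) = AA \<Longrightarrow> (\<And>n. n \<in> AA \<Longrightarrow> lk (g * h) n = c n) \<Longrightarrow> card (kys g) \<le> 1 \<or> card (kys h) \<le> 1"
    using generic_coefficients[OF pgA, of S] by metis
  define \<psi> where "\<psi> = (\<lambda>n. if n \<in> AA then Re (c n) else 0)"
  have \<psi>: "c n = of_real (\<psi> n) \<and> b n < \<psi> n \<and> \<psi> n < b n + \<eta> \<and> \<psi> n \<noteq> 0" if n: "n \<in> AA" for n
  proof -
    obtain r where "r \<in> {b n<..<b n + \<eta>} - {0}" "c n = of_real r" using c(1)[OF n] unfolding S_def by (elim imageE)
    then show ?thesis using n by (simp add: \<psi>_def)
  qed
  have v: "vof AA \<psi>" by (simp add: vof_def \<psi>_def)
  have TA: "T \<subseteq> AA"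
  proof
    fix n assume "n \<in> T" then show "n \<in> AA" unfolding T_def using msum_mem fPQ by (elim imageE) blast
  qed
  have "(\<Sum>n\<in>AA. \<psi> n * rm x y n) > 0" if xy: "x \<noteq> 0" "y \<noteq> 0" for x y
  proof -
    define p where "p = (\<Sum>s\<in>SP. (rm x y s)\<^sup>2)"
    have rn: "rm x y s \<noteq> 0" for s using xy by (simp add: rm_def)
    have p0: "p > 0" unfolding p_def using fPQ rn by (intro sum_pos) simp_all
    have pT: "(\<Sum>n\<in>AA. (if n \<in> T then \<delta> else 0) * rm x y n) = \<delta> * p"
    proof -
      have "(\<Sum>n\<in>AA. (if n \<in> T then \<delta> else 0) * rm x y n) = (\<Sum>n\<in>T. \<delta> * rm x y n)"
        by (rule sum.mono_neutral_cong_right) (use fin(1) TA in auto)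
      also have "\<dots> = (\<Sum>s\<in>SP. \<delta> * rm x y (s + s))" unfolding T_def
      proof (subst sum.reindex)
        show "inj_on (\<lambda>s. s + s) SP" by (rule inj_onI) (simp add: prod_eq_iff)
      qed simp
      also have "\<dots> = \<delta> * p" unfolding p_def sum_distrib_left rm_add[OF xy] by (simp add: power2_eq_square)
      finally show ?thesis .
    qed
    have "(\<psi> n - b n) * rm x y n \<ge> - (\<eta> * p)" if n: "n \<in> AA" for n
    proof -
      have "\<bar>(\<psi> n - b n) * rm x y n\<bar> \<le> \<eta> * p"
        unfolding abs_mult using \<psi>[OF n] rm_bound[OF fPQ(1,2) n xy] e0 by (intro mult_mono) (simp_all add: p_def)
      then show ?thesis by linarith
    qed
    then have "(\<Sum>n\<in>AA. (\<psi> n - b n) * rm x y n) \<ge> (\<Sum>n\<in>AA. - (\<eta> * p))" by (rule sum_mono)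
    moreover have "(\<Sum>n\<in>AA. - (\<eta> * p)) = - (\<delta> * p / 2)" using cA by (simp add: \<eta>_def)
    moreover have "(\<Sum>n\<in>AA. \<psi> n * rm x y n) = (\<Sum>n\<in>AA. \<phi> n * rm x y n) + (\<Sum>n\<in>AA. (if n \<in> T then \<delta> else 0) * rm x y n)
       + (\<Sum>n\<in>AA. (\<psi> n - b n) * rm x y n)"
      unfolding sum.distrib[symmetric] by (rule sum.cong[OF refl]) (simp add: b_def algebra_simps)
    moreover have "\<delta> * p > 0" using d p0 by simp
    ultimately show ?thesis using \<phi>(2)[OF xy] unfolding pT by linarith
  qed
  then have nz: "(\<Sum>n\<in>AA. \<psi> n * rm x y n) \<noteq> 0" if "x \<noteq> 0" "y \<noteq> 0" for x y using that by (metis less_irrefl)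
  have irr: "card (kys g) \<le> 1 \<or> card (kys h) \<le> 1"
    if "kys (g * h) = AA" "\<And>n. n \<in> AA \<Longrightarrow> lk (g * h) n = of_real (\<psi> n)" for g h
    by (rule c(2)[OF that(1)]) (use that(2) \<psi> in simp)
  have "\<exists>g. multiplier \<psi> g"
    by (rule generic_multiplier[OF v _ irr nz big]) (use \<psi> in blast)
  moreover have "\<bar>\<psi> n - \<phi> n\<bar> \<le> 2 * \<delta>" for n
  proof (cases "n \<in> AA")
    case True then show ?thesis using \<psi>[OF True] e0 d unfolding b_def by (auto split: if_splits)
  next
    case False then show ?thesis using vofD[OF \<phi>(1) False] d by (simp add: \<psi>_def)
  qed
  ultimately show thesis using that by blast
qed

lemma nonnegative_multiplier:
  assumes \<phi>: "vof AA \<phi>" "\<And>x y. x \<noteq> 0 \<Longrightarrow> y \<noteq> 0 \<Longrightarrow> (\<Sum>n\<in>AA. \<phi> n * rm x y n) \<ge> 0"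
    and big: "mv AA HS < 2 * (int (card HS) - 1)"
  shows "\<exists>g. multiplier \<phi> g"
proof -
  have "\<exists>\<psi>. (\<forall>n. \<bar>\<psi> n - \<phi> n\<bar> \<le> 2 * inverse (real (Suc k))) \<and> (\<exists>g. multiplier \<psi> g)" for k
  proof -
    have "inverse (real (Suc k)) > 0" by simp
    then obtain \<psi> where "\<And>n. \<bar>\<psi> n - \<phi> n\<bar> \<le> 2 * inverse (real (Suc k))" "\<exists>g. multiplier \<psi> g"
      using generic_neighbour[OF \<phi> _ big] by metis
    then show ?thesis by blast
  qed
  then obtain F where F: "\<And>k n. \<bar>F k n - \<phi> n\<bar> \<le> 2 * inverse (real (Suc k))" "\<And>k. \<exists>g. multiplier (F k) g" by metis
  have "(\<lambda>k. F k n) \<longlonglongrightarrow> \<phi> n" for n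
  proof (rule LIM_zero_cancel, rule Lim_null_comparison)
    show "\<forall>\<^sub>F k in sequentially. norm (F k n - \<phi> n) \<le> 2 * inverse (real (Suc k))" using F(1) by simp
    show "(\<lambda>k. 2 * inverse (real (Suc k))) \<longlonglongrightarrow> 0" using tendsto_mult[OF tendsto_const LIMSEQ_inverse_real_of_nat, of 2] by simp
  qed
  then show ?thesis using multiplier_closed F(2) by blast
qed

end

lemma lmult_cnv: assumes "finite S" "vof S f" shows "lmult f g = cnv S f g"
proof
  fix n show "lmult f g n = cnv S f g n"
    unfolding lmult_def cnv_def lsupp_def
    by (rule sum.mono_neutral_left) (use assms vofD[OF assms(2)] in auto)
qed

lemma supported_Lt: assumes "finite (Lt C)" shows "supported_in f C \<longleftrightarrow> vof (Lt C) f"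
proof
  assume "supported_in f C"
  then show "vof (Lt C) f" unfolding supported_in_def lsupp_def vof_def Lt_def by blast
next
  assume v: "vof (Lt C) f"
  have sub: "{s. f s \<noteq> 0} \<subseteq> Lt C" using vofD[OF v] by blast
  then show "supported_in f C" unfolding supported_in_def is_lpoly_def lsupp_def
    using finite_subset[OF sub assms] by (auto simp: Lt_def)
qed

theorem theorem5p1:
  fixes P Q :: "pt set"
  assumes "convex_lattice_polygon P" and "convex_lattice_polygon Q"
    and "\<not> (\<exists>m. ltrans P m \<subseteq> Q)"
    and "int (nlat (mink Q Q)) + hcount P Q > int (nlat (interior (mink P Q)))"
  shows "supports_multipliers Q P"
proof -
  obtain SP where SP: "pg SP" "P = cv SP" "interior (cv SP) \<noteq> {}" by (rule polygon_lattice[OF assms(1)])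
  obtain SQ where SQ: "pg SQ" "Q = cv SQ" "interior (cv SQ) \<noteq> {}" by (rule polygon_lattice[OF assms(2)])
  interpret polygon_pair SP SQ
    using SP(1) SQ(1) fat_interior[OF SP(1,3)] fat_interior[OF SQ(1,3)] by unfold_locales
  have big: "mv AA HS < 2 * (int (card HS) - 1)"
    by (rule polygon_inequality[OF SP(1,3) SQ(1,3)]) (use assms(3,4) in \<open>simp_all add: SP(2) SQ(2)\<close>)
  have Lt: "Lt (mink P P) = AA" "Lt (mink Q Q) = GG" "Lt (mink P Q) = HS"
    unfolding SP(2) SQ(2) by (rule Lt_mink; use fPQ in simp)+
  show ?thesis unfolding supports_multipliers_def
  proof (intro allI impI, elim conjE)
    fix f assume "supported_in f (mink P P)" and nn: "lnonneg f"
    then have f: "vof AA f" using supported_Lt[of "mink P P" f] fin(1) by (simp add: Lt)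
    have "(\<Sum>n\<in>AA. f n * rm x y n) = leval f x y" for x y
      unfolding leval_def lsupp_def rm_def mult.assoc
      by (rule sum.mono_neutral_right) (use fin(1) vofD[OF f] in auto)
    then have "\<exists>g. multiplier f g"
      using nn unfolding lnonneg_def by (intro nonnegative_multiplier[OF f _ big]) simp
    then obtain g h where g: "vof GG g" "g \<noteq> (\<lambda>_. 0)" and h: "tuple h" "\<And>n. cnv AA f g n = sos h n"
      unfolding multiplier_def by blast
    have hv: "vof HS (h j)" for j using h(1) by (simp add: tuple_def)
    have "lmult f g = (\<lambda>n. \<Sum>h\<leftarrow>map h [0..<M]. lmult h h n)"
    proof
      fix n
      have "lmult f g n = (\<Sum>j<M. lmult (h j) (h j) n)"
        by (simp add: lmult_cnv[OF fin(1) f] h(2) sos_def lmult_cnv[OF fin(3) hv])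
      also have "\<dots> = (\<Sum>j\<leftarrow>[0..<M]. lmult (h j) (h j) n)"
        by (simp add: sum_set_upt_conv_sum_list_nat[symmetric] atLeast0LessThan)
      finally show "lmult f g n = (\<Sum>h\<leftarrow>map h [0..<M]. lmult h h n)" by (simp add: o_def)
    qed
    moreover have "\<forall>p\<in>set (map h [0..<M]). supported_in p (mink P Q)"
      using hv supported_Lt[of "mink P Q"] fin(3) by (auto simp: Lt)
    ultimately have "sos_in (lmult f g) (mink P Q)" unfolding sos_in_def by blast
    moreover have "supported_in g (mink Q Q)" using supported_Lt[of "mink Q Q" g] g(1) fin(2) by (simp add: Lt)
    ultimately show "\<exists>g. supported_in g (mink Q Q) \<and> g \<noteq> (\<lambda>_. 0) \<and> sos_in (lmult f g) (mink P Q)" using g(2) by blast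
  qed
qed
end
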